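(* Let $\Omega\subset\mathbb{R}^3$ be a domain. Let $p\in C[0,\infty)\cap C^1(0,\infty)$ with $p(0)=0$, $p(\rho)\ge0$ for all $\rho\ge0$, and $p'(\rho)\ge0$ for all $\rho>0$, and let $P$ be the associated pressure potential. Assume that for some $\gamma>1$ $$\liminf_{\rho\to0^+}\frac{P(\rho)}{p(\rho)}>0,\qquad \liminf_{\rho\to0^+}\frac{p(\rho)}{\rho^\gamma}>0.$$ Suppose that $G\in D_0^{1,q}(\Omega)$ for some $\frac65\le q\le\frac{6\gamma}{5\gamma-6}$ if $\gamma>\frac65$, and that either $G\in D_0^{1,q}(\Omega)$ for some $\frac65\le q<\infty$ or $G\in W^{1,\infty}(\Omega)$ if $1<\gamma\le\frac65$. Let $(\rho,\mathbf{u})$ be a weak solution in $\Omega$ of the steady barotropic Navier--Stokes system with pressure $p$ and force potential $G$ such that $$\rho\in L^\infty(\Omega),\qquad \int_\Omega\left(\tfrac12\rho|\mathbf{u}|^2+P(\rho)\right)dx<\infty.$$ Then $\mathbf{u}=0$ a.e. in $\Omega$.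
   Context: The system is $\operatorname{div}(\rho\mathbf{u})=0$, $\operatorname{div}(\rho\mathbf{u}\otimes\mathbf{u})+\nabla p(\rho)-\operatorname{div}\mathbb{S}(\nabla\mathbf{u})=\rho\nabla G$ in $\Omega$, $\mathbf{u}|_{\partial\Omega}=0$, where $\mathbb{S}(\nabla\mathbf{u})=\mu\left(\nabla\mathbf{u}+\nabla^t\mathbf{u}-\frac23\operatorname{div}\mathbf{u}\,\mathbb{I}\right)+\eta\operatorname{div}\mathbf{u}\,\mathbb{I}$ with constants $\mu>0$, $\eta\ge0$. Pressure potential: $P:[0,\infty)\to\mathbb{R}$ satisfies $P(0)=0$ and $P'(\rho)\rho-P(\rho)=p(\rho)$ for $\rho>0$. Since $p'\ge0$, $P''(\rho)=p'(\rho)/\rho\ge0$, so $P$ is convex and determined up to a linear function of $\rho$; it is fixed by requiring $P'(0)=0$ if $P'(0)>-\infty$ (the remaining alternative is $P'(0)=-\infty$). Function space: for $1\le q<\infty$, $D_0^{1,q}(\Omega)$ is the completion of $C_c^\infty(\Omega)$ in the norm $\left(\int_\Omega|\nabla v|^q\,dx\right)^{1/q}$; $D_0^{1,q}(\Omega;\mathbb{R}^3)$ is the vector-valued version. (It is identified with a closed subspace of $\{v\in L^1_{\rm loc}(\Omega):\nabla v\in L^q(\Omega)\}$ modulo constants.) For matrices, $F:G=\sum_{i,j}F_{ij}G_{ij}$. Weak solution: $(\rho,\mathbf{u})$ is a weak solution if (1) $\rho,\mathbf{u}$ are measurable in $\Omega$ and $\rho\ge0$ a.e. in $\Omega$; (2)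 $\rho\mathbf{u}\in L^1_{\rm loc}(\overline\Omega;\mathbb{R}^3)$ and $\int_\Omega\rho\mathbf{u}\cdot\nabla\phi\,dx=0$ for all $\phi\in C_c^\infty(\mathbb{R}^3)$; (3) $\rho,\ \rho|\mathbf{u}|^2,\ p(\rho),\ \rho\nabla G$ are in $L^1_{\rm loc}(\Omega)$, $\mathbf{u}\in D_0^{1,2}(\Omega;\mathbb{R}^3)$, and $$\int_\Omega[\rho\mathbf{u}\otimes\mathbf{u}:\nabla\boldsymbol{\varphi}+p(\rho)\operatorname{div}\boldsymbol{\varphi}]\,dx=\int_\Omega\mathbb{S}(\nabla\mathbf{u}):\nabla\boldsymbol{\varphi}\,dx-\int_\Omega\rho\nabla G\cdot\boldsymbol{\varphi}\,dx$$ for all $\boldsymbol{\varphi}\in C_c^1(\Omega;\mathbb{R}^3)$. *)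

theory Defs
  imports "HOL-Analysis.Analysis"
begin

type_synonym R3 = "real ^ 3"

definition partial :: "3 \<Rightarrow> (R3 \<Rightarrow> real) \<Rightarrow> R3 \<Rightarrow> real" where
  "partial i f x = frechet_derivative f (at x) (axis i 1)"

definition grad :: "(R3 \<Rightarrow> real) \<Rightarrow> R3 \<Rightarrow> R3" where
  "grad f x = (\<chi> i. partial i f x)"

text \<open>Row \<open>i\<close> of a Jacobian is the gradient of the \<open>i\<close>-th component.\<close>

definition jacobian_mat :: "(R3 \<Rightarrow> R3) \<Rightarrow> R3 \<Rightarrow> real ^ 3 ^ 3" where
  "jacobian_mat f x = (\<chi> i. grad (\<lambda>y. f y $ i) x)"

primrec Ck :: "nat \<Rightarrow> (R3 \<Rightarrow> real) \<Rightarrow> bool" where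
  "Ck 0 f \<longleftrightarrow> continuous_on UNIV f"
| "Ck (Suc k) f \<longleftrightarrow> (\<forall>x. f differentiable (at x)) \<and> (\<forall>i. Ck k (partial i f))"

definition compact_support_in :: "R3 set \<Rightarrow> (R3 \<Rightarrow> 'b::zero) \<Rightarrow> bool" where
  "compact_support_in \<Omega> f \<longleftrightarrow>
     compact (closure {x. f x \<noteq> 0}) \<and> closure {x. f x \<noteq> 0} \<subseteq> \<Omega>"

definition Cc_inf :: "R3 set \<Rightarrow> (R3 \<Rightarrow> real) set" where
  "Cc_inf \<Omega> = {f. (\<forall>k. Ck k f) \<and> compact_support_in \<Omega> f}"

definition Cc1_vec :: "R3 set \<Rightarrow> (R3 \<Rightarrow> R3) set" where
  "Cc1_vec \<Omega> = {f. (\<forall>i. Ck 1 (\<lambda>x. f x $ i)) \<and> compact_support_in \<Omega> f}"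

definition L1_loc :: "R3 set \<Rightarrow> (R3 \<Rightarrow> 'b::{banach, second_countable_topology}) set" where
  "L1_loc \<Omega> = {f. \<forall>K. compact K \<and> K \<subseteq> \<Omega> \<longrightarrow> set_integrable lebesgue K f}"

text \<open>The space \<open>L\<^sup>1\<^sub>l\<^sub>o\<^sub>c\<close> on the closure of \<open>\<Omega>\<close>, for functions given on the open set \<open>\<Omega>\<close> only:
  integrability up to the boundary on bounded pieces of \<open>\<Omega>\<close>.\<close>

definition L1_loc_closure ::
    "R3 set \<Rightarrow> (R3 \<Rightarrow> 'b::{banach, second_countable_topology}) set" where
  "L1_loc_closure \<Omega> =
     {f. \<forall>K. compact K \<and> K \<subseteq> closure \<Omega> \<longrightarrow> set_integrable lebesgue (K \<inter> \<Omega>) f}"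

definition Lq :: "real \<Rightarrow> R3 set \<Rightarrow> (R3 \<Rightarrow> 'b::euclidean_space) set" where
  "Lq q \<Omega> = {f. f \<in> borel_measurable (lebesgue_on \<Omega>) \<and>
                 set_integrable lebesgue \<Omega> (\<lambda>x. norm (f x) powr q)}"

definition Linf :: "R3 set \<Rightarrow> (R3 \<Rightarrow> 'b::euclidean_space) set" where
  "Linf \<Omega> = {f. f \<in> borel_measurable (lebesgue_on \<Omega>) \<and>
                 (\<exists>C. AE x in lebesgue. x \<in> \<Omega> \<longrightarrow> norm (f x) \<le> C)}"

definition has_weak_gradient :: "R3 set \<Rightarrow> (R3 \<Rightarrow> real) \<Rightarrow> (R3 \<Rightarrow> R3) \<Rightarrow> bool" where
  "has_weak_gradient \<Omega> v g \<longleftrightarrow> v \<in> L1_loc \<Omega> \<and> g \<in> L1_loc \<Omega> \<and>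
     (\<forall>\<phi>\<in>Cc_inf \<Omega>. (LINT x:\<Omega>|lebesgue. v x *\<^sub>R grad \<phi> x) = - (LINT x:\<Omega>|lebesgue. \<phi> x *\<^sub>R g x))"

text \<open>A weak gradient is determined only up to a null set of \<open>\<Omega>\<close>; this picks one representative.\<close>

definition weak_grad :: "R3 set \<Rightarrow> (R3 \<Rightarrow> real) \<Rightarrow> R3 \<Rightarrow> R3" where
  "weak_grad \<Omega> v = (SOME g. has_weak_gradient \<Omega> v g)"

definition weak_jacobian :: "R3 set \<Rightarrow> (R3 \<Rightarrow> R3) \<Rightarrow> R3 \<Rightarrow> real ^ 3 ^ 3" where
  "weak_jacobian \<Omega> v x = (\<chi> i. weak_grad \<Omega> (\<lambda>y. v y $ i) x)"

definition W1_inf :: "R3 set \<Rightarrow> (R3 \<Rightarrow> real) set" where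
  "W1_inf \<Omega> = {v. v \<in> Linf \<Omega> \<and> (\<exists>g. has_weak_gradient \<Omega> v g \<and> g \<in> Linf \<Omega>)}"

definition D0_approx :: "real \<Rightarrow> R3 set \<Rightarrow> (nat \<Rightarrow> R3 \<Rightarrow> real) \<Rightarrow> (R3 \<Rightarrow> real) \<Rightarrow> bool" where
  "D0_approx q \<Omega> \<psi> v \<longleftrightarrow> (\<forall>n. \<psi> n \<in> Cc_inf \<Omega>) \<and>
     (\<exists>g. has_weak_gradient \<Omega> v g \<and> g \<in> Lq q \<Omega> \<and>
        (\<lambda>n. LINT x:\<Omega>|lebesgue. norm (grad (\<psi> n) x - g x) powr q) \<longlonglongrightarrow> 0)"

text \<open>The completion \<open>D\<^sub>0\<^sup>1\<^sup>,\<^sup>q(\<Omega>)\<close>, realised as a closed subspace of the locally integrable functions with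
  gradient in \<open>L\<^sup>q(\<Omega>)\<close> modulo constants: \<open>D0 q \<Omega>\<close> is the set of all representatives of its elements.\<close>

definition D0 :: "real \<Rightarrow> R3 set \<Rightarrow> (R3 \<Rightarrow> real) set" where
  "D0 q \<Omega> = {v. \<exists>\<psi>. D0_approx q \<Omega> \<psi> v}"

text \<open>For \<open>1 \<le> q < 3\<close> the Sobolev inequality makes the completion a space of genuine functions: a sequence
  of test functions whose gradients are Cauchy in \<open>L\<^sup>q(\<Omega>)\<close> also converges in \<open>L\<^sup>1\<^sub>l\<^sub>o\<^sub>c(\<Omega>)\<close>, so that every element
  has exactly one representative (up to null sets) that is such a limit.  This representative, which
  carries the zero boundary values, is the one needed where a function itself, and not just its
  gradient, matters; adding a nonzero constant to it leaves \<open>D0_fun q \<Omega>\<close>.\<close>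

definition D0_fun :: "real \<Rightarrow> R3 set \<Rightarrow> (R3 \<Rightarrow> real) set" where
  "D0_fun q \<Omega> = {v. \<exists>\<psi>. D0_approx q \<Omega> \<psi> v \<and>
     (\<forall>K. compact K \<and> K \<subseteq> \<Omega> \<longrightarrow> (\<lambda>n. LINT x:K|lebesgue. \<bar>\<psi> n x - v x\<bar>) \<longlonglongrightarrow> 0)}"

definition D0_fun_vec :: "real \<Rightarrow> R3 set \<Rightarrow> (R3 \<Rightarrow> R3) set" where
  "D0_fun_vec q \<Omega> = {v. \<forall>i. (\<lambda>x. v x $ i) \<in> D0_fun q \<Omega>}"

text \<open>As \<open>P 0 = 0\<close>, the quotient \<open>P r / r\<close> is the difference quotient of \<open>P\<close> at \<open>0\<close>; it is nondecreasing
  when \<open>p \<ge> 0\<close>, so \<open>P'(0)\<close> always exists in \<open>[-\<infinity>, \<infinity>)\<close>.  The last conjunct normalises \<open>P'(0) = 0\<close> if this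
  derivative is finite and otherwise says \<open>P'(0) = -\<infinity>\<close>.  Values of \<open>p\<close> and \<open>P\<close> at negative
  arguments are irrelevant.\<close>

definition pressure_potential :: "(real \<Rightarrow> real) \<Rightarrow> (real \<Rightarrow> real) \<Rightarrow> bool" where
  "pressure_potential p P \<longleftrightarrow> P 0 = 0 \<and>
     (\<forall>r>0. P differentiable (at r) \<and> deriv P r * r - P r = p r) \<and>
     ((P has_real_derivative 0) (at 0 within {0..}) \<or>
      filterlim (\<lambda>r. P r / r) at_bot (at_right 0))"

definition stress :: "real \<Rightarrow> real \<Rightarrow> real ^ 3 ^ 3 \<Rightarrow> real ^ 3 ^ 3" where
  "stress \<mu> \<eta> F = \<mu> *\<^sub>R (F + transpose F - (2 / 3 * trace F) *\<^sub>R mat 1) + (\<eta> * trace F) *\<^sub>R mat 1"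

definition outer :: "R3 \<Rightarrow> R3 \<Rightarrow> real ^ 3 ^ 3" where
  "outer a b = (\<chi> i j. a $ i * b $ j)"

text \<open>The library inner product on \<open>real ^ 3 ^ 3\<close> is \<open>F : G = \<Sum>i j. F\<^sub>i\<^sub>j G\<^sub>i\<^sub>j\<close>.\<close>

definition weak_solution ::
    "real \<Rightarrow> real \<Rightarrow> (real \<Rightarrow> real) \<Rightarrow> (R3 \<Rightarrow> real) \<Rightarrow> R3 set \<Rightarrow> (R3 \<Rightarrow> real) \<Rightarrow> (R3 \<Rightarrow> R3) \<Rightarrow> bool" where
  "weak_solution \<mu> \<eta> p G \<Omega> \<rho> u \<longleftrightarrow>
     \<rho> \<in> borel_measurable (lebesgue_on \<Omega>) \<and>
     u \<in> borel_measurable (lebesgue_on \<Omega>) \<and>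
     (AE x in lebesgue. x \<in> \<Omega> \<longrightarrow> \<rho> x \<ge> 0) \<and>
     (\<lambda>x. \<rho> x *\<^sub>R u x) \<in> L1_loc_closure \<Omega> \<and>
     (\<forall>\<phi>\<in>Cc_inf UNIV. (LINT x:\<Omega>|lebesgue. (\<rho> x *\<^sub>R u x) \<bullet> grad \<phi> x) = 0) \<and>
     \<rho> \<in> L1_loc \<Omega> \<and>
     (\<lambda>x. \<rho> x * (norm (u x))\<^sup>2) \<in> L1_loc \<Omega> \<and>
     (\<lambda>x. p (\<rho> x)) \<in> L1_loc \<Omega> \<and>
     (\<lambda>x. \<rho> x *\<^sub>R weak_grad \<Omega> G x) \<in> L1_loc \<Omega> \<and>
     u \<in> D0_fun_vec 2 \<Omega> \<and>
     (\<forall>\<phi>\<in>Cc1_vec \<Omega>.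
        (LINT x:\<Omega>|lebesgue. (\<rho> x *\<^sub>R outer (u x) (u x)) \<bullet> jacobian_mat \<phi> x
                              + p (\<rho> x) * trace (jacobian_mat \<phi> x))
        = (LINT x:\<Omega>|lebesgue. stress \<mu> \<eta> (weak_jacobian \<Omega> u x) \<bullet> jacobian_mat \<phi> x)
          - (LINT x:\<Omega>|lebesgue. (\<rho> x *\<^sub>R weak_grad \<Omega> G x) \<bullet> \<phi> x))"

end

theory Submission imports Defs begin

text \<open>
  Elements of \<open>D\<^sub>0\<^sup>1\<^sup>,\<^sup>2\<close> lie in \<open>L\<^sup>6\<close>. Mollifying the continuity equation and estimating the commutator gives its
  renormalized form \<open>div (b(\<rho>) u) + (b'(\<rho>) \<rho> - b(\<rho>)) div u = 0\<close> on the whole space. With \<open>b = P\<close>, the integrability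
  of \<open>P(\<rho>)\<close> removes the cutoff at infinity, so that the pressure does no work: \<open>\<integral> p(\<rho>) div u = 0\<close>. Since \<open>P\<close> dominates
  \<open>\<rho>\<^sup>\<gamma>\<close> on bounded sets, \<open>\<rho>\<close> lies in every \<open>L\<^sup>s\<close> with \<open>s \<ge> \<gamma>\<close>, and the exponents are such that \<open>\<rho> \<nabla>G\<close> lies in \<open>L\<^sup>6\<^sup>/\<^sup>5\<close>, the
  dual of \<open>L\<^sup>6\<close>; as \<open>\<rho> u\<close> is divergence free, the force does no work either. Testing the momentum equation with
  test functions converging to \<open>u\<close>, the convective term vanishes for the same reason, and what remains is that the
  dissipation is zero, hence \<open>\<nabla>u = 0\<close> and \<open>u = 0\<close> by Sobolev's inequality.
\<close>

section \<open>Smooth functions and test functions\<close>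

text \<open>The continuity equation is tested on the whole space, so \<rho> and u may be extended by
  zero; the proof runs with Borel representatives that vanish outside \<Omega>. The exponents are
  tied by 1/s + 1/q = 5/6, that is s = 6q/(5q-6). This s puts \<rho> grad G into L^(6/5) and at the
  same time \<rho> u into the dual of L^q; for \<gamma> > 6/5 the bound on q says exactly s \<ge>
  \<gamma>. The condition on P/p makes P positive near zero. This excludes P'(0) = -infinity and
  lets P extend to a C^1 renormalizing function on the line. The gradient of a bounded Lipschitz G
  need not be a limit of gradients of test functions. There G itself is tested with a cutoff built
  from u, and the error is controlled by \<rho> |grad u|, which is integrable since \<rho> lies in
  L^2 when \<gamma> \<le> 6/5. Convection and dissipation are computed for the smooth approximations
  of u: only there are products such as the square of the velocity admissible test functions and
  derivatives freely exchanged under the integral.\<close>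

definition smooth :: "(R3 \<Rightarrow> real) \<Rightarrow> bool" where
 "smooth f \<longleftrightarrow> (\<forall>k. Ck k f)"

section \<open>Partial derivatives and functions of class C^k\<close>

lemma has_derivative_grad:
 assumes "f differentiable (at x)"
 shows "(f has_derivative (\<lambda>h. grad f x \<bullet> h)) (at x)"
proof -
 have D: "(f has_derivative frechet_derivative f (at x)) (at x)"
  using assms frechet_derivative_works by blast
 then interpret bounded_linear "frechet_derivative f (at x)" by (rule has_derivative_bounded_linear)
 have "frechet_derivative f (at x) h = grad f x \<bullet> h" for h :: R3
 proof -
  have "frechet_derivative f (at x) h = frechet_derivative f (at x) (\<Sum>i\<in>UNIV. h $ i *\<^sub>R axis i 1)"
   by (metis basis_expansion scalar_mult_eq_scaleR)
  also have "\<dots> = (\<Sum>i\<in>UNIV. h $ i * frechet_derivative f (at x) (axis i 1))"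
   by (simp add: sum scaleR)
  also have "\<dots> = grad f x \<bullet> h"
   by (simp add: inner_vec_def grad_def partial_def mult.commute)
  finally show ?thesis .
 qed
 then show ?thesis using D by (simp add: has_derivative_eq_rhs ext)
qed

lemma grad_eqI:
 assumes "(f has_derivative (\<lambda>h. v \<bullet> h)) (at x)"
 shows "grad f x = v"
proof -
 have "frechet_derivative f (at x) = (\<lambda>h. v \<bullet> h)"
  using frechet_derivative_at[OF assms] by simp
 then show ?thesis by (simp add: grad_def partial_def vec_eq_iff inner_axis)
qed

lemma grad_nth [simp]: "grad f x $ i = partial i f x"
 by (simp add: grad_def)

lemma partial_eqI:
 assumes "(f has_derivative f') (at x)"
 shows "partial i f x = f' (axis i 1)"
 using frechet_derivative_at[OF assms] by (simp add: partial_def)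

lemma partial_const [simp]: "partial i (\<lambda>x. c) = (\<lambda>x. 0)"
 by (rule ext, subst partial_eqI) (auto intro!: derivative_eq_intros)

lemma partial_add:
 assumes "f differentiable (at x)" "g differentiable (at x)"
 shows "partial i (\<lambda>x. f x + g x) x = partial i f x + partial i g x"
 using assms has_derivative_add[OF assms[unfolded frechet_derivative_works]]
 by (subst partial_eqI) (auto simp: partial_def)

lemma partial_diff:
 assumes "f differentiable (at x)" "g differentiable (at x)"
 shows "partial i (\<lambda>x. f x - g x) x = partial i f x - partial i g x"
 using assms has_derivative_diff[OF assms[unfolded frechet_derivative_works]]
 by (subst partial_eqI) (auto simp: partial_def)

lemma partial_mult:
 assumes "f differentiable (at x)" "g differentiable (at x)"
 shows "partial i (\<lambda>x. f x * g x) x = f x * partial i g x + partial i f x * g x"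
 using assms has_derivative_mult[OF assms[unfolded frechet_derivative_works]]
 by (subst partial_eqI) (auto simp: partial_def)

lemma partial_chain:
 assumes "f differentiable (at x)" "(b has_real_derivative b') (at (f x))"
 shows "partial i (\<lambda>x. b (f x)) x = b' * partial i f x"
  and "(\<lambda>x. b (f x)) differentiable (at x)"
proof -
 have *: "((\<lambda>x. b (f x)) has_derivative (\<lambda>h. b' * frechet_derivative f (at x) h)) (at x)"
  using has_derivative_compose[OF assms(1)[unfolded frechet_derivative_works]
    assms(2)[unfolded has_field_derivative_def]] by simp
 show "partial i (\<lambda>x. b (f x)) x = b' * partial i f x"
  by (subst partial_eqI[OF *]) (simp add: partial_def)
 show "(\<lambda>x. b (f x)) differentiable (at x)"
  using * by (auto simp: differentiable_def)
qed

lemma partial_affine: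
 assumes "f differentiable (at (c *\<^sub>R x + d))"
 shows "partial i (\<lambda>x. f (c *\<^sub>R x + d)) x = c * partial i f (c *\<^sub>R x + d)"
  and "(\<lambda>x. f (c *\<^sub>R x + d)) differentiable (at x)"
proof -
 have "((\<lambda>x. c *\<^sub>R x + d) has_derivative (\<lambda>h. c *\<^sub>R h)) (at x)"
  by (auto intro!: derivative_eq_intros)
 from has_derivative_compose[OF this has_derivative_grad[OF assms]]
 have *: "((\<lambda>x. f (c *\<^sub>R x + d)) has_derivative (\<lambda>h. grad f (c *\<^sub>R x + d) \<bullet> (c *\<^sub>R h))) (at x)" .
 show "partial i (\<lambda>x. f (c *\<^sub>R x + d)) x = c * partial i f (c *\<^sub>R x + d)"
  by (subst partial_eqI[OF *]) (simp add: inner_axis)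
 show "(\<lambda>x. f (c *\<^sub>R x + d)) differentiable (at x)"
  using * by (auto simp: differentiable_def)
qed

lemma Ck_SucD: "Ck (Suc k) f \<Longrightarrow> Ck k f"
proof (induction k arbitrary: f)
 case 0
 then show ?case
  by (auto intro!: differentiable_imp_continuous_on simp: differentiable_on_def differentiable_at_withinI)
next
 case (Suc k)
 then show ?case by (metis Ck.simps(2))
qed

lemma Ck_continuous: "Ck k f \<Longrightarrow> continuous_on UNIV f"
proof (induction k)
 case (Suc k)
 then show ?case using Ck_SucD by blast
qed simp

lemma Ck_const: "Ck k (\<lambda>x. c)"
 by (induction k arbitrary: c) auto

lemma Ck_component: "Ck k (\<lambda>x. x $ i)"
proof (cases k)
 case (Suc m)
 have d: "((\<lambda>x::R3. x $ i) has_derivative (\<lambda>h. h $ i)) (at x)" for x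
  by (intro bounded_linear_imp_has_derivative bounded_linear_vec_nth)
 have "partial j (\<lambda>x. x $ i) = (\<lambda>x. axis j 1 $ i)" for j
  by (rule ext) (simp add: partial_eqI[OF d])
 then show ?thesis using d by (auto simp: Suc differentiable_def intro!: Ck_const)
qed (auto intro!: continuous_intros)

lemma Ck_add: "Ck k f \<Longrightarrow> Ck k g \<Longrightarrow> Ck k (\<lambda>x. f x + g x)"
proof (induction k arbitrary: f g)
 case (Suc k)
 have "partial i (\<lambda>x. f x + g x) = (\<lambda>x. partial i f x + partial i g x)" for i
  using Suc.prems by (intro ext partial_add) auto
 with Suc show ?case by auto
qed (auto intro!: continuous_intros)

lemma Ck_mult: "Ck k f \<Longrightarrow> Ck k g \<Longrightarrow> Ck k (\<lambda>x. f x * g x)"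
proof (induction k arbitrary: f g)
 case (Suc k)
 have "partial i (\<lambda>x. f x * g x) = (\<lambda>x. f x * partial i g x + partial i f x * g x)" for i
  using Suc.prems by (intro ext partial_mult) auto
 moreover have "Ck k f" "Ck k g" using Suc.prems by (auto dest: Ck_SucD simp del: Ck.simps)
 ultimately show ?case using Suc by (auto intro!: Ck_add)
qed (auto intro!: continuous_intros)

lemma Ck_diff: 
 assumes "Ck k f" "Ck k g" shows "Ck k (\<lambda>x. f x - g x)"
proof -
 have "Ck k (\<lambda>x. f x + (-1) * g x)" by (intro Ck_add Ck_mult Ck_const assms)
 then show ?thesis by simp
qed

lemma Ck_sum: "(\<And>i. i \<in> I \<Longrightarrow> Ck k (f i)) \<Longrightarrow> Ck k (\<lambda>x. \<Sum>i\<in>I. f i x)"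
 by (induction I rule: infinite_finite_induct) (auto intro: Ck_const Ck_add)

text \<open>Each derivative of \<open>inverse (f x)\<close> is a polynomial in
  \<open>inverse (f x)\<close> and derivatives of \<open>f\<close>, so the claim for
  \<open>k\<close> yields the claim for \<open>Suc k\<close>. This makes the cutoff t/(t + \<delta>)
  of a test function smooth.\<close>

lemma Ck_inverse: "(\<And>x. f x > 0) \<Longrightarrow> Ck k f \<Longrightarrow> Ck k (\<lambda>x. inverse (f x))"
proof (induction k)
 case 0
 then show ?case by (auto intro!: continuous_intros simp: less_imp_neq[symmetric])
next
 case (Suc k)
 have nz: "f x \<noteq> 0" for x using Suc.prems(1)[of x] by simp
 have d: "((\<lambda>y. inverse y) has_real_derivative - (inverse (f x) * inverse (f x))) (at (f x))" for x
  using DERIV_inverse[OF nz[of x]] by (simp add: power2_eq_square)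
 have df: "f differentiable (at x)" for x using Suc.prems by auto
 have eq: "partial i (\<lambda>x. inverse (f x)) = (\<lambda>x. (-1) * (inverse (f x) * inverse (f x)) * partial i f x)" for i
  by (rule ext) (simp add: partial_chain(1)[OF df d])
 have "Ck k (\<lambda>x. inverse (f x))" using Suc Ck_SucD by blast
 then have "Ck k (partial i (\<lambda>x. inverse (f x)))" for i
  unfolding eq using Suc.prems by (intro Ck_mult Ck_const) auto
 then show ?case using partial_chain(2)[OF df d] by simp
qed

lemma Ck_affine: "Ck k f \<Longrightarrow> Ck k (\<lambda>x. f (c *\<^sub>R x + d))"
proof (induction k arbitrary: f)
 case 0
 then have "continuous_on UNIV f" by simp
 then show ?case 
  by (auto intro!: continuous_intros continuous_on_compose2[of UNIV f])
next
 case (Suc k)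
 have df: "f differentiable (at x)" for x using Suc.prems by auto
 have "partial i (\<lambda>x. f (c *\<^sub>R x + d)) = (\<lambda>x. c * partial i f (c *\<^sub>R x + d))" for i
  by (rule ext) (rule partial_affine(1)[OF df])
 moreover have "(\<lambda>x. f (c *\<^sub>R x + d)) differentiable (at x)" for x
  by (rule partial_affine(2)[OF df])
 ultimately show ?case using Suc by (auto intro!: Ck_mult Ck_const)
qed

lemma smooth_partial: "smooth f \<Longrightarrow> smooth (partial i f)"
 unfolding smooth_def
proof
 fix k assume "\<forall>k. Ck k f"
 then have "Ck (Suc k) f" by blast
 then show "Ck k (partial i f)" by simp
qed

lemma smooth_differentiable: "smooth f \<Longrightarrow> f differentiable (at x)"
proof -
 assume "smooth f"
 then have "Ck (Suc 0) f" unfolding smooth_def by blast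
 then show ?thesis by simp
qed

lemma smooth_continuous: "smooth f \<Longrightarrow> continuous_on S f"
 unfolding smooth_def by (meson Ck_continuous continuous_on_subset top_greatest)

lemma smooth_add: "smooth f \<Longrightarrow> smooth g \<Longrightarrow> smooth (\<lambda>x. f x + g x)"
 and smooth_diff: "smooth f \<Longrightarrow> smooth g \<Longrightarrow> smooth (\<lambda>x. f x - g x)"
 and smooth_mult: "smooth f \<Longrightarrow> smooth g \<Longrightarrow> smooth (\<lambda>x. f x * g x)"
 and smooth_const: "smooth (\<lambda>x. c)"
 and smooth_component: "smooth (\<lambda>x. x $ i)"
 and smooth_sum: "(\<And>i. i \<in> I \<Longrightarrow> smooth (F i)) \<Longrightarrow> smooth (\<lambda>x. \<Sum>i\<in>I. F i x)"
 and smooth_inverse: "(\<And>x. f x > 0) \<Longrightarrow> smooth f \<Longrightarrow> smooth (\<lambda>x. inverse (f x))"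
 and smooth_affine: "smooth f \<Longrightarrow> smooth (\<lambda>x. f (c *\<^sub>R x + d))"
 unfolding smooth_def by (auto intro: Ck_add Ck_diff Ck_mult Ck_const Ck_component Ck_sum Ck_inverse Ck_affine)

lemma smooth_grad_continuous: "smooth f \<Longrightarrow> continuous_on S (grad f)"
 unfolding grad_def by (intro continuous_on_vec_lambda smooth_continuous smooth_partial)

lemma Ck1_grad_continuous: "Ck 1 f \<Longrightarrow> continuous_on S (grad f)"
 unfolding grad_def
 by (intro continuous_on_vec_lambda) (auto intro: continuous_on_subset)

section \<open>Algebra of test functions\<close>

lemma Cc_inf_iff: "f \<in> Cc_inf \<Omega> \<longleftrightarrow> smooth f \<and> compact_support_in \<Omega> f"
 by (auto simp: Cc_inf_def smooth_def)

lemma compact_support_inI: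
 assumes "compact K" "K \<subseteq> \<Omega>" "\<And>x. x \<notin> K \<Longrightarrow> f x = 0"
 shows "compact_support_in \<Omega> f"
proof -
 have "closure {x. f x \<noteq> 0} \<subseteq> K"
  using assms by (intro closure_minimal compact_imp_closed) auto
 then show ?thesis
  using assms compact_Int_closed[of K "closure {x. f x \<noteq> 0}"] by (auto simp: compact_support_in_def Int_absorb1)
qed

lemma compact_support_inE:
 assumes "compact_support_in \<Omega> f"
 obtains K where "compact K" "K \<subseteq> \<Omega>" "\<And>x. x \<notin> K \<Longrightarrow> f x = 0"
 using assms closure_subset[of "{x. f x \<noteq> 0}"] unfolding compact_support_in_def by blast

lemma partial_zero_outside:
 assumes "closed K" "\<And>x. x \<notin> K \<Longrightarrow> f x = 0" "x \<notin> K"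
 shows "partial i f x = 0"
proof -
 have "(f has_derivative (\<lambda>h. 0)) (at x)"
  by (rule has_derivative_transform_within_open[where f = "\<lambda>_. 0" and s = "- K"])
   (use assms in auto)
 from partial_eqI[OF this] show ?thesis by simp
qed

lemma grad_zero_outside:
 assumes "closed K" "\<And>x. x \<notin> K \<Longrightarrow> f x = 0" "x \<notin> K"
 shows "grad f x = 0"
 using partial_zero_outside[OF assms] by (simp add: vec_eq_iff)

lemma Cc_inf_partial: "f \<in> Cc_inf \<Omega> \<Longrightarrow> partial i f \<in> Cc_inf \<Omega>"
proof -
 assume f: "f \<in> Cc_inf \<Omega>"
 then obtain K where K: "compact K" "K \<subseteq> \<Omega>" "\<And>x. x \<notin> K \<Longrightarrow> f x = 0"
  using compact_support_inE by (metis Cc_inf_iff)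
 have "partial i f x = 0" if "x \<notin> K" for x
  by (rule partial_zero_outside[OF compact_imp_closed[OF K(1)] K(3) that])
 then have "compact_support_in \<Omega> (partial i f)" by (rule compact_support_inI[OF K(1,2)])
 then show ?thesis using f by (simp add: Cc_inf_iff smooth_partial)
qed

lemma Cc_inf_mult: "f \<in> Cc_inf \<Omega> \<Longrightarrow> smooth g \<Longrightarrow> (\<lambda>x. g x * f x) \<in> Cc_inf \<Omega>"
proof -
 assume f: "f \<in> Cc_inf \<Omega>" and g: "smooth g"
 then obtain K where K: "compact K" "K \<subseteq> \<Omega>" "\<And>x. x \<notin> K \<Longrightarrow> f x = 0"
  using compact_support_inE by (metis Cc_inf_iff)
 have "compact_support_in \<Omega> (\<lambda>x. g x * f x)"
  by (rule compact_support_inI[OF K(1,2)]) (simp add: K(3))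
 then show ?thesis using f g by (simp add: Cc_inf_iff smooth_mult)
qed

lemma Cc_inf_add: 
 assumes "f \<in> Cc_inf \<Omega>" "g \<in> Cc_inf \<Omega>" shows "(\<lambda>x. f x + g x) \<in> Cc_inf \<Omega>"
proof -
 obtain K where K: "compact K" "K \<subseteq> \<Omega>" "\<And>x. x \<notin> K \<Longrightarrow> f x = 0"
  using assms compact_support_inE by (metis Cc_inf_iff)
 obtain L where L: "compact L" "L \<subseteq> \<Omega>" "\<And>x. x \<notin> L \<Longrightarrow> g x = 0"
  using assms compact_support_inE by (metis Cc_inf_iff)
 have "compact_support_in \<Omega> (\<lambda>x. f x + g x)"
  by (rule compact_support_inI[of "K \<union> L"]) (use K L in auto)
 then show ?thesis using assms by (auto simp: Cc_inf_iff intro: smooth_add)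
qed

lemma Cc_inf_diff: 
 assumes "f \<in> Cc_inf \<Omega>" "g \<in> Cc_inf \<Omega>" shows "(\<lambda>x. f x - g x) \<in> Cc_inf \<Omega>"
 using Cc_inf_add[OF assms(1) Cc_inf_mult[OF assms(2) smooth_const[of "-1"]]] by simp

lemma Cc_inf_sum: 
 assumes "finite I" "I \<noteq> {}" "\<And>i. i \<in> I \<Longrightarrow> F i \<in> Cc_inf \<Omega>" shows "(\<lambda>x. \<Sum>i\<in>I. F i x) \<in> Cc_inf \<Omega>"
 using assms by (induction I rule: finite_ne_induct) (auto intro: Cc_inf_add)

lemma Cc_inf_mono: "f \<in> Cc_inf \<Omega> \<Longrightarrow> \<Omega> \<subseteq> \<Omega>' \<Longrightarrow> f \<in> Cc_inf \<Omega>'"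
 by (auto simp: Cc_inf_iff compact_support_in_def)

lemma Cc_inf_bounded_support:
 assumes "f \<in> Cc_inf \<Omega>"
 obtains R where "R > 0" "\<And>x. x \<notin> cball 0 R \<Longrightarrow> f x = 0"
proof -
 obtain K where K: "compact K" "\<And>x. x \<notin> K \<Longrightarrow> f x = 0"
  using assms compact_support_inE by (metis Cc_inf_iff)
 obtain R where "R > 0" "\<forall>x\<in>K. norm x \<le> R"
  using compact_imp_bounded[OF K(1)] by (meson bounded_pos)
 then have "K \<subseteq> cball 0 R" by auto
 with \<open>R > 0\<close> show ?thesis using that K by blast
qed

section \<open>Integrals of compactly supported functions and of their derivatives\<close>

lemma emeasure_cball_less_top: "emeasure lborel (cball (a::'a::euclidean_space) r) < top"
 using emeasure_lborel_cball_finite by (metis infinity_ennreal_def)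

lemma integrable_continuous_cball:
 fixes f :: "R3 \<Rightarrow> 'b::{banach, second_countable_topology}"
 assumes "continuous_on UNIV f" "\<And>x. x \<notin> cball 0 R \<Longrightarrow> f x = 0"
 shows "integrable lborel f"
proof -
 have "integrable lborel (\<lambda>x. indicator (cball 0 R) x *\<^sub>R f x)"
  using assms(1) by (intro borel_integrable_compact) (auto intro: continuous_on_subset)
 moreover have "(\<lambda>x. indicator (cball 0 R) x *\<^sub>R f x) = f"
  using assms(2) by (auto simp: indicator_def)
 ultimately show ?thesis by simp
qed

lemma bounded_continuous_cball:
 fixes f :: "R3 \<Rightarrow> 'b::real_normed_vector"
 assumes "continuous_on UNIV f" "\<And>x. x \<notin> cball 0 R \<Longrightarrow> f x = 0"
 obtains B where "B > 0" "\<And>x. norm (f x) \<le> B"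
proof -
 have "compact (f ` cball 0 R)"
  by (rule compact_continuous_image[OF continuous_on_subset[OF assms(1)]]) auto
 then obtain B where "B > 0" "\<forall>y\<in>f ` cball 0 R. norm y \<le> B"
  by (meson bounded_pos compact_imp_bounded)
 then have "norm (f x) \<le> B" for x
  using assms(2)[of x] by (cases "x \<in> cball 0 R") auto
 with \<open>B > 0\<close> that show ?thesis by blast
qed

lemma integral_translate:
 fixes f :: "R3 \<Rightarrow> 'b::{banach, second_countable_topology}"
 assumes "f \<in> borel_measurable borel"
 shows "(LBINT x. f (x + h)) = (LBINT x. f x)"
  and "integrable lborel (\<lambda>x. f (x + h)) \<longleftrightarrow> integrable lborel f"
proof -
 have "(\<lambda>x. x + h) = (+) h" by (simp add: fun_eq_iff add.commute)
 then have eq: "distr lborel borel (\<lambda>x::R3. x + h) = lborel"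
  by (simp add: lborel_distr_plus)
 show "(LBINT x. f (x + h)) = (LBINT x. f x)"
  using integral_distr[of "\<lambda>x. x + h" lborel borel f] assms by (simp add: eq)
 show "integrable lborel (\<lambda>x. f (x + h)) \<longleftrightarrow> integrable lborel f"
  using integrable_distr_eq[of "\<lambda>x. x + h" lborel borel f] assms by (simp add: eq)
qed

lemma Lipschitz_of_grad:
 assumes "\<And>x. f differentiable (at x)" "\<And>x. norm (grad f x) \<le> B"
 shows "\<bar>f y - f x\<bar> \<le> B * norm (y - x)"
proof -
 have "norm (f y - f x) \<le> B * norm (y - x)"
 proof (rule differentiable_bound[where S = UNIV and f' = "\<lambda>x h. grad f x \<bullet> h"])
  show "(f has_derivative (\<lambda>h. grad f x \<bullet> h)) (at x within UNIV)" for x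
   using has_derivative_grad[OF assms(1)] by simp
  show "onorm (\<lambda>h. grad f x \<bullet> h) \<le> B" for x
  proof (rule onorm_le)
   fix h
   have "norm (grad f x \<bullet> h) \<le> norm (grad f x) * norm h" by (simp add: Cauchy_Schwarz_ineq2)
   also have "\<dots> \<le> B * norm h" by (intro mult_right_mono assms(2)) simp
   finally show "norm (grad f x \<bullet> h) \<le> B * norm h" .
  qed
 qed auto
 then show ?thesis by simp
qed

text \<open>Translation invariance makes the integral of every difference quotient vanish.\<close>

lemma integral_partial_eq_0:
 assumes f: "Ck 1 f" and supp: "\<And>x. x \<notin> cball 0 R \<Longrightarrow> f x = 0"
 shows "(LBINT x. partial i f x) = 0"
proof -
 have d: "f differentiable (at x)" for x using f by simp
 have cont: "continuous_on UNIV f" using f Ck_continuous by blast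
 have gsupp: "grad f x = 0" if "x \<notin> cball 0 R" for x
  by (rule grad_zero_outside[OF _ supp that]) auto
 obtain B where B: "B > 0" "\<And>x. norm (grad f x) \<le> B"
  using bounded_continuous_cball[OF Ck1_grad_continuous[OF f] gsupp] by metis
 let ?e = "axis i 1 :: R3" and ?t = "\<lambda>n. inverse (real (Suc n))"
 let ?q = "\<lambda>n x. (f (x + ?t n *\<^sub>R ?e) - f x) / ?t n"
 have [measurable]: "f \<in> borel_measurable borel" using cont borel_measurable_continuous_onI by blast
 have int: "integrable lborel f" by (rule integrable_continuous_cball[OF cont supp])
 have z: "(LBINT x. ?q n x) = 0" for n
  using int by (simp add: integral_translate Bochner_Integration.integral_diff)
 have "(\<lambda>n. LBINT x. ?q n x) \<longlonglongrightarrow> (LBINT x. partial i f x)"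
 proof (rule integral_dominated_convergence)
  have [measurable]: "partial i f \<in> borel_measurable borel"
   using f by (intro borel_measurable_continuous_onI) simp
  show "partial i f \<in> borel_measurable lborel" by simp
  show "?q n \<in> borel_measurable lborel" for n by simp
  \<comment> \<open>The steps \<open>?t n\<close> are at most 1, so all difference quotients vanish
    off the ball of radius \<open>R + 1\<close>; the gradient bound \<open>B\<close> is a Lipschitz
    constant. This gives one dominating function.\<close>
  show "integrable lborel (\<lambda>x. B * indicator (cball 0 (R + 1)) x :: real)"
   by (intro integrable_mult_right integrable_real_indicator) (auto simp: emeasure_cball_less_top)
  show "AE x in lborel. (\<lambda>n. ?q n x) \<longlonglongrightarrow> partial i f x"
  proof (rule AE_I2)
   fix x
   have "((\<lambda>s. f (x + s *\<^sub>R ?e)) has_derivative (\<lambda>s. grad f x \<bullet> (s *\<^sub>R ?e))) (at 0)"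
   proof (rule has_derivative_compose[where f = "\<lambda>s. x + s *\<^sub>R ?e" and g = f])
    show "((\<lambda>s. x + s *\<^sub>R ?e) has_derivative (\<lambda>s. s *\<^sub>R ?e)) (at 0)"
     by (auto intro!: derivative_eq_intros)
    show "(f has_derivative (\<lambda>h. grad f x \<bullet> h)) (at (x + 0 *\<^sub>R ?e))"
     using has_derivative_grad[OF d[of x]] by simp
   qed
   moreover have "(\<lambda>s. grad f x \<bullet> (s *\<^sub>R ?e)) = (*) (partial i f x)"
    by (rule ext) (simp add: inner_axis)
   ultimately have "((\<lambda>s. f (x + s *\<^sub>R ?e)) has_real_derivative partial i f x) (at 0)"
    by (simp add: has_field_derivative_def)
   then have "(\<lambda>h. (f (x + (0 + h) *\<^sub>R ?e) - f (x + 0 *\<^sub>R ?e)) / h) \<midarrow>0\<rightarrow> partial i f x"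
    by (simp add: DERIV_def)
   moreover have "filterlim ?t (at 0) sequentially"
    unfolding filterlim_at using LIMSEQ_inverse_real_of_nat by auto
   ultimately show "(\<lambda>n. ?q n x) \<longlonglongrightarrow> partial i f x"
    by (auto dest: filterlim_compose)
  qed
  show "AE x in lborel. norm (?q n x) \<le> B * indicator (cball 0 (R + 1)) x" for n
  proof (rule AE_I2)
   fix x
   have "norm ((f (x + t *\<^sub>R ?e) - f x) / t) \<le> B * indicator (cball 0 (R + 1)) x"
    if t: "0 < t" "t \<le> 1" for t
   proof (cases "x \<in> cball 0 (R + 1)")
    case True
    have "\<bar>f (x + t *\<^sub>R ?e) - f x\<bar> \<le> B * norm (x + t *\<^sub>R ?e - x)"
     by (rule Lipschitz_of_grad[OF d B(2)])
    also have "\<dots> = B * t" using t by simp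
    finally show ?thesis using True t by (simp add: abs_divide pos_divide_le_eq)
   next
    case False
    have "norm x \<le> norm (x + t *\<^sub>R ?e) + norm (t *\<^sub>R ?e)" 
     using norm_triangle_ineq4[of "x + t *\<^sub>R ?e" "t *\<^sub>R ?e"] by simp
    then have "norm (x + t *\<^sub>R ?e) > R" "norm x > R" using False t by auto
    then show ?thesis using B(1) by (simp add: supp)
   qed
   moreover have "0 < ?t n" "?t n \<le> 1" by (auto simp: field_simps)
   ultimately show "norm (?q n x) \<le> B * indicator (cball 0 (R + 1)) x" by blast
  qed
 qed
 then show ?thesis unfolding z by (simp add: LIMSEQ_const_iff)
qed

text \<open>If the integral vanished, \<open>f\<close> would be zero almost everywhere; the zero set
  is closed, and a closed set of full measure is the whole space. Needed to normalize the mollifying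
  kernel.\<close>

lemma continuous_nonneg_integral_pos:
 fixes f :: "R3 \<Rightarrow> real"
 assumes "continuous_on UNIV f" "\<And>x. f x \<ge> 0" "integrable lborel f" "f a > 0"
 shows "(LBINT x. f x) > 0"
proof (rule ccontr)
 assume "\<not> ?thesis"
 moreover have "(LBINT x. f x) \<ge> 0" using assms by simp
 ultimately have "(LBINT x. f x) = 0" by simp
 then have "AE x in lborel. f x = 0"
  using integral_nonneg_eq_0_iff_AE[OF assms(3)] assms(2) by simp
 then have "AE x in lebesgue. x \<in> {x. f x = 0}" by (auto intro: AE_completion)
 moreover have "closed {x. f x = 0}"
  using continuous_closed_preimage_constant[of UNIV f 0] assms(1) by simp
 ultimately show False using mem_closed_if_AE_lebesgue assms(4) by force
qed

text \<open>The smooth function exp(-1/t) together with its multiples by powers of 1/t. The index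
  \<open>m\<close> makes the family closed under differentiation up to linear combinations.\<close>

definition exp_bump :: "nat \<Rightarrow> real \<Rightarrow> real" where
 "exp_bump m t = (if t > 0 then exp (- inverse t) * inverse t ^ m else 0)"

text \<open>With y = 1/t, the term of order m + 2 of the exponential series gives y^(m+2) \<le>
  (m+2)! exp y. The two powers beyond y^m become the factor t^2, whence the derivative at 0 exists
  and is 0.\<close>

lemma exp_bump_le: "\<bar>exp_bump m t\<bar> \<le> fact (m + 2) * \<bar>t\<bar> ^ 2"
proof (cases "t > 0")
 case True
 define y where "y = inverse t"
 have y: "y > 0" using True by (simp add: y_def)
 have "(\<Sum>n\<in>{m + 2}. y ^ n /\<^sub>R fact n) \<le> (\<Sum>n. y ^ n /\<^sub>R fact n)"
  using y by (intro sum_le_suminf summable_exp_generic) auto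
 then have "y ^ (m + 2) / fact (m + 2) \<le> exp y"
  by (simp add: exp_def divide_inverse mult.commute)
 then   have "y ^ m * y ^ 2 \<le> fact (m + 2) * exp y"
  by (simp only: power_add pos_divide_le_eq[OF fact_gt_zero] mult.commute)
 then have "y ^ m * exp (- y) \<le> fact (m + 2) * t ^ 2"
  using y by (simp add: y_def exp_minus field_simps)
 then show ?thesis using True by (simp add: exp_bump_def y_def mult.commute)
qed (simp add: exp_bump_def)

lemma exp_bump_deriv:
 "(exp_bump m has_real_derivative (exp_bump (m + 2) t - real m * exp_bump (m + 1) t)) (at t)"
proof -
 consider "t > 0" | "t < 0" | "t = 0" by linarith
 then show ?thesis
 proof cases
  case 1
  define y where "y = inverse t"
  have "((\<lambda>y. exp (- y) * y ^ m) has_real_derivative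
    - exp (- y) * y ^ m + exp (- y) * (real m * y ^ (m - 1))) (at (inverse t))"
   unfolding y_def by (auto intro!: derivative_eq_intros)
  moreover have "(inverse has_real_derivative - (y * y)) (at t)"
   using DERIV_inverse[of t] 1 by (simp add: y_def power2_eq_square)
  ultimately have "((\<lambda>t. exp (- inverse t) * inverse t ^ m) has_real_derivative
    (- exp (- y) * y ^ m + exp (- y) * (real m * y ^ (m - 1))) * - (y * y)) (at t)"
   by (rule DERIV_chain2)
  moreover have "(- exp (- y) * y ^ m + exp (- y) * (real m * y ^ (m - 1))) * - (y * y)
    = exp (- y) * y ^ (m + 2) - real m * (exp (- y) * y ^ (m + 1))"
   by (cases m) (simp_all add: algebra_simps)
  ultimately have "((\<lambda>t. exp (- inverse t) * inverse t ^ m) has_real_derivative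
    (exp (- inverse t) * inverse t ^ (m + 2) - real m * (exp (- inverse t) * inverse t ^ (m + 1)))) (at t)"
   unfolding y_def by simp
  moreover have "\<forall>\<^sub>F s in nhds t. exp_bump m s = exp (- inverse s) * inverse s ^ m"
   using eventually_nhds_in_open[of "{0<..}" t] 1 by (auto elim!: eventually_mono simp: exp_bump_def)
  ultimately show ?thesis using 1
   by (subst DERIV_cong_ev[OF refl _ refl]) (auto simp: exp_bump_def)
 next
  case 2
  have "\<forall>\<^sub>F s in nhds t. exp_bump m s = 0"
   using eventually_nhds_in_open[of "{..<0}" t] 2 by (auto elim!: eventually_mono simp: exp_bump_def)
  then show ?thesis using 2
   by (subst DERIV_cong_ev[OF refl _ refl]) (auto simp: exp_bump_def)
 next
  case 3
  have "((\<lambda>h. exp_bump m h / h) \<longlongrightarrow> 0) (at 0)"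
  proof (rule Lim_null_comparison)
   show "\<forall>\<^sub>F h in at 0. norm (exp_bump m h / h) \<le> fact (m + 2) * \<bar>h\<bar>"
   proof (rule eventually_at_filter[THEN iffD2], rule always_eventually, intro allI impI)
    fix h :: real assume "h \<noteq> 0"
    define c where "c = (fact (m + 2) :: real)"
    have "\<bar>exp_bump m h\<bar> \<le> c * (\<bar>h\<bar> * \<bar>h\<bar>)"
     using exp_bump_le[of m h] by (simp only: c_def power2_eq_square)
    then show "norm (exp_bump m h / h) \<le> fact (m + 2) * \<bar>h\<bar>"
     unfolding c_def[symmetric] using \<open>h \<noteq> 0\<close> by (simp add: abs_divide pos_divide_le_eq mult.assoc)
   qed
   show "((\<lambda>h::real. fact (m + 2) * \<bar>h\<bar>) \<longlongrightarrow> 0) (at 0)"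
    by (auto intro!: tendsto_eq_intros)
  qed
  then show ?thesis using 3 by (simp add: DERIV_def exp_bump_def)
 qed
qed

text \<open>Differentiation raises the index of \<open>exp_bump\<close>, so the induction on the
  order must run for all \<open>m\<close> at once.\<close>

lemma smooth_exp_bump: "smooth (\<lambda>x. exp_bump m (1 - x \<bullet> x))"
 unfolding smooth_def
proof
 fix k
 show "Ck k (\<lambda>x. exp_bump m (1 - x \<bullet> x))"
 proof (induction k arbitrary: m)
  case 0
  have "continuous_on UNIV (exp_bump m)"
   using exp_bump_deriv by (meson DERIV_isCont continuous_at_imp_continuous_on)
  then show ?case 
   by (auto intro!: continuous_on_compose2[of UNIV "exp_bump m"] continuous_intros)
 next
  case (Suc k)
  have d: "((\<lambda>x::R3. 1 - x \<bullet> x) has_derivative (\<lambda>h. - (x \<bullet> h + h \<bullet> x))) (at x)" for x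
   by (auto intro!: derivative_eq_intros)
  then have df: "(\<lambda>x::R3. 1 - x \<bullet> x) differentiable (at x)" for x
   unfolding differentiable_def by blast
  have p: "partial i (\<lambda>x. 1 - x \<bullet> x) x = - 2 * x $ i" for i and x :: R3
   by (simp add: partial_eqI[OF d] inner_axis inner_axis')
  have "partial i (\<lambda>x. exp_bump m (1 - x \<bullet> x))
    = (\<lambda>x. (exp_bump (m + 2) (1 - x \<bullet> x) - real m * exp_bump (m + 1) (1 - x \<bullet> x)) * (- 2 * x $ i))" for i
   by (rule ext) (simp only: partial_chain(1)[OF df exp_bump_deriv] p)
  moreover have "(\<lambda>x. exp_bump m (1 - x \<bullet> x)) differentiable (at x)" for x :: R3
   by (rule partial_chain(2)[OF df exp_bump_deriv])
  moreover have "Ck k (\<lambda>x. (exp_bump (m + 2) (1 - x \<bullet> x) - real m * exp_bump (m + 1) (1 - x \<bullet> x)) * (- 2 * x $ i))" for i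
   by (intro Ck_mult Ck_diff Ck_const Ck_component Suc)
  ultimately show ?case by simp
 qed
qed

text \<open>The standard kernel exp(-1/(1 - |x|^2)) on the unit ball, divided by its mass.\<close>

definition bump :: "R3 \<Rightarrow> real" where
 "bump x = exp_bump 0 (1 - x \<bullet> x) / (LBINT y. exp_bump 0 (1 - y \<bullet> (y::R3)))"

lemma bump_facts:
 shows smooth_bump: "smooth bump"
  and bump_zero: "x \<notin> cball 0 1 \<Longrightarrow> bump x = 0"
  and bump_nonneg: "bump x \<ge> 0"
  and bump_0_pos: "bump 0 > 0"
  and integral_bump: "(LBINT x. bump x) = 1"
  and integrable_bump: "integrable lborel bump"
proof -
 let ?h = "\<lambda>x::R3. exp_bump 0 (1 - x \<bullet> x)"
 have supp: "?h x = 0" if "x \<notin> cball 0 1" for x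
 proof -
  have "norm x > 1" using that by simp
  then have "x \<bullet> x > 1" by (metis dot_square_norm one_less_power zero_less_numeral)
  then show ?thesis by (simp add: exp_bump_def)
 qed
 have cont: "continuous_on UNIV ?h" by (rule smooth_continuous[OF smooth_exp_bump])
 have int: "integrable lborel ?h" by (rule integrable_continuous_cball[OF cont supp])
 have pos: "(LBINT x. ?h x) > 0"
  by (rule continuous_nonneg_integral_pos[OF cont _ int, of 0]) (auto simp: exp_bump_def)
 have "smooth (\<lambda>x. inverse (LBINT x. ?h x) * ?h x)"
  by (intro smooth_mult smooth_const smooth_exp_bump)
 then show "smooth bump" by (simp add: bump_def[abs_def] field_simps)
 show "x \<notin> cball 0 1 \<Longrightarrow> bump x = 0" using supp by (simp add: bump_def)
 show "bump x \<ge> 0" using pos by (simp add: bump_def exp_bump_def)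
 show "bump 0 > 0" using pos by (simp add: bump_def exp_bump_def)
 show "(LBINT x. bump x) = 1" using pos by (simp add: bump_def[abs_def])
 show "integrable lborel bump" using int by (simp add: bump_def[abs_def])
qed

lemma bump_Cc_inf: "bump \<in> Cc_inf UNIV"
 unfolding Cc_inf_iff using smooth_bump bump_zero by (auto intro: compact_support_inI[of "cball 0 1"])

text \<open>Used with c = 1/\<epsilon> and d = -y/\<epsilon> for kernels concentrated at y, with
  small c for cutoffs that exhaust the space, and with c = 1 for translates.\<close>

lemma Cc_inf_reflected:
 assumes f: "f \<in> Cc_inf UNIV" and "c \<noteq> 0"
 shows "(\<lambda>x. f (c *\<^sub>R x + d)) \<in> Cc_inf UNIV"
proof -
 obtain R where R: "R > 0" "\<And>x. x \<notin> cball 0 R \<Longrightarrow> f x = 0"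
  using Cc_inf_bounded_support[OF f] by metis
 have "f (c *\<^sub>R x + d) = 0" if "x \<notin> cball 0 ((R + norm d) / \<bar>c\<bar>)" for x
 proof (rule R(2))
  have "norm x * \<bar>c\<bar> > R + norm d" using that assms(2) by (simp add: field_simps)
  moreover have "norm (c *\<^sub>R x) \<le> norm (c *\<^sub>R x + d) + norm d"
   using norm_triangle_ineq4[of "c *\<^sub>R x + d" d] by simp
  ultimately show "c *\<^sub>R x + d \<notin> cball 0 R" by (simp add: mult.commute)
 qed
 then have "compact_support_in UNIV (\<lambda>x. f (c *\<^sub>R x + d))"
  by (intro compact_support_inI[of "cball 0 ((R + norm d) / \<bar>c\<bar>)"]) auto
 then show ?thesis using f by (auto simp: Cc_inf_iff intro: smooth_affine)
qed

section \<open>Sobolev's inequality\<close>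

lemma Cauchy_Schwarz_integral:
 fixes f g :: "'a \<Rightarrow> real"
 assumes [measurable]: "f \<in> borel_measurable M" "g \<in> borel_measurable M"
  and f: "integrable M (\<lambda>x. (f x)\<^sup>2)" and g: "integrable M (\<lambda>x. (g x)\<^sup>2)"
 shows "integrable M (\<lambda>x. f x * g x)"
  and "(\<integral>x. \<bar>f x * g x\<bar> \<partial>M)\<^sup>2 \<le> (\<integral>x. (f x)\<^sup>2 \<partial>M) * (\<integral>x. (g x)\<^sup>2 \<partial>M)"
proof -
 have le: "\<bar>f x * g x\<bar> \<le> (f x)\<^sup>2 + (g x)\<^sup>2" for x
 proof -
  have "0 \<le> (\<bar>f x\<bar> - \<bar>g x\<bar>)\<^sup>2" by simp
  then have "2 * \<bar>f x * g x\<bar> \<le> (f x)\<^sup>2 + (g x)\<^sup>2" by (simp add: power2_diff abs_mult)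
  then show ?thesis by (smt (verit) zero_le_power2)
 qed
 show i: "integrable M (\<lambda>x. f x * g x)"
  by (rule Bochner_Integration.integrable_bound[OF Bochner_Integration.integrable_add[OF f g]])
   (use le in auto)
 define a b c where "a = (\<integral>x. (f x)\<^sup>2 \<partial>M)" and "b = (\<integral>x. (g x)\<^sup>2 \<partial>M)" and "c = (\<integral>x. \<bar>f x * g x\<bar> \<partial>M)"
 \<comment> \<open>A nonnegative polynomial in \<open>t\<close>. For \<open>b > 0\<close> its
   minimizer \<open>c / b\<close> gives the claim; for \<open>b = 0\<close> it is affine, and t = (a
   + 1)/(2c) would give it the value -1 unless \<open>c = 0\<close>.\<close>
 have q: "0 \<le> a - 2 * t * c + t\<^sup>2 * b" for t
 proof -
  have "0 \<le> (\<integral>x. (\<bar>f x\<bar> - t * \<bar>g x\<bar>)\<^sup>2 \<partial>M)" by simp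
  also have "\<dots> = (\<integral>x. (f x)\<^sup>2 - 2 * t * \<bar>f x * g x\<bar> + t\<^sup>2 * (g x)\<^sup>2 \<partial>M)"
   by (intro Bochner_Integration.integral_cong) (auto simp: power2_diff power_mult_distrib abs_mult algebra_simps)
  also have "\<dots> = a - 2 * t * c + t\<^sup>2 * b"
   using f g i by (simp add: a_def b_def c_def)
  finally show ?thesis .
 qed
 have nn: "a \<ge> 0" "b \<ge> 0" "c \<ge> 0" by (auto simp: a_def b_def c_def)
 show "c\<^sup>2 \<le> a * b"
 proof (cases "b = 0")
  case True
  have "c = 0"
  proof (rule ccontr)
   assume "c \<noteq> 0"
   then show False using q[of "(a + 1) / (2 * c)"] True nn by (simp add: field_simps)
  qed
  then show ?thesis using nn by simp
 next
  case False
  then have "b > 0" using nn by simp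
  moreover have "0 \<le> a - c\<^sup>2 / b"
   using q[of "c / b"] \<open>b > 0\<close> by (simp add: field_simps power2_eq_square)
  ultimately show ?thesis by (simp add: field_simps)
 qed
qed

text \<open>In this form the finite bounds supply the integrability, so that it applies to sections
  of functions of several variables without further side conditions.\<close>

lemma nn_integral_Cauchy_Schwarz:
 fixes f g :: "'a \<Rightarrow> real"
 assumes [measurable]: "f \<in> borel_measurable M" "g \<in> borel_measurable M"
  and nn: "\<And>x. f x \<ge> 0" "\<And>x. g x \<ge> 0" "A \<ge> 0" "B \<ge> 0"
  and f: "(\<integral>\<^sup>+x. ennreal ((f x)\<^sup>2) \<partial>M) \<le> ennreal (A\<^sup>2)"
  and g: "(\<integral>\<^sup>+x. ennreal ((g x)\<^sup>2) \<partial>M) \<le> ennreal (B\<^sup>2)"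
 shows "(\<integral>\<^sup>+x. ennreal (f x * g x) \<partial>M) \<le> ennreal (A * B)"
proof -
 have i: "integrable M (\<lambda>x. (f x)\<^sup>2)" "integrable M (\<lambda>x. (g x)\<^sup>2)"
  using f g by (auto simp: integrable_iff_bounded intro: le_less_trans)
 have "(\<integral>x. \<bar>f x * g x\<bar> \<partial>M)\<^sup>2 \<le> (\<integral>x. (f x)\<^sup>2 \<partial>M) * (\<integral>x. (g x)\<^sup>2 \<partial>M)"
  by (rule Cauchy_Schwarz_integral) (use i in auto)
 also have "\<dots> \<le> A\<^sup>2 * B\<^sup>2"
 proof (rule mult_mono)
  show "(\<integral>x. (f x)\<^sup>2 \<partial>M) \<le> A\<^sup>2"
   using f nn_integral_eq_integral[OF i(1)] by (auto simp: ennreal_le_iff)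
  show "(\<integral>x. (g x)\<^sup>2 \<partial>M) \<le> B\<^sup>2"
   using g nn_integral_eq_integral[OF i(2)] by (auto simp: ennreal_le_iff)
 qed auto
 finally have "(\<integral>x. \<bar>f x * g x\<bar> \<partial>M)\<^sup>2 \<le> (A * B)\<^sup>2" by (simp add: power_mult_distrib)
 then have "(\<integral>x. f x * g x \<partial>M) \<le> A * B"
  using nn by (simp add: abs_of_nonneg power2_le_iff_abs_le)
 moreover have "integrable M (\<lambda>x. f x * g x)"
  by (rule Cauchy_Schwarz_integral) (use i in auto)
 ultimately show ?thesis
  using nn by (subst nn_integral_eq_integral) (auto intro: ennreal_leI)
qed

lemma nn_integral_lborel_pair:
 fixes F :: "'a::euclidean_space \<Rightarrow> 'b::euclidean_space \<Rightarrow> ennreal"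
 assumes [measurable]: "case_prod F \<in> borel_measurable (borel \<Otimes>\<^sub>M borel)"
 shows "(\<integral>\<^sup>+p. F (fst p) (snd p) \<partial>(lborel \<Otimes>\<^sub>M lborel)) = (\<integral>\<^sup>+x. \<integral>\<^sup>+y. F x y \<partial>lborel \<partial>lborel)"
  and "(\<integral>\<^sup>+x. \<integral>\<^sup>+y. F x y \<partial>lborel \<partial>lborel) = (\<integral>\<^sup>+y. \<integral>\<^sup>+x. F x y \<partial>lborel \<partial>lborel)"
proof -
 have m: "(\<lambda>p. F (fst p) (snd p)) \<in> borel_measurable (lborel \<Otimes>\<^sub>M lborel)"
  using assms by (simp add: case_prod_beta' cong: sets_pair_measure_cong measurable_cong_sets)
 show "(\<integral>\<^sup>+p. F (fst p) (snd p) \<partial>(lborel \<Otimes>\<^sub>M lborel)) = (\<integral>\<^sup>+x. \<integral>\<^sup>+y. F x y \<partial>lborel \<partial>lborel)"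
  using lborel.nn_integral_fst[OF m] by simp
 show "(\<integral>\<^sup>+x. \<integral>\<^sup>+y. F x y \<partial>lborel \<partial>lborel) = (\<integral>\<^sup>+y. \<integral>\<^sup>+x. F x y \<partial>lborel \<partial>lborel)"
  using lborel_pair.Fubini'[of F] m by (simp add: case_prod_beta')
qed

text \<open>For fixed x, Cauchy-Schwarz in (y, z) separates g1 from the product g2 g3, whose square
  integral factorizes into \<open>(a x)\<^sup>2 * (b x)\<^sup>2\<close>. A second Cauchy-Schwarz, in
  x, separates \<open>a\<close> from \<open>b\<close>. Finite sections make \<open>a\<close> and
  \<open>b\<close> real-valued functions.\<close>

lemma Loomis_Whitney:
 fixes g1 g2 g3 :: "real \<Rightarrow> real \<Rightarrow> real"
 assumes [measurable]: "case_prod g1 \<in> borel_measurable (borel \<Otimes>\<^sub>M borel)"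
   "case_prod g2 \<in> borel_measurable (borel \<Otimes>\<^sub>M borel)" "case_prod g3 \<in> borel_measurable (borel \<Otimes>\<^sub>M borel)"
  and nn: "\<And>x y. g1 x y \<ge> 0" "\<And>x y. g2 x y \<ge> 0" "\<And>x y. g3 x y \<ge> 0" "A1 \<ge> 0" "A2 \<ge> 0" "A3 \<ge> 0"
  and fin: "\<And>x. (\<integral>\<^sup>+z. ennreal ((g2 x z)\<^sup>2) \<partial>lborel) < \<infinity>" "\<And>x. (\<integral>\<^sup>+y. ennreal ((g3 x y)\<^sup>2) \<partial>lborel) < \<infinity>"
  and A1: "(\<integral>\<^sup>+y. \<integral>\<^sup>+z. ennreal ((g1 y z)\<^sup>2) \<partial>lborel \<partial>lborel) \<le> ennreal (A1\<^sup>2)"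
  and A2: "(\<integral>\<^sup>+x. \<integral>\<^sup>+z. ennreal ((g2 x z)\<^sup>2) \<partial>lborel \<partial>lborel) \<le> ennreal (A2\<^sup>2)"
  and A3: "(\<integral>\<^sup>+x. \<integral>\<^sup>+y. ennreal ((g3 x y)\<^sup>2) \<partial>lborel \<partial>lborel) \<le> ennreal (A3\<^sup>2)"
 shows "(\<integral>\<^sup>+x. \<integral>\<^sup>+y. \<integral>\<^sup>+z. ennreal (g1 y z * g2 x z * g3 x y) \<partial>lborel \<partial>lborel \<partial>lborel) \<le> ennreal (A1 * (A2 * A3))"
proof -
 define a where "a x = sqrt (enn2real (\<integral>\<^sup>+z. ennreal ((g2 x z)\<^sup>2) \<partial>lborel))" for x
 define b where "b x = sqrt (enn2real (\<integral>\<^sup>+y. ennreal ((g3 x y)\<^sup>2) \<partial>lborel))" for x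
 have [measurable]: "a \<in> borel_measurable borel" "b \<in> borel_measurable borel"
  unfolding a_def b_def by measurable
 have a2: "ennreal ((a x)\<^sup>2) = (\<integral>\<^sup>+z. ennreal ((g2 x z)\<^sup>2) \<partial>lborel)" for x
  using fin(1)[of x] by (simp add: a_def ennreal_enn2real less_top)
 have b2: "ennreal ((b x)\<^sup>2) = (\<integral>\<^sup>+y. ennreal ((g3 x y)\<^sup>2) \<partial>lborel)" for x
  using fin(2)[of x] by (simp add: b_def ennreal_enn2real less_top)
 have ab: "a x \<ge> 0" "b x \<ge> 0" for x by (auto simp: a_def b_def)
 have sec: "(\<integral>\<^sup>+y. \<integral>\<^sup>+z. ennreal (g1 y z * g2 x z * g3 x y) \<partial>lborel \<partial>lborel) \<le> ennreal (A1 * (a x * b x))" for x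
 proof -
  have "(\<integral>\<^sup>+y. \<integral>\<^sup>+z. ennreal (g1 y z * g2 x z * g3 x y) \<partial>lborel \<partial>lborel)
    = (\<integral>\<^sup>+p. ennreal (g1 (fst p) (snd p) * (g2 x (snd p) * g3 x (fst p))) \<partial>(lborel \<Otimes>\<^sub>M lborel))"
   by (subst nn_integral_lborel_pair(1)) (auto simp: mult.assoc)
  also have "\<dots> \<le> ennreal (A1 * (a x * b x))"
  proof (rule nn_integral_Cauchy_Schwarz)
   show "(\<integral>\<^sup>+p. ennreal ((g1 (fst p) (snd p))\<^sup>2) \<partial>(lborel \<Otimes>\<^sub>M lborel)) \<le> ennreal (A1\<^sup>2)"
    using A1 by (subst nn_integral_lborel_pair(1)) auto
   have "(\<integral>\<^sup>+p. ennreal ((g2 x (snd p) * g3 x (fst p))\<^sup>2) \<partial>(lborel \<Otimes>\<^sub>M lborel))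
     = (\<integral>\<^sup>+y. \<integral>\<^sup>+z. ennreal ((g3 x y)\<^sup>2) * ennreal ((g2 x z)\<^sup>2) \<partial>lborel \<partial>lborel)"
    by (subst nn_integral_lborel_pair(1)) (auto simp: power_mult_distrib ennreal_mult' mult.commute)
   also have "\<dots> = (\<integral>\<^sup>+y. ennreal ((g3 x y)\<^sup>2) * ennreal ((a x)\<^sup>2) \<partial>lborel)"
    by (simp add: nn_integral_cmult a2)
   also have "\<dots> = ennreal ((b x)\<^sup>2) * ennreal ((a x)\<^sup>2)"
    by (simp add: nn_integral_multc b2)
   also have "\<dots> = ennreal ((a x * b x)\<^sup>2)"
    by (simp add: power_mult_distrib ennreal_mult' mult.commute)
   finally show "(\<integral>\<^sup>+p. ennreal ((g2 x (snd p) * g3 x (fst p))\<^sup>2) \<partial>(lborel \<Otimes>\<^sub>M lborel)) \<le> ennreal ((a x * b x)\<^sup>2)"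
    by simp
  qed (use nn ab in auto)
  finally show ?thesis .
 qed
 have "(\<integral>\<^sup>+x. \<integral>\<^sup>+y. \<integral>\<^sup>+z. ennreal (g1 y z * g2 x z * g3 x y) \<partial>lborel \<partial>lborel \<partial>lborel)
  \<le> (\<integral>\<^sup>+x. ennreal A1 * ennreal (a x * b x) \<partial>lborel)"
  using sec nn by (intro nn_integral_mono) (auto simp: ennreal_mult')
 also have "\<dots> = ennreal A1 * (\<integral>\<^sup>+x. ennreal (a x * b x) \<partial>lborel)"
  by (rule nn_integral_cmult) auto
 also have "\<dots> \<le> ennreal A1 * ennreal (A2 * A3)"
  by (intro mult_left_mono nn_integral_Cauchy_Schwarz) (use nn ab A2 A3 in \<open>auto simp: a2 b2\<close>)
 finally show ?thesis using nn by (simp add: ennreal_mult')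
qed

section \<open>Cartesian coordinates and iterated integrals\<close>

definition vec3 :: "real \<times> real \<times> real \<Rightarrow> R3" where
 "vec3 p = vector [fst p, fst (snd p), snd (snd p)]"

lemma vec3_nth [simp]: "vec3 p $ 1 = fst p" "vec3 p $ 2 = fst (snd p)" "vec3 p $ 3 = snd (snd p)"
 by (auto simp: vec3_def)

lemma continuous_vec3: "continuous_on UNIV vec3"
proof -
 have "continuous_on UNIV (\<lambda>p. vec3 p $ i)" for i
 proof -
  consider "i = 1" | "i = 2" | "i = 3" using exhaust_3 by blast
  then show ?thesis by cases (simp_all add: continuous_intros continuous_on_fst continuous_on_snd)
 qed
 then have "continuous_on UNIV (\<lambda>p. \<chi> i. vec3 p $ i)" by (intro continuous_on_vec_lambda)
 then show ?thesis by simp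
qed

lemma vec3_measurable [measurable]: "vec3 \<in> borel_measurable borel"
 using continuous_vec3 borel_measurable_continuous_onI by blast

text \<open>A measure is Lebesgue measure once it has the right values on boxes, and the preimage of
  a box is a product of three intervals.\<close>

lemma lborel_vec3: "distr (lborel \<Otimes>\<^sub>M (lborel \<Otimes>\<^sub>M lborel)) borel vec3 = lborel"
proof (rule lborel_eqI[symmetric])
 fix l u :: R3 assume le: "\<And>b. b \<in> Basis \<Longrightarrow> l \<bullet> b \<le> u \<bullet> b"
 then have le': "l $ i \<le> u $ i" for i
  using le[of "axis i 1"] by (simp add: inner_axis axis_in_Basis_iff)
 have pre: "vec3 -` box l u = {l$1<..<u$1} \<times> ({l$2<..<u$2} \<times> {l$3<..<u$3})"
  by (auto simp: mem_box_cart forall_3)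
 have prodB: "(\<Prod>b\<in>Basis. (u - l) \<bullet> b) = (\<Prod>i\<in>UNIV. (u - l) $ i)"
  unfolding Basis_vec_def
  by (subst prod.reindex_cong[of "\<lambda>i. axis i 1" UNIV]) (auto simp: inj_on_def axis_eq_axis inner_axis)
 have "emeasure (distr (lborel \<Otimes>\<^sub>M (lborel \<Otimes>\<^sub>M lborel)) borel vec3) (box l u)
  = emeasure (lborel \<Otimes>\<^sub>M (lborel \<Otimes>\<^sub>M lborel)) ({l$1<..<u$1} \<times> ({l$2<..<u$2} \<times> {l$3<..<u$3}))"
  by (subst emeasure_distr) (auto simp: pre lborel_prod)
 also have "\<dots> = ennreal (u$1 - l$1) * (ennreal (u$2 - l$2) * ennreal (u$3 - l$3))"
 proof -
  have "emeasure (lborel \<Otimes>\<^sub>M (lborel \<Otimes>\<^sub>M lborel)) ({l$1<..<u$1} \<times> ({l$2<..<u$2} \<times> {l$3<..<u$3}))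
   = emeasure lborel {l$1<..<u$1} * emeasure (lborel \<Otimes>\<^sub>M lborel) ({l$2<..<u$2} \<times> {l$3<..<u$3})"
   unfolding lborel_prod
   by (subst lborel_prod[symmetric], rule lborel.emeasure_pair_measure_Times) (auto intro!: borel_open open_Times)
  also have "emeasure (lborel \<Otimes>\<^sub>M lborel) ({l$2<..<u$2} \<times> {l$3<..<u$3}) = emeasure lborel {l$2<..<u$2} * emeasure lborel {l$3<..<u$3}"
   by (rule lborel.emeasure_pair_measure_Times) auto
  finally show ?thesis using le' by simp
 qed
 also have "\<dots> = ennreal (\<Prod>b\<in>Basis. (u - l) \<bullet> b)"
 proof -
  have "(\<Prod>b\<in>Basis. (u - l) \<bullet> b) = (u$1 - l$1) * ((u$2 - l$2) * (u$3 - l$3))"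
   unfolding prodB UNIV_3 by (subst prod.insert, simp, simp, subst prod.insert, simp, simp, simp add: algebra_simps)
  moreover have "u$1 - l$1 \<ge> 0" "u$2 - l$2 \<ge> 0" "u$3 - l$3 \<ge> 0" using le' by simp_all
  ultimately show ?thesis by (simp only: ennreal_mult mult_nonneg_nonneg)
 qed
 finally show "emeasure (distr (lborel \<Otimes>\<^sub>M (lborel \<Otimes>\<^sub>M lborel)) borel vec3) (box l u) = ennreal (\<Prod>b\<in>Basis. (u - l) \<bullet> b)" .
qed simp

lemma nn_integral_vec3:
 fixes F :: "R3 \<Rightarrow> ennreal"
 assumes [measurable]: "F \<in> borel_measurable borel"
 shows "(\<integral>\<^sup>+x. F x \<partial>lborel) = (\<integral>\<^sup>+x. \<integral>\<^sup>+y. \<integral>\<^sup>+z. F (vec3 (x, y, z)) \<partial>lborel \<partial>lborel \<partial>lborel)"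
proof -
 have [measurable]: "vec3 \<in> borel_measurable (lborel \<Otimes>\<^sub>M (lborel \<Otimes>\<^sub>M lborel))"
  by (simp add: lborel_prod)
 have "(\<integral>\<^sup>+x. F x \<partial>lborel) = (\<integral>\<^sup>+p. F (vec3 p) \<partial>(lborel \<Otimes>\<^sub>M (lborel \<Otimes>\<^sub>M lborel)))"
  by (subst lborel_vec3[symmetric], subst nn_integral_distr) auto
 also have "\<dots> = (\<integral>\<^sup>+x. \<integral>\<^sup>+q. F (vec3 (x, q)) \<partial>(lborel \<Otimes>\<^sub>M lborel) \<partial>lborel)"
  by (subst lborel_prod, subst lborel.nn_integral_fst[symmetric]) (auto simp: lborel_prod)
 also have "\<dots> = (\<integral>\<^sup>+x. \<integral>\<^sup>+y. \<integral>\<^sup>+z. F (vec3 (x, y, z)) \<partial>lborel \<partial>lborel \<partial>lborel)"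
  by (intro nn_integral_cong, subst lborel.nn_integral_fst[symmetric]) (auto simp: lborel_prod)
 finally show ?thesis .
qed

lemma abs_le_nn_integral_deriv:
 fixes h h' :: "real \<Rightarrow> real"
 assumes d: "\<And>t. (h has_real_derivative h' t) (at t)" and c: "continuous_on UNIV h'"
  and z: "\<And>t. \<bar>t\<bar> > L \<Longrightarrow> h t = 0"
 shows "ennreal \<bar>h t\<bar> \<le> (\<integral>\<^sup>+s. ennreal \<bar>h' s\<bar> \<partial>lborel)"
proof -
 \<comment> \<open>A point to the left of both \<open>t\<close> and the support: there
   \<open>h\<close> vanishes, so \<open>h t\<close> is the integral of \<open>h'\<close> from
   \<open>a\<close> to \<open>t\<close>.\<close>
 define a where "a = min (t - 1) (- (\<bar>L\<bar> + 1))"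
 have [measurable]: "h' \<in> borel_measurable borel" using c borel_measurable_continuous_onI by blast
 have "a \<le> t" "h a = 0" using z[of a] by (auto simp: a_def)
 have "(LBINT x. h' x * indicator {a..t} x) = h t - h a"
  using \<open>a \<le> t\<close> d c by (intro integral_FTC_Icc_real) (auto simp: continuous_on_eq_continuous_at)
 then have "ennreal \<bar>h t\<bar> = ennreal \<bar>\<integral>x. h' x * indicator {a..t} x \<partial>lborel\<bar>" using \<open>h a = 0\<close> by simp
 also have "\<dots> \<le> (\<integral>\<^sup>+x. ennreal (norm (h' x * indicator {a..t} x)) \<partial>lborel)"
 proof (cases "integrable lborel (\<lambda>x. h' x * indicator {a..t} x)")
  case True
  then show ?thesis using integral_norm_bound_ennreal[of lborel "\<lambda>x. h' x * indicator {a..t} x"] by simp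
 next
  case False
  \<comment> \<open>The integral of a nonintegrable function is 0 by convention, so the bound is
    trivial here.\<close>
  then show ?thesis by (simp add: not_integrable_integral_eq)
 qed
 also have "\<dots> \<le> (\<integral>\<^sup>+s. ennreal \<bar>h' s\<bar> \<partial>lborel)"
  by (intro nn_integral_mono ennreal_leI) (auto simp: indicator_def)
 finally show ?thesis .
qed

lemma nn_integral_bounded_support:
 fixes h :: "real \<Rightarrow> real"
 assumes "\<And>t. \<bar>h t\<bar> \<le> B" "\<And>t. \<bar>t\<bar> > L \<Longrightarrow> h t = 0"
 shows "(\<integral>\<^sup>+s. ennreal \<bar>h s\<bar> \<partial>lborel) \<le> ennreal (2 * B * \<bar>L\<bar>)"
proof -
 have B: "B \<ge> 0" using assms(1)[of 0] by linarith
 have "(\<integral>\<^sup>+s. ennreal \<bar>h s\<bar> \<partial>lborel) \<le> (\<integral>\<^sup>+s. ennreal B * indicator {-\<bar>L\<bar>..\<bar>L\<bar>} s \<partial>lborel)"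
 proof (intro nn_integral_mono)
  fix s show "ennreal \<bar>h s\<bar> \<le> ennreal B * indicator {-\<bar>L\<bar>..\<bar>L\<bar>} s"
   using assms(1)[of s] assms(2)[of s] by (auto simp: indicator_def intro: ennreal_leI)
 qed
 also have "\<dots> = ennreal B * ennreal (2 * \<bar>L\<bar>)" by (simp add: nn_integral_cmult_indicator)
 finally show ?thesis using B by (simp add: ennreal_mult'[symmetric] mult.assoc mult.left_commute)
qed


lemma vec3_measurable_comp [measurable (raw)]:
 assumes [measurable]: "a \<in> borel_measurable M" "b \<in> borel_measurable M" "c \<in> borel_measurable M"
 shows "(\<lambda>x. vec3 (a x, b x, c x)) \<in> borel_measurable M"
proof -
 have "(\<lambda>x. (a x, (b x, c x))) \<in> borel_measurable M"
  by (intro borel_measurable_Pair assms)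
 then show ?thesis by (rule measurable_compose[OF _ vec3_measurable])
qed

lemma line_derivative:
 assumes "f differentiable (at (x + s *\<^sub>R axis i 1))"
 shows "((\<lambda>s. f (x + s *\<^sub>R axis i 1)) has_real_derivative partial i f (x + s *\<^sub>R axis i 1)) (at s)"
proof -
 have "((\<lambda>s. f (x + s *\<^sub>R axis i 1)) has_derivative (\<lambda>h. grad f (x + s *\<^sub>R axis i 1) \<bullet> (h *\<^sub>R axis i 1))) (at s)"
  by (rule has_derivative_compose[where f = "\<lambda>s. x + s *\<^sub>R axis i 1" and g = f, OF _ has_derivative_grad[OF assms]])
   (auto intro!: derivative_eq_intros)
 moreover have "(\<lambda>h. grad f (x + s *\<^sub>R axis i 1) \<bullet> (h *\<^sub>R axis i 1)) = (*) (partial i f (x + s *\<^sub>R axis i 1))"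
  by (rule ext) (simp add: inner_axis)
 ultimately show ?thesis by (simp add: has_field_derivative_def)
qed

lemma vec3_lines:
 "vec3 (s, y, z) = vec3 (0, y, z) + s *\<^sub>R axis 1 1"
 "vec3 (y, s, z) = vec3 (y, 0, z) + s *\<^sub>R axis 2 1"
 "vec3 (y, z, s) = vec3 (y, z, 0) + s *\<^sub>R axis 3 1"
 by (auto simp: vec_eq_iff forall_3 axis_def)

lemma vec3_norm: "\<bar>a\<bar> \<le> norm (vec3 (a, b, c))" "\<bar>b\<bar> \<le> norm (vec3 (a, b, c))" "\<bar>c\<bar> \<le> norm (vec3 (a, b, c))"
 using component_le_norm_cart[of "vec3 (a, b, c)" 1] component_le_norm_cart[of "vec3 (a, b, c)" 2]
  component_le_norm_cart[of "vec3 (a, b, c)" 3] by auto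

lemma enn2real_sqrt_sq:
 assumes "e < \<infinity>" shows "ennreal ((sqrt (enn2real e))\<^sup>2) = e"
 using assms by (simp add: ennreal_enn2real less_top)

text \<open>Gagliardo--Nirenberg: the Loomis--Whitney inequality applied to the fourth power of \<open>f\<close>.\<close>

theorem Sobolev_inequality:
 assumes f: "Ck 1 f" and supp: "\<And>x. x \<notin> cball 0 R \<Longrightarrow> f x = 0"
 shows "(LBINT x. (f x)^6) \<le> 4096 * (LBINT x. (norm (grad f x))\<^sup>2)^3"
proof -
 have df: "f differentiable (at x)" for x using f by simp
 have cf: "continuous_on UNIV f" using f Ck_continuous by blast
 have cg: "continuous_on UNIV (grad f)" using f by (rule Ck1_grad_continuous)
 have gsupp: "grad f x = 0" if "x \<notin> cball 0 R" for x
  by (rule grad_zero_outside[OF _ supp that]) auto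
 have psupp: "partial i f x = 0" if "x \<notin> cball 0 R" for x i
  by (rule partial_zero_outside[OF _ supp that]) auto
 have cp: "continuous_on UNIV (partial i f)" for i using f by simp
 \<comment> \<open>The partial derivatives of the fourth power of \<open>f\<close>. The power four
   is right because its square root is \<open>f\<^sup>2\<close>, and three such factors make up the
   sixth power.\<close>
 define D where "D i x = 4 * (f x)^3 * partial i f x" for i x
 have cD: "continuous_on UNIV (D i)" for i
  unfolding D_def using cf cp by (intro continuous_intros) auto
 have [measurable]: "D i \<in> borel_measurable borel" for i
  using cD borel_measurable_continuous_onI by blast
 have [measurable]: "f \<in> borel_measurable borel" "grad f \<in> borel_measurable borel"
  using cf cg borel_measurable_continuous_onI by blast+
 have Dsupp: "D i x = 0" if "x \<notin> cball 0 R" for x i using supp[OF that] by (simp add: D_def)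
 have intD: "integrable lborel (D i)" for i by (rule integrable_continuous_cball[OF cD Dsupp])
 have "\<exists>B. \<forall>x. \<bar>D i x\<bar> \<le> B" for i
  using bounded_continuous_cball[OF cD Dsupp] by (metis real_norm_def)
 then obtain Bd where Bd: "\<bar>D i x\<bar> \<le> Bd i" for i x by metis
 \<comment> \<open>Integrating along a coordinate line bounds the fourth power of \<open>f\<close>
   by a function that no longer depends on that coordinate, which is the shape that
   \<open>Loomis_Whitney\<close> asks for.\<close>
 define N1 where "N1 y z = (\<integral>\<^sup>+s. ennreal \<bar>D 1 (vec3 (s, y, z))\<bar> \<partial>lborel)" for y z
 define N2 where "N2 x z = (\<integral>\<^sup>+s. ennreal \<bar>D 2 (vec3 (x, s, z))\<bar> \<partial>lborel)" for x z
 define N3 where "N3 x y = (\<integral>\<^sup>+s. ennreal \<bar>D 3 (vec3 (x, y, s))\<bar> \<partial>lborel)" for x y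
 have out: "D i (vec3 (a, b, c)) = 0" if "\<bar>a\<bar> > R \<or> \<bar>b\<bar> > R \<or> \<bar>c\<bar> > R" for i a b c
  by (rule Dsupp) (use that vec3_norm(1)[of a b c] vec3_norm(2)[of b a c] vec3_norm(3)[of c a b] in auto)
 have fin1: "N1 y z < \<infinity>" for y z
  unfolding N1_def by (rule le_less_trans[OF nn_integral_bounded_support[where L = R, OF Bd]]) (auto intro: out)
 have fin2: "N2 y z < \<infinity>" for y z
  unfolding N2_def by (rule le_less_trans[OF nn_integral_bounded_support[where L = R, OF Bd]]) (auto intro: out)
 have fin3: "N3 y z < \<infinity>" for y z
  unfolding N3_def by (rule le_less_trans[OF nn_integral_bounded_support[where L = R, OF Bd]]) (auto intro: out)
 have [measurable]: "case_prod N1 \<in> borel_measurable (borel \<Otimes>\<^sub>M borel)"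
   "case_prod N2 \<in> borel_measurable (borel \<Otimes>\<^sub>M borel)" "case_prod N3 \<in> borel_measurable (borel \<Otimes>\<^sub>M borel)"
  unfolding N1_def N2_def N3_def by measurable
 have dpsi: "((\<lambda>s. (f (x + s *\<^sub>R axis i 1))^4) has_real_derivative D i (x + s *\<^sub>R axis i 1)) (at s)" for x i s
  by (rule DERIV_cong[OF DERIV_power[OF line_derivative[OF df]]]) (simp add: D_def)
 have cDl: "continuous_on UNIV (\<lambda>s. D i (x + s *\<^sub>R axis i 1))" for i x
  by (rule continuous_on_compose2[OF cD]) (auto intro!: continuous_intros)
 have z: "f (vec3 (a, b, c)) ^ 4 = 0" if "\<bar>a\<bar> > R \<or> \<bar>b\<bar> > R \<or> \<bar>c\<bar> > R" for a b c
  using supp[of "vec3 (a, b, c)"] that vec3_norm(1)[of a b c] vec3_norm(2)[of b a c] vec3_norm(3)[of c a b] by auto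
 have b1: "ennreal \<bar>f (vec3 (x, y, z)) ^ 4\<bar> \<le> N1 y z" for x y z
  unfolding N1_def
 proof (rule abs_le_nn_integral_deriv[where h = "\<lambda>s. f (vec3 (s, y, z)) ^ 4" and L = R])
  show "((\<lambda>s. f (vec3 (s, y, z)) ^ 4) has_real_derivative D 1 (vec3 (t, y, z))) (at t)" for t
   using dpsi[of "vec3 (0, y, z)" 1 t] by (simp flip: vec3_lines)
  show "continuous_on UNIV (\<lambda>s. D 1 (vec3 (s, y, z)))"
   using cDl[of 1 "vec3 (0, y, z)"] by (simp flip: vec3_lines)
 qed (use \<open>\<And>c b a. R < \<bar>a\<bar> \<or> R < \<bar>b\<bar> \<or> R < \<bar>c\<bar> \<Longrightarrow> f (vec3 (a, b, c)) ^ 4 = 0\<close> in auto)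
 have b2: "ennreal \<bar>f (vec3 (x, y, z)) ^ 4\<bar> \<le> N2 x z" for x y z
  unfolding N2_def
 proof (rule abs_le_nn_integral_deriv[where h = "\<lambda>s. f (vec3 (x, s, z)) ^ 4" and L = R])
  show "((\<lambda>s. f (vec3 (x, s, z)) ^ 4) has_real_derivative D 2 (vec3 (x, t, z))) (at t)" for t
   using dpsi[of "vec3 (x, 0, z)" 2 t] by (simp flip: vec3_lines)
  show "continuous_on UNIV (\<lambda>s. D 2 (vec3 (x, s, z)))"
   using cDl[of 2 "vec3 (x, 0, z)"] by (simp flip: vec3_lines)
 qed (use \<open>\<And>c b a. R < \<bar>a\<bar> \<or> R < \<bar>b\<bar> \<or> R < \<bar>c\<bar> \<Longrightarrow> f (vec3 (a, b, c)) ^ 4 = 0\<close> in auto)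
 have b3: "ennreal \<bar>f (vec3 (x, y, z)) ^ 4\<bar> \<le> N3 x y" for x y z
  unfolding N3_def
 proof (rule abs_le_nn_integral_deriv[where h = "\<lambda>s. f (vec3 (x, y, s)) ^ 4" and L = R])
  show "((\<lambda>s. f (vec3 (x, y, s)) ^ 4) has_real_derivative D 3 (vec3 (x, y, t))) (at t)" for t
   using dpsi[of "vec3 (x, y, 0)" 3 t] by (simp flip: vec3_lines)
  show "continuous_on UNIV (\<lambda>s. D 3 (vec3 (x, y, s)))"
   using cDl[of 3 "vec3 (x, y, 0)"] by (simp flip: vec3_lines)
 qed (use \<open>\<And>c b a. R < \<bar>a\<bar> \<or> R < \<bar>b\<bar> \<or> R < \<bar>c\<bar> \<Longrightarrow> f (vec3 (a, b, c)) ^ 4 = 0\<close> in auto)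
 have sq: "f p ^ 2 \<le> sqrt (enn2real e)" if "ennreal \<bar>f p ^ 4\<bar> \<le> e" "e < \<infinity>" for p e
 proof -
  have "f p ^ 4 \<le> enn2real e" using that by (metis abs_of_nonneg enn2real_ennreal enn2real_mono infinity_ennreal_def zero_le_even_power even_numeral)
  then show ?thesis by (intro real_le_rsqrt) (simp flip: power_mult)
 qed
 define S where "S i = (LBINT x. \<bar>D i x\<bar>)" for i
 have Snn: "S i \<ge> 0" for i by (simp add: S_def)
 have nnS: "(\<integral>\<^sup>+x. ennreal \<bar>D i x\<bar> \<partial>lborel) = ennreal (S i)" for i
  unfolding S_def using intD by (intro nn_integral_eq_integral) auto
 have S1: "(\<integral>\<^sup>+y. \<integral>\<^sup>+z. N1 y z \<partial>lborel \<partial>lborel) = ennreal (S 1)"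
 proof -
  have "(\<integral>\<^sup>+y. \<integral>\<^sup>+z. N1 y z \<partial>lborel \<partial>lborel) = (\<integral>\<^sup>+y. \<integral>\<^sup>+x. \<integral>\<^sup>+z. ennreal \<bar>D 1 (vec3 (x, y, z))\<bar> \<partial>lborel \<partial>lborel \<partial>lborel)"
   unfolding N1_def by (rule nn_integral_cong, rule nn_integral_lborel_pair(2)) measurable
  also have "\<dots> = (\<integral>\<^sup>+x. \<integral>\<^sup>+y. \<integral>\<^sup>+z. ennreal \<bar>D 1 (vec3 (x, y, z))\<bar> \<partial>lborel \<partial>lborel \<partial>lborel)"
   by (rule nn_integral_lborel_pair(2)) measurable
  finally show ?thesis using nn_integral_vec3[of "\<lambda>x. ennreal \<bar>D 1 x\<bar>"] nnS[of 1] by simp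
 qed
 have S2: "(\<integral>\<^sup>+x. \<integral>\<^sup>+z. N2 x z \<partial>lborel \<partial>lborel) = ennreal (S 2)"
 proof -
  have "(\<integral>\<^sup>+x. \<integral>\<^sup>+z. N2 x z \<partial>lborel \<partial>lborel) = (\<integral>\<^sup>+x. \<integral>\<^sup>+y. \<integral>\<^sup>+z. ennreal \<bar>D 2 (vec3 (x, y, z))\<bar> \<partial>lborel \<partial>lborel \<partial>lborel)"
   unfolding N2_def by (rule nn_integral_cong, rule nn_integral_lborel_pair(2)) measurable
  then show ?thesis using nn_integral_vec3[of "\<lambda>x. ennreal \<bar>D 2 x\<bar>"] nnS[of 2] by simp
 qed
 have S3: "(\<integral>\<^sup>+x. \<integral>\<^sup>+y. N3 x y \<partial>lborel \<partial>lborel) = ennreal (S 3)"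
  unfolding N3_def using nn_integral_vec3[of "\<lambda>x. ennreal \<bar>D 3 x\<bar>"] nnS[of 3] by simp
 have sec2: "(\<integral>\<^sup>+z. N2 x z \<partial>lborel) < \<infinity>" for x
 proof -
  have "(\<integral>\<^sup>+z. N2 x z \<partial>lborel) \<le> (\<integral>\<^sup>+z. ennreal \<bar>2 * Bd 2 * \<bar>R\<bar> * indicator {-\<bar>R\<bar>..\<bar>R\<bar>} z\<bar> \<partial>lborel)"
  proof (intro nn_integral_mono)
   fix z show "N2 x z \<le> ennreal \<bar>2 * Bd 2 * \<bar>R\<bar> * indicator {-\<bar>R\<bar>..\<bar>R\<bar>} z\<bar>"
   proof (cases "z \<in> {-\<bar>R\<bar>..\<bar>R\<bar>}")
    case True
    then show ?thesis unfolding N2_def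
     by (intro order_trans[OF nn_integral_bounded_support[where L = R, OF Bd]]) (auto intro: out intro!: ennreal_leI)
   next
    case False
    then have "\<bar>z\<bar> > R" by auto
    then show ?thesis unfolding N2_def by (simp add: out)
   qed
  qed
  also have "\<dots> < \<infinity>"
   by (rule le_less_trans[OF nn_integral_bounded_support[where L = "\<bar>R\<bar>" and B = "\<bar>2 * Bd 2 * \<bar>R\<bar>\<bar>"]])
    (auto simp: indicator_def)
  finally show ?thesis .
 qed
 have sec3: "(\<integral>\<^sup>+z. N3 x z \<partial>lborel) < \<infinity>" for x
 proof -
  have "(\<integral>\<^sup>+z. N3 x z \<partial>lborel) \<le> (\<integral>\<^sup>+z. ennreal \<bar>2 * Bd 3 * \<bar>R\<bar> * indicator {-\<bar>R\<bar>..\<bar>R\<bar>} z\<bar> \<partial>lborel)"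
  proof (intro nn_integral_mono)
   fix z show "N3 x z \<le> ennreal \<bar>2 * Bd 3 * \<bar>R\<bar> * indicator {-\<bar>R\<bar>..\<bar>R\<bar>} z\<bar>"
   proof (cases "z \<in> {-\<bar>R\<bar>..\<bar>R\<bar>}")
    case True
    then show ?thesis unfolding N3_def
     by (intro order_trans[OF nn_integral_bounded_support[where L = R, OF Bd]]) (auto intro: out intro!: ennreal_leI)
   next
    case False
    then have "\<bar>z\<bar> > R" by auto
    then show ?thesis unfolding N3_def by (simp add: out)
   qed
  qed
  also have "\<dots> < \<infinity>"
   by (rule le_less_trans[OF nn_integral_bounded_support[where L = "\<bar>R\<bar>" and B = "\<bar>2 * Bd 3 * \<bar>R\<bar>\<bar>"]])
    (auto simp: indicator_def)
  finally show ?thesis .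
 qed
 define I where "I = (LBINT x. (f x)^6)"
 define J where "J = (LBINT x. (norm (grad f x))\<^sup>2)"
 define B where "B = (LBINT x. \<bar>(f x)^3 * norm (grad f x)\<bar>)"
 have int6: "integrable lborel (\<lambda>x. (f x)^6)"
  by (rule integrable_continuous_cball[where R = R]) (auto intro!: continuous_intros cf supp)
 have intJ: "integrable lborel (\<lambda>x. (norm (grad f x))\<^sup>2)"
  by (rule integrable_continuous_cball[where R = R]) (auto intro!: continuous_intros cg gsupp)
 have intB: "integrable lborel (\<lambda>x. (f x)^3 * norm (grad f x))"
  by (rule integrable_continuous_cball[where R = R]) (auto intro!: continuous_intros cf cg supp)
 have "ennreal I = (\<integral>\<^sup>+x. ennreal ((f x)^6) \<partial>lborel)"
  unfolding I_def using int6 by (intro nn_integral_eq_integral[symmetric]) auto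
 also have "\<dots> = (\<integral>\<^sup>+x. \<integral>\<^sup>+y. \<integral>\<^sup>+z. ennreal ((f (vec3 (x, y, z)))^6) \<partial>lborel \<partial>lborel \<partial>lborel)"
  by (rule nn_integral_vec3) auto
 \<comment> \<open>The sixth power is split into three squares, and each square is bounded through a
   different coordinate direction.\<close>
 also have "\<dots> \<le> (\<integral>\<^sup>+x. \<integral>\<^sup>+y. \<integral>\<^sup>+z. ennreal (sqrt (enn2real (N1 y z)) * sqrt (enn2real (N2 x z)) * sqrt (enn2real (N3 x y))) \<partial>lborel \<partial>lborel \<partial>lborel)"
 proof (intro nn_integral_mono ennreal_leI)
  fix x y z
  have "f (vec3 (x, y, z)) ^ 6 = f (vec3 (x, y, z)) ^ 2 * f (vec3 (x, y, z)) ^ 2 * f (vec3 (x, y, z)) ^ 2"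
   by (simp flip: power_add)
  also have "\<dots> \<le> sqrt (enn2real (N1 y z)) * sqrt (enn2real (N2 x z)) * sqrt (enn2real (N3 x y))"
   by (intro mult_mono sq b1 b2 b3 fin1 fin2 fin3) auto
  finally show "f (vec3 (x, y, z)) ^ 6 \<le> sqrt (enn2real (N1 y z)) * sqrt (enn2real (N2 x z)) * sqrt (enn2real (N3 x y))" .
 qed
 also have "\<dots> \<le> ennreal (sqrt (S 1) * (sqrt (S 2) * sqrt (S 3)))"
  by (rule Loomis_Whitney[where ?g1.0 = "\<lambda>y z. sqrt (enn2real (N1 y z))" and ?g2.0 = "\<lambda>y z. sqrt (enn2real (N2 y z))"
     and ?g3.0 = "\<lambda>y z. sqrt (enn2real (N3 y z))"])
   (auto simp only: enn2real_sqrt_sq[OF fin1] enn2real_sqrt_sq[OF fin2] enn2real_sqrt_sq[OF fin3] S1 S2 S3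
     real_sqrt_pow2[OF Snn] sec2 sec3 order_refl real_sqrt_ge_zero[OF Snn] real_sqrt_ge_zero[OF enn2real_nonneg], measurable)
 finally have "I \<le> sqrt (S 1) * (sqrt (S 2) * sqrt (S 3))"
  using Snn by (simp add: ennreal_le_iff)
 moreover have Inn: "I \<ge> 0" unfolding I_def by (simp add: zero_le_even_power)
 ultimately have "I\<^sup>2 \<le> (sqrt (S 1) * (sqrt (S 2) * sqrt (S 3)))\<^sup>2" by (intro power_mono) auto
 then have I2: "I\<^sup>2 \<le> S 1 * (S 2 * S 3)" using Snn by (simp add: power_mult_distrib)
 have Bnn: "B \<ge> 0" by (simp add: B_def)
 \<comment> \<open>Origin of the constant: three factors 4 give
   \<open>I\<^sup>2 \<le> 64 * B^3\<close>, and \<open>B\<^sup>2 \<le> I * J\<close> then gives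
   \<open>I ^ 4 \<le> 64\<^sup>2 * (I * J)^3\<close>. Cancelling the cube of \<open>I\<close>, when
   it is nonzero, leaves 4096 times the cube of \<open>J\<close>.\<close>
 have SB: "S i \<le> 4 * B" for i
 proof -
  have "S i \<le> (LBINT x. 4 * \<bar>(f x)^3 * norm (grad f x)\<bar>)"
   unfolding S_def
  proof (rule integral_mono)
   show "\<bar>D i x\<bar> \<le> 4 * \<bar>f x ^ 3 * norm (grad f x)\<bar>" for x
    using component_le_norm_cart[of "grad f x" i] by (auto simp: D_def abs_mult intro!: mult_left_mono)
  qed (use intD intB in auto)
  then show ?thesis by (simp add: B_def)
 qed
 have "S 1 * (S 2 * S 3) \<le> (4 * B) * ((4 * B) * (4 * B))"
  using SB Snn Bnn by (intro mult_mono) auto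
 with I2 have I2: "I\<^sup>2 \<le> 64 * B^3" by (simp add: power3_eq_cube)
 have B2: "B\<^sup>2 \<le> I * J"
  unfolding B_def I_def J_def
  using Cauchy_Schwarz_integral(2)[of "\<lambda>x. (f x)^3" lborel "\<lambda>x. norm (grad f x)"] int6 intJ
  by (simp flip: power_mult)
 have "I ^ 4 = (I\<^sup>2)\<^sup>2" by (simp flip: power_mult)
 also have "\<dots> \<le> (64 * B^3)\<^sup>2" using I2 Inn by (intro power_mono) auto
 also have "\<dots> = 4096 * (B\<^sup>2)^3" by (simp add: power_mult_distrib flip: power_mult)
 also have "\<dots> \<le> 4096 * (I * J)^3" using B2 by (intro mult_left_mono power_mono) auto
 finally have *: "I ^ 4 \<le> 4096 * (I * J)^3" .
 have Jnn: "J \<ge> 0" by (simp add: J_def)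
 have "I \<le> 4096 * J ^ 3"
 proof (cases "I = 0")
  case False
  then have "I ^ 3 > 0" using Inn by simp
  moreover have "I * I ^ 3 \<le> (4096 * J^3) * I ^ 3"
   using * by (simp add: power_mult_distrib power_Suc[symmetric] del: power_Suc) (simp add: algebra_simps)
  ultimately show ?thesis by (simp add: mult_le_cancel_right)
 qed (use Jnn in simp)
 then show ?thesis by (simp add: I_def J_def)
qed

section \<open>Mollification\<close>

lemma cball_sets_borel [measurable]: "cball (a :: 'a::metric_space) r \<in> sets borel"
 by (simp add: borel_closed)

lemma nn_integral_affine:
 fixes f :: "'a::euclidean_space \<Rightarrow> ennreal"
 assumes [measurable]: "f \<in> borel_measurable borel" and c: "c \<noteq> 0"
 shows "(\<integral>\<^sup>+x. f x \<partial>lborel) = ennreal (\<bar>c\<bar> ^ DIM('a)) * (\<integral>\<^sup>+x. f (t + c *\<^sub>R x) \<partial>lborel)"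
 by (subst lborel_affine[OF c, of t])
  (simp add: nn_integral_density nn_integral_distr nn_integral_cmult)

lemma integrable_affine:
 fixes f :: "'a::euclidean_space \<Rightarrow> 'b :: {banach, second_countable_topology}"
 assumes f: "integrable lborel f" and c: "c \<noteq> 0"
 shows "integrable lborel (\<lambda>x. f (t + c *\<^sub>R x))"
 using f f[THEN borel_measurable_integrable] c unfolding integrable_iff_bounded
 by (subst (asm) nn_integral_affine[where c=c and t=t]) (auto simp: ennreal_mult_less_top)

lemma integral_affine:
 fixes f :: "'a::euclidean_space \<Rightarrow> 'b :: {banach, second_countable_topology}"
 assumes f[measurable]: "integrable lborel f" and c: "c \<noteq> 0"
 shows "(\<integral>x. f x \<partial> lborel) = (\<bar>c\<bar> ^ DIM('a)) *\<^sub>R (LBINT x. f (t + c *\<^sub>R x))"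
 using c f f[THEN borel_measurable_integrable] integrable_affine[OF f c, of t]
 by (subst lborel_affine[OF c, of t])
  (simp add: integral_density integral_distr)

text \<open>Local integrability on the whole space, tested on balls about the origin, for Borel
  functions: all data are replaced by Borel representatives.\<close>

definition loc_integrable :: "(R3 \<Rightarrow> 'b::{banach, second_countable_topology}) \<Rightarrow> bool" where
 "loc_integrable f \<longleftrightarrow> f \<in> borel_measurable borel \<and>
  (\<forall>R. integrable lborel (\<lambda>x. indicator (cball 0 R) x *\<^sub>R f x))"

text \<open>The L^1 seminorm over a ball; convergence for every \<open>R\<close> is convergence in
  L^1_loc.\<close>

definition bnorm :: "real \<Rightarrow> (R3 \<Rightarrow> 'b::{banach, second_countable_topology}) \<Rightarrow> real" where
 "bnorm R f = (LBINT x. indicator (cball 0 R) x *\<^sub>R norm (f x))"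

lemma loc_integrable_measurable: "loc_integrable f \<Longrightarrow> f \<in> borel_measurable borel"
 by (simp add: loc_integrable_def)

lemma loc_integrable_cball: "loc_integrable f \<Longrightarrow> integrable lborel (\<lambda>x. indicator (cball 0 R) x *\<^sub>R f x)"
 by (simp add: loc_integrable_def)

lemma loc_integrable_norm_cball: "loc_integrable f \<Longrightarrow> integrable lborel (\<lambda>x. indicator (cball 0 R) x *\<^sub>R norm (f x))"
 using integrable_norm[OF loc_integrable_cball, of f R] by simp

lemma loc_integrable_bound:
 assumes "loc_integrable g" "f \<in> borel_measurable borel" "\<And>x. norm (f x) \<le> norm (g x)"
 shows "loc_integrable f"
 unfolding loc_integrable_def
proof (intro conjI allI)
 fix R
 show "integrable lborel (\<lambda>x. indicator (cball 0 R) x *\<^sub>R f x)"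
  by (rule Bochner_Integration.integrable_bound[OF loc_integrable_cball[OF assms(1), of R]])
   (use assms in \<open>auto simp: indicator_def\<close>)
qed (use assms in auto)

lemma loc_integrable_diff: "loc_integrable f \<Longrightarrow> loc_integrable g \<Longrightarrow> loc_integrable (\<lambda>x. f x - g x)"
 by (auto simp: loc_integrable_def scaleR_diff_right)

lemma integrable_loc_integrable:
 assumes "integrable lborel f" shows "loc_integrable f"
 unfolding loc_integrable_def using integrable_mult_indicator[OF _ assms] assms by auto

lemma loc_integrable_bounded:
 assumes "f \<in> borel_measurable borel" "\<And>x. norm (f x) \<le> B"
 shows "loc_integrable f"
proof (rule loc_integrable_bound[of "\<lambda>x. B"])
 show "loc_integrable (\<lambda>x. B)"
  unfolding loc_integrable_def
  by (auto intro!: integrable_scaleR_left integrable_real_indicator simp: emeasure_cball_less_top)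
 show "norm (f x) \<le> norm B" for x using assms(2)[of x] by simp
qed (use assms in auto)

lemma loc_integrable_bounded_mult:
 fixes f :: "R3 \<Rightarrow> real"
 assumes "loc_integrable g" and [measurable]: "f \<in> borel_measurable borel" and "\<And>x. \<bar>f x\<bar> \<le> B"
 shows "loc_integrable (\<lambda>x. f x *\<^sub>R g x)"
proof (rule loc_integrable_bound)
 have [measurable]: "g \<in> borel_measurable borel" using assms by (simp add: loc_integrable_measurable)
 show "(\<lambda>x. f x *\<^sub>R g x) \<in> borel_measurable borel" by measurable
 show "loc_integrable (\<lambda>x. B *\<^sub>R g x)"
  using assms(1) integrable_scaleR_right[of B lborel] unfolding loc_integrable_def
  by (auto simp: scaleR_left_commute[of _ B] simp del: scaleR_scaleR)
 show "norm (f x *\<^sub>R g x) \<le> norm (B *\<^sub>R g x)" for x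
  using assms(3)[of x] by (auto intro!: mult_right_mono)
qed

lemma loc_integrable_affine:
 fixes f :: "R3 \<Rightarrow> 'b::{banach, second_countable_topology}"
 assumes f: "loc_integrable f" and c: "c \<noteq> 0"
 shows "loc_integrable (\<lambda>x. f (y + c *\<^sub>R x))"
 unfolding loc_integrable_def
proof (intro conjI allI)
 have [measurable]: "f \<in> borel_measurable borel" using f by (rule loc_integrable_measurable)
 show "(\<lambda>x. f (y + c *\<^sub>R x)) \<in> borel_measurable borel" by measurable
 fix R
 have "integrable lborel (\<lambda>x. indicator (cball 0 (norm y + \<bar>c\<bar> * R)) (y + c *\<^sub>R x) *\<^sub>R f (y + c *\<^sub>R x))"
  by (rule integrable_affine[OF loc_integrable_cball[OF f] c])
 then show "integrable lborel (\<lambda>x. indicator (cball 0 R) x *\<^sub>R f (y + c *\<^sub>R x))"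
 proof (rule Bochner_Integration.integrable_bound)
  have "norm (y + c *\<^sub>R x) \<le> norm y + \<bar>c\<bar> * R" if "norm x \<le> R" for x
   using norm_triangle_ineq[of y "c *\<^sub>R x"] mult_left_mono[OF that, of "\<bar>c\<bar>"] by simp
  then show "AE x in lborel. norm (indicator (cball 0 R) x *\<^sub>R f (y + c *\<^sub>R x))
    \<le> norm (indicator (cball 0 (norm y + \<bar>c\<bar> * R)) (y + c *\<^sub>R x) *\<^sub>R f (y + c *\<^sub>R x))"
   by (intro AE_I2) (auto simp: indicator_def)
  have "(\<lambda>x. indicator (cball 0 R) x *\<^sub>R f (y + c *\<^sub>R x)) \<in> borel_measurable borel"
   by measurable
  then show "(\<lambda>x. indicator (cball 0 R) x *\<^sub>R f (y + c *\<^sub>R x)) \<in> borel_measurable lborel"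
   by simp
 qed
qed

lemma loc_integrable_translate:
 "loc_integrable f \<Longrightarrow> loc_integrable (\<lambda>x. f (x + h))"
 using loc_integrable_affine[of f 1 h] by (simp add: add.commute)

lemma bnorm_nonneg: "bnorm R f \<ge> 0"
 unfolding bnorm_def by (intro Bochner_Integration.integral_nonneg) auto

lemma bnorm_mono:
 assumes "loc_integrable f" "loc_integrable g" "\<And>x. norm x \<le> R \<Longrightarrow> norm (f x) \<le> norm (g x)"
 shows "bnorm R f \<le> bnorm R g"
 unfolding bnorm_def using assms
 by (intro integral_mono loc_integrable_norm_cball) (auto simp: indicator_def)

lemma bnorm_triangle:
 assumes "loc_integrable f" "loc_integrable g" "loc_integrable h" 
  "\<And>x. norm (f x) \<le> norm (g x) + norm (h x)"
 shows "bnorm R f \<le> bnorm R g + bnorm R h"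
proof -
 have "bnorm R f \<le> (LBINT x. indicator (cball 0 R) x *\<^sub>R norm (g x) + indicator (cball 0 R) x *\<^sub>R norm (h x))"
  unfolding bnorm_def using assms
  by (intro integral_mono loc_integrable_norm_cball Bochner_Integration.integrable_add) (auto simp: indicator_def)
 also have "\<dots> = bnorm R g + bnorm R h"
  unfolding bnorm_def using assms
  by (intro Bochner_Integration.integral_add loc_integrable_norm_cball)
 finally show ?thesis .
qed

lemma bnorm_translate:
 fixes f :: "R3 \<Rightarrow> 'b::{banach, second_countable_topology}"
 assumes f: "loc_integrable f" and h: "norm h \<le> d"
 shows "bnorm R (\<lambda>x. f (x + h)) \<le> bnorm (R + d) f"
proof -
 have [measurable]: "f \<in> borel_measurable borel" using f by (rule loc_integrable_measurable)
 have i: "integrable lborel (\<lambda>x. indicator (cball 0 (R + d)) (x + h) *\<^sub>R norm (f (x + h)))"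
  by (subst integral_translate(2)[of "\<lambda>x. indicator (cball 0 (R + d)) x *\<^sub>R norm (f x)" h])
   (use loc_integrable_norm_cball[OF f] in auto)
 have le: "norm (x + h) \<le> R + d" if "norm x \<le> R" for x
  using norm_triangle_ineq[of x h] that h by simp
 have "bnorm R (\<lambda>x. f (x + h)) \<le> (LBINT x. indicator (cball 0 (R + d)) (x + h) *\<^sub>R norm (f (x + h)))"
  unfolding bnorm_def
  by (rule integral_mono[OF loc_integrable_norm_cball[OF loc_integrable_translate[OF f]] i])
   (use le in \<open>auto simp: indicator_def\<close>)
 also have "\<dots> = bnorm (R + d) f"
  unfolding bnorm_def
  by (rule integral_translate(1)[of "\<lambda>x. indicator (cball 0 (R + d)) x *\<^sub>R norm (f x)" h]) measurable
 finally show ?thesis .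
qed

text \<open>A density argument. The functions that are continuous under translation form a closed
  subset of L^1 and include indicators of open sets of finite measure; outer regularity adds all
  measurable sets of finite measure, and sums and dominated limits reach every integrable
  function.\<close>

lemma L1_translation_seq:
 fixes f :: "R3 \<Rightarrow> 'b::{banach, second_countable_topology}"
 assumes f: "integrable lborel f" and h: "h \<longlonglongrightarrow> 0"
 shows "(\<lambda>n. LBINT x. norm (f (x + h n) - f x)) \<longlonglongrightarrow> 0"
proof -
 define T where "T g \<longleftrightarrow> (\<lambda>n. LBINT x. norm (g (x + h n) - g x)) \<longlonglongrightarrow> 0" for g :: "R3 \<Rightarrow> 'b"
 \<comment> \<open>The closedness: the error splits into two copies of the approximation error,
   equal by translation invariance, and the error of the approximant.\<close>
 have approx: "T g" if g: "integrable lborel g"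
  and app: "\<And>e. e > 0 \<Longrightarrow> \<exists>k. integrable lborel k \<and> T k \<and> (LBINT x. norm (g x - k x)) \<le> e" for g
  unfolding T_def
 proof (rule LIMSEQ_I)
  fix r :: real assume "r > 0"
  obtain k where k: "integrable lborel k" "T k" "(LBINT x. norm (g x - k x)) \<le> r / 4"
   using app[of "r / 4"] \<open>r > 0\<close> by auto
  have [measurable]: "g \<in> borel_measurable borel" "k \<in> borel_measurable borel"
   using g k borel_measurable_integrable by fastforce+
  obtain N where N: "\<And>n. n \<ge> N \<Longrightarrow> (LBINT x. norm (k (x + h n) - k x)) < r / 2"
   using LIMSEQ_D[OF k(2)[unfolded T_def], of "r / 2"] \<open>r > 0\<close> by auto
  have "norm ((LBINT x. norm (g (x + h n) - g x)) - 0) < r" if "n \<ge> N" for n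
  proof -
   have i1: "integrable lborel (\<lambda>x. norm (g x - k x))" using g k by auto
   have i2: "integrable lborel (\<lambda>x. norm (g (x + h n) - k (x + h n)))"
    using i1 by (subst integral_translate(2)[of "\<lambda>x. norm (g x - k x)"]) auto
   have i3: "integrable lborel (\<lambda>x. norm (k (x + h n) - k x))"
    using k by (intro integrable_norm Bochner_Integration.integrable_diff) (auto simp: integral_translate(2))
   have i4: "integrable lborel (\<lambda>x. norm (g (x + h n) - g x))"
    using g by (intro integrable_norm Bochner_Integration.integrable_diff) (auto simp: integral_translate(2))
   have "(LBINT x. norm (g (x + h n) - g x))
     \<le> (LBINT x. norm (g (x + h n) - k (x + h n)) + norm (k (x + h n) - k x) + norm (g x - k x))"
   proof (rule integral_mono[OF i4])
    fix x
    have "g (x + h n) - g x = (g (x + h n) - k (x + h n)) + (k (x + h n) - k x) - (g x - k x)" by simp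
    then show "norm (g (x + h n) - g x) \<le> norm (g (x + h n) - k (x + h n)) + norm (k (x + h n) - k x) + norm (g x - k x)"
     by (metis (no_types, opaque_lifting) add_right_mono norm_triangle_ineq norm_triangle_ineq4 order_trans)
   qed (intro Bochner_Integration.integrable_add i1 i2 i3)
   also have "\<dots> = (LBINT x. norm (g (x + h n) - k (x + h n))) + (LBINT x. norm (k (x + h n) - k x)) + (LBINT x. norm (g x - k x))"
    using i1 i2 i3 by simp
   also have "(LBINT x. norm (g (x + h n) - k (x + h n))) = (LBINT x. norm (g x - k x))"
    by (rule integral_translate(1)[of "\<lambda>x. norm (g x - k x)"]) measurable
   finally have "(LBINT x. norm (g (x + h n) - g x)) < r" using N[OF that] k(3) by linarith
   then show ?thesis by simp
  qed
  then show "\<exists>no. \<forall>n\<ge>no. norm ((LBINT x. norm (g (x + h n) - g x)) - 0) < r" by blast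
 qed
 \<comment> \<open>If x lies in the open set, so does x + h n eventually; thus the product of the
   shifted indicator and the indicator tends to the indicator. The absolute difference of two
   indicators is their sum minus twice their product.\<close>
 have openT: "T (\<lambda>x. indicator U x *\<^sub>R c)" if "open U" "emeasure lborel U < \<infinity>" for U and c :: 'b
 proof -
  have [measurable]: "U \<in> sets borel" using that by auto
  have iU: "integrable lborel (indicator U :: R3 \<Rightarrow> real)" using that by simp
  have iUh: "integrable lborel (\<lambda>x. indicator U (x + h n) :: real)" for n
   using iU by (subst integral_translate(2)[of "indicator U :: R3 \<Rightarrow> real"]) auto
  have iUU: "integrable lborel (\<lambda>x. indicator U (x + h n) * indicator U x :: real)" for n
   by (rule Bochner_Integration.integrable_bound[OF iU]) (auto simp: indicator_def)
  have "(\<lambda>n. LBINT x. indicator U (x + h n) * indicator U x) \<longlonglongrightarrow> (\<integral>x. indicator U x \<partial>lborel :: real)"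
  proof (rule integral_dominated_convergence[OF _ _ iU])
   show "AE x in lborel. (\<lambda>n. indicator U (x + h n) * indicator U x :: real) \<longlonglongrightarrow> indicator U x"
   proof (rule AE_I2)
    fix x
    show "(\<lambda>n. indicator U (x + h n) * indicator U x :: real) \<longlonglongrightarrow> indicator U x"
    proof (cases "x \<in> U")
     case True
     have "(\<lambda>n. x + h n) \<longlonglongrightarrow> x + 0" by (intro tendsto_intros h)
     then have "\<forall>\<^sub>F n in sequentially. x + h n \<in> U" using that(1) True by (simp add: topological_tendstoD)
     then have "\<forall>\<^sub>F n in sequentially. (indicator U (x + h n) * indicator U x :: real) = indicator U x"
      by (auto elim!: eventually_mono simp: True)
     then show ?thesis by (rule tendsto_eventually)
    qed simp
   qed
  qed (auto simp: indicator_def)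
  then have "(\<lambda>n. norm c * (2 * (LBINT x. indicator U x) - 2 * (\<integral>x. indicator U (x + h n) * indicator U x \<partial>lborel :: real)))
    \<longlonglongrightarrow> norm c * (2 * (LBINT x. indicator U x) - 2 * (\<integral>x. indicator U x \<partial>lborel :: real))"
   by (intro tendsto_intros)
  moreover have "(LBINT x. norm (indicator U (x + h n) *\<^sub>R c - indicator U x *\<^sub>R c))
   = norm c * (2 * (LBINT x. indicator U x) - 2 * (\<integral>x. indicator U (x + h n) * indicator U x \<partial>lborel :: real))" for n
  proof -
   have "(LBINT x. norm (indicator U (x + h n) *\<^sub>R c - indicator U x *\<^sub>R c))
    = (LBINT x. norm c * (indicator U (x + h n) + indicator U x - 2 * (indicator U (x + h n) * indicator U x)))"
    by (intro Bochner_Integration.integral_cong) (auto simp: indicator_def)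
   also have "\<dots> = norm c * ((LBINT x. indicator U (x + h n)) + (LBINT x. indicator U x)
     - 2 * (\<integral>x. indicator U (x + h n) * indicator U x \<partial>lborel :: real))"
    using iU iUh[of n] iUU[of n] by simp
   also have "(\<integral>x. indicator U (x + h n) \<partial>lborel :: real) = (LBINT x. indicator U x)"
    by (rule integral_translate(1)) measurable
   finally show ?thesis by simp
  qed
  ultimately show ?thesis by (simp add: T_def)
 qed
 from f have "T f"
 proof (induct rule: integrable_induct)
  case (base A c)
  then have [measurable]: "A \<in> sets borel" by simp
  have iA: "integrable lborel (\<lambda>x. indicator A x *\<^sub>R c)" using base by simp
  show ?case
  proof (rule approx[OF iA])
   fix e :: real assume "e > 0"
   \<comment> \<open>The summand 1 in the denominator covers the case \<open>c = 0\<close>.\<close>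
   then have "e / (norm c + 1) > 0" by (simp add: add_nonneg_pos)
   then obtain U where U: "open U" "A \<subseteq> U" "emeasure lborel (U - A) < e / (norm c + 1)"
    using outer_regular_lborel[of A "e / (norm c + 1)"] base by auto
   have [measurable]: "U \<in> sets borel" using U by auto
   have "emeasure lborel U \<le> emeasure lborel A + emeasure lborel (U - A)"
    using emeasure_subadditive[of A lborel "U - A"] U(2) by (simp add: Un_absorb1)
   also have "\<dots> < \<infinity>" using base U(3) by (simp add: less_top order_less_trans)
   finally have fU: "emeasure lborel U < \<infinity>" .
   have "(LBINT x. norm (indicator A x *\<^sub>R c - indicator U x *\<^sub>R c)) = (LBINT x. norm c * indicator (U - A) x)"
    using U(2) by (intro Bochner_Integration.integral_cong) (auto simp: indicator_def)
   also have "\<dots> = norm c * measure lborel (U - A)" by simp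
   also have "\<dots> \<le> norm c * (e / (norm c + 1))"
   proof (rule mult_left_mono)
    show "measure lborel (U - A) \<le> e / (norm c + 1)"
     unfolding measure_def using U(3) \<open>e / (norm c + 1) > 0\<close> by (intro enn2real_leI less_imp_le)
   qed simp
   also have "\<dots> \<le> e" 
   proof -
    have "norm c * e \<le> e * (norm c + 1)" using \<open>e > 0\<close> by (simp add: algebra_simps)
    moreover have "norm c + 1 > 0" by (simp add: add_nonneg_pos)
    ultimately show ?thesis by (simp add: pos_divide_le_eq)
   qed
   finally show "\<exists>k. integrable lborel k \<and> T k \<and> (LBINT x. norm (indicator A x *\<^sub>R c - k x)) \<le> e"
    using openT[OF U(1) fU, of c] fU by (intro exI[of _ "\<lambda>x. indicator U x *\<^sub>R c"]) auto
  qed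
 next
  case (add f g)
  have [measurable]: "g \<in> borel_measurable borel" "f \<in> borel_measurable borel"
   using add borel_measurable_integrable by fastforce+
  have i: "integrable lborel (\<lambda>x. norm (f (x + h n) - f x))" "integrable lborel (\<lambda>x. norm (g (x + h n) - g x))"
   "integrable lborel (\<lambda>x. norm (f (x + h n) + g (x + h n) - (f x + g x)))" for n
   using add by (intro integrable_norm Bochner_Integration.integrable_diff Bochner_Integration.integrable_add; simp add: integral_translate(2))+
  have "(\<lambda>n. (LBINT x. norm (f (x + h n) - f x)) + (LBINT x. norm (g (x + h n) - g x))) \<longlonglongrightarrow> 0 + 0"
   using add(2,4) unfolding T_def by (rule tendsto_add)
  then have lim: "(\<lambda>n. (LBINT x. norm (f (x + h n) - f x)) + (LBINT x. norm (g (x + h n) - g x))) \<longlonglongrightarrow> 0"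
   by simp
  show ?case unfolding T_def
  proof (rule tendsto_sandwich[OF _ _ tendsto_const lim])
   show "\<forall>\<^sub>F n in sequentially. (LBINT x. norm (f (x + h n) + g (x + h n) - (f x + g x)))
     \<le> (LBINT x. norm (f (x + h n) - f x)) + (LBINT x. norm (g (x + h n) - g x))"
   proof (rule always_eventually, rule allI)
    fix n
    have "(LBINT x. norm (f (x + h n) + g (x + h n) - (f x + g x))) \<le> (LBINT x. norm (f (x + h n) - f x) + norm (g (x + h n) - g x))"
     using i by (intro integral_mono Bochner_Integration.integrable_add) (auto simp: norm_diff_triangle_ineq)
    then show "(LBINT x. norm (f (x + h n) + g (x + h n) - (f x + g x)))
     \<le> (LBINT x. norm (f (x + h n) - f x)) + (LBINT x. norm (g (x + h n) - g x))"
     using i by simp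
   qed
  qed auto
 next
  case (lim f s)
  have [measurable]: "f \<in> borel_measurable borel" "\<And>i. s i \<in> borel_measurable borel"
   using lim borel_measurable_integrable by fastforce+
  have "(\<lambda>i. LBINT x. norm (f x - s i x)) \<longlonglongrightarrow> (\<integral>x. 0 \<partial>(lborel::R3 measure))"
  proof (rule integral_dominated_convergence[where w = "\<lambda>x. 3 * norm (f x)"])
   show "AE x in lborel. (\<lambda>i. norm (f x - s i x)) \<longlonglongrightarrow> 0"
    using lim(3) by (intro AE_I2 tendsto_norm_zero) (auto intro!: tendsto_eq_intros)
   show "AE x in lborel. norm (norm (f x - s i x)) \<le> 3 * norm (f x)" for i
   proof (rule AE_I2)
    fix x
    have "norm (f x - s i x) \<le> norm (f x) + norm (s i x)" by (rule norm_triangle_ineq4)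
    then show "norm (norm (f x - s i x)) \<le> 3 * norm (f x)" using lim(4)[of x i] by simp
   qed
   show "integrable lborel (\<lambda>x. 3 * norm (f x))" using lim by simp
  qed auto
  then have conv: "(\<lambda>i. LBINT x. norm (f x - s i x)) \<longlonglongrightarrow> 0" by simp
  show ?case
  proof (rule approx[OF lim(5)])
   fix e :: real assume "e > 0"
   then obtain i where "norm ((LBINT x. norm (f x - s i x)) - 0) < e"
    using LIMSEQ_D[OF conv] by blast
   then show "\<exists>k. integrable lborel k \<and> T k \<and> (LBINT x. norm (f x - k x)) \<le> e"
    using lim(1,2) by (intro exI[of _ "s i"]) auto
  qed
 qed
 then show ?thesis by (simp add: T_def)
qed

text \<open>The sequential statement turned into one with a modulus \<open>d\<close>: shifts
  violating every candidate 1/(n+1) would form a null sequence contradicting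
  \<open>L1_translation_seq\<close>.\<close>

lemma bnorm_translation:
 fixes f :: "R3 \<Rightarrow> 'b::{banach, second_countable_topology}"
 assumes f: "loc_integrable f" and e: "e > 0"
 shows "\<exists>d>0. d \<le> 1 \<and> (\<forall>h. norm h < d \<longrightarrow> bnorm R (\<lambda>x. f (x + h) - f x) < e)"
proof (rule ccontr)
 assume "\<not> ?thesis"
 then have neg: "\<And>d. d > 0 \<Longrightarrow> d \<le> 1 \<Longrightarrow> \<exists>h. norm h < d \<and> \<not> bnorm R (\<lambda>x. f (x + h) - f x) < e"
  by blast
 have "\<forall>n. \<exists>h. norm h < inverse (real (Suc n)) \<and> \<not> bnorm R (\<lambda>x. f (x + h) - f x) < e"
  by (intro allI neg) (auto simp: inverse_le_1_iff)
 from choice[OF this] obtain h where 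
  "\<forall>n. norm (h n) < inverse (real (Suc n)) \<and> \<not> bnorm R (\<lambda>x. f (x + h n) - f x) < e" by blast
 then have h: "\<And>n. norm (h n) < inverse (real (Suc n))" "\<And>n. bnorm R (\<lambda>x. f (x + h n) - f x) \<ge> e"
  by (simp_all only: not_less)
 have h0: "h \<longlonglongrightarrow> 0"
  by (rule Lim_null_comparison[OF _ LIMSEQ_inverse_real_of_nat]) (rule always_eventually, rule allI, rule less_imp_le, rule h(1))
 have [measurable]: "f \<in> borel_measurable borel" using f by (rule loc_integrable_measurable)
 \<comment> \<open>The enlarged radius ensures that shifts of length at most 1 starting in the ball
   of radius \<open>R\<close> do not see the truncation.\<close>
 define g where "g x = indicator (cball 0 (R + 1)) x *\<^sub>R f x" for x
 have g: "integrable lborel g" unfolding g_def[abs_def] by (rule loc_integrable_cball[OF f])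
 have [measurable]: "g \<in> borel_measurable borel" using g by simp
 have "bnorm R (\<lambda>x. f (x + h n) - f x) \<le> (LBINT x. norm (g (x + h n) - g x))" for n
  unfolding bnorm_def
 proof (rule integral_mono)
  show "integrable lborel (\<lambda>x. indicator (cball 0 R) x *\<^sub>R norm (f (x + h n) - f x))"
   by (intro loc_integrable_norm_cball loc_integrable_diff loc_integrable_translate f)
  show "integrable lborel (\<lambda>x. norm (g (x + h n) - g x))"
   using g by (intro integrable_norm Bochner_Integration.integrable_diff) (auto simp: integral_translate(2))
  fix x
  have "norm (h n) < 1"
   using h(1)[of n] by (rule less_le_trans) (simp add: inverse_le_1_iff)
  then have "norm (x + h n) \<le> R + 1" if "norm x \<le> R" using norm_triangle_ineq[of x "h n"] that by simp
  then show "indicator (cball 0 R) x *\<^sub>R norm (f (x + h n) - f x) \<le> norm (g (x + h n) - g x)"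
   by (auto simp: g_def indicator_def)
 qed
 then have "e \<le> (LBINT x. norm (g (x + h n) - g x))" for n using h(2) order_trans by blast
 moreover have "(\<lambda>n. LBINT x. norm (g (x + h n) - g x)) \<longlonglongrightarrow> 0"
  by (rule L1_translation_seq[OF g h0])
 ultimately have "e \<le> 0" by (intro LIMSEQ_le_const) auto
 with e show False by simp
qed

text \<open>Convolution with the scaled kernel, written as an average of translates so that
  \<epsilon> enters only the argument of \<open>f\<close>. As \<open>bump\<close> is even, the sign
  in front of \<epsilon> is immaterial.\<close>

definition mollify :: "real \<Rightarrow> (R3 \<Rightarrow> 'b::{banach, second_countable_topology}) \<Rightarrow> R3 \<Rightarrow> 'b" where
 "mollify \<epsilon> f y = (LBINT z. bump z *\<^sub>R f (y + \<epsilon> *\<^sub>R z))"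

lemma bump_measurable [measurable]: "bump \<in> borel_measurable borel"
 by (intro borel_measurable_continuous_onI smooth_continuous smooth_bump)

lemma mollify_measurable [measurable]:
 assumes [measurable]: "f \<in> borel_measurable borel"
 shows "mollify \<epsilon> f \<in> borel_measurable borel"
 unfolding mollify_def[abs_def] by measurable

lemma integrable_Cc_mult:
 fixes f :: "R3 \<Rightarrow> 'b::{banach, second_countable_topology}"
 assumes k: "continuous_on UNIV k" "\<And>x. x \<notin> cball 0 R \<Longrightarrow> k x = (0::real)" and f: "loc_integrable f"
 shows "integrable lborel (\<lambda>x. k x *\<^sub>R f x)"
proof -
 obtain B where B: "\<And>x. norm (k x) \<le> B" using bounded_continuous_cball[OF k] by metis
 have [measurable]: "f \<in> borel_measurable borel" "k \<in> borel_measurable borel"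
  using f k(1) by (auto simp: loc_integrable_measurable borel_measurable_continuous_onI)
 show ?thesis
 proof (rule Bochner_Integration.integrable_bound)
  show "integrable lborel (\<lambda>x. B *\<^sub>R indicator (cball 0 R) x *\<^sub>R f x)"
   by (intro integrable_scaleR_right loc_integrable_cball f)
  show "AE x in lborel. norm (k x *\<^sub>R f x) \<le> norm (B *\<^sub>R indicator (cball 0 R) x *\<^sub>R f x)"
  proof (rule AE_I2)
   fix x show "norm (k x *\<^sub>R f x) \<le> norm (B *\<^sub>R indicator (cball 0 R) x *\<^sub>R f x)"
   proof (cases "x \<in> cball 0 R")
    case True
    have "\<bar>k x\<bar> \<le> \<bar>B\<bar>" using B[of x] by simp
    then show ?thesis using True by (auto intro!: mult_right_mono)
   qed (simp add: k(2))
  qed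
 qed auto
qed

lemma integrable_bump_mult:
 assumes f: "loc_integrable f" and e: "\<epsilon> \<noteq> 0"
 shows "integrable lborel (\<lambda>z. bump z *\<^sub>R f (y + \<epsilon> *\<^sub>R z))"
 by (rule integrable_Cc_mult[OF smooth_continuous[OF smooth_bump] bump_zero loc_integrable_affine[OF f e]])

text \<open>Since \<open>bump\<close> has mass one, the mollification error is an average of
  translation errors. Tonelli moves the average outside the L^1 norm, and only shifts of length at
  most \<epsilon> carry weight. The same bound yields the integrability of the error.\<close>

lemma bnorm_mollify:
 fixes f :: "R3 \<Rightarrow> 'b::{banach, second_countable_topology}"
 assumes f: "loc_integrable f" and e: "e > 0"
 shows "\<exists>d>0. d \<le> 1 \<and> (\<forall>\<epsilon>. 0 < \<epsilon> \<longrightarrow> \<epsilon> < d \<longrightarrow>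
  integrable lborel (\<lambda>x. indicator (cball 0 R) x *\<^sub>R norm (mollify \<epsilon> f x - f x)) \<and>
  bnorm R (\<lambda>x. mollify \<epsilon> f x - f x) \<le> e)"
proof -
 obtain d where d: "d > 0" "d \<le> 1" "\<And>h. norm h < d \<Longrightarrow> bnorm R (\<lambda>x. f (x + h) - f x) < e"
  using bnorm_translation[OF f e] by blast
 have [measurable]: "f \<in> borel_measurable borel" using f by (rule loc_integrable_measurable)
 have nn: "(\<integral>\<^sup>+y. ennreal (indicator (cball 0 R) y *\<^sub>R norm (mollify \<epsilon> f y - f y)) \<partial>lborel) \<le> ennreal e"
  if \<epsilon>: "0 < \<epsilon>" "\<epsilon> < d" for \<epsilon>
 proof -
  have "(\<integral>\<^sup>+y. ennreal (indicator (cball 0 R) y *\<^sub>R norm (mollify \<epsilon> f y - f y)) \<partial>lborel)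
   \<le> (\<integral>\<^sup>+y. \<integral>\<^sup>+z. ennreal (bump z * (indicator (cball 0 R) y *\<^sub>R norm (f (y + \<epsilon> *\<^sub>R z) - f y))) \<partial>lborel \<partial>lborel)"
  proof (rule nn_integral_mono)
   fix y
   have "mollify \<epsilon> f y - f y = (LBINT z. bump z *\<^sub>R f (y + \<epsilon> *\<^sub>R z) - bump z *\<^sub>R f y)"
    unfolding mollify_def
    by (subst Bochner_Integration.integral_diff)
     (use integrable_bump_mult[OF f] \<epsilon> integrable_bump integral_bump in auto)
   also have "\<dots> = (LBINT z. bump z *\<^sub>R (f (y + \<epsilon> *\<^sub>R z) - f y))"
    by (simp add: scaleR_diff_right)
   finally have eq: "mollify \<epsilon> f y - f y = (LBINT z. bump z *\<^sub>R (f (y + \<epsilon> *\<^sub>R z) - f y))" .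
   have i: "integrable lborel (\<lambda>z. bump z *\<^sub>R (f (y + \<epsilon> *\<^sub>R z) - f y))"
    using integrable_bump_mult[OF f] \<epsilon> integrable_bump by (simp add: scaleR_diff_right)
   have "ennreal (norm (mollify \<epsilon> f y - f y)) \<le> (\<integral>\<^sup>+z. ennreal (norm (bump z *\<^sub>R (f (y + \<epsilon> *\<^sub>R z) - f y))) \<partial>lborel)"
    unfolding eq by (rule integral_norm_bound_ennreal[OF i])
   then show "ennreal (indicator (cball 0 R) y *\<^sub>R norm (mollify \<epsilon> f y - f y))
    \<le> (\<integral>\<^sup>+z. ennreal (bump z * (indicator (cball 0 R) y *\<^sub>R norm (f (y + \<epsilon> *\<^sub>R z) - f y))) \<partial>lborel)"
    by (auto simp: indicator_def bump_nonneg)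
  qed
  also have "\<dots> = (\<integral>\<^sup>+z. \<integral>\<^sup>+y. ennreal (bump z * (indicator (cball 0 R) y *\<^sub>R norm (f (y + \<epsilon> *\<^sub>R z) - f y))) \<partial>lborel \<partial>lborel)"
   by (rule nn_integral_lborel_pair(2)) measurable
  also have "\<dots> \<le> (\<integral>\<^sup>+z. ennreal (bump z) * ennreal e \<partial>lborel)"
  proof (rule nn_integral_mono)
   fix z
   have i: "integrable lborel (\<lambda>y. indicator (cball 0 R) y *\<^sub>R norm (f (y + \<epsilon> *\<^sub>R z) - f y))"
    by (intro loc_integrable_norm_cball loc_integrable_diff loc_integrable_translate f)
   have "(\<integral>\<^sup>+y. ennreal (bump z * (indicator (cball 0 R) y *\<^sub>R norm (f (y + \<epsilon> *\<^sub>R z) - f y))) \<partial>lborel)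
    = ennreal (bump z) * (\<integral>\<^sup>+y. ennreal (indicator (cball 0 R) y *\<^sub>R norm (f (y + \<epsilon> *\<^sub>R z) - f y)) \<partial>lborel)"
    by (subst nn_integral_cmult[symmetric]) (auto simp: ennreal_mult' bump_nonneg)
   also have "(\<integral>\<^sup>+y. ennreal (indicator (cball 0 R) y *\<^sub>R norm (f (y + \<epsilon> *\<^sub>R z) - f y)) \<partial>lborel)
    = ennreal (bnorm R (\<lambda>y. f (y + \<epsilon> *\<^sub>R z) - f y))"
    unfolding bnorm_def by (rule nn_integral_eq_integral[OF i]) auto
   also have "ennreal (bump z) * ennreal (bnorm R (\<lambda>y. f (y + \<epsilon> *\<^sub>R z) - f y)) \<le> ennreal (bump z) * ennreal e"
   proof (cases "z \<in> cball 0 1")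
    case True
    have "norm (\<epsilon> *\<^sub>R z) \<le> \<epsilon>" using True \<epsilon> by (simp add: mult_left_le)
    then have "norm (\<epsilon> *\<^sub>R z) < d" using \<epsilon>(2) by (rule le_less_trans)
    then show ?thesis using d(3)[of "\<epsilon> *\<^sub>R z"] by (intro mult_left_mono ennreal_leI) auto
   qed (simp add: bump_zero)
   finally show "(\<integral>\<^sup>+y. ennreal (bump z * (indicator (cball 0 R) y *\<^sub>R norm (f (y + \<epsilon> *\<^sub>R z) - f y))) \<partial>lborel)
    \<le> ennreal (bump z) * ennreal e" .
  qed
  also have "\<dots> = ennreal e"
   using nn_integral_eq_integral[OF integrable_bump] bump_nonneg integral_bump
   by (simp add: nn_integral_multc)
  finally show ?thesis .
 qed
 have "integrable lborel (\<lambda>x. indicator (cball 0 R) x *\<^sub>R norm (mollify \<epsilon> f x - f x)) \<and>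
  bnorm R (\<lambda>x. mollify \<epsilon> f x - f x) \<le> e" if \<epsilon>: "0 < \<epsilon>" "\<epsilon> < d" for \<epsilon>
 proof
  have "(\<integral>\<^sup>+y. ennreal (indicator (cball 0 R) y *\<^sub>R norm (mollify \<epsilon> f y - f y)) \<partial>lborel) < \<infinity>"
   by (rule le_less_trans[OF nn[OF \<epsilon>]]) simp
  then show i: "integrable lborel (\<lambda>x. indicator (cball 0 R) x *\<^sub>R norm (mollify \<epsilon> f x - f x))"
   by (intro integrableI_nonneg) auto
  have "ennreal (bnorm R (\<lambda>x. mollify \<epsilon> f x - f x)) = (\<integral>\<^sup>+y. ennreal (indicator (cball 0 R) y *\<^sub>R norm (mollify \<epsilon> f y - f y)) \<partial>lborel)"
   unfolding bnorm_def by (rule nn_integral_eq_integral[OF i, symmetric]) auto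
  also have "\<dots> \<le> ennreal e" by (rule nn[OF \<epsilon>])
  finally show "bnorm R (\<lambda>x. mollify \<epsilon> f x - f x) \<le> e" using e by (simp add: ennreal_le_iff)
 qed
 then show ?thesis using d(1,2) by blast
qed

section \<open>Borel representatives\<close>

lemma borel_representative:
 fixes f :: "R3 \<Rightarrow> 'b::euclidean_space"
 assumes f: "f \<in> borel_measurable lebesgue"
 obtains g where "g \<in> borel_measurable borel" "AE x in lborel. f x = g x"
proof -
 have "\<exists>g'\<in>borel_measurable lborel. AE x in lborel. f x \<bullet> b = g' x" for b :: 'b
  by (rule completion_ex_borel_measurable_real) (use f in measurable)
 then obtain g' where g': "\<And>b. g' b \<in> borel_measurable lborel" "\<And>b. AE x in lborel. f x \<bullet> b = g' b x" by metis
 have "AE x in lborel. \<forall>b\<in>Basis. f x \<bullet> b = g' b x"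
  by (rule AE_finite_allI) (use g' in auto)
 then have "AE x in lborel. f x = (\<Sum>b\<in>Basis. g' b x *\<^sub>R b)"
 proof eventually_elim
  case (elim x)
  have "f x = (\<Sum>b\<in>Basis. (f x \<bullet> b) *\<^sub>R b)" by (rule euclidean_representation[symmetric])
  then show ?case using elim by simp
 qed
 moreover have "(\<lambda>x. \<Sum>b\<in>Basis. g' b x *\<^sub>R b) \<in> borel_measurable borel" using g'(1) by simp
 ultimately show ?thesis using that by blast
qed

section \<open>Weak gradients and limits of test functions\<close>

text \<open>The substitution x = y + \<epsilon> z. The argument (x - y)/\<epsilon> of the kernel is
  kept in affine form so that \<open>Cc_inf_reflected\<close> and \<open>partial_affine\<close>
  apply to it.\<close>

lemma kernel_subst:
 fixes f :: "R3 \<Rightarrow> 'b::{banach, second_countable_topology}"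
 assumes k: "continuous_on UNIV k" "\<And>x. x \<notin> cball 0 R \<Longrightarrow> k x = (0::real)" and f: "loc_integrable f" and e: "\<epsilon> > 0"
 shows "(LBINT z. k z *\<^sub>R f (y + \<epsilon> *\<^sub>R z)) = (1 / \<epsilon> ^ 3) *\<^sub>R (LBINT x. k ((1 / \<epsilon>) *\<^sub>R x + (- (1 / \<epsilon>)) *\<^sub>R y) *\<^sub>R f x)"
proof -
 let ?k = "\<lambda>x. k ((1 / \<epsilon>) *\<^sub>R x + (- (1 / \<epsilon>)) *\<^sub>R y)"
 have "continuous_on UNIV ?k"
  by (rule continuous_on_compose2[OF k(1)]) (auto intro!: continuous_intros)
 moreover have "?k x = 0" if "x \<notin> cball 0 (norm y + \<epsilon> * \<bar>R\<bar>)" for x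
 proof (rule k(2))
  have "norm x > norm y + \<epsilon> * \<bar>R\<bar>" using that by simp
  moreover have "norm x \<le> norm y + norm (x - y)" using norm_triangle_ineq[of y "x - y"] by simp
  ultimately have "\<epsilon> * \<bar>R\<bar> < norm (x - y)" by linarith
  then have "\<bar>R\<bar> < norm (x - y) / \<epsilon>" using e by (simp add: pos_less_divide_eq mult.commute)
  then have "\<bar>R\<bar> < norm ((1 / \<epsilon>) *\<^sub>R (x - y))" using e by simp
  then show "(1 / \<epsilon>) *\<^sub>R x + (- (1 / \<epsilon>)) *\<^sub>R y \<notin> cball 0 R"
   by (simp add: scaleR_diff_right)
 qed
 ultimately have "integrable lborel (\<lambda>x. ?k x *\<^sub>R f x)"
  by (rule integrable_Cc_mult[OF _ _ f])
 from integral_affine[OF this, of \<epsilon> y] e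
 have "(LBINT x. ?k x *\<^sub>R f x) = \<epsilon> ^ 3 *\<^sub>R (LBINT z. ?k (y + \<epsilon> *\<^sub>R z) *\<^sub>R f (y + \<epsilon> *\<^sub>R z))"
  by simp
 also have "(\<lambda>z. ?k (y + \<epsilon> *\<^sub>R z) *\<^sub>R f (y + \<epsilon> *\<^sub>R z)) = (\<lambda>z. k z *\<^sub>R f (y + \<epsilon> *\<^sub>R z))"
  using e by (auto simp: scaleR_add_right)
 finally show ?thesis using e by simp
qed

text \<open>By the Lindelof property countably many of the local neighbourhoods cover \<Omega>, and
  a countable union of null sets is null.\<close>

lemma AE_local_to_global:
 assumes "\<And>a. a \<in> \<Omega> \<Longrightarrow> \<exists>r>0. AE x in M. x \<in> ball a r \<longrightarrow> P x"
 shows "AE x in M. x \<in> (\<Omega> :: R3 set) \<longrightarrow> P x"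
proof -
 define F where "F = {S. open S \<and> (AE x in M. x \<in> S \<longrightarrow> P x)}"
 obtain F' where F': "F' \<subseteq> F" "countable F'" "\<Union>F' = \<Union>F"
  using Lindelof[of F] by (auto simp: F_def)
 have ae: "AE x in M. \<forall>S\<in>F'. x \<in> S \<longrightarrow> P x"
  using F' by (subst AE_ball_countable) (auto simp: F_def)
 have sub: "\<Omega> \<subseteq> \<Union>F'"
 proof
  fix a assume "a \<in> \<Omega>"
  then obtain r where "r > 0" "AE x in M. x \<in> ball a r \<longrightarrow> P x" using assms by blast
  then have "ball a r \<in> F" "a \<in> ball a r" by (auto simp: F_def)
  then show "a \<in> \<Union>F'" using F'(3) by blast
 qed
 show ?thesis using ae
 proof eventually_elim
  case (elim x)
  then show ?case using sub by blast
 qed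
qed

lemma AE_eq_lebesgue_measurable:
 fixes f g :: "'a::euclidean_space \<Rightarrow> 'b::topological_space"
 assumes g: "g \<in> borel_measurable lebesgue" and ae: "AE x in lebesgue. f x = g x"
 shows "f \<in> borel_measurable lebesgue"
proof (rule measurableI)
 fix S :: "'b set" assume S: "S \<in> sets borel"
 show "f -` S \<inter> space lebesgue \<in> sets lebesgue"
 proof (rule completion.in_sets_AE)
  show "g -` S \<inter> space lebesgue \<in> sets lebesgue" using g S by (rule measurable_sets)
  show "AE x in lebesgue. (x \<in> g -` S \<inter> space lebesgue) = (x \<in> f -` S \<inter> space lebesgue)"
   using ae by eventually_elim auto
 qed auto
qed auto

text \<open>The bridge from Lebesgue integrals over \<Omega>, in which the problem is posed, to
  Borel integrals over the whole space, in which it is solved. It requires a representative that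
  vanishes outside \<Omega>.\<close>

lemma lebesgue_integral_borel_rep:
 fixes F :: "R3 \<Rightarrow> 'b::{banach, second_countable_topology}"
 assumes F0: "F0 \<in> borel_measurable borel" "\<And>x. x \<notin> \<Omega> \<Longrightarrow> F0 x = 0"
  and ae: "AE x in lborel. x \<in> \<Omega> \<longrightarrow> F x = F0 x"
 shows "(LINT x:\<Omega>|lebesgue. F x) = (LBINT x. F0 x)"
  and "set_integrable lebesgue \<Omega> F \<longleftrightarrow> integrable lborel F0"
proof -
 have ae': "AE x in lebesgue. indicator \<Omega> x *\<^sub>R F x = F0 x"
 proof (rule AE_completion)
  show "AE x in lborel. indicator \<Omega> x *\<^sub>R F x = F0 x"
   using ae by eventually_elim (auto simp: indicator_def F0(2))
 qed
 have m0: "F0 \<in> borel_measurable lebesgue" using F0(1) by (simp add: measurable_completion)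
 have m: "(\<lambda>x. indicator \<Omega> x *\<^sub>R F x) \<in> borel_measurable lebesgue"
  by (rule AE_eq_lebesgue_measurable[OF m0 ae'])
 show "(LINT x:\<Omega>|lebesgue. F x) = (LBINT x. F0 x)"
  unfolding set_lebesgue_integral_def integral_cong_AE[OF m m0 ae']
  using F0(1) by (intro integral_completion) simp
 show "set_integrable lebesgue \<Omega> F \<longleftrightarrow> integrable lborel F0"
  unfolding set_integrable_def integrable_cong_AE[OF m m0 ae']
  using F0(1) by (intro integrable_completion) simp
qed

lemma borel_rep_on:
 fixes f :: "R3 \<Rightarrow> 'b::euclidean_space"
 assumes "open \<Omega>" and f: "f \<in> borel_measurable (lebesgue_on \<Omega>)"
 obtains f0 where "f0 \<in> borel_measurable borel" "\<And>x. x \<notin> \<Omega> \<Longrightarrow> f0 x = 0" "AE x in lborel. x \<in> \<Omega> \<longrightarrow> f x = f0 x"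
proof -
 have \<Omega>[measurable]: "\<Omega> \<in> sets borel" using assms by simp
 have "(\<lambda>x. if x \<in> \<Omega> then f x else 0) \<in> borel_measurable lebesgue"
  using f \<Omega> by (subst borel_measurable_if) auto
 then obtain g where g: "g \<in> borel_measurable borel" "AE x in lborel. (if x \<in> \<Omega> then f x else 0) = g x"
  by (rule borel_representative)
 show ?thesis
 proof (rule that[of "\<lambda>x. indicator \<Omega> x *\<^sub>R g x"])
  show "(\<lambda>x. indicator \<Omega> x *\<^sub>R g x) \<in> borel_measurable borel" using g(1) by measurable
  show "AE x in lborel. x \<in> \<Omega> \<longrightarrow> f x = indicator \<Omega> x *\<^sub>R g x"
   using g(2) by eventually_elim auto
 qed auto
qed

lemma compact_exhaustion:
 assumes "open (\<Omega> :: R3 set)"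
 obtains C where "\<And>n::nat. compact (C n)" "\<And>n. C n \<subseteq> \<Omega>" "\<And>x. x \<in> \<Omega> \<Longrightarrow> eventually (\<lambda>n. x \<in> C n) sequentially"
proof -
 obtain C where C: "\<And>n. compact (C n)" "\<And>n. C n \<subseteq> \<Omega>" "\<And>n. C n \<subseteq> interior (C (Suc n))" "\<Union>(range C) = \<Omega>"
  using open_Union_compact_subsets[OF assms] by (metis (no_types))
 have "C n \<subseteq> C (Suc n)" for n using C(3)[of n] interior_subset by blast
 then have mono: "C n \<subseteq> C m" if "n \<le> m" for n m using that by (rule lift_Suc_mono_le)
 have "eventually (\<lambda>n. x \<in> C n) sequentially" if "x \<in> \<Omega>" for x
 proof -
  obtain n where "x \<in> C n" using C(4) \<open>x \<in> \<Omega>\<close> by blast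
  then show ?thesis unfolding eventually_sequentially using mono by (intro exI[of _ n]) blast
 qed
 with C(1,2) that show ?thesis by blast
qed

text \<open>Along a compact exhaustion the truncations are integrable, hence measurable, and
  converge pointwise to the extension by zero.\<close>

lemma L1_loc_measurable:
 fixes f :: "R3 \<Rightarrow> 'b::euclidean_space"
 assumes \<Omega>: "open \<Omega>" and f: "f \<in> L1_loc \<Omega>"
 shows "f \<in> borel_measurable (lebesgue_on \<Omega>)"
proof -
 obtain C where C: "\<And>n::nat. compact (C n)" "\<And>n. C n \<subseteq> \<Omega>" "\<And>x. x \<in> \<Omega> \<Longrightarrow> eventually (\<lambda>n. x \<in> C n) sequentially"
  using compact_exhaustion[OF \<Omega>] by blast
 have "(\<lambda>x. indicator (C n) x *\<^sub>R f x) \<in> borel_measurable lebesgue" for n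
 proof -
  have "set_integrable lebesgue (C n) f" using f C(1,2)[of n] by (simp add: L1_loc_def)
  then show ?thesis unfolding set_integrable_def by (rule borel_measurable_integrable)
 qed
 moreover have "(\<lambda>n. indicator (C n) x *\<^sub>R f x) \<longlonglongrightarrow> (if x \<in> \<Omega> then f x else 0)" for x
 proof (cases "x \<in> \<Omega>")
  case True
  have "eventually (\<lambda>n. indicator (C n) x *\<^sub>R f x = f x) sequentially"
   using C(3)[OF True] by eventually_elim auto
  then show ?thesis using True by (simp add: tendsto_eventually)
 next
  case False
  then have "x \<notin> C n" for n using C(2) by blast
  then show ?thesis using False by simp
 qed
 ultimately have "(\<lambda>x. if x \<in> \<Omega> then f x else 0) \<in> borel_measurable lebesgue"
  by (rule borel_measurable_LIMSEQ_metric)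
 then show ?thesis using \<Omega> by (subst (asm) borel_measurable_if) auto
qed

text \<open>At a point of the small ball, a mollification at scale below \<open>r\<close> is the
  integral of \<open>g\<close> against a test function supported in the double ball, hence zero. As
  \<epsilon> tends to 0 the mollifications converge to \<open>g\<close> in L^1.\<close>

lemma fundamental_lemma_ball:
 fixes g :: "R3 \<Rightarrow> 'b::{banach, second_countable_topology}"
 assumes g: "integrable lborel g" and r: "r > 0"
  and z: "\<And>\<phi>. \<phi> \<in> Cc_inf UNIV \<Longrightarrow> (\<And>x. x \<notin> cball a (2 * r) \<Longrightarrow> \<phi> x = 0) \<Longrightarrow> (LBINT x. \<phi> x *\<^sub>R g x) = 0"
 shows "AE x in lborel. x \<in> ball a r \<longrightarrow> g x = 0"
proof -
 have lg: "loc_integrable g" using g by (rule integrable_loc_integrable)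
 have [measurable]: "g \<in> borel_measurable borel" using lg by (rule loc_integrable_measurable)
 have m0: "mollify \<epsilon> g y = 0" if \<epsilon>: "0 < \<epsilon>" "\<epsilon> < r" and y: "y \<in> ball a r" for \<epsilon> y
 proof -
  let ?\<phi> = "\<lambda>x. bump ((1 / \<epsilon>) *\<^sub>R x + (- (1 / \<epsilon>)) *\<^sub>R y)"
  have "?\<phi> x = 0" if "x \<notin> cball a (2 * r)" for x
  proof (rule bump_zero)
   have "dist a x > 2 * r" using that by simp
   moreover have "dist a y < r" using y by simp
   ultimately have "dist y x > \<epsilon>" using dist_triangle[of a x y] \<epsilon> by linarith
   then have "norm ((1 / \<epsilon>) *\<^sub>R (x - y)) > 1" using \<epsilon> by (simp add: dist_norm norm_minus_commute)
   then show "(1 / \<epsilon>) *\<^sub>R x + (- (1 / \<epsilon>)) *\<^sub>R y \<notin> cball 0 1"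
    by (simp add: scaleR_diff_right)
  qed
  moreover have "?\<phi> \<in> Cc_inf UNIV" using \<epsilon> by (intro Cc_inf_reflected bump_Cc_inf) auto
  ultimately have "(LBINT x. ?\<phi> x *\<^sub>R g x) = 0" by (intro z)
  moreover have "mollify \<epsilon> g y = (1 / \<epsilon> ^ 3) *\<^sub>R (LBINT x. ?\<phi> x *\<^sub>R g x)"
   unfolding mollify_def by (rule kernel_subst[OF smooth_continuous[OF smooth_bump] bump_zero lg \<epsilon>(1)])
  ultimately show ?thesis by (simp only: scaleR_zero_right)
 qed
 define R where "R = norm a + r"
 have sub: "x \<in> cball 0 R" if "x \<in> ball a r" for x
  using that norm_triangle_ineq[of a "x - a"] by (simp add: R_def dist_norm norm_minus_commute)
 have i: "integrable lborel (\<lambda>x. indicator (ball a r) x *\<^sub>R norm (g x))"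
  using integrable_mult_indicator[OF _ integrable_norm[OF g], of "ball a r"] by simp
 have le: "(LBINT x. indicator (ball a r) x *\<^sub>R norm (g x)) \<le> e" if e0: "e > 0" for e
 proof -
  obtain d where d: "d > 0" "\<And>\<epsilon>. 0 < \<epsilon> \<Longrightarrow> \<epsilon> < d \<Longrightarrow> integrable lborel (\<lambda>x. indicator (cball 0 R) x *\<^sub>R norm (mollify \<epsilon> g x - g x)) \<and> bnorm R (\<lambda>x. mollify \<epsilon> g x - g x) \<le> e"
   using bnorm_mollify[OF lg e0, of R] by blast
  define \<epsilon> where "\<epsilon> = min d r / 2"
  have \<epsilon>: "0 < \<epsilon>" "\<epsilon> < d" "\<epsilon> < r" using d r by (auto simp: \<epsilon>_def)
  have "(LBINT x. indicator (ball a r) x *\<^sub>R norm (g x)) \<le> (LBINT x. indicator (cball 0 R) x *\<^sub>R norm (mollify \<epsilon> g x - g x))"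
  proof (rule integral_mono[OF i])
   show "integrable lborel (\<lambda>x. indicator (cball 0 R) x *\<^sub>R norm (mollify \<epsilon> g x - g x))" using d \<epsilon> by blast
   fix x show "indicator (ball a r) x *\<^sub>R norm (g x) \<le> indicator (cball 0 R) x *\<^sub>R norm (mollify \<epsilon> g x - g x)"
   proof (cases "x \<in> ball a r")
    case True
    then show ?thesis using sub[OF True] m0[OF \<epsilon>(1,3) True] by simp
   qed simp
  qed
  also have "\<dots> \<le> e" using d(2)[OF \<epsilon>(1,2)] by (simp add: bnorm_def)
  finally show ?thesis .
 qed
 have "(LBINT x. indicator (ball a r) x *\<^sub>R norm (g x)) \<le> 0"
  by (rule field_le_epsilon) (use le in auto)
 moreover have "(LBINT x. indicator (ball a r) x *\<^sub>R norm (g x)) \<ge> 0"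
  by (intro Bochner_Integration.integral_nonneg) auto
 ultimately have "(LBINT x. indicator (ball a r) x *\<^sub>R norm (g x)) = 0" by linarith
 then have "AE x in lborel. indicator (ball a r) x *\<^sub>R norm (g x) = 0"
  by (subst (asm) integral_nonneg_eq_0_iff_AE[OF i]) auto
 then show ?thesis by eventually_elim auto
qed

text \<open>Needed because \<open>weak_grad\<close> is an arbitrary choice: it makes every computed
  weak gradient agree with the chosen one up to a null set. The difference of two candidates is
  orthogonal to all test functions, locally.\<close>

lemma has_weak_gradient_unique:
 assumes \<Omega>: "open \<Omega>" and g: "has_weak_gradient \<Omega> v g" and h: "has_weak_gradient \<Omega> v h"
 shows "AE x in lborel. x \<in> \<Omega> \<longrightarrow> g x = h x"
proof (rule AE_local_to_global)
 fix a assume "a \<in> \<Omega>"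
 then obtain s where s: "s > 0" "cball a s \<subseteq> \<Omega>" using \<Omega> open_contains_cball by blast
 \<comment> \<open>Half the radius, so that the double ball required by
   \<open>fundamental_lemma_ball\<close> is still inside \<Omega>.\<close>
 define r where "r = s / 2"
 have r: "r > 0" "cball a (2 * r) \<subseteq> \<Omega>" using s by (auto simp: r_def)
 define B where "B = cball a (2 * r)"
 have B: "compact B" "B \<subseteq> \<Omega>" using r by (auto simp: B_def)
 have [measurable]: "B \<in> sets borel" by (simp add: B_def)
 have iK: "set_integrable lebesgue K g" "set_integrable lebesgue K h" if "compact K" "K \<subseteq> \<Omega>" for K
  using g h that by (auto simp: has_weak_gradient_def L1_loc_def)
 have "integrable lebesgue (\<lambda>x. indicator B x *\<^sub>R (g x - h x))"
  using set_integral_diff(1)[OF iK[OF B]] by (simp add: set_integrable_def)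
 then obtain w where w: "w \<in> borel_measurable borel" "AE x in lborel. indicator B x *\<^sub>R (g x - h x) = w x"
  using borel_representative borel_measurable_integrable by blast
 define w0 where "w0 x = indicator B x *\<^sub>R w x" for x
 have w0m[measurable]: "w0 \<in> borel_measurable borel" unfolding w0_def[abs_def] using w(1) by measurable
 have aew: "AE x in lborel. x \<in> B \<longrightarrow> g x - h x = w0 x"
  using w(2) by eventually_elim (auto simp: w0_def)
 have w0z: "w0 x = 0" if "x \<notin> B" for x using that by (simp add: w0_def)
 have iw: "integrable lborel w0"
  using lebesgue_integral_borel_rep(2)[OF w0m w0z aew] set_integral_diff(1)[OF iK[OF B]] by blast
 have "AE x in lborel. x \<in> ball a r \<longrightarrow> w0 x = 0"
 proof (rule fundamental_lemma_ball[OF iw r(1)])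
  fix \<phi> assume \<phi>: "\<phi> \<in> Cc_inf UNIV" "\<And>x. x \<notin> cball a (2 * r) \<Longrightarrow> \<phi> x = 0"
  then have \<phi>\<Omega>: "\<phi> \<in> Cc_inf \<Omega>"
   using B by (auto simp: Cc_inf_iff B_def intro: compact_support_inI[of "cball a (2 * r)"])
  have \<phi>m[measurable]: "\<phi> \<in> borel_measurable borel"
   using \<phi>(1) by (auto simp: Cc_inf_iff intro: borel_measurable_continuous_onI smooth_continuous)
  have eq: "(LINT x:\<Omega>|lebesgue. \<phi> x *\<^sub>R k x) = (LINT x:B|lebesgue. \<phi> x *\<^sub>R k x)" for k :: "R3 \<Rightarrow> R3"
   unfolding set_lebesgue_integral_def
   using \<phi>(2) B(2) by (intro Bochner_Integration.integral_cong) (auto simp: indicator_def B_def)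
  have iB: "set_integrable lebesgue B (\<lambda>x. \<phi> x *\<^sub>R k x)" if "set_integrable lebesgue B k" for k :: "R3 \<Rightarrow> R3"
  proof -
   obtain c where c: "\<And>x. norm (\<phi> x) \<le> c"
   proof (rule bounded_continuous_cball[of \<phi> "norm a + 2 * r"])
    show "continuous_on UNIV \<phi>" using \<phi>(1) by (auto simp: Cc_inf_iff intro: smooth_continuous)
    show "\<phi> x = 0" if "x \<notin> cball 0 (norm a + 2 * r)" for x
     using that norm_triangle_ineq[of a "x - a"] by (intro \<phi>(2)) (auto simp: dist_norm norm_minus_commute)
   qed blast
   have m: "\<phi> \<in> borel_measurable lebesgue" by (simp add: measurable_completion)
   show ?thesis
    unfolding set_integrable_def
   proof (rule Bochner_Integration.integrable_bound)
    show "integrable lebesgue (\<lambda>x. c *\<^sub>R (indicator B x *\<^sub>R k x))"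
     using that unfolding set_integrable_def by (rule integrable_scaleR_right)
    have "(\<lambda>x. \<phi> x *\<^sub>R (indicator B x *\<^sub>R k x)) \<in> borel_measurable lebesgue"
     using borel_measurable_scaleR[OF m borel_measurable_integrable[OF that[unfolded set_integrable_def]]] .
    then show "(\<lambda>x. indicator B x *\<^sub>R \<phi> x *\<^sub>R k x) \<in> borel_measurable lebesgue"
     by (simp add: scaleR_left_commute mult.commute)
    show "AE x in lebesgue. norm (indicator B x *\<^sub>R \<phi> x *\<^sub>R k x) \<le> norm (c *\<^sub>R (indicator B x *\<^sub>R k x))"
    proof (rule AE_I2)
     fix x have "\<bar>\<phi> x\<bar> \<le> \<bar>c\<bar>" using c[of x] by simp
     then show "norm (indicator B x *\<^sub>R \<phi> x *\<^sub>R k x) \<le> norm (c *\<^sub>R (indicator B x *\<^sub>R k x))"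
      by (auto simp: indicator_def intro!: mult_right_mono)
    qed
   qed
  qed
  have "(LINT x:\<Omega>|lebesgue. v x *\<^sub>R grad \<phi> x) = - (LINT x:\<Omega>|lebesgue. \<phi> x *\<^sub>R g x)"
   "(LINT x:\<Omega>|lebesgue. v x *\<^sub>R grad \<phi> x) = - (LINT x:\<Omega>|lebesgue. \<phi> x *\<^sub>R h x)"
   using g h \<phi>\<Omega> unfolding has_weak_gradient_def by blast+
  then have "- (LINT x:\<Omega>|lebesgue. \<phi> x *\<^sub>R g x) = - (LINT x:\<Omega>|lebesgue. \<phi> x *\<^sub>R h x)"
   by simp
  then have "(LINT x:B|lebesgue. \<phi> x *\<^sub>R g x) = (LINT x:B|lebesgue. \<phi> x *\<^sub>R h x)"
   unfolding eq by simp
  then have "(LINT x:B|lebesgue. \<phi> x *\<^sub>R g x - \<phi> x *\<^sub>R h x) = 0"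
   using set_integral_diff(2)[OF iB[OF iK(1)[OF B]] iB[OF iK(2)[OF B]]] by simp
  moreover have "(LINT x:B|lebesgue. \<phi> x *\<^sub>R g x - \<phi> x *\<^sub>R h x) = (LBINT x. \<phi> x *\<^sub>R w0 x)"
  proof (rule lebesgue_integral_borel_rep(1))
   show "AE x in lborel. x \<in> B \<longrightarrow> \<phi> x *\<^sub>R g x - \<phi> x *\<^sub>R h x = \<phi> x *\<^sub>R w0 x"
    using aew by eventually_elim (auto simp: scaleR_diff_right[symmetric])
  qed (auto simp: w0z)
  ultimately show "(LBINT x. \<phi> x *\<^sub>R w0 x) = 0" by simp
 qed
 then have "AE x in lborel. x \<in> ball a r \<longrightarrow> g x = h x"
  using aew by eventually_elim (use r(1) in \<open>auto simp: B_def\<close>)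
 then show "\<exists>r>0. AE x in lborel. x \<in> ball a r \<longrightarrow> g x = h x" using r(1) by blast
qed

lemma weak_grad_eq_AE:
 assumes "open \<Omega>" "has_weak_gradient \<Omega> v g"
 shows "AE x in lborel. x \<in> \<Omega> \<longrightarrow> weak_grad \<Omega> v x = g x"
proof -
 have "has_weak_gradient \<Omega> v (weak_grad \<Omega> v)"
  unfolding weak_grad_def by (rule someI[where P = "has_weak_gradient \<Omega> v", OF assms(2)])
 then show ?thesis by (rule has_weak_gradient_unique[OF assms(1) _ assms(2)])
qed

section \<open>Sixth-power integrability of the elements of \<open>D0_fun\<close>\<close>

lemma grad_diff:
 assumes "f differentiable (at x)" "g differentiable (at x)"
 shows "grad (\<lambda>x. f x - g x) x = grad f x - grad g x"
 using partial_diff[OF assms] by (simp add: vec_eq_iff)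

lemma integrable_norm_diff_sq:
 fixes f g :: "'a \<Rightarrow> 'b::{real_inner, second_countable_topology}"
 assumes [measurable]: "f \<in> borel_measurable M" "g \<in> borel_measurable M"
  and "integrable M (\<lambda>x. (norm (f x))\<^sup>2)" "integrable M (\<lambda>x. (norm (g x))\<^sup>2)"
 shows "integrable M (\<lambda>x. (norm (f x - g x))\<^sup>2)"
  and "(\<integral>x. (norm (f x - g x))\<^sup>2 \<partial>M) \<le> 2 * (\<integral>x. (norm (f x))\<^sup>2 \<partial>M) + 2 * (\<integral>x. (norm (g x))\<^sup>2 \<partial>M)"
proof -
 have le: "(norm (f x - g x))\<^sup>2 \<le> 2 * (norm (f x))\<^sup>2 + 2 * (norm (g x))\<^sup>2" for x
 proof -
  have "(norm (f x - g x))\<^sup>2 \<le> (norm (f x) + norm (g x))\<^sup>2" by (intro power_mono norm_triangle_ineq4) auto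
  also have "\<dots> \<le> 2 * (norm (f x))\<^sup>2 + 2 * (norm (g x))\<^sup>2"
   using zero_le_power2[of "norm (f x) - norm (g x)"] by (simp add: power2_sum power2_diff)
  finally show ?thesis .
 qed
 have i: "integrable M (\<lambda>x. 2 * (norm (f x))\<^sup>2 + 2 * (norm (g x))\<^sup>2)" using assms by auto
 show id: "integrable M (\<lambda>x. (norm (f x - g x))\<^sup>2)"
  by (rule Bochner_Integration.integrable_bound[OF i]) (use le in auto)
 have "(\<integral>x. (norm (f x - g x))\<^sup>2 \<partial>M) \<le> (\<integral>x. 2 * (norm (f x))\<^sup>2 + 2 * (norm (g x))\<^sup>2 \<partial>M)"
  by (rule integral_mono[OF id i le])
 then show "(\<integral>x. (norm (f x - g x))\<^sup>2 \<partial>M) \<le> 2 * (\<integral>x. (norm (f x))\<^sup>2 \<partial>M) + 2 * (\<integral>x. (norm (g x))\<^sup>2 \<partial>M)"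
  using assms by simp
qed

lemma Cc_inf_zero_outside:
 assumes f: "f \<in> Cc_inf \<Omega>" and x: "x \<notin> \<Omega>"
 shows "f x = 0" "grad f x = 0"
proof -
 obtain K where K: "compact K" "K \<subseteq> \<Omega>" "\<And>x. x \<notin> K \<Longrightarrow> f x = 0"
  using f by (auto simp: Cc_inf_iff elim: compact_support_inE)
 have xK: "x \<notin> K" using x K(2) by blast
 show "f x = 0" by (rule K(3)[OF xK])
 show "grad f x = 0" by (rule grad_zero_outside[OF compact_imp_closed[OF K(1)] K(3) xK])
qed

lemma Cc_inf_Ck: "f \<in> Cc_inf \<Omega> \<Longrightarrow> Ck k f"
 by (simp add: Cc_inf_def)

lemma Cc_inf_integrable_sq:
 assumes "f \<in> Cc_inf \<Omega>"
 shows "integrable lborel (\<lambda>x. (norm (grad f x))\<^sup>2)" "grad f \<in> borel_measurable borel" "f \<in> borel_measurable borel"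
proof -
 obtain R where R: "\<And>x. x \<notin> cball 0 R \<Longrightarrow> f x = 0" using Cc_inf_bounded_support[OF assms] by metis
 have c: "continuous_on UNIV (grad f)" "continuous_on UNIV f"
  using assms by (auto simp: Cc_inf_iff intro: smooth_grad_continuous smooth_continuous)
 have "grad f x = 0" if "x \<notin> cball 0 R" for x
  by (rule grad_zero_outside[OF _ R that]) auto
 then show "integrable lborel (\<lambda>x. (norm (grad f x))\<^sup>2)"
  using c by (intro integrable_continuous_cball[where R = R]) (auto intro!: continuous_intros)
 show "grad f \<in> borel_measurable borel" "f \<in> borel_measurable borel"
  using c by (auto intro: borel_measurable_continuous_onI)
qed


text \<open>Sobolev's inequality turns convergence of the gradients in L^2 into the Cauchy property
  in L^6. Fatou's lemma identifies the limit, which is where the L^1_loc convergence in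
  \<open>D0_fun\<close> enters: gradients alone would fix \<open>v\<close> only up to a
  constant.\<close>

theorem D0_fun_Sobolev_limit:
 assumes \<Omega>: "open \<Omega>" and v: "v \<in> D0_fun 2 \<Omega>"
 shows "\<exists>\<psi> v0 g0. (\<forall>n. \<psi> n \<in> Cc_inf \<Omega>) \<and>
  v0 \<in> borel_measurable borel \<and> (\<forall>x. x \<notin> \<Omega> \<longrightarrow> v0 x = 0) \<and> (AE x in lborel. x \<in> \<Omega> \<longrightarrow> v x = v0 x) \<and>
  g0 \<in> borel_measurable borel \<and> (\<forall>x. x \<notin> \<Omega> \<longrightarrow> g0 x = 0) \<and> (AE x in lborel. x \<in> \<Omega> \<longrightarrow> weak_grad \<Omega> v x = g0 x) \<and>
  integrable lborel (\<lambda>x. (norm (g0 x))\<^sup>2) \<and> (\<lambda>n. LBINT x. (norm (grad (\<psi> n) x - g0 x))\<^sup>2) \<longlonglongrightarrow> 0 \<and>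
  (\<forall>n. integrable lborel (\<lambda>x. (\<psi> n x - v0 x)^6)) \<and> (\<lambda>n. LBINT x. (\<psi> n x - v0 x)^6) \<longlonglongrightarrow> 0"
proof -
 obtain \<psi> where ap: "D0_approx 2 \<Omega> \<psi> v"
  and L1: "\<And>K. compact K \<Longrightarrow> K \<subseteq> \<Omega> \<Longrightarrow> (\<lambda>n. LINT x:K|lebesgue. \<bar>\<psi> n x - v x\<bar>) \<longlonglongrightarrow> 0"
  using v unfolding D0_fun_def by blast
 obtain g where \<psi>: "\<And>n. \<psi> n \<in> Cc_inf \<Omega>" and g: "has_weak_gradient \<Omega> v g" "g \<in> Lq 2 \<Omega>"
  and lim: "(\<lambda>n. LINT x:\<Omega>|lebesgue. norm (grad (\<psi> n) x - g x) powr 2) \<longlonglongrightarrow> 0"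
  using ap unfolding D0_approx_def by blast
 have \<Omega>m[measurable]: "\<Omega> \<in> sets borel" using \<Omega> by simp
 have gm: "g \<in> borel_measurable (lebesgue_on \<Omega>)" and gi: "set_integrable lebesgue \<Omega> (\<lambda>x. norm (g x) powr 2)"
  using g(2) by (auto simp: Lq_def)
 have vL: "v \<in> L1_loc \<Omega>" using g(1) by (simp add: has_weak_gradient_def)
 obtain g0 where g0m[measurable]: "g0 \<in> borel_measurable borel" and g0z: "\<And>x. x \<notin> \<Omega> \<Longrightarrow> g0 x = 0"
  and g0e: "AE x in lborel. x \<in> \<Omega> \<longrightarrow> g x = g0 x"
  using borel_rep_on[OF \<Omega> gm] by blast
 obtain v0 where v0m[measurable]: "v0 \<in> borel_measurable borel" and v0z: "\<And>x. x \<notin> \<Omega> \<Longrightarrow> v0 x = 0"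
  and v0e: "AE x in lborel. x \<in> \<Omega> \<longrightarrow> v x = v0 x"
  using borel_rep_on[OF \<Omega> L1_loc_measurable[OF \<Omega> vL]] by blast
 have \<psi>d: "\<psi> n differentiable (at x)" for n x
  using \<psi>[of n] by (auto simp: Cc_inf_iff intro: smooth_differentiable)
 have [measurable]: "\<psi> n \<in> borel_measurable borel" "grad (\<psi> n) \<in> borel_measurable borel" for n
  using Cc_inf_integrable_sq[OF \<psi>] by auto
 have \<psi>z: "\<psi> n x = 0" "grad (\<psi> n) x = 0" if "x \<notin> \<Omega>" for n x
  using Cc_inf_zero_outside[OF \<psi> that] by auto
 have p2: "norm y powr 2 = (norm y)\<^sup>2" for y :: R3 by (simp add: powr_numeral)
 have g0i: "integrable lborel (\<lambda>x. (norm (g0 x))\<^sup>2)"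
 proof (rule lebesgue_integral_borel_rep(2)[THEN iffD1, OF _ _ _ gi])
  show "AE x in lborel. x \<in> \<Omega> \<longrightarrow> norm (g x) powr 2 = (norm (g0 x))\<^sup>2"
   using g0e by eventually_elim (auto simp: p2)
 qed (auto simp: g0z)
 define a where "a n = (LBINT x. (norm (grad (\<psi> n) x - g0 x))\<^sup>2)" for n
 have aeq: "a n = (LINT x:\<Omega>|lebesgue. norm (grad (\<psi> n) x - g x) powr 2)" for n
  unfolding a_def
 proof (rule lebesgue_integral_borel_rep(1)[symmetric])
  show "AE x in lborel. x \<in> \<Omega> \<longrightarrow> norm (grad (\<psi> n) x - g x) powr 2 = (norm (grad (\<psi> n) x - g0 x))\<^sup>2"
   using g0e by eventually_elim (auto simp: p2)
 qed (auto simp: g0z \<psi>z)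
 have alim: "a \<longlonglongrightarrow> 0" using lim unfolding aeq[symmetric] .
 have ann: "a n \<ge> 0" for n by (simp add: a_def)
 have ai: "integrable lborel (\<lambda>x. (norm (grad (\<psi> n) x - g0 x))\<^sup>2)" for n
  by (rule integrable_norm_diff_sq) (use Cc_inf_integrable_sq[OF \<psi>] g0i in auto)
 \<comment> \<open>Both gradients are compared with the common limit \<open>g0\<close>, so the bound
   involves only \<open>a m\<close> and \<open>a n\<close>.\<close>
 have sob: "integrable lborel (\<lambda>x. (\<psi> m x - \<psi> n x)^6) \<and> (LBINT x. (\<psi> m x - \<psi> n x)^6) \<le> 4096 * (2 * a m + 2 * a n)^3" for m n
 proof -
  have d: "(\<lambda>x. \<psi> m x - \<psi> n x) \<in> Cc_inf \<Omega>" by (intro Cc_inf_diff \<psi>)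
  obtain R where R: "\<And>x. x \<notin> cball 0 R \<Longrightarrow> \<psi> m x - \<psi> n x = 0" using Cc_inf_bounded_support[OF d] by metis
  have "continuous_on UNIV (\<lambda>x. \<psi> m x - \<psi> n x)" using d by (auto simp: Cc_inf_iff intro: smooth_continuous)
  then have i: "integrable lborel (\<lambda>x. (\<psi> m x - \<psi> n x)^6)"
   by (intro integrable_continuous_cball[where R = R]) (auto simp: R intro!: continuous_on_power)
  have "(LBINT x. (\<psi> m x - \<psi> n x)^6) \<le> 4096 * (LBINT x. (norm (grad (\<lambda>x. \<psi> m x - \<psi> n x) x))\<^sup>2)^3"
   by (rule Sobolev_inequality[OF Cc_inf_Ck[OF d] R])
  also have "(LBINT x. (norm (grad (\<lambda>x. \<psi> m x - \<psi> n x) x))\<^sup>2) = (LBINT x. (norm ((grad (\<psi> m) x - g0 x) - (grad (\<psi> n) x - g0 x)))\<^sup>2)"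
   by (simp add: grad_diff \<psi>d)
  also have "4096 * (LBINT x. (norm ((grad (\<psi> m) x - g0 x) - (grad (\<psi> n) x - g0 x)))\<^sup>2)^3 \<le> 4096 * (2 * a m + 2 * a n)^3"
   unfolding a_def
   by (intro mult_left_mono power_mono integrable_norm_diff_sq(2)) (use ai in auto)
  finally show ?thesis using i by blast
 qed
 \<comment> \<open>With \<open>n\<close> fixed, Fatou is applied to
   \<open>\<psi> m - \<psi> n\<close> along a subsequence converging almost everywhere on
   \<open>K\<close>. The contribution of \<open>a m\<close> disappears, and a bound independent of
   \<open>K\<close> remains.\<close>
 have Fat: "(\<integral>\<^sup>+x. ennreal (indicator K x * (\<psi> n x - v0 x)^6) \<partial>lborel) \<le> ennreal (4096 * (2 * a n)^3)"
  if K: "compact K" "K \<subseteq> \<Omega>" for K n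
 proof -
  have [measurable]: "K \<in> sets borel" using K by (simp add: compact_imp_closed)
  define w where "w m x = indicator K x *\<^sub>R (\<psi> m x - v0 x)" for m x
  have iw: "integrable lborel (w m)" for m
  proof -
   have "set_integrable lebesgue K (\<psi> m)"
   proof -
    have "integrable lborel (\<lambda>x. indicator K x *\<^sub>R \<psi> m x)"
     using \<psi>[of m] K by (intro borel_integrable_compact) (auto simp: Cc_inf_iff intro: smooth_continuous)
    then show ?thesis
     by (intro lebesgue_integral_borel_rep(2)[THEN iffD2, of "\<lambda>x. indicator K x *\<^sub>R \<psi> m x"]) auto
   qed
   moreover have "set_integrable lebesgue K v" using vL K by (auto simp: L1_loc_def)
   ultimately have "set_integrable lebesgue K (\<lambda>x. \<psi> m x - v x)" by (rule set_integral_diff(1))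
   then show ?thesis
   proof (rule lebesgue_integral_borel_rep(2)[THEN iffD1, rotated -1])
    show "AE x in lborel. x \<in> K \<longrightarrow> \<psi> m x - v x = w m x"
     using v0e by eventually_elim (use K in \<open>auto simp: w_def\<close>)
   qed (auto simp: w_def[abs_def])
  qed
  have "(LBINT x. norm (w m x)) = (LINT x:K|lebesgue. \<bar>\<psi> m x - v x\<bar>)" for m
  proof (rule lebesgue_integral_borel_rep(1)[symmetric])
   show "AE x in lborel. x \<in> K \<longrightarrow> \<bar>\<psi> m x - v x\<bar> = norm (w m x)"
    using v0e by eventually_elim (use K in \<open>auto simp: w_def\<close>)
  qed (auto simp: w_def[abs_def])
  then have "(\<lambda>m. LBINT x. norm (w m x)) \<longlonglongrightarrow> 0" using L1[OF K] by simp
  then obtain r where r: "strict_mono r" "AE x in lborel. (\<lambda>m. w (r m) x) \<longlonglongrightarrow> 0"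
   using tendsto_L1_AE_subseq[of lborel w, OF iw] by blast
  have "(\<integral>\<^sup>+x. ennreal (indicator K x * (\<psi> n x - v0 x)^6) \<partial>lborel)
   \<le> (\<integral>\<^sup>+x. liminf (\<lambda>m. ennreal (indicator K x * (\<psi> (r m) x - \<psi> n x)^6)) \<partial>lborel)"
  proof (rule nn_integral_mono_AE)
   show "AE x in lborel. ennreal (indicator K x * (\<psi> n x - v0 x)^6) \<le> liminf (\<lambda>m. ennreal (indicator K x * (\<psi> (r m) x - \<psi> n x)^6))"
    using r(2)
   proof eventually_elim
    case (elim x)
    have "(\<lambda>m. indicator K x * (\<psi> (r m) x - \<psi> n x)^6) \<longlonglongrightarrow> indicator K x * (\<psi> n x - v0 x)^6"
    proof (cases "x \<in> K")
     case True
     then have "(\<lambda>m. (\<psi> (r m) x - v0 x) + (v0 x - \<psi> n x)) \<longlonglongrightarrow> 0 + (v0 x - \<psi> n x)"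
      using elim by (intro tendsto_intros) (simp add: w_def)
     then have "(\<lambda>m. (\<psi> (r m) x - \<psi> n x)^6) \<longlonglongrightarrow> (v0 x - \<psi> n x)^6"
      by (intro tendsto_power) simp
     moreover have "(v0 x - \<psi> n x)^6 = (\<psi> n x - v0 x)^6"
      using power_minus_even[of 6 "\<psi> n x - v0 x"] by simp
     ultimately show ?thesis using True by simp
    qed simp
    then have "(\<lambda>m. ennreal (indicator K x * (\<psi> (r m) x - \<psi> n x)^6)) \<longlonglongrightarrow> ennreal (indicator K x * (\<psi> n x - v0 x)^6)"
     by (rule tendsto_ennrealI)
    then have "liminf (\<lambda>m. ennreal (indicator K x * (\<psi> (r m) x - \<psi> n x)^6)) = ennreal (indicator K x * (\<psi> n x - v0 x)^6)"
     by (intro lim_imp_Liminf) auto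
    then show ?case by simp
   qed
  qed
  also have "\<dots> \<le> liminf (\<lambda>m. \<integral>\<^sup>+x. ennreal (indicator K x * (\<psi> (r m) x - \<psi> n x)^6) \<partial>lborel)"
   by (rule nn_integral_liminf) measurable
  also have "\<dots> \<le> liminf (\<lambda>m. ennreal (4096 * (2 * a (r m) + 2 * a n)^3))"
  proof (rule Liminf_mono, rule always_eventually, rule allI)
   fix m
   have "(\<integral>\<^sup>+x. ennreal (indicator K x * (\<psi> (r m) x - \<psi> n x)^6) \<partial>lborel) \<le> (\<integral>\<^sup>+x. ennreal ((\<psi> (r m) x - \<psi> n x)^6) \<partial>lborel)"
    by (intro nn_integral_mono ennreal_leI) (auto simp: indicator_def zero_le_even_power)
   also have "\<dots> = ennreal (LBINT x. (\<psi> (r m) x - \<psi> n x)^6)"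
    using sob by (intro nn_integral_eq_integral) (auto simp: zero_le_even_power)
   also have "\<dots> \<le> ennreal (4096 * (2 * a (r m) + 2 * a n)^3)" using sob by (intro ennreal_leI) auto
   finally show "(\<integral>\<^sup>+x. ennreal (indicator K x * (\<psi> (r m) x - \<psi> n x)^6) \<partial>lborel) \<le> ennreal (4096 * (2 * a (r m) + 2 * a n)^3)" .
  qed
  also have "\<dots> = ennreal (4096 * (2 * a n)^3)"
  proof (rule lim_imp_Liminf)
   have "(\<lambda>m. 4096 * (2 * a (r m) + 2 * a n)^3) \<longlonglongrightarrow> 4096 * (2 * 0 + 2 * a n)^3"
    using LIMSEQ_subseq_LIMSEQ[OF alim r(1)] by (intro tendsto_intros) (simp add: o_def)
   then show "(\<lambda>m. ennreal (4096 * (2 * a (r m) + 2 * a n)^3)) \<longlonglongrightarrow> ennreal (4096 * (2 * a n)^3)"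
    by (intro tendsto_ennrealI) simp
  qed simp
  finally show ?thesis .
 qed
 obtain C where C: "\<And>n::nat. compact (C n)" "\<And>n. C n \<subseteq> \<Omega>" "\<And>x. x \<in> \<Omega> \<Longrightarrow> eventually (\<lambda>n. x \<in> C n) sequentially"
  using compact_exhaustion[OF \<Omega>] by blast
 have Cm[measurable]: "C n \<in> sets borel" for n using C(1)[of n] by (simp add: compact_imp_closed)
 \<comment> \<open>A second use of Fatou, along the compact exhaustion; outside \<Omega> both
   functions vanish.\<close>
 have nn6: "(\<integral>\<^sup>+x. ennreal ((\<psi> n x - v0 x)^6) \<partial>lborel) \<le> ennreal (4096 * (2 * a n)^3)" for n
 proof -
  have "(\<integral>\<^sup>+x. ennreal ((\<psi> n x - v0 x)^6) \<partial>lborel) \<le> (\<integral>\<^sup>+x. liminf (\<lambda>j. ennreal (indicator (C j) x * (\<psi> n x - v0 x)^6)) \<partial>lborel)"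
  proof (rule nn_integral_mono)
   fix x show "ennreal ((\<psi> n x - v0 x)^6) \<le> liminf (\<lambda>j. ennreal (indicator (C j) x * (\<psi> n x - v0 x)^6))"
   proof (cases "x \<in> \<Omega>")
    case True
    have "eventually (\<lambda>j. ennreal ((\<psi> n x - v0 x)^6) \<le> ennreal (indicator (C j) x * (\<psi> n x - v0 x)^6)) sequentially"
     using C(3)[OF True] by eventually_elim simp
    then show ?thesis by (rule Liminf_bounded)
   qed (simp add: \<psi>z v0z)
  qed
  also have "\<dots> \<le> liminf (\<lambda>j. \<integral>\<^sup>+x. ennreal (indicator (C j) x * (\<psi> n x - v0 x)^6) \<partial>lborel)"
   by (rule nn_integral_liminf) measurable
  also have "\<dots> \<le> liminf (\<lambda>j::nat. ennreal (4096 * (2 * a n)^3))"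
   by (rule Liminf_mono, rule always_eventually) (use Fat C in blast)
  also have "\<dots> = ennreal (4096 * (2 * a n)^3)" by (simp add: Liminf_const)
  finally show ?thesis .
 qed
 have i6: "integrable lborel (\<lambda>x. (\<psi> n x - v0 x)^6)" for n
  by (rule integrableI_nonneg) (auto simp: zero_le_even_power intro: le_less_trans[OF nn6])
 have le6: "(LBINT x. (\<psi> n x - v0 x)^6) \<le> 4096 * (2 * a n)^3" for n
 proof -
  have "ennreal (LBINT x. (\<psi> n x - v0 x)^6) \<le> ennreal (4096 * (2 * a n)^3)"
   using nn6[of n] by (subst nn_integral_eq_integral[OF i6, symmetric]) (auto simp: zero_le_even_power)
  then show ?thesis using ann[of n] by (simp add: ennreal_le_iff)
 qed
 have lim6: "(\<lambda>n. LBINT x. (\<psi> n x - v0 x)^6) \<longlonglongrightarrow> 0"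
 proof (rule tendsto_sandwich[OF _ _ tendsto_const])
  have "(\<lambda>n. 4096 * (2 * a n)^3) \<longlonglongrightarrow> 4096 * (2 * 0)^3" by (intro tendsto_intros alim)
  then show "(\<lambda>n. 4096 * (2 * a n)^3) \<longlonglongrightarrow> 0" by simp
  show "\<forall>\<^sub>F n in sequentially. (LBINT x. (\<psi> n x - v0 x)^6) \<le> 4096 * (2 * a n)^3"
   using le6 by simp
  show "\<forall>\<^sub>F n in sequentially. 0 \<le> (LBINT x. (\<psi> n x - v0 x)^6)"
   by (intro always_eventually allI Bochner_Integration.integral_nonneg) (simp add: zero_le_even_power)
 qed
 have wg: "AE x in lborel. x \<in> \<Omega> \<longrightarrow> weak_grad \<Omega> v x = g0 x"
  using weak_grad_eq_AE[OF \<Omega> g(1)] g0e by eventually_elim auto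
 show ?thesis
  by (intro exI[of _ \<psi>] exI[of _ v0] exI[of _ g0] conjI allI impI \<psi> v0m v0z v0e g0m g0z wg g0i i6 lim6 alim[unfolded a_def[abs_def]])
qed

section \<open>Convergence in L^1 on balls\<close>

lemma bnorm_const_mult: "bnorm R (\<lambda>x. c *\<^sub>R f x) = \<bar>c\<bar> * bnorm R f"
 by (simp add: bnorm_def mult.left_commute)

text \<open>Comparing t with d shows t \<le> d + t^(k+1)/d^k for t \<ge> 0. Integrated over a ball
  this embeds L^(k+1) into L^1; the free parameter \<open>d\<close> makes it strong enough for
  limits.\<close>

lemma integrable_power_loc_integrable:
 fixes f :: "R3 \<Rightarrow> 'b::{banach, second_countable_topology}"
 assumes m[measurable]: "f \<in> borel_measurable borel" and i: "integrable lborel (\<lambda>x. norm (f x) ^ Suc k)"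
 shows "loc_integrable f"
  and "d > 0 \<Longrightarrow> bnorm R f \<le> d * measure lborel (cball 0 R :: R3 set) + (1 / d ^ k) * (LBINT x. norm (f x) ^ Suc k)"
proof -
 have le: "t \<le> d + (1 / d ^ k) * t ^ Suc k" if "d > 0" "t \<ge> 0" for d t :: real
 proof (cases "t \<le> d")
  case True then show ?thesis using that by (simp add: add_increasing2)
 next
  case False
  then have "d ^ k \<le> t ^ k" using that by (intro power_mono) auto
  then have "t * d ^ k \<le> t ^ Suc k" using that by (simp add: mult_left_mono)
  then have "t \<le> (1 / d ^ k) * t ^ Suc k" using that by (simp add: pos_le_divide_eq)
  then show ?thesis using that by linarith
 qed
 have ci: "integrable lborel (\<lambda>x::R3. c * indicator (cball 0 R) x :: real)" for c R
  by (intro integrable_mult_right integrable_real_indicator) (auto simp: emeasure_cball_less_top)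
 have ib: "integrable lborel (\<lambda>x. d * indicator (cball 0 R) x + (1 / d ^ k) * norm (f x) ^ Suc k)" for d R
  by (intro Bochner_Integration.integrable_add ci integrable_mult_right i)
 show lf: "loc_integrable f"
  unfolding loc_integrable_def
 proof (intro conjI allI m)
  fix R
  show "integrable lborel (\<lambda>x. indicator (cball 0 R) x *\<^sub>R f x)"
  proof (rule Bochner_Integration.integrable_bound[OF ib[of 1 R]])
   show "AE x in lborel. norm (indicator (cball 0 R) x *\<^sub>R f x) \<le> norm (1 * indicator (cball 0 R) x + (1 / 1 ^ k) * norm (f x) ^ Suc k)"
    using le[of 1 "norm (f x)" for x] by (intro AE_I2) (auto simp: indicator_def)
  qed measurable
 qed
 assume d: "d > 0"
 have "bnorm R f \<le> (LBINT x. d * indicator (cball 0 R) x + (1 / d ^ k) * norm (f x) ^ Suc k)"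
  unfolding bnorm_def
 proof (rule integral_mono[OF loc_integrable_norm_cball[OF lf] ib])
  fix x show "indicator (cball 0 R) x *\<^sub>R norm (f x) \<le> d * indicator (cball 0 R) x + (1 / d ^ k) * norm (f x) ^ Suc k"
   using le[OF d, of "norm (f x)"] d by (cases "x \<in> cball 0 R") auto
 qed
 also have "\<dots> = d * measure lborel (cball 0 R :: R3 set) + (1 / d ^ k) * (LBINT x. norm (f x) ^ Suc k)"
  using ci[of d R] i by (subst Bochner_Integration.integral_add) auto
 finally show "bnorm R f \<le> d * measure lborel (cball 0 R :: R3 set) + (1 / d ^ k) * (LBINT x. norm (f x) ^ Suc k)" .
qed

lemma bnorm_tendsto_power:
 fixes f :: "nat \<Rightarrow> R3 \<Rightarrow> 'b::{banach, second_countable_topology}"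
 assumes m: "\<And>n. f n \<in> borel_measurable borel" and i: "\<And>n. integrable lborel (\<lambda>x. norm (f n x) ^ Suc k)"
  and lim: "(\<lambda>n. LBINT x. norm (f n x) ^ Suc k) \<longlonglongrightarrow> 0"
 shows "(\<lambda>n. bnorm R (f n)) \<longlonglongrightarrow> 0"
proof (rule LIMSEQ_I)
 fix r :: real assume r: "r > 0"
 \<comment> \<open>The summand 1 makes the divisor positive even for an empty ball. The choice of
   \<open>d\<close> then lets the volume term use up half of \<open>r\<close>.\<close>
 define V where "V = measure lborel (cball 0 R :: R3 set) + 1"
 have V: "V > 0" "measure lborel (cball 0 R :: R3 set) \<le> V" unfolding V_def by (simp_all add: add_nonneg_pos)
 define d where "d = r / (2 * V)"
 have d: "d > 0" using r V by (simp add: d_def)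
 obtain N where N: "\<And>n. n \<ge> N \<Longrightarrow> norm ((LBINT x. norm (f n x) ^ Suc k) - 0) < d ^ k * (r / 2)"
  using LIMSEQ_D[OF lim, of "d ^ k * (r / 2)"] d r by auto
 have "norm (bnorm R (f n) - 0) < r" if "n \<ge> N" for n
 proof -
  have "bnorm R (f n) \<le> d * measure lborel (cball 0 R :: R3 set) + (1 / d ^ k) * (LBINT x. norm (f n x) ^ Suc k)"
   by (rule integrable_power_loc_integrable(2)[OF m i d])
  moreover have "d * measure lborel (cball 0 R :: R3 set) \<le> r / 2"
   using mult_left_mono[OF V(2), of d] d V(1) by (simp add: d_def)
  moreover have "(1 / d ^ k) * (LBINT x. norm (f n x) ^ Suc k) < r / 2"
  proof -
   have "(LBINT x. norm (f n x) ^ Suc k) < d ^ k * (r / 2)" using N[OF that] by simp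
   then show ?thesis using d by (simp add: pos_divide_less_eq mult.commute)
  qed
  ultimately have "bnorm R (f n) < r" by linarith
  then show ?thesis using bnorm_nonneg[of R "f n"] by simp
 qed
 then show "\<exists>no. \<forall>n\<ge>no. norm (bnorm R (f n) - 0) < r" by blast
qed

text \<open>The weight is only integrable, so it is split at height N: below N the product is
  controlled by N times the seminorm of \<open>h n\<close>, above N by \<open>C\<close> times the
  tail \<open>T N\<close>. First N is chosen, then n.\<close>

lemma bnorm_bounded_mult_tendsto:
 fixes h :: "nat \<Rightarrow> R3 \<Rightarrow> real" and w :: "R3 \<Rightarrow> real"
 assumes hm: "\<And>n. h n \<in> borel_measurable borel" and hb: "\<And>n x. \<bar>h n x\<bar> \<le> C"
  and lim: "(\<lambda>n. bnorm R (h n)) \<longlonglongrightarrow> 0" and w: "loc_integrable w"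
 shows "(\<lambda>n. bnorm R (\<lambda>x. h n x * w x)) \<longlonglongrightarrow> 0"
proof -
 have [measurable]: "w \<in> borel_measurable borel" "\<And>n. h n \<in> borel_measurable borel"
  using w hm by (auto simp: loc_integrable_measurable)
 have C0: "C \<ge> 0" using hb[of 0 0] by linarith
 have lh: "loc_integrable (h n)" for n by (rule loc_integrable_bounded) (use hm hb in auto)
 have lhw: "loc_integrable (\<lambda>x. h n x * w x)" for n
  using loc_integrable_bounded_mult[OF w hm hb, of n] by simp
 define T where "T N = (LBINT x. indicator (cball 0 R) x * (if \<bar>w x\<bar> > real N then \<bar>w x\<bar> else 0))" for N :: nat
 have iw: "integrable lborel (\<lambda>x. indicator (cball 0 R) x *\<^sub>R norm (w x))" by (rule loc_integrable_norm_cball[OF w])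
 have iT: "integrable lborel (\<lambda>x. indicator (cball 0 R) x * (if \<bar>w x\<bar> > real N then \<bar>w x\<bar> else 0))" for N
  by (rule Bochner_Integration.integrable_bound[OF iw]) (auto simp: indicator_def)
 have "T \<longlonglongrightarrow> (\<integral>x. 0 \<partial>(lborel :: R3 measure))"
  unfolding T_def
 proof (rule integral_dominated_convergence[OF _ _ iw])
  show "AE x in lborel. (\<lambda>N. indicator (cball 0 R) x * (if \<bar>w x\<bar> > real N then \<bar>w x\<bar> else 0)) \<longlonglongrightarrow> 0"
  proof (rule AE_I2)
   fix x
   obtain N0 where N0: "\<bar>w x\<bar> \<le> real N0" using real_arch_simple by blast
   have "eventually (\<lambda>N. indicator (cball 0 R) x * (if \<bar>w x\<bar> > real N then \<bar>w x\<bar> else 0) = 0) sequentially"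
    unfolding eventually_sequentially using N0 by (intro exI[of _ N0]) auto
   then show "(\<lambda>N. indicator (cball 0 R) x * (if \<bar>w x\<bar> > real N then \<bar>w x\<bar> else 0)) \<longlonglongrightarrow> 0"
    by (rule tendsto_eventually)
  qed
  show "AE x in lborel. norm (indicator (cball 0 R) x * (if \<bar>w x\<bar> > real N then \<bar>w x\<bar> else 0)) \<le> indicator (cball 0 R) x *\<^sub>R norm (w x)" for N
   by (intro AE_I2) (auto simp: indicator_def)
 qed measurable
 then have T0: "T \<longlonglongrightarrow> 0" by simp
 have le: "bnorm R (\<lambda>x. h n x * w x) \<le> real N * bnorm R (h n) + C * T N" for n N
 proof -
  have "bnorm R (\<lambda>x. h n x * w x) \<le> (LBINT x. real N * (indicator (cball 0 R) x *\<^sub>R norm (h n x)) + C * (indicator (cball 0 R) x * (if \<bar>w x\<bar> > real N then \<bar>w x\<bar> else 0)))"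
   unfolding bnorm_def
  proof (rule integral_mono[OF loc_integrable_norm_cball[OF lhw]])
   show "integrable lborel (\<lambda>x. real N * (indicator (cball 0 R) x *\<^sub>R norm (h n x)) + C * (indicator (cball 0 R) x * (if \<bar>w x\<bar> > real N then \<bar>w x\<bar> else 0)))"
    by (intro Bochner_Integration.integrable_add integrable_mult_right loc_integrable_norm_cball lh iT)
   fix x
   have "\<bar>h n x\<bar> * \<bar>w x\<bar> \<le> real N * \<bar>h n x\<bar> + C * (if \<bar>w x\<bar> > real N then \<bar>w x\<bar> else 0)"
   proof (cases "\<bar>w x\<bar> > real N")
    case True
    then show ?thesis using mult_right_mono[OF hb[of n x], of "\<bar>w x\<bar>"] by (simp add: add_increasing)
   next
    case False
    then show ?thesis using mult_left_mono[of "\<bar>w x\<bar>" "real N" "\<bar>h n x\<bar>"] by (simp add: mult.commute)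
   qed
   then show "indicator (cball 0 R) x *\<^sub>R norm (h n x * w x) \<le> real N * (indicator (cball 0 R) x *\<^sub>R norm (h n x)) + C * (indicator (cball 0 R) x * (if \<bar>w x\<bar> > real N then \<bar>w x\<bar> else 0))"
    by (cases "x \<in> cball 0 R") (auto simp: abs_mult)
  qed
  also have "\<dots> = real N * bnorm R (h n) + C * T N"
   unfolding bnorm_def T_def
   by (subst Bochner_Integration.integral_add) (use loc_integrable_norm_cball[OF lh] iT in auto)
  finally show ?thesis .
 qed
 show ?thesis
 proof (rule LIMSEQ_I)
  fix r :: real assume r: "r > 0"
  have "(\<lambda>N. C * T N) \<longlonglongrightarrow> C * 0" by (intro tendsto_intros T0)
  then obtain N where N: "\<bar>C * T N\<bar> < r / 2" using LIMSEQ_D[of "\<lambda>N. C * T N" 0 "r / 2"] r by auto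
  have "(\<lambda>n. real N * bnorm R (h n)) \<longlonglongrightarrow> real N * 0" by (intro tendsto_intros lim)
  then obtain n0 where n0: "\<And>n. n \<ge> n0 \<Longrightarrow> \<bar>real N * bnorm R (h n)\<bar> < r / 2"
   using LIMSEQ_D[of "\<lambda>n. real N * bnorm R (h n)" 0 "r / 2"] r by auto
  have "norm (bnorm R (\<lambda>x. h n x * w x) - 0) < r" if "n \<ge> n0" for n
   using le[of n N] n0[OF that] N bnorm_nonneg[of R "\<lambda>x. h n x * w x"] by (simp add: abs_if split: if_splits)
  then show "\<exists>no. \<forall>n\<ge>no. norm (bnorm R (\<lambda>x. h n x * w x) - 0) < r" by blast
 qed
qed

lemma integral_tendsto_bnorm:
 fixes w :: "R3 \<Rightarrow> real" and f :: "nat \<Rightarrow> R3 \<Rightarrow> real"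
 assumes wm: "w \<in> borel_measurable borel" and wb: "\<And>x. \<bar>w x\<bar> \<le> C" and wz: "\<And>x. x \<notin> cball 0 R \<Longrightarrow> w x = 0"
  and f: "\<And>n. loc_integrable (f n)" "loc_integrable g"
  and lim: "(\<lambda>n. bnorm R (\<lambda>x. f n x - g x)) \<longlonglongrightarrow> 0"
 shows "(\<lambda>n. LBINT x. w x * f n x) \<longlonglongrightarrow> (LBINT x. w x * g x)"
  and "integrable lborel (\<lambda>x. w x * g x)"
proof -
 have i: "integrable lborel (\<lambda>x. w x * k x)" if k: "loc_integrable k" for k
 proof -
  have "integrable lborel (\<lambda>x. indicator (cball 0 R) x *\<^sub>R (w x *\<^sub>R k x))"
   by (rule loc_integrable_cball[OF loc_integrable_bounded_mult[OF k wm wb]])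
  moreover have "(\<lambda>x. indicator (cball 0 R) x *\<^sub>R (w x *\<^sub>R k x)) = (\<lambda>x. w x * k x)"
  proof
   fix x show "indicator (cball 0 R) x *\<^sub>R (w x *\<^sub>R k x) = w x * k x"
    using wz[of x] by (cases "x \<in> cball 0 R") auto
  qed
  ultimately show ?thesis by simp
 qed
 show "integrable lborel (\<lambda>x. w x * g x)" by (rule i[OF f(2)])
 have C0: "C \<ge> 0" using wb[of 0] by linarith
 have le: "norm ((LBINT x. w x * f n x) - (LBINT x. w x * g x)) \<le> C * bnorm R (\<lambda>x. f n x - g x)" for n
 proof -
  have ld: "loc_integrable (\<lambda>x. f n x - g x)" by (intro loc_integrable_diff f)
  have "(LBINT x. w x * f n x) - (LBINT x. w x * g x) = (LBINT x. w x * (f n x - g x))"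
   using i[OF f(1)[of n]] i[OF f(2)] by (simp add: right_diff_distrib)
  also have "norm \<dots> \<le> (LBINT x. norm (w x * (f n x - g x)))" by (rule integral_norm_bound)
  also have "\<dots> \<le> (LBINT x. C * (indicator (cball 0 R) x *\<^sub>R norm (f n x - g x)))"
  proof (rule integral_mono)
   show "integrable lborel (\<lambda>x. norm (w x * (f n x - g x)))" by (intro integrable_norm i ld)
   show "integrable lborel (\<lambda>x. C * (indicator (cball 0 R) x *\<^sub>R norm (f n x - g x)))"
    by (intro integrable_mult_right loc_integrable_norm_cball ld)
   fix x show "norm (w x * (f n x - g x)) \<le> C * (indicator (cball 0 R) x *\<^sub>R norm (f n x - g x))"
    using wb[of x] wz[of x] by (cases "x \<in> cball 0 R") (auto simp: abs_mult intro!: mult_right_mono)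
  qed
  also have "\<dots> = C * bnorm R (\<lambda>x. f n x - g x)" by (simp add: bnorm_def)
  finally show ?thesis .
 qed
 have lim0: "(\<lambda>n. C * bnorm R (\<lambda>x. f n x - g x)) \<longlonglongrightarrow> 0"
  using tendsto_mult[OF tendsto_const[of C] lim] by simp
 have "(\<lambda>n. (LBINT x. w x * f n x) - (LBINT x. w x * g x)) \<longlonglongrightarrow> 0"
  by (rule Lim_null_comparison[OF _ lim0]) (rule always_eventually, rule allI, rule le)
 then show "(\<lambda>n. LBINT x. w x * f n x) \<longlonglongrightarrow> (LBINT x. w x * g x)"
  by (simp add: LIM_zero_iff)
qed

section \<open>Difference quotients in L^1 on balls\<close>

lemma Cc_inf_loc_integrable:
 assumes "f \<in> Cc_inf \<Omega>"
 shows "loc_integrable f" "loc_integrable (grad f)"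
proof -
 obtain R where R: "\<And>x. x \<notin> cball 0 R \<Longrightarrow> f x = 0" using Cc_inf_bounded_support[OF assms] by metis
 have c: "continuous_on UNIV (grad f)" "continuous_on UNIV f"
  using assms by (auto simp: Cc_inf_iff intro: smooth_grad_continuous smooth_continuous)
 have "grad f x = 0" if "x \<notin> cball 0 R" for x
  by (rule grad_zero_outside[OF _ R that]) auto
 then show "loc_integrable f" "loc_integrable (grad f)"
  using c R by (auto intro!: integrable_loc_integrable integrable_continuous_cball[where R = R])
qed

lemma grad_line_derivative:
 assumes "\<And>x. f differentiable (at x)"
 shows "((\<lambda>t. f (y + t *\<^sub>R h)) has_real_derivative (grad f (y + t *\<^sub>R h) \<bullet> h)) (at t)"
proof -
 have "((\<lambda>s. f (y + s *\<^sub>R h)) has_derivative (\<lambda>s. grad f (y + t *\<^sub>R h) \<bullet> (s *\<^sub>R h))) (at t)"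
  by (rule has_derivative_compose[where f = "\<lambda>s. y + s *\<^sub>R h" and g = f, OF _ has_derivative_grad[OF assms]])
   (auto intro!: derivative_eq_intros)
 moreover have "(\<lambda>s. grad f (y + t *\<^sub>R h) \<bullet> (s *\<^sub>R h)) = (*) (grad f (y + t *\<^sub>R h) \<bullet> h)"
  by (rule ext) simp
 ultimately show ?thesis by (simp add: has_field_derivative_def)
qed

lemma loc_integrable_inner_const:
 fixes g :: "R3 \<Rightarrow> R3"
 assumes "loc_integrable g" shows "loc_integrable (\<lambda>y. g y \<bullet> h)" "bnorm R (\<lambda>y. g y \<bullet> h) \<le> norm h * bnorm R g"
proof -
 have l: "loc_integrable (\<lambda>y. norm h *\<^sub>R g y)"
  using assms integrable_scaleR_right[of "norm h" lborel] unfolding loc_integrable_def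
  by (auto simp: scaleR_left_commute[of _ "norm h"] simp del: scaleR_scaleR)
 have [measurable]: "g \<in> borel_measurable borel" using assms by (rule loc_integrable_measurable)
 have le: "norm (g y \<bullet> h) \<le> norm (norm h *\<^sub>R g y)" for y
  using Cauchy_Schwarz_ineq2[of "g y" h] by (simp add: mult.commute)
 show li: "loc_integrable (\<lambda>y. g y \<bullet> h)" by (rule loc_integrable_bound[OF l _ le]) measurable
 have "bnorm R (\<lambda>y. g y \<bullet> h) \<le> bnorm R (\<lambda>y. norm h *\<^sub>R g y)" by (rule bnorm_mono[OF li l le])
 then show "bnorm R (\<lambda>y. g y \<bullet> h) \<le> norm h * bnorm R g" by (simp add: bnorm_const_mult)
qed

text \<open>The first-order remainder is the integral over t in [0, 1] of (grad f(y + t h) - grad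
  f(y)) \<bullet> h. Tonelli leaves for each t a translation error of the gradient, bounded by
  \<open>s\<close>.\<close>

lemma difference_quotient_smooth:
 assumes f: "f \<in> Cc_inf \<Omega>" and s: "\<And>t. 0 \<le> t \<Longrightarrow> t \<le> 1 \<Longrightarrow> bnorm R (\<lambda>y. grad f (y + t *\<^sub>R h) - grad f y) \<le> s"
 shows "bnorm R (\<lambda>y. f (y + h) - f y - grad f y \<bullet> h) \<le> norm h * s"
proof -
 have df: "\<And>x. f differentiable (at x)" using f by (auto simp: Cc_inf_iff intro: smooth_differentiable)
 have cg: "continuous_on UNIV (grad f)" using f by (auto simp: Cc_inf_iff intro: smooth_grad_continuous)
 have [measurable]: "f \<in> borel_measurable borel" "grad f \<in> borel_measurable borel"
  using Cc_inf_integrable_sq[OF f] by auto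
 note lf = Cc_inf_loc_integrable[OF f]
 have s0: "s \<ge> 0" using order_trans[OF bnorm_nonneg s[of 0]] by simp
 have li: "loc_integrable (\<lambda>y. f (y + h) - f y - grad f y \<bullet> h)"
  by (intro loc_integrable_diff loc_integrable_translate lf loc_integrable_inner_const)
 have lg: "loc_integrable (\<lambda>y. grad f (y + t *\<^sub>R h) - grad f y)" for t
  by (intro loc_integrable_diff loc_integrable_translate lf)
 have pt: "ennreal (norm (f (y + h) - f y - grad f y \<bullet> h)) \<le> (\<integral>\<^sup>+t. indicator {0..1} t * ennreal (norm h * norm (grad f (y + t *\<^sub>R h) - grad f y)) \<partial>lborel)" for y
 proof -
  let ?F = "\<lambda>t. f (y + t *\<^sub>R h) - t * (grad f y \<bullet> h)" and ?f = "\<lambda>t. (grad f (y + t *\<^sub>R h) - grad f y) \<bullet> h"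
  have "(LBINT t. ?f t * indicator {0..1} t) = ?F 1 - ?F 0"
  proof (rule integral_FTC_Icc_real)
   fix t :: real
   show "DERIV ?F t :> ?f t"
    using DERIV_diff[OF grad_line_derivative[OF df, of y h t] DERIV_cmult_Id[of "grad f y \<bullet> h"]]
    by (simp add: inner_diff_left mult.commute)
   have "continuous_on UNIV ?f"
    by (intro continuous_intros continuous_on_compose2[OF cg]) auto
   then show "isCont ?f t" by (simp add: continuous_on_eq_continuous_at)
  qed simp
  then have eq: "f (y + h) - f y - grad f y \<bullet> h = (LBINT t. ?f t * indicator {0..1} t)" by simp
  have "ennreal (norm (f (y + h) - f y - grad f y \<bullet> h)) \<le> (\<integral>\<^sup>+t. ennreal (norm (?f t * indicator {0..1} t)) \<partial>lborel)"
   unfolding eq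
  proof (cases "integrable lborel (\<lambda>t. ?f t * indicator {0..1} t)")
   case True
   then show "ennreal (norm (LBINT t. ?f t * indicator {0..1} t)) \<le> (\<integral>\<^sup>+t. ennreal (norm (?f t * indicator {0..1} t)) \<partial>lborel)"
    by (rule integral_norm_bound_ennreal)
  next
   case False
   then show "ennreal (norm (LBINT t. ?f t * indicator {0..1} t)) \<le> (\<integral>\<^sup>+t. ennreal (norm (?f t * indicator {0..1} t)) \<partial>lborel)"
    by (simp add: not_integrable_integral_eq)
  qed
  also have "\<dots> \<le> (\<integral>\<^sup>+t. indicator {0..1} t * ennreal (norm h * norm (grad f (y + t *\<^sub>R h) - grad f y)) \<partial>lborel)"
  proof (rule nn_integral_mono)
   fix t
   have "\<bar>(grad f (y + t *\<^sub>R h) - grad f y) \<bullet> h\<bar> \<le> norm h * norm (grad f (y + t *\<^sub>R h) - grad f y)"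
    using Cauchy_Schwarz_ineq2[of "grad f (y + t *\<^sub>R h) - grad f y" h] by (simp add: mult.commute)
   then show "ennreal (norm (?f t * indicator {0..1} t)) \<le> indicator {0..1} t * ennreal (norm h * norm (grad f (y + t *\<^sub>R h) - grad f y))"
    by (auto simp: indicator_def intro: ennreal_leI)
  qed
  finally show ?thesis .
 qed
 have "ennreal (bnorm R (\<lambda>y. f (y + h) - f y - grad f y \<bullet> h)) = (\<integral>\<^sup>+y. ennreal (indicator (cball 0 R) y *\<^sub>R norm (f (y + h) - f y - grad f y \<bullet> h)) \<partial>lborel)"
  unfolding bnorm_def by (rule nn_integral_eq_integral[symmetric, OF loc_integrable_norm_cball[OF li]]) auto
 also have "\<dots> \<le> (\<integral>\<^sup>+y. \<integral>\<^sup>+t. indicator (cball 0 R) y * (indicator {0..1} t * ennreal (norm h * norm (grad f (y + t *\<^sub>R h) - grad f y))) \<partial>lborel \<partial>lborel)"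
  using pt by (intro nn_integral_mono) (auto simp: indicator_def)
 also have "\<dots> = (\<integral>\<^sup>+t. \<integral>\<^sup>+y. indicator (cball 0 R) y * (indicator {0..1} t * ennreal (norm h * norm (grad f (y + t *\<^sub>R h) - grad f y))) \<partial>lborel \<partial>lborel)"
  by (rule nn_integral_lborel_pair(2)) measurable
 also have "\<dots> \<le> (\<integral>\<^sup>+t. indicator {0..1::real} t * ennreal (norm h * s) \<partial>lborel)"
 proof (rule nn_integral_mono)
  fix t :: real
  show "(\<integral>\<^sup>+y. indicator (cball 0 R) y * (indicator {0..1} t * ennreal (norm h * norm (grad f (y + t *\<^sub>R h) - grad f y))) \<partial>lborel) \<le> indicator {0..1} t * ennreal (norm h * s)"
  proof (cases "t \<in> {0..1}")
   case True
   have "(\<integral>\<^sup>+y. indicator (cball 0 R) y * ennreal (norm h * norm (grad f (y + t *\<^sub>R h) - grad f y)) \<partial>lborel)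
     = (\<integral>\<^sup>+y. ennreal (norm h * (indicator (cball 0 R) y *\<^sub>R norm (grad f (y + t *\<^sub>R h) - grad f y))) \<partial>lborel)"
    by (intro nn_integral_cong) (auto simp: indicator_def)
   also have "\<dots> = ennreal (LBINT y. norm h * (indicator (cball 0 R) y *\<^sub>R norm (grad f (y + t *\<^sub>R h) - grad f y)))"
    by (intro nn_integral_eq_integral integrable_mult_right loc_integrable_norm_cball lg) auto
   also have "\<dots> = ennreal (norm h * bnorm R (\<lambda>y. grad f (y + t *\<^sub>R h) - grad f y))" by (simp add: bnorm_def)
   also have "\<dots> \<le> ennreal (norm h * s)" using True s by (intro ennreal_leI mult_left_mono) auto
   finally show ?thesis using True by simp
  qed simp
 qed
 also have "\<dots> = ennreal (norm h * s)" by (simp add: nn_integral_multc)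
 finally show ?thesis using s0 by (simp add: ennreal_le_iff)
qed

text \<open>First-order differentiability in L^1 on balls for limits of test functions. The
  remainder of \<open>\<psi> n\<close> is governed by the translation modulus of its gradient, which
  is that of \<open>g\<close> up to errors vanishing with n; so one modulus \<open>d\<close> serves
  all n in the limit.\<close>

lemma difference_quotient:
 assumes \<psi>: "\<And>n. \<psi> n \<in> Cc_inf \<Omega>" and v: "loc_integrable v" and g: "loc_integrable g"
  and l1: "\<And>R. (\<lambda>n. bnorm R (\<lambda>x. \<psi> n x - v x)) \<longlonglongrightarrow> 0" and l2: "\<And>R. (\<lambda>n. bnorm R (\<lambda>x. grad (\<psi> n) x - g x)) \<longlonglongrightarrow> 0"
  and e: "e > 0"
 shows "\<exists>d>0. d \<le> 1 \<and> (\<forall>h. norm h < d \<longrightarrow> bnorm R (\<lambda>y. v (y + h) - v y - g y \<bullet> h) \<le> e * norm h)"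
proof -
 obtain d where d: "d > 0" "d \<le> 1" "\<And>h. norm h < d \<Longrightarrow> bnorm R (\<lambda>x. g (x + h) - g x) < e"
  using bnorm_translation[OF g e] by blast
 note lf = Cc_inf_loc_integrable[OF \<psi>]
 have "bnorm R (\<lambda>y. v (y + h) - v y - g y \<bullet> h) \<le> e * norm h" if h: "norm h < d" for h
 proof -
  define A where "A n R = bnorm R (\<lambda>x. \<psi> n x - v x)" for n R
  define B where "B n R = bnorm R (\<lambda>x. grad (\<psi> n) x - g x)" for n R
  have h1: "norm h \<le> 1" using h d by simp
  have lB: "loc_integrable (\<lambda>x. grad (\<psi> n) x - g x)" for n by (intro loc_integrable_diff lf g)
  have lA: "loc_integrable (\<lambda>x. \<psi> n x - v x)" for n by (intro loc_integrable_diff lf v)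
  have sm: "bnorm R (\<lambda>y. grad (\<psi> n) (y + t *\<^sub>R h) - grad (\<psi> n) y) \<le> e + (B n (R + 1) + B n R)" if t: "0 \<le> t" "t \<le> 1" for t n
  proof -
   have th: "norm (t *\<^sub>R h) \<le> norm h" using t by (simp add: mult_left_le_one_le)
   then have th1: "norm (t *\<^sub>R h) < d" "norm (t *\<^sub>R h) \<le> 1" using h h1 by linarith+
   have l1: "loc_integrable (\<lambda>y. g (y + t *\<^sub>R h) - g y)" by (intro loc_integrable_diff loc_integrable_translate g)
   have l2: "loc_integrable (\<lambda>y. (grad (\<psi> n) (y + t *\<^sub>R h) - g (y + t *\<^sub>R h)))"
    using loc_integrable_translate[OF lB] .
   have l3: "loc_integrable (\<lambda>y. (grad (\<psi> n) (y + t *\<^sub>R h) - g (y + t *\<^sub>R h)) - (grad (\<psi> n) y - g y))"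
    by (rule loc_integrable_diff[OF l2 lB])
   have "bnorm R (\<lambda>y. grad (\<psi> n) (y + t *\<^sub>R h) - grad (\<psi> n) y) \<le>
     bnorm R (\<lambda>y. g (y + t *\<^sub>R h) - g y) + bnorm R (\<lambda>y. (grad (\<psi> n) (y + t *\<^sub>R h) - g (y + t *\<^sub>R h)) - (grad (\<psi> n) y - g y))"
   proof (rule bnorm_triangle[OF _ l1 l3])
    show "loc_integrable (\<lambda>y. grad (\<psi> n) (y + t *\<^sub>R h) - grad (\<psi> n) y)" by (intro loc_integrable_diff loc_integrable_translate lf)
    fix x
    have "grad (\<psi> n) (x + t *\<^sub>R h) - grad (\<psi> n) x = (g (x + t *\<^sub>R h) - g x) + ((grad (\<psi> n) (x + t *\<^sub>R h) - g (x + t *\<^sub>R h)) - (grad (\<psi> n) x - g x))" by simp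
    then show "norm (grad (\<psi> n) (x + t *\<^sub>R h) - grad (\<psi> n) x) \<le> norm (g (x + t *\<^sub>R h) - g x) + norm ((grad (\<psi> n) (x + t *\<^sub>R h) - g (x + t *\<^sub>R h)) - (grad (\<psi> n) x - g x))"
     using norm_triangle_ineq[of "g (x + t *\<^sub>R h) - g x" "(grad (\<psi> n) (x + t *\<^sub>R h) - g (x + t *\<^sub>R h)) - (grad (\<psi> n) x - g x)"] by simp
   qed
   also have "bnorm R (\<lambda>y. g (y + t *\<^sub>R h) - g y) \<le> e" using d(3)[OF th1(1)] by simp
   also have "bnorm R (\<lambda>y. (grad (\<psi> n) (y + t *\<^sub>R h) - g (y + t *\<^sub>R h)) - (grad (\<psi> n) y - g y)) \<le>
     bnorm R (\<lambda>y. grad (\<psi> n) (y + t *\<^sub>R h) - g (y + t *\<^sub>R h)) + bnorm R (\<lambda>y. grad (\<psi> n) y - g y)"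
    by (rule bnorm_triangle[OF l3 l2 lB norm_triangle_ineq4])
   also have "bnorm R (\<lambda>y. grad (\<psi> n) (y + t *\<^sub>R h) - g (y + t *\<^sub>R h)) \<le> B n (R + 1)"
    unfolding B_def by (rule bnorm_translate[OF lB th1(2)])
   finally show ?thesis by (simp add: B_def)
  qed
  have bound: "bnorm R (\<lambda>y. v (y + h) - v y - g y \<bullet> h) \<le> norm h * (e + (B n (R + 1) + B n R)) + ((A n (R + 1) + A n R) + norm h * B n R)" for n
  proof -
   have l1: "loc_integrable (\<lambda>y. \<psi> n (y + h) - \<psi> n y - grad (\<psi> n) y \<bullet> h)"
    by (intro loc_integrable_diff loc_integrable_translate lf loc_integrable_inner_const)
   have l2: "loc_integrable (\<lambda>y. (\<psi> n (y + h) - v (y + h)) - (\<psi> n y - v y))"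
    by (intro loc_integrable_diff loc_integrable_translate lf v)
   have l3: "loc_integrable (\<lambda>y. (grad (\<psi> n) y - g y) \<bullet> h)"
    by (intro loc_integrable_inner_const lB)
   have l4: "loc_integrable (\<lambda>y. ((\<psi> n (y + h) - v (y + h)) - (\<psi> n y - v y)) - (grad (\<psi> n) y - g y) \<bullet> h)"
    by (rule loc_integrable_diff[OF l2 l3])
   have "bnorm R (\<lambda>y. v (y + h) - v y - g y \<bullet> h) \<le> bnorm R (\<lambda>y. \<psi> n (y + h) - \<psi> n y - grad (\<psi> n) y \<bullet> h)
     + bnorm R (\<lambda>y. ((\<psi> n (y + h) - v (y + h)) - (\<psi> n y - v y)) - (grad (\<psi> n) y - g y) \<bullet> h)"
   proof (rule bnorm_triangle[OF _ l1 l4])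
    show "loc_integrable (\<lambda>y. v (y + h) - v y - g y \<bullet> h)"
     by (intro loc_integrable_diff loc_integrable_translate v loc_integrable_inner_const g)
    fix x
    have "v (x + h) - v x - g x \<bullet> h = (\<psi> n (x + h) - \<psi> n x - grad (\<psi> n) x \<bullet> h) - (((\<psi> n (x + h) - v (x + h)) - (\<psi> n x - v x)) - (grad (\<psi> n) x - g x) \<bullet> h)"
     by (simp add: inner_diff_left)
    then show "norm (v (x + h) - v x - g x \<bullet> h) \<le> norm (\<psi> n (x + h) - \<psi> n x - grad (\<psi> n) x \<bullet> h) + norm (((\<psi> n (x + h) - v (x + h)) - (\<psi> n x - v x)) - (grad (\<psi> n) x - g x) \<bullet> h)"
     by (simp only: norm_triangle_ineq4)
   qed
   also have "bnorm R (\<lambda>y. \<psi> n (y + h) - \<psi> n y - grad (\<psi> n) y \<bullet> h) \<le> norm h * (e + (B n (R + 1) + B n R))"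
    by (rule difference_quotient_smooth[OF \<psi> sm])
   also have "bnorm R (\<lambda>y. ((\<psi> n (y + h) - v (y + h)) - (\<psi> n y - v y)) - (grad (\<psi> n) y - g y) \<bullet> h)
     \<le> bnorm R (\<lambda>y. (\<psi> n (y + h) - v (y + h)) - (\<psi> n y - v y)) + bnorm R (\<lambda>y. (grad (\<psi> n) y - g y) \<bullet> h)"
    by (rule bnorm_triangle[OF l4 l2 l3 norm_triangle_ineq4])
   also have "bnorm R (\<lambda>y. (\<psi> n (y + h) - v (y + h)) - (\<psi> n y - v y)) \<le> bnorm R (\<lambda>y. \<psi> n (y + h) - v (y + h)) + bnorm R (\<lambda>y. \<psi> n y - v y)"
    by (rule bnorm_triangle[OF l2 loc_integrable_translate[OF lA] lA norm_triangle_ineq4])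
   also have "bnorm R (\<lambda>y. \<psi> n (y + h) - v (y + h)) \<le> A n (R + 1)"
    unfolding A_def by (rule bnorm_translate[OF lA h1])
   also have "bnorm R (\<lambda>y. (grad (\<psi> n) y - g y) \<bullet> h) \<le> norm h * B n R"
    unfolding B_def by (rule loc_integrable_inner_const(2)[OF lB])
   finally show ?thesis by (simp add: A_def)
  qed
  \<comment> \<open>The limit in n is taken with \<open>h\<close> fixed: the approximation errors
    vanish without being divided by the length of \<open>h\<close>.\<close>
  have "(\<lambda>n. norm h * (e + (B n (R + 1) + B n R)) + ((A n (R + 1) + A n R) + norm h * B n R)) \<longlonglongrightarrow> norm h * (e + (0 + 0)) + ((0 + 0) + norm h * 0)"
   unfolding A_def B_def by (intro tendsto_intros l1 l2)
  then have "bnorm R (\<lambda>y. v (y + h) - v y - g y \<bullet> h) \<le> norm h * (e + (0 + 0)) + ((0 + 0) + norm h * 0)"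
   by (rule LIMSEQ_le_const) (use bound in blast)
  then show ?thesis by (simp add: mult.commute)
 qed
 then show ?thesis using d(1,2) by blast
qed

section \<open>The commutator estimate and renormalization\<close>

text \<open>Differentiation under the integral. The kernel is Lipschitz with compact support, so its
  first-order remainder quotients are bounded by 2L on one common ball. The minus sign is the inner
  derivative of x - y with respect to y.\<close>

lemma convolution_has_derivative:
 fixes f :: "R3 \<Rightarrow> real"
 assumes k: "k \<in> Cc_inf UNIV" and f: "loc_integrable f"
 shows "((\<lambda>y. LBINT x. k (x - y) * f x) has_derivative (\<lambda>h. - (LBINT x. f x *\<^sub>R grad k (x - y)) \<bullet> h)) (at y)"
  and "integrable lborel (\<lambda>x. f x *\<^sub>R grad k (x - y))"
proof -
 obtain R where R: "R > 0" "\<And>x. x \<notin> cball 0 R \<Longrightarrow> k x = 0" using Cc_inf_bounded_support[OF k] by metis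
 have ck: "continuous_on UNIV k" "continuous_on UNIV (grad k)" and dk: "\<And>x. k differentiable (at x)"
  using k by (auto simp: Cc_inf_iff intro: smooth_grad_continuous smooth_continuous smooth_differentiable)
 have gz: "grad k x = 0" if "x \<notin> cball 0 R" for x by (rule grad_zero_outside[OF _ R(2) that]) auto
 obtain L where L: "L > 0" "\<And>x. norm (grad k x) \<le> L" using bounded_continuous_cball[OF ck(2) gz] by metis
 have [measurable]: "k \<in> borel_measurable borel" "grad k \<in> borel_measurable borel" "f \<in> borel_measurable borel"
  using ck f by (auto simp: loc_integrable_measurable borel_measurable_continuous_onI)
 have out: "x - w \<notin> cball 0 R" if "norm w \<le> B" "x \<notin> cball 0 (R + B)" for x w :: R3 and B
  using that norm_triangle_ineq2[of x w] by simp
 have ik: "integrable lborel (\<lambda>x. k (x - w) * f x)" for w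
 proof -
  have "continuous_on UNIV (\<lambda>x. k (x - w))" by (rule continuous_on_compose2[OF ck(1)]) (auto intro!: continuous_intros)
  then have "integrable lborel (\<lambda>x. k (x - w) *\<^sub>R f x)"
   by (rule integrable_Cc_mult[where R = "R + norm w", OF _ _ f]) (auto intro!: R(2) out[OF order_refl])
  then show ?thesis by simp
 qed
 show ig: "integrable lborel (\<lambda>x. f x *\<^sub>R grad k (x - w))" for w
 proof (rule Bochner_Integration.integrable_bound)
  show "integrable lborel (\<lambda>x. L * (indicator (cball 0 (R + norm w)) x *\<^sub>R norm (f x)))"
   by (intro integrable_mult_right loc_integrable_norm_cball f)
  show "AE x in lborel. norm (f x *\<^sub>R grad k (x - w)) \<le> norm (L * (indicator (cball 0 (R + norm w)) x *\<^sub>R norm (f x)))"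
  proof (rule AE_I2)
   fix x show "norm (f x *\<^sub>R grad k (x - w)) \<le> norm (L * (indicator (cball 0 (R + norm w)) x *\<^sub>R norm (f x)))"
   proof (cases "x \<in> cball 0 (R + norm w)")
    case True
    then show ?thesis using L(1) mult_left_mono[OF L(2)[of "x - w"], of "\<bar>f x\<bar>"] by (simp add: abs_mult mult.commute)
   next
    case False
    then show ?thesis using gz[OF out[OF order_refl False]] by simp
   qed
  qed
 qed measurable
 let ?c = "\<lambda>y. LBINT x. k (x - y) * f x" and ?G = "- (LBINT x. f x *\<^sub>R grad k (x - y))"
 show "(?c has_derivative (\<lambda>h. ?G \<bullet> h)) (at y)"
  unfolding has_derivative_iff_norm
 proof (intro conjI bounded_linear_inner_right)
  show "((\<lambda>w. norm (?c w - ?c y - ?G \<bullet> (w - y)) / norm (w - y)) \<longlongrightarrow> 0) (at y)"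
   unfolding tendsto_at_iff_sequentially
  proof (intro allI impI)
   fix X assume X: "\<forall>i. X i \<in> UNIV - {y}" "X \<longlonglongrightarrow> y"
   then have Xy: "X n \<noteq> y" for n by auto
   obtain B where B: "\<And>n. norm (X n) \<le> B"
    using convergent_imp_bounded[OF X(2)] by (auto simp: bounded_iff)
   define B' where "B' = max B (norm y)"
   \<comment> \<open>The remainder quotient of the kernel times \<open>f\<close>, for a sequence
     \<open>X n\<close> tending to \<open>y\<close>; its integral is the remainder quotient of the
     convolution.\<close>
   define Q where "Q n x = (k (x - X n) - k (x - y) + grad k (x - y) \<bullet> (X n - y)) / norm (X n - y) * f x" for n x
   have Qm[measurable]: "Q n \<in> borel_measurable borel" for n unfolding Q_def[abs_def] by measurable
   have eq: "norm (?c (X n) - ?c y - ?G \<bullet> (X n - y)) / norm (X n - y) = \<bar>\<integral>x. Q n x \<partial>lborel\<bar>" for n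
   proof -
    have i3: "integrable lborel (\<lambda>x. (f x *\<^sub>R grad k (x - y)) \<bullet> (X n - y))"
     by (intro integrable_inner_left ig)
    have "(LBINT x. Q n x) = (LBINT x. (k (x - X n) * f x - k (x - y) * f x + (f x *\<^sub>R grad k (x - y)) \<bullet> (X n - y)) / norm (X n - y))"
     by (intro Bochner_Integration.integral_cong) (auto simp: Q_def algebra_simps)
    also have "\<dots> = (LBINT x. k (x - X n) * f x - k (x - y) * f x + (f x *\<^sub>R grad k (x - y)) \<bullet> (X n - y)) / norm (X n - y)"
     by simp
    also have "(LBINT x. k (x - X n) * f x - k (x - y) * f x + (f x *\<^sub>R grad k (x - y)) \<bullet> (X n - y))
      = ?c (X n) - ?c y + (LBINT x. (f x *\<^sub>R grad k (x - y)) \<bullet> (X n - y))"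
     using ik i3 by simp
    also have "(LBINT x. (f x *\<^sub>R grad k (x - y)) \<bullet> (X n - y)) = - (?G \<bullet> (X n - y))"
     using integral_inner_left[OF ig, of y "X n - y"] by simp
    finally show ?thesis by simp
   qed
   have "(\<lambda>n. LBINT x. Q n x) \<longlonglongrightarrow> (\<integral>x. 0 \<partial>(lborel :: R3 measure))"
   proof (rule integral_dominated_convergence)
    show "integrable lborel (\<lambda>x. 2 * L * (indicator (cball 0 (R + B')) x *\<^sub>R norm (f x)))"
     by (intro integrable_mult_right loc_integrable_norm_cball f)
    show "AE x in lborel. (\<lambda>n. Q n x) \<longlonglongrightarrow> 0"
    proof (rule AE_I2)
     fix x
     have L: "((\<lambda>w. norm (k w - k (x - y) - grad k (x - y) \<bullet> (w - (x - y))) / norm (w - (x - y))) \<longlongrightarrow> 0) (at (x - y))"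
      using has_derivative_grad[OF dk[of "x - y"]] unfolding has_derivative_iff_norm by blast
     have lim: "(\<lambda>n. x - X n) \<longlonglongrightarrow> x - y" by (intro tendsto_intros X)
     have X': "\<forall>n. x - X n \<in> UNIV - {x - y}" using Xy by auto
     have "((\<lambda>w. norm (k w - k (x - y) - grad k (x - y) \<bullet> (w - (x - y))) / norm (w - (x - y))) \<circ> (\<lambda>n. x - X n)) \<longlonglongrightarrow> 0"
      by (rule L[unfolded tendsto_at_iff_sequentially, THEN spec, THEN mp, THEN mp, OF X' lim])
     then have "(\<lambda>n. norm (k (x - X n) - k (x - y) + grad k (x - y) \<bullet> (X n - y)) / norm (X n - y)) \<longlonglongrightarrow> 0"
      by (simp add: o_def norm_minus_commute inner_diff_right algebra_simps)
     then have "(\<lambda>n. \<bar>(k (x - X n) - k (x - y) + grad k (x - y) \<bullet> (X n - y)) / norm (X n - y)\<bar>) \<longlonglongrightarrow> 0"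
      by simp
     then have "(\<lambda>n. (k (x - X n) - k (x - y) + grad k (x - y) \<bullet> (X n - y)) / norm (X n - y)) \<longlonglongrightarrow> 0"
      by (rule tendsto_rabs_zero_cancel)
     then show "(\<lambda>n. Q n x) \<longlonglongrightarrow> 0"
      unfolding Q_def by (rule tendsto_mult_left_zero)
    qed
    show "AE x in lborel. norm (Q n x) \<le> 2 * L * (indicator (cball 0 (R + B')) x *\<^sub>R norm (f x))" for n
    proof (rule AE_I2)
     fix x
     show "norm (Q n x) \<le> 2 * L * (indicator (cball 0 (R + B')) x *\<^sub>R norm (f x))"
     proof (cases "x \<in> cball 0 (R + B')")
      case True
      have np: "norm (X n - y) > 0" using Xy by simp
      have "\<bar>k (x - X n) - k (x - y)\<bar> \<le> L * norm (X n - y)"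
       using Lipschitz_of_grad[OF dk L(2), of "x - X n" "x - y"] by (simp add: norm_minus_commute)
      moreover have "\<bar>grad k (x - y) \<bullet> (X n - y)\<bar> \<le> L * norm (X n - y)"
       using order_trans[OF Cauchy_Schwarz_ineq2 mult_right_mono[OF L(2)]] by simp
      ultimately have "\<bar>k (x - X n) - k (x - y) + grad k (x - y) \<bullet> (X n - y)\<bar> \<le> 2 * L * norm (X n - y)" by linarith
      then have "\<bar>(k (x - X n) - k (x - y) + grad k (x - y) \<bullet> (X n - y)) / norm (X n - y)\<bar> \<le> 2 * L"
       using np by (simp add: pos_divide_le_eq)
      then have "\<bar>(k (x - X n) - k (x - y) + grad k (x - y) \<bullet> (X n - y)) / norm (X n - y)\<bar> * \<bar>f x\<bar> \<le> 2 * L * \<bar>f x\<bar>"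
       by (rule mult_right_mono) simp
      then show ?thesis using True unfolding Q_def real_norm_def abs_mult[symmetric] by simp
     next
      case False
      have "x - X n \<notin> cball 0 R" "x - y \<notin> cball 0 R"
       using out[of "X n" B' x] out[of y B' x] B[of n] False by (auto simp: B'_def)
      then show ?thesis using L(1) by (simp add: Q_def R(2) gz)
     qed
    qed
   qed measurable
   then have "(\<lambda>n. \<bar>\<integral>x. Q n x \<partial>lborel\<bar>) \<longlonglongrightarrow> 0"
    by (intro tendsto_rabs_zero) simp
   then show "((\<lambda>w. norm (?c w - ?c y - ?G \<bullet> (w - y)) / norm (w - y)) \<circ> X) \<longlonglongrightarrow> 0"
    unfolding o_def eq .
  qed
 qed
qed

lemma convolution_Ck1:
 fixes f :: "R3 \<Rightarrow> real"
 assumes k: "k \<in> Cc_inf UNIV" and f: "loc_integrable f"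
 shows "Ck 1 (\<lambda>y. LBINT x. k (x - y) * f x)"
  and "partial i (\<lambda>y. LBINT x. k (x - y) * f x) y = - (LBINT x. partial i k (x - y) * f x)"
proof -
 have p: "partial i (\<lambda>y. LBINT x. k (x - y) * f x) y = - (LBINT x. partial i k (x - y) * f x)" for i y
 proof -
  have "partial i (\<lambda>y. LBINT x. k (x - y) * f x) y = - (LBINT x. f x *\<^sub>R grad k (x - y)) \<bullet> axis i 1"
   by (rule partial_eqI[OF convolution_has_derivative(1)[OF k f]])
  also have "\<dots> = - (LBINT x. (f x *\<^sub>R grad k (x - y)) \<bullet> axis i 1)"
   using integral_inner_left[OF convolution_has_derivative(2)[OF k f], of y "axis i 1"] by simp
  also have "(\<lambda>x. (f x *\<^sub>R grad k (x - y)) \<bullet> axis i 1) = (\<lambda>x. partial i k (x - y) * f x)"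
   by (auto simp: inner_axis)
  finally show ?thesis .
 qed
 show "partial i (\<lambda>y. LBINT x. k (x - y) * f x) y = - (LBINT x. partial i k (x - y) * f x)" by (rule p)
 have d: "(\<lambda>y. LBINT x. k (x - y) * f x) differentiable (at y)" if "k \<in> Cc_inf UNIV" for k y
  using convolution_has_derivative(1)[OF that f] unfolding differentiable_def by blast
 have "continuous_on UNIV (\<lambda>y. - (LBINT x. partial i k (x - y) * f x))" for i
  using d[OF Cc_inf_partial[OF k]]
  by (intro continuous_on_minus differentiable_imp_continuous_on) (auto simp: differentiable_on_def differentiable_at_withinI)
 then show "Ck 1 (\<lambda>y. LBINT x. k (x - y) * f x)"
  using d[OF k] by (simp add: p[abs_def])
qed

section \<open>Derivatives and limits of mollified functions\<close>

lemma partial_bump_facts: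
 shows "continuous_on UNIV (partial i bump)" "x \<notin> cball 0 1 \<Longrightarrow> partial i bump x = 0"
  "partial i bump \<in> borel_measurable borel"
proof -
 show c: "continuous_on UNIV (partial i bump)" by (intro smooth_continuous smooth_partial smooth_bump)
 then show "partial i bump \<in> borel_measurable borel" by (rule borel_measurable_continuous_onI)
 show "x \<notin> cball 0 1 \<Longrightarrow> partial i bump x = 0"
  by (rule partial_zero_outside[of "cball 0 1"]) (auto simp: bump_zero)
qed

text \<open>The derivative falls on the scaled kernel and costs a factor 1/\<epsilon>. It is
  expressed again as an average of translates, the form in which it is combined with a difference
  quotient of the velocity.\<close>

lemma mollify_Ck1:
 fixes f :: "R3 \<Rightarrow> real"
 assumes f: "loc_integrable f" and e: "\<epsilon> > 0"
 shows "Ck 1 (mollify \<epsilon> f)"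
  and "partial i (mollify \<epsilon> f) y = - (1 / \<epsilon>) * (LBINT z. partial i bump z * f (y + \<epsilon> *\<^sub>R z))"
proof -
 define k where "k = (\<lambda>w. bump ((1 / \<epsilon>) *\<^sub>R w + 0))"
 have k: "k \<in> Cc_inf UNIV" unfolding k_def using e by (intro Cc_inf_reflected bump_Cc_inf) auto
 have kd: "k (x - y) = bump ((1 / \<epsilon>) *\<^sub>R x + (- (1 / \<epsilon>)) *\<^sub>R y)" for x y
  by (simp add: k_def scaleR_diff_right)
 have pk: "partial i k w = (1 / \<epsilon>) * partial i bump ((1 / \<epsilon>) *\<^sub>R w)" for w
  unfolding k_def using partial_affine(1)[of bump "1 / \<epsilon>" w 0 i] smooth_differentiable[OF smooth_bump] by simp
 have m: "mollify \<epsilon> f = (\<lambda>y. (1 / \<epsilon> ^ 3) * (LBINT x. k (x - y) * f x))"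
  using kernel_subst[OF smooth_continuous[OF smooth_bump] bump_zero f e]
  unfolding mollify_def[abs_def] kd by simp
 have C: "Ck 1 (\<lambda>y. LBINT x. k (x - y) * f x)" by (rule convolution_Ck1(1)[OF k f])
 show "Ck 1 (mollify \<epsilon> f)" unfolding m by (intro Ck_mult Ck_const C)
 have "partial i (mollify \<epsilon> f) y = (1 / \<epsilon> ^ 3) * partial i (\<lambda>y. LBINT x. k (x - y) * f x) y"
  unfolding m using C by (subst partial_mult) auto
 also have "\<dots> = (1 / \<epsilon> ^ 3) * - (LBINT x. partial i k (x - y) * f x)"
  by (simp only: convolution_Ck1(2)[OF k f])
 also have "(LBINT x. partial i k (x - y) * f x) = (1 / \<epsilon>) * (LBINT x. partial i bump ((1 / \<epsilon>) *\<^sub>R x + (- (1 / \<epsilon>)) *\<^sub>R y) * f x)"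
  unfolding pk by (simp add: scaleR_diff_right)
 also have "(1 / \<epsilon> ^ 3) * - ((1 / \<epsilon>) * (LBINT x. partial i bump ((1 / \<epsilon>) *\<^sub>R x + (- (1 / \<epsilon>)) *\<^sub>R y) * f x))
  = - (1 / \<epsilon>) * ((1 / \<epsilon> ^ 3) *\<^sub>R (LBINT x. partial i bump ((1 / \<epsilon>) *\<^sub>R x + (- (1 / \<epsilon>)) *\<^sub>R y) *\<^sub>R f x))"
  by simp
 also have "(1 / \<epsilon> ^ 3) *\<^sub>R (LBINT x. partial i bump ((1 / \<epsilon>) *\<^sub>R x + (- (1 / \<epsilon>)) *\<^sub>R y) *\<^sub>R f x) = (LBINT z. partial i bump z *\<^sub>R f (y + \<epsilon> *\<^sub>R z))"
  by (rule kernel_subst[OF partial_bump_facts(1,2) f e, symmetric])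
 finally show "partial i (mollify \<epsilon> f) y = - (1 / \<epsilon>) * (LBINT z. partial i bump z * f (y + \<epsilon> *\<^sub>R z))" by simp
qed

lemma mollify_bounds:
 fixes f :: "R3 \<Rightarrow> real"
 assumes m: "f \<in> borel_measurable borel" and b: "\<And>x. 0 \<le> f x" "\<And>x. f x \<le> M" and e: "\<epsilon> > 0"
 shows "0 \<le> mollify \<epsilon> f y" "mollify \<epsilon> f y \<le> M"
proof -
 have f: "loc_integrable f" by (rule loc_integrable_bounded[OF m, of M]) (use b in auto)
 show "0 \<le> mollify \<epsilon> f y"
  unfolding mollify_def by (intro Bochner_Integration.integral_nonneg) (auto simp: b bump_nonneg)
 have "mollify \<epsilon> f y \<le> (LBINT z. bump z *\<^sub>R M)"
  unfolding mollify_def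
  by (rule integral_mono[OF integrable_bump_mult[OF f]])
   (use e b integrable_bump in \<open>auto intro!: mult_left_mono simp: bump_nonneg\<close>)
 then show "mollify \<epsilon> f y \<le> M" by (simp add: integral_bump)
qed

text \<open>Scales with L^1 error at most 1/(m+1) are chosen first; a subsequence then converges
  almost everywhere on the ball, which the nonlinear functions of the density require.\<close>

lemma mollify_AE_seq:
 fixes f :: "R3 \<Rightarrow> real"
 assumes f: "loc_integrable f"
 shows "\<exists>\<epsilon>. (\<forall>m::nat. 0 < \<epsilon> m \<and> \<epsilon> m \<le> 1) \<and> \<epsilon> \<longlonglongrightarrow> 0 \<and>
  (AE x in lborel. x \<in> cball 0 R \<longrightarrow> (\<lambda>m. mollify (\<epsilon> m) f x) \<longlonglongrightarrow> f x)"
proof -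
 have [measurable]: "f \<in> borel_measurable borel" using f by (rule loc_integrable_measurable)
 have "\<exists>e. 0 < e \<and> e \<le> inverse (real (Suc m)) \<and> integrable lborel (\<lambda>x. indicator (cball 0 R) x *\<^sub>R norm (mollify e f x - f x)) \<and>
   bnorm R (\<lambda>x. mollify e f x - f x) \<le> inverse (real (Suc m))" for m
 proof -
  have p: "inverse (real (Suc m)) > 0" by simp
  obtain d where d: "d > 0" "\<And>e. 0 < e \<Longrightarrow> e < d \<Longrightarrow> integrable lborel (\<lambda>x. indicator (cball 0 R) x *\<^sub>R norm (mollify e f x - f x)) \<and>
   bnorm R (\<lambda>x. mollify e f x - f x) \<le> inverse (real (Suc m))"
   using bnorm_mollify[OF f p, of R] by blast
  let ?e = "min d (inverse (real (Suc m))) / 2"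
  have "0 < ?e" "?e < d" "?e \<le> inverse (real (Suc m))" using d(1) p by (auto simp: min_def)
  then show ?thesis using d(2)[of ?e] by blast
 qed
 from choice[OF allI[OF this]] obtain e where E: "\<forall>m. 0 < e m \<and> e m \<le> inverse (real (Suc m)) \<and>
   integrable lborel (\<lambda>x. indicator (cball 0 R) x *\<^sub>R norm (mollify (e m) f x - f x)) \<and>
   bnorm R (\<lambda>x. mollify (e m) f x - f x) \<le> inverse (real (Suc m))" by (rule exE)
 have e: "0 < e m" "e m \<le> inverse (real (Suc m))"
  "integrable lborel (\<lambda>x. indicator (cball 0 R) x *\<^sub>R norm (mollify (e m) f x - f x))"
  "bnorm R (\<lambda>x. mollify (e m) f x - f x) \<le> inverse (real (Suc m))" for m
  by (rule E[THEN spec, of m, THEN conjunct1] E[THEN spec, of m, THEN conjunct2, THEN conjunct1]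
    E[THEN spec, of m, THEN conjunct2, THEN conjunct2, THEN conjunct1]
    E[THEN spec, of m, THEN conjunct2, THEN conjunct2, THEN conjunct2])+
 let ?w = "\<lambda>m x. indicator (cball 0 R) x *\<^sub>R norm (mollify (e m) f x - f x)"
 have "(\<lambda>m. LBINT x. norm (?w m x)) \<longlonglongrightarrow> 0"
 proof (rule tendsto_sandwich[OF _ _ tendsto_const LIMSEQ_inverse_real_of_nat])
  show "\<forall>\<^sub>F m in sequentially. (LBINT x. norm (?w m x)) \<le> inverse (real (Suc m))"
   using e(4) by (intro always_eventually) (simp add: bnorm_def)
 qed auto
 then obtain r where r: "strict_mono r" "AE x in lborel. (\<lambda>m. ?w (r m) x) \<longlonglongrightarrow> 0"
  using tendsto_L1_AE_subseq[of lborel ?w, OF e(3)] by blast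
 have "e \<longlonglongrightarrow> 0"
  by (rule tendsto_sandwich[OF _ _ tendsto_const LIMSEQ_inverse_real_of_nat])
   (intro always_eventually allI less_imp_le e(1), intro always_eventually allI e(2))
 then have "(e \<circ> r) \<longlonglongrightarrow> 0" using LIMSEQ_subseq_LIMSEQ r(1) by blast
 moreover have "0 < (e \<circ> r) m \<and> (e \<circ> r) m \<le> 1" for m
  using e(1)[of "r m"] order_trans[OF e(2)[of "r m"], of 1] by (simp add: inverse_le_1_iff)
 moreover have "AE x in lborel. x \<in> cball 0 R \<longrightarrow> (\<lambda>m. mollify ((e \<circ> r) m) f x) \<longlonglongrightarrow> f x"
  using r(2)
 proof eventually_elim
  case (elim x)
  show ?case
  proof
   assume "x \<in> cball 0 R"
   then have "(\<lambda>m. norm (mollify (e (r m)) f x - f x)) \<longlonglongrightarrow> 0" using elim by simp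
   then have "(\<lambda>m. mollify (e (r m)) f x - f x) \<longlonglongrightarrow> 0" by (rule tendsto_norm_zero_cancel)
   then show "(\<lambda>m. mollify ((e \<circ> r) m) f x) \<longlonglongrightarrow> f x"
    unfolding o_def by (rule LIM_zero_cancel)
  qed
 qed
 ultimately show ?thesis by blast
qed

text \<open>The commutator estimate of DiPerna and Lions. After exchanging the integrals,
  \<open>z\<close> is a parameter: the difference quotient of \<open>v\<close> in direction
  \<open>z\<close> converges in L^1 to \<open>g y \<bullet> z\<close>, while the bounded factors
  from \<rho> and \<open>q m\<close> converge in L^1 and almost everywhere. Dominated convergence in
  \<open>z\<close> over the unit ball concludes.\<close>

lemma commutator_limit:
 fixes \<rho> v k :: "R3 \<Rightarrow> real" and g :: "R3 \<Rightarrow> R3" and q :: "nat \<Rightarrow> R3 \<Rightarrow> real"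
 assumes rm[measurable]: "\<rho> \<in> borel_measurable borel" and rb: "\<And>x. \<bar>\<rho> x\<bar> \<le> M"
  and v: "loc_integrable v" and g: "loc_integrable g"
  and DQ: "\<And>e. e > 0 \<Longrightarrow> \<exists>d>0. d \<le> 1 \<and> (\<forall>h. norm h < d \<longrightarrow> bnorm R (\<lambda>y. v (y + h) - v y - g y \<bullet> h) \<le> e * norm h)"
  and kc: "continuous_on UNIV k" and kz: "\<And>z. z \<notin> cball 0 1 \<Longrightarrow> k z = 0"
  and qm[measurable]: "\<And>m. q m \<in> borel_measurable borel" "q' \<in> borel_measurable borel"
  and qb: "\<And>m x. \<bar>q m x\<bar> \<le> G" "\<And>x. \<bar>q' x\<bar> \<le> G"
  and qz: "\<And>m x. x \<notin> cball 0 R \<Longrightarrow> q m x = 0" "\<And>x. x \<notin> cball 0 R \<Longrightarrow> q' x = 0"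
  and ql: "AE x in lborel. (\<lambda>m. q m x) \<longlonglongrightarrow> q' x"
  and \<epsilon>: "\<And>m. 0 < \<epsilon> m" "\<And>m. \<epsilon> m \<le> 1" "\<epsilon> \<longlonglongrightarrow> 0"
 shows "(\<lambda>m. LBINT y. q m y * (LBINT z. k z * (\<rho> (y + \<epsilon> m *\<^sub>R z) * ((v (y + \<epsilon> m *\<^sub>R z) - v y) / \<epsilon> m))))
  \<longlonglongrightarrow> (LBINT z. k z * (LBINT y. q' y * (\<rho> y * (g y \<bullet> z))))"
proof -
 have [measurable]: "v \<in> borel_measurable borel" "g \<in> borel_measurable borel" "k \<in> borel_measurable borel"
  using v g kc by (auto simp: loc_integrable_measurable borel_measurable_continuous_onI)
 obtain K where K: "K > 0" "\<And>z. norm (k z) \<le> K" using bounded_continuous_cball[OF kc kz] by metis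
 have M0: "M \<ge> 0" using rb[of 0] by linarith
 have G0: "G \<ge> 0" using qb(2)[of 0] by linarith
 define D where "D m z y = (v (y + \<epsilon> m *\<^sub>R z) - v y) / \<epsilon> m" for m z y
 have [measurable]: "D m z \<in> borel_measurable borel" for m z unfolding D_def[abs_def] by measurable
 have Dl: "loc_integrable (D m z)" for m z
 proof -
  have "loc_integrable (\<lambda>y. (1 / \<epsilon> m) *\<^sub>R (v (y + \<epsilon> m *\<^sub>R z) - v y))"
   by (rule loc_integrable_bounded_mult[where B = "1 / \<epsilon> m"])
    (use \<epsilon>(1)[of m] in \<open>auto intro!: loc_integrable_diff loc_integrable_translate v\<close>)
  then show ?thesis by (simp add: D_def[abs_def])
 qed
 have gl: "loc_integrable (\<lambda>y. g y \<bullet> z)" for z by (rule loc_integrable_inner_const(1)[OF g])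
 define J where "J m z = (LBINT y. q m y * (\<rho> (y + \<epsilon> m *\<^sub>R z) * D m z y))" for m z
 have int: "integrable lborel (\<lambda>y. w y * (s y * f y))" 
  if "w \<in> borel_measurable borel" "s \<in> borel_measurable borel" "\<And>x. \<bar>w x\<bar> \<le> G" "\<And>x. \<bar>s x\<bar> \<le> C" "\<And>x. x \<notin> cball 0 R \<Longrightarrow> w x = 0" "loc_integrable f"
  for w s f :: "R3 \<Rightarrow> real" and C
 proof -
  have "loc_integrable (\<lambda>y. s y *\<^sub>R f y)" by (rule loc_integrable_bounded_mult) (use that in auto)
  then have l: "loc_integrable (\<lambda>y. s y * f y)" by simp
  show ?thesis
   by (rule integral_tendsto_bnorm(2)[where f = "\<lambda>n y. s y * f y", OF that(1,3,5) l l]) (simp_all add: bnorm_def)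
 qed
 have bnd: "\<bar>\<integral>y. w y * (s y * f y) \<partial>lborel\<bar> \<le> G * C * bnorm R f" 
  if "w \<in> borel_measurable borel" "s \<in> borel_measurable borel" "\<And>x. \<bar>w x\<bar> \<le> G" "\<And>x. \<bar>s x\<bar> \<le> C" "\<And>x. x \<notin> cball 0 R \<Longrightarrow> w x = 0" "loc_integrable f"
  for w s f :: "R3 \<Rightarrow> real" and C
 proof -
  have "\<bar>\<integral>y. w y * (s y * f y) \<partial>lborel\<bar> \<le> (LBINT y. \<bar>w y * (s y * f y)\<bar>)"
   using integral_norm_bound[of lborel "\<lambda>y. w y * (s y * f y)"] by simp
  also have "\<dots> \<le> (LBINT y. G * C * (indicator (cball 0 R) y *\<^sub>R norm (f y)))"
  proof (rule integral_mono)
   show "integrable lborel (\<lambda>y. \<bar>w y * (s y * f y)\<bar>)" using int[OF that] by simp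
   show "integrable lborel (\<lambda>y. G * C * (indicator (cball 0 R) y *\<^sub>R norm (f y)))"
    by (intro integrable_mult_right loc_integrable_norm_cball that)
   fix y show "\<bar>w y * (s y * f y)\<bar> \<le> G * C * (indicator (cball 0 R) y *\<^sub>R norm (f y))"
   proof (cases "y \<in> cball 0 R")
    case True
    have "\<bar>w y\<bar> * \<bar>s y\<bar> \<le> G * C" using that(3,4) G0 by (intro mult_mono) auto
    then have "\<bar>w y\<bar> * \<bar>s y\<bar> * \<bar>f y\<bar> \<le> G * C * \<bar>f y\<bar>" by (rule mult_right_mono) simp
    then show ?thesis using True by (simp add: abs_mult mult.assoc)
   qed (simp add: that(5))
  qed
  also have "\<dots> = G * C * bnorm R f" by (simp add: bnorm_def)
  finally show ?thesis .
 qed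
 have swap: "(LBINT y. q m y * (LBINT z. k z * (\<rho> (y + \<epsilon> m *\<^sub>R z) * ((v (y + \<epsilon> m *\<^sub>R z) - v y) / \<epsilon> m)))) = (LBINT z. k z * J m z)" for m
 proof -
  let ?H = "\<lambda>z y. k z * (q m y * (\<rho> (y + \<epsilon> m *\<^sub>R z) * D m z y))"
  have Hm: "case_prod ?H \<in> borel_measurable (lborel \<Otimes>\<^sub>M lborel)"
   unfolding D_def by measurable
  \<comment> \<open>A crude bound that blows up as \<epsilon> tends to 0; it is only meant to
    justify Fubini at a fixed \<open>m\<close>.\<close>
  define C1 where "C1 = G * M * ((bnorm (R + 1) v + bnorm R v) / \<epsilon> m)"
  have C1: "C1 \<ge> 0" using G0 M0 \<epsilon>(1)[of m] bnorm_nonneg[of R v] bnorm_nonneg[of "R + 1" v] by (simp add: C1_def)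
  have Jb: "(\<integral>\<^sup>+y. ennreal (norm (?H z y)) \<partial>lborel) \<le> ennreal (K * C1) * indicator (cball 0 1) z" for z
  proof (cases "z \<in> cball 0 1")
   case True
   have nz: "norm (\<epsilon> m *\<^sub>R z) \<le> 1" using True \<epsilon>(1)[of m] \<epsilon>(2)[of m] by (simp add: mult_le_one)
   have "bnorm R (\<lambda>y. v (y + \<epsilon> m *\<^sub>R z) - v y) \<le> bnorm R (\<lambda>y. v (y + \<epsilon> m *\<^sub>R z)) + bnorm R v"
    by (rule bnorm_triangle[OF loc_integrable_diff[OF loc_integrable_translate[OF v] v] loc_integrable_translate[OF v] v norm_triangle_ineq4])
   also have "bnorm R (\<lambda>y. v (y + \<epsilon> m *\<^sub>R z)) \<le> bnorm (R + 1) v" by (rule bnorm_translate[OF v nz])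
   finally have b1: "bnorm R (\<lambda>y. v (y + \<epsilon> m *\<^sub>R z) - v y) \<le> bnorm (R + 1) v + bnorm R v" by simp
   have "D m z = (\<lambda>y. (1 / \<epsilon> m) *\<^sub>R (v (y + \<epsilon> m *\<^sub>R z) - v y))" by (auto simp: D_def)
   then have "bnorm R (D m z) = bnorm R (\<lambda>y. v (y + \<epsilon> m *\<^sub>R z) - v y) / \<epsilon> m"
    using \<epsilon>(1)[of m] by (simp only: bnorm_const_mult) simp
   also have "\<dots> \<le> (bnorm (R + 1) v + bnorm R v) / \<epsilon> m" using b1 \<epsilon>(1)[of m] by (intro divide_right_mono) auto
   finally have b2: "bnorm R (D m z) \<le> (bnorm (R + 1) v + bnorm R v) / \<epsilon> m" .
   have "(\<integral>\<^sup>+y. ennreal (norm (?H z y)) \<partial>lborel) \<le> (\<integral>\<^sup>+y. ennreal (K * (G * M) * (indicator (cball 0 R) y *\<^sub>R norm (D m z y))) \<partial>lborel)"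
   proof (intro nn_integral_mono ennreal_leI)
    fix y show "norm (?H z y) \<le> K * (G * M) * (indicator (cball 0 R) y *\<^sub>R norm (D m z y))"
    proof (cases "y \<in> cball 0 R")
     case True
     have "\<bar>k z\<bar> * (\<bar>q m y\<bar> * \<bar>\<rho> (y + \<epsilon> m *\<^sub>R z)\<bar>) \<le> K * (G * M)"
      using K qb(1) rb G0 M0 by (intro mult_mono) (auto intro: less_imp_le)
     then have "\<bar>k z\<bar> * (\<bar>q m y\<bar> * \<bar>\<rho> (y + \<epsilon> m *\<^sub>R z)\<bar>) * \<bar>D m z y\<bar> \<le> K * (G * M) * \<bar>D m z y\<bar>" by (rule mult_right_mono) simp
     then show ?thesis using True by (simp add: abs_mult mult.assoc)
    qed (simp add: qz)
   qed
   also have "\<dots> = ennreal (LBINT y. K * (G * M) * (indicator (cball 0 R) y *\<^sub>R norm (D m z y)))"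
    using K(1) G0 M0 by (intro nn_integral_eq_integral integrable_mult_right loc_integrable_norm_cball Dl) auto
   also have "(LBINT y. K * (G * M) * (indicator (cball 0 R) y *\<^sub>R norm (D m z y))) = K * (G * M) * bnorm R (D m z)"
    by (simp add: bnorm_def)
   also have "ennreal (K * (G * M) * bnorm R (D m z)) \<le> ennreal (K * C1)"
   proof (rule ennreal_leI)
    have "K * (G * M) * bnorm R (D m z) \<le> K * (G * M) * ((bnorm (R + 1) v + bnorm R v) / \<epsilon> m)"
     using K(1) G0 M0 by (intro mult_left_mono b2) auto
    then show "K * (G * M) * bnorm R (D m z) \<le> K * C1" by (simp only: C1_def mult.assoc)
   qed
   finally show ?thesis using True by simp
  qed (simp add: kz)
  have "(\<integral>\<^sup>+p. ennreal (norm (case_prod ?H p)) \<partial>(lborel \<Otimes>\<^sub>M lborel)) = (\<integral>\<^sup>+z. \<integral>\<^sup>+y. ennreal (norm (?H z y)) \<partial>lborel \<partial>lborel)"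
   unfolding case_prod_beta' by (rule nn_integral_lborel_pair(1)) (use Hm in \<open>simp add: case_prod_beta'\<close>)
  also have "\<dots> \<le> (\<integral>\<^sup>+z. ennreal (K * C1) * indicator (cball 0 1) z \<partial>(lborel::R3 measure))"
   by (intro nn_integral_mono Jb)
  also have "\<dots> < \<infinity>"
   by (simp add: nn_integral_cmult_indicator ennreal_mult_less_top emeasure_cball_less_top)
  finally have "integrable (lborel \<Otimes>\<^sub>M lborel) (case_prod ?H)"
   using Hm by (intro integrableI_bounded) auto
  from lborel_pair.Fubini_integral[OF this]
  have F1: "(LBINT y. \<integral>z. ?H z y \<partial>lborel) = (LBINT z. \<integral>y. ?H z y \<partial>lborel)" .
  have F2: "(LBINT z. ?H z y) = q m y * (LBINT z. k z * (\<rho> (y + \<epsilon> m *\<^sub>R z) * ((v (y + \<epsilon> m *\<^sub>R z) - v y) / \<epsilon> m)))" for y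
   unfolding D_def by (subst integral_mult_right_zero[symmetric]) (simp add: mult_ac)
  have F3: "(LBINT y. ?H z y) = k z * J m z" for z
   unfolding J_def by (rule integral_mult_right_zero)
  show ?thesis using F1 unfolding F2 F3 .
 qed
 have Dlim: "(\<lambda>m. bnorm R (\<lambda>y. D m z y - g y \<bullet> z)) \<longlonglongrightarrow> 0" if z: "z \<in> cball 0 1" for z
 proof (rule LIMSEQ_I)
  fix r :: real assume r: "r > 0"
  obtain d where d: "d > 0" "\<And>h. norm h < d \<Longrightarrow> bnorm R (\<lambda>y. v (y + h) - v y - g y \<bullet> h) \<le> r / 2 * norm h"
   using DQ[of "r / 2"] r by auto
  obtain N where N: "\<And>m. m \<ge> N \<Longrightarrow> norm (\<epsilon> m - 0) < d" using LIMSEQ_D[OF \<epsilon>(3) d(1)] by blast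
  have "norm (bnorm R (\<lambda>y. D m z y - g y \<bullet> z) - 0) < r" if "m \<ge> N" for m
  proof -
   have e: "0 < \<epsilon> m" "\<epsilon> m < d" using N[OF that] \<epsilon>(1)[of m] by auto
   have nz: "norm (\<epsilon> m *\<^sub>R z) \<le> \<epsilon> m" using z e by (simp add: mult_left_le)
   have "D m z y - g y \<bullet> z = (1 / \<epsilon> m) *\<^sub>R (v (y + \<epsilon> m *\<^sub>R z) - v y - g y \<bullet> (\<epsilon> m *\<^sub>R z))" for y
    using e by (simp add: D_def field_simps)
   then have "bnorm R (\<lambda>y. D m z y - g y \<bullet> z) = (1 / \<epsilon> m) * bnorm R (\<lambda>y. v (y + \<epsilon> m *\<^sub>R z) - v y - g y \<bullet> (\<epsilon> m *\<^sub>R z))"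
    using e by (simp only: bnorm_const_mult) simp
   also have "\<dots> \<le> (1 / \<epsilon> m) * (r / 2 * norm (\<epsilon> m *\<^sub>R z))"
    using d(2)[OF le_less_trans[OF nz e(2)]] e by (intro mult_left_mono) auto
   also have "\<dots> \<le> (1 / \<epsilon> m) * (r / 2 * \<epsilon> m)" using nz e r by (intro mult_left_mono) auto
   also have "\<dots> = r / 2" using e by simp
   finally show ?thesis using r bnorm_nonneg[of R "\<lambda>y. D m z y - g y \<bullet> z"] by simp
  qed
  then show "\<exists>no. \<forall>n\<ge>no. norm (bnorm R (\<lambda>y. D n z y - g y \<bullet> z) - 0) < r" by blast
 qed
 have rlim: "(\<lambda>m. bnorm R (\<lambda>y. \<rho> (y + \<epsilon> m *\<^sub>R z) - \<rho> y)) \<longlonglongrightarrow> 0" if z: "z \<in> cball 0 1" for z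
 proof (rule LIMSEQ_I)
  fix r :: real assume r: "r > 0"
  have lr: "loc_integrable \<rho>" by (rule loc_integrable_bounded[OF rm]) (use rb in auto)
  obtain d where d: "d > 0" "\<And>h. norm h < d \<Longrightarrow> bnorm R (\<lambda>x. \<rho> (x + h) - \<rho> x) < r"
   using bnorm_translation[OF lr r] by blast
  obtain N where N: "\<And>m. m \<ge> N \<Longrightarrow> norm (\<epsilon> m - 0) < d" using LIMSEQ_D[OF \<epsilon>(3) d(1)] by blast
  have "norm (bnorm R (\<lambda>y. \<rho> (y + \<epsilon> m *\<^sub>R z) - \<rho> y) - 0) < r" if "m \<ge> N" for m
  proof -
   have e: "0 < \<epsilon> m" "\<epsilon> m < d" using N[OF that] \<epsilon>(1)[of m] by auto
   have nz: "norm (\<epsilon> m *\<^sub>R z) \<le> \<epsilon> m" using z e by (simp add: mult_left_le)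
   show ?thesis using d(2)[OF le_less_trans[OF nz e(2)]] bnorm_nonneg[of R "\<lambda>y. \<rho> (y + \<epsilon> m *\<^sub>R z) - \<rho> y"] by simp
  qed
  then show "\<exists>no. \<forall>n\<ge>no. norm (bnorm R (\<lambda>y. \<rho> (y + \<epsilon> n *\<^sub>R z) - \<rho> y) - 0) < r" by blast
 qed
 define J' where "J' z = (LBINT y. q' y * (\<rho> y * (g y \<bullet> z)))" for z
 have Jlim: "(\<lambda>m. J m z) \<longlonglongrightarrow> J' z" if z: "z \<in> cball 0 1" for z
 proof -
  let ?\<rho> = "\<lambda>m y. \<rho> (y + \<epsilon> m *\<^sub>R z)" and ?a = "\<lambda>y. g y \<bullet> z"
  \<comment> \<open>\<open>J m z\<close> is telescoped: first the difference quotient is replaced by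
    its limit, then the shifted density by \<rho>, and finally the weight \<open>q m\<close> by
    \<open>q'\<close>.\<close>
  have d1: "(\<lambda>m. LBINT y. q m y * (?\<rho> m y * (D m z y - ?a y))) \<longlonglongrightarrow> 0"
  proof (rule Lim_null_comparison)
   show "(\<lambda>m. G * M * bnorm R (\<lambda>y. D m z y - ?a y)) \<longlonglongrightarrow> 0"
    using tendsto_mult[OF tendsto_const[of "G * M"] Dlim[OF z]] by simp
   show "\<forall>\<^sub>F m in sequentially. norm (LBINT y. q m y * (?\<rho> m y * (D m z y - ?a y))) \<le> G * M * bnorm R (\<lambda>y. D m z y - ?a y)"
    unfolding real_norm_def
    by (rule always_eventually, rule allI, rule bnd) (auto simp: qb rb qz intro!: loc_integrable_diff Dl gl)
  qed
  have d2: "(\<lambda>m. LBINT y. q m y * (1 * ((?\<rho> m y - \<rho> y) * ?a y))) \<longlonglongrightarrow> 0"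
  proof (rule Lim_null_comparison)
   have b2M: "\<bar>?\<rho> m y - \<rho> y\<bar> \<le> 2 * M" for m y using rb[of "y + \<epsilon> m *\<^sub>R z"] rb[of y] by linarith
   have "(\<lambda>m. bnorm R (\<lambda>y. (?\<rho> m y - \<rho> y) * ?a y)) \<longlonglongrightarrow> 0"
    by (rule bnorm_bounded_mult_tendsto[OF _ b2M rlim[OF z] gl]) measurable
   then show "(\<lambda>m. G * 1 * bnorm R (\<lambda>y. (?\<rho> m y - \<rho> y) * ?a y)) \<longlonglongrightarrow> 0"
    using tendsto_mult[OF tendsto_const[of "G * 1"]] by fastforce
   have l: "loc_integrable (\<lambda>y. (?\<rho> m y - \<rho> y) * ?a y)" for m
    using loc_integrable_bounded_mult[OF gl[of z], of "\<lambda>y. ?\<rho> m y - \<rho> y" "2 * M"] b2M by simp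
   show "\<forall>\<^sub>F m in sequentially. norm (LBINT y. q m y * (1 * ((?\<rho> m y - \<rho> y) * ?a y))) \<le> G * 1 * bnorm R (\<lambda>y. (?\<rho> m y - \<rho> y) * ?a y)"
    unfolding real_norm_def
    by (rule always_eventually, rule allI, rule bnd) (auto simp: qb qz intro!: l)
  qed
  have d3: "(\<lambda>m. LBINT y. q m y * (\<rho> y * ?a y)) \<longlonglongrightarrow> J' z"
   unfolding J'_def
  proof (rule integral_dominated_convergence)
   show "integrable lborel (\<lambda>y. G * M * (indicator (cball 0 R) y *\<^sub>R norm (?a y)))"
    by (intro integrable_mult_right loc_integrable_norm_cball gl)
   show "AE x in lborel. (\<lambda>m. q m x * (\<rho> x * ?a x)) \<longlonglongrightarrow> q' x * (\<rho> x * ?a x)"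
    using ql by eventually_elim (intro tendsto_intros)
   show "AE x in lborel. norm (q m x * (\<rho> x * ?a x)) \<le> G * M * (indicator (cball 0 R) x *\<^sub>R norm (?a x))" for m
   proof (rule AE_I2)
    fix x show "norm (q m x * (\<rho> x * ?a x)) \<le> G * M * (indicator (cball 0 R) x *\<^sub>R norm (?a x))"
    proof (cases "x \<in> cball 0 R")
     case True
     have "\<bar>q m x\<bar> * \<bar>\<rho> x\<bar> \<le> G * M" using qb rb G0 by (intro mult_mono) auto
     then have "\<bar>q m x\<bar> * \<bar>\<rho> x\<bar> * \<bar>?a x\<bar> \<le> G * M * \<bar>?a x\<bar>" by (rule mult_right_mono) simp
     then show ?thesis using True by (simp add: abs_mult mult.assoc)
    qed (simp add: qz)
   qed
  qed measurable
  have "J m z = (LBINT y. q m y * (?\<rho> m y * (D m z y - ?a y))) + (LBINT y. q m y * (1 * ((?\<rho> m y - \<rho> y) * ?a y))) + (LBINT y. q m y * (\<rho> y * ?a y))" for m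
  proof -
   have i1: "integrable lborel (\<lambda>y. q m y * (?\<rho> m y * (D m z y - ?a y)))"
    by (rule int[where C = M]) (auto simp: qb rb qz intro!: loc_integrable_diff Dl gl)
   have i3: "integrable lborel (\<lambda>y. q m y * (\<rho> y * ?a y))"
    by (rule int[where C = M]) (auto simp: qb rb qz intro!: gl)
   have "integrable lborel (\<lambda>y. q m y * (?\<rho> m y * ?a y))"
    by (rule int[where C = M]) (auto simp: qb rb qz intro!: gl)
   from Bochner_Integration.integrable_diff[OF this i3]
   have i2: "integrable lborel (\<lambda>y. q m y * (1 * ((?\<rho> m y - \<rho> y) * ?a y)))" by (simp add: algebra_simps)
   have "J m z = (LBINT y. q m y * (?\<rho> m y * (D m z y - ?a y)) + q m y * (1 * ((?\<rho> m y - \<rho> y) * ?a y)) + q m y * (\<rho> y * ?a y))"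
    unfolding J_def by (intro Bochner_Integration.integral_cong) (auto simp: algebra_simps)
   then show ?thesis using i1 i2 i3 by simp
  qed
  then show ?thesis using tendsto_add[OF tendsto_add[OF d1 d2] d3] by simp
 qed
 \<comment> \<open>A bound on \<open>J m z\<close> uniform in \<open>m\<close> comes from the
   difference quotient estimate with \<open>e = 1\<close>, valid once \<epsilon> m is below
   \<open>d1\<close>. Hence domination starts at \<open>N\<close>, and the sequence is
   shifted.\<close>
 obtain d1 where d1: "d1 > 0" "\<And>h. norm h < d1 \<Longrightarrow> bnorm R (\<lambda>y. v (y + h) - v y - g y \<bullet> h) \<le> 1 * norm h"
  using DQ[of 1] by auto
 obtain N where N: "\<And>m. m \<ge> N \<Longrightarrow> norm (\<epsilon> m - 0) < d1" using LIMSEQ_D[OF \<epsilon>(3) d1(1)] by blast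
 define C2 where "C2 = G * M * (1 + bnorm R g)"
 have C2: "C2 \<ge> 0" using G0 M0 bnorm_nonneg[of R g] by (simp add: C2_def)
 have Jbnd: "\<bar>J m z\<bar> \<le> C2" if "m \<ge> N" "z \<in> cball 0 1" for m z
 proof -
  have e: "0 < \<epsilon> m" "\<epsilon> m < d1" using N[OF that(1)] \<epsilon>(1)[of m] by auto
  have nz: "norm (\<epsilon> m *\<^sub>R z) \<le> \<epsilon> m" using that(2) e by (simp add: mult_left_le)
  have "D m z y - g y \<bullet> z = (1 / \<epsilon> m) *\<^sub>R (v (y + \<epsilon> m *\<^sub>R z) - v y - g y \<bullet> (\<epsilon> m *\<^sub>R z))" for y
   using e by (simp add: D_def field_simps)
  then have "bnorm R (\<lambda>y. D m z y - g y \<bullet> z) = (1 / \<epsilon> m) * bnorm R (\<lambda>y. v (y + \<epsilon> m *\<^sub>R z) - v y - g y \<bullet> (\<epsilon> m *\<^sub>R z))"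
   using e by (simp only: bnorm_const_mult) simp
  also have "\<dots> \<le> (1 / \<epsilon> m) * (1 * norm (\<epsilon> m *\<^sub>R z))"
   using d1(2)[OF le_less_trans[OF nz e(2)]] e by (intro mult_left_mono) auto
  also have "\<dots> \<le> (1 / \<epsilon> m) * \<epsilon> m" using nz e by (intro mult_left_mono) auto
  also have "\<dots> = 1" using e by simp
  finally have b1: "bnorm R (\<lambda>y. D m z y - g y \<bullet> z) \<le> 1" .
  have "bnorm R (\<lambda>y. g y \<bullet> z) \<le> norm z * bnorm R g" by (rule loc_integrable_inner_const(2)[OF g])
  also have "\<dots> \<le> bnorm R g" using that(2) bnorm_nonneg[of R g] by (simp add: mult_left_le_one_le)
  finally have b2: "bnorm R (\<lambda>y. g y \<bullet> z) \<le> bnorm R g" .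
  have "bnorm R (D m z) \<le> bnorm R (\<lambda>y. D m z y - g y \<bullet> z) + bnorm R (\<lambda>y. g y \<bullet> z)"
  proof (rule bnorm_triangle[OF Dl loc_integrable_diff[OF Dl gl] gl])
   show "norm (D m z y) \<le> norm (D m z y - g y \<bullet> z) + norm (g y \<bullet> z)" for y
    using norm_triangle_ineq[of "D m z y - g y \<bullet> z" "g y \<bullet> z"] by simp
  qed
  then have b3: "bnorm R (D m z) \<le> 1 + bnorm R g" using b1 b2 by linarith
  have "\<bar>J m z\<bar> \<le> G * M * bnorm R (D m z)"
   unfolding J_def by (rule bnd) (auto simp: qb rb qz intro!: Dl)
  also have "\<dots> \<le> C2" unfolding C2_def using b3 G0 M0 by (intro mult_left_mono) auto
  finally show ?thesis .
 qed
 have Jm[measurable]: "J m \<in> borel_measurable borel" "J' \<in> borel_measurable borel" for m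
  unfolding J_def[abs_def] J'_def[abs_def] D_def by measurable
 have "(\<lambda>m. LBINT z. k z * J (m + N) z) \<longlonglongrightarrow> (LBINT z. k z * J' z)"
 proof (rule integral_dominated_convergence)
  show "integrable lborel (\<lambda>z. K * C2 * indicator (cball 0 1) z :: real)"
   by (intro integrable_mult_right integrable_real_indicator) (auto simp: emeasure_cball_less_top)
  show "AE z in lborel. (\<lambda>m. k z * J (m + N) z) \<longlonglongrightarrow> k z * J' z"
  proof (rule AE_I2)
   fix z show "(\<lambda>m. k z * J (m + N) z) \<longlonglongrightarrow> k z * J' z"
   proof (cases "z \<in> cball 0 1")
    case True
    show ?thesis by (intro tendsto_intros LIMSEQ_ignore_initial_segment Jlim[OF True])
   qed (simp add: kz)
  qed
  show "AE z in lborel. norm (k z * J (m + N) z) \<le> K * C2 * indicator (cball 0 1) z" for m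
  proof (rule AE_I2)
   fix z show "norm (k z * J (m + N) z) \<le> K * C2 * indicator (cball 0 1) z"
   proof (cases "z \<in> cball 0 1")
    case True
    have "\<bar>k z\<bar> * \<bar>J (m + N) z\<bar> \<le> K * C2" using K(2)[of z] Jbnd[of "m + N" z] True K(1) by (intro mult_mono) auto
    then show ?thesis using True by (simp add: abs_mult)
   qed (simp add: kz)
  qed
 qed measurable
 then have "(\<lambda>m. LBINT z. k z * J m z) \<longlonglongrightarrow> (LBINT z. k z * J' z)"
  by (rule LIMSEQ_offset)
 then show ?thesis unfolding swap J'_def .
qed

section \<open>Passage to the limit in integrals with weights; integration by parts\<close>

lemma integral_tendsto_AE_weight:
 fixes w :: "nat \<Rightarrow> R3 \<Rightarrow> real" and f :: "R3 \<Rightarrow> real"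
 assumes [measurable]: "\<And>m. w m \<in> borel_measurable borel" "w' \<in> borel_measurable borel"
  and wb: "\<And>m x. \<bar>w m x\<bar> \<le> C" and wz: "\<And>m x. x \<notin> cball 0 R \<Longrightarrow> w m x = 0"
  and ae: "AE x in lborel. (\<lambda>m. w m x) \<longlonglongrightarrow> w' x" and f: "loc_integrable f"
 shows "(\<lambda>m. LBINT x. w m x * f x) \<longlonglongrightarrow> (LBINT x. w' x * f x)"
proof -
 have [measurable]: "f \<in> borel_measurable borel" using f by (rule loc_integrable_measurable)
 show ?thesis
 proof (rule integral_dominated_convergence)
  show "integrable lborel (\<lambda>x. C * (indicator (cball 0 R) x *\<^sub>R norm (f x)))"
   by (intro integrable_mult_right loc_integrable_norm_cball f)
  show "AE x in lborel. (\<lambda>m. w m x * f x) \<longlonglongrightarrow> w' x * f x"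
   using ae by eventually_elim (intro tendsto_intros)
  show "AE x in lborel. norm (w m x * f x) \<le> C * (indicator (cball 0 R) x *\<^sub>R norm (f x))" for m
  proof (rule AE_I2)
   fix x show "norm (w m x * f x) \<le> C * (indicator (cball 0 R) x *\<^sub>R norm (f x))"
    using mult_right_mono[OF wb[of m x], of "\<bar>f x\<bar>"]
    by (cases "x \<in> cball 0 R") (auto simp: abs_mult wz)
  qed
 qed measurable
qed

lemma integrable_bounded_cball_mult:
 fixes w f :: "R3 \<Rightarrow> real"
 assumes wm: "w \<in> borel_measurable borel" and wb: "\<And>x. \<bar>w x\<bar> \<le> C" and wz: "\<And>x. x \<notin> cball 0 R \<Longrightarrow> w x = 0" and f: "loc_integrable f"
 shows "integrable lborel (\<lambda>x. w x * f x)"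
 by (rule integral_tendsto_bnorm(2)[where f = "\<lambda>n. f", OF wm wb wz f f]) (simp_all add: bnorm_def)

text \<open>For \<open>\<psi> n\<close> this is the vanishing integral of a derivative of r \<theta>
  \<open>\<psi> n\<close>. Every weight is bounded with compact support, so L^1 convergence on balls
  suffices for the limit.\<close>

lemma integration_by_parts_limit:
 fixes \<psi> :: "nat \<Rightarrow> R3 \<Rightarrow> real" and r \<theta> v :: "R3 \<Rightarrow> real" and g :: "R3 \<Rightarrow> R3"
 assumes \<psi>: "\<And>n. \<psi> n \<in> Cc_inf \<Omega>" and v: "loc_integrable v" and g: "loc_integrable g"
  and l1: "\<And>R. (\<lambda>n. bnorm R (\<lambda>x. \<psi> n x - v x)) \<longlonglongrightarrow> 0" and l2: "\<And>R. (\<lambda>n. bnorm R (\<lambda>x. grad (\<psi> n) x - g x)) \<longlonglongrightarrow> 0"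
  and r: "Ck 1 r" and \<theta>: "\<theta> \<in> Cc_inf UNIV"
 shows "(LBINT x. (\<theta> x * partial i r x) * v x) + (LBINT x. (r x * \<theta> x) * g x $ i) + (LBINT x. (r x * partial i \<theta> x) * v x) = 0"
proof -
 obtain R where R: "\<And>x. x \<notin> cball 0 R \<Longrightarrow> \<theta> x = 0" using Cc_inf_bounded_support[OF \<theta>] by metis
 have ptz: "partial i \<theta> x = 0" if "x \<notin> cball 0 R" for x by (rule partial_zero_outside[OF _ R that]) auto
 have c: "continuous_on UNIV \<theta>" "continuous_on UNIV (partial i \<theta>)" "continuous_on UNIV r" "continuous_on UNIV (partial i r)"
  using \<theta> r Ck_continuous[OF r] by (auto simp: Cc_inf_iff intro: smooth_continuous smooth_partial)
 have W: "\<exists>C. \<forall>x. \<bar>w x\<bar> \<le> C" "w \<in> borel_measurable borel" if cw: "continuous_on UNIV w" "\<And>x. x \<notin> cball 0 R \<Longrightarrow> w x = 0" for w :: "R3 \<Rightarrow> real"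
 proof -
  obtain B where "\<And>x. norm (w x) \<le> B" using bounded_continuous_cball[OF cw] by metis
  then show "\<exists>C. \<forall>x. \<bar>w x\<bar> \<le> C" by auto
  show "w \<in> borel_measurable borel" using cw(1) by (rule borel_measurable_continuous_onI)
 qed
 have W1: "continuous_on UNIV (\<lambda>x. \<theta> x * partial i r x)" "\<And>x. x \<notin> cball 0 R \<Longrightarrow> \<theta> x * partial i r x = 0"
  and W2: "continuous_on UNIV (\<lambda>x. r x * \<theta> x)" "\<And>x. x \<notin> cball 0 R \<Longrightarrow> r x * \<theta> x = 0"
  and W3: "continuous_on UNIV (\<lambda>x. r x * partial i \<theta> x)" "\<And>x. x \<notin> cball 0 R \<Longrightarrow> r x * partial i \<theta> x = 0"
  using c R ptz by (auto intro!: continuous_intros)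
 obtain C1 C2 C3 where C: "\<And>x. \<bar>\<theta> x * partial i r x\<bar> \<le> C1" "\<And>x. \<bar>r x * \<theta> x\<bar> \<le> C2" "\<And>x. \<bar>r x * partial i \<theta> x\<bar> \<le> C3"
  using W(1)[OF W1] W(1)[OF W2] W(1)[OF W3] by blast
 have lf: "loc_integrable (\<psi> n)" "loc_integrable (grad (\<psi> n))" for n using Cc_inf_loc_integrable[OF \<psi>] by auto
 have gi: "loc_integrable (\<lambda>x. g x $ i)" and fi: "loc_integrable (\<lambda>x. partial i (\<psi> n) x)" for n
  using loc_integrable_inner_const(1)[OF g, of "axis i 1"] loc_integrable_inner_const(1)[OF lf(2)[of n], of "axis i 1"]
  by (simp_all add: inner_axis)
 have l2': "(\<lambda>n. bnorm R (\<lambda>x. partial i (\<psi> n) x - g x $ i)) \<longlonglongrightarrow> 0"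
 proof (rule tendsto_sandwich[OF _ _ tendsto_const l2[of R]])
  show "\<forall>\<^sub>F n in sequentially. bnorm R (\<lambda>x. partial i (\<psi> n) x - g x $ i) \<le> bnorm R (\<lambda>x. grad (\<psi> n) x - g x)"
  proof (rule always_eventually, rule allI)
   fix n
   have "bnorm R (\<lambda>x. (grad (\<psi> n) x - g x) \<bullet> axis i 1) \<le> norm (axis i 1 :: R3) * bnorm R (\<lambda>x. grad (\<psi> n) x - g x)"
    by (intro loc_integrable_inner_const loc_integrable_diff lf g)
   then show "bnorm R (\<lambda>x. partial i (\<psi> n) x - g x $ i) \<le> bnorm R (\<lambda>x. grad (\<psi> n) x - g x)"
    by (simp add: inner_axis)
  qed
 qed (simp add: bnorm_nonneg)
 have z: "(LBINT x. (\<theta> x * partial i r x) * \<psi> n x) + (LBINT x. (r x * \<theta> x) * partial i (\<psi> n) x) + (LBINT x. (r x * partial i \<theta> x) * \<psi> n x) = 0" for n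
 proof -
  have Cks: "Ck 1 (\<psi> n)" "Ck 1 \<theta>" using \<psi> \<theta> by (auto intro: Cc_inf_Ck simp del: Ck.simps One_nat_def)
  have d: "\<psi> n differentiable (at x)" "\<theta> differentiable (at x)" "r differentiable (at x)" "(\<lambda>x. r x * \<theta> x) differentiable (at x)" for x
   using Cks r Ck_mult[OF r Cks(2)] by simp_all
  have i1: "integrable lborel (\<lambda>x. (\<theta> x * partial i r x) * \<psi> n x)"
   by (rule integrable_bounded_cball_mult[OF W(2)[OF W1] C(1) W1(2) lf(1)])
  have i2: "integrable lborel (\<lambda>x. (r x * \<theta> x) * partial i (\<psi> n) x)"
   by (rule integrable_bounded_cball_mult[OF W(2)[OF W2] C(2) W2(2) fi])
  have i3: "integrable lborel (\<lambda>x. (r x * partial i \<theta> x) * \<psi> n x)"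
   by (rule integrable_bounded_cball_mult[OF W(2)[OF W3] C(3) W3(2) lf(1)])
  have "0 = (LBINT x. partial i (\<lambda>x. (r x * \<theta> x) * \<psi> n x) x)"
   by (rule integral_partial_eq_0[symmetric, where R = R]) (auto intro!: Ck_mult r Cks simp: R simp del: Ck.simps One_nat_def)
  also have "\<dots> = (LBINT x. (\<theta> x * partial i r x) * \<psi> n x + (r x * \<theta> x) * partial i (\<psi> n) x + (r x * partial i \<theta> x) * \<psi> n x)"
   by (simp only: partial_mult[OF d(4) d(1)] partial_mult[OF d(3) d(2)]) (simp add: algebra_simps)
  also have "\<dots> = (LBINT x. (\<theta> x * partial i r x) * \<psi> n x) + (LBINT x. (r x * \<theta> x) * partial i (\<psi> n) x) + (LBINT x. (r x * partial i \<theta> x) * \<psi> n x)"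
   using i1 i2 i3 by simp
  finally show ?thesis by simp
 qed
 have "(\<lambda>n. (LBINT x. (\<theta> x * partial i r x) * \<psi> n x) + (LBINT x. (r x * \<theta> x) * partial i (\<psi> n) x) + (LBINT x. (r x * partial i \<theta> x) * \<psi> n x))
  \<longlonglongrightarrow> (LBINT x. (\<theta> x * partial i r x) * v x) + (LBINT x. (r x * \<theta> x) * g x $ i) + (LBINT x. (r x * partial i \<theta> x) * v x)"
  by (intro tendsto_add integral_tendsto_bnorm(1)[OF W(2)[OF W1] C(1) W1(2) lf(1) v l1]
    integral_tendsto_bnorm(1)[OF W(2)[OF W2] C(2) W2(2) fi gi l2']
    integral_tendsto_bnorm(1)[OF W(2)[OF W3] C(3) W3(2) lf(1) v l1])
 then show ?thesis unfolding z by (simp add: LIMSEQ_const_iff)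
qed

text \<open>Integration by parts moves the derivative onto the linear function, and the kernel has
  mass one. This evaluates the limit found in \<open>commutator_limit\<close>.\<close>

lemma integral_partial_bump_linear:
 "(LBINT z. partial i bump z * (w \<bullet> z)) = - (w $ i)"
proof -
 have d: "((\<lambda>z::R3. w \<bullet> z) has_derivative (\<lambda>h. w \<bullet> h)) (at z)" for z
  by (auto intro!: derivative_eq_intros)
 have p: "partial j (\<lambda>z::R3. w \<bullet> z) = (\<lambda>z. w $ j)" for j
  by (rule ext) (simp add: partial_eqI[OF d] inner_axis)
 have df: "(\<lambda>z::R3. w \<bullet> z) differentiable (at z)" for z using d by (auto simp: differentiable_def)
 have C: "Ck 1 (\<lambda>z::R3. w \<bullet> z)" using df by (simp add: p)
 have Cb: "Ck 1 bump" using bump_Cc_inf by (rule Cc_inf_Ck)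
 have db: "bump differentiable (at z)" for z by (rule smooth_differentiable[OF smooth_bump])
 have i1: "integrable lborel (\<lambda>z. partial i bump z * (w \<bullet> z))"
  by (rule integrable_continuous_cball[where R = 1])
   (auto simp: partial_bump_facts intro!: continuous_intros partial_bump_facts)
 have "0 = (LBINT z. partial i (\<lambda>z. bump z * (w \<bullet> z)) z)"
  by (rule integral_partial_eq_0[symmetric, where R = 1]) (auto intro!: Ck_mult C Cb simp: bump_zero simp del: Ck.simps One_nat_def)
 also have "\<dots> = (LBINT z. bump z * w $ i + partial i bump z * (w \<bullet> z))"
  by (simp add: partial_mult[OF db df] p)
 also have "\<dots> = w $ i + (LBINT z. partial i bump z * (w \<bullet> z))"
  using i1 integrable_bump by (simp add: integral_bump)
 finally show ?thesis by simp
qed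

text \<open>Up to a factor, the divergence at \<open>y\<close> is the continuity equation tested
  with the kernel scaled by \<epsilon> and centred at \<open>y\<close>.\<close>

lemma mollify_divergence_free:
 fixes \<rho> :: "R3 \<Rightarrow> real" and u :: "R3 \<Rightarrow> R3"
 assumes ru: "\<And>i. loc_integrable (\<lambda>x. \<rho> x * u x $ i)"
  and cont: "\<And>f. f \<in> Cc_inf UNIV \<Longrightarrow> (LBINT x. \<rho> x * (u x \<bullet> grad f x)) = 0"
  and "\<epsilon> > 0"
 shows "(\<Sum>i\<in>UNIV. partial i (mollify \<epsilon> (\<lambda>x. \<rho> x * u x $ i)) y) = 0"
proof -
 have e: "\<epsilon> > 0" by (rule assms(3))
 define f where "f = (\<lambda>x. bump ((1 / \<epsilon>) *\<^sub>R x + (- (1 / \<epsilon>)) *\<^sub>R y))"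
 have f: "f \<in> Cc_inf UNIV" unfolding f_def using e by (intro Cc_inf_reflected bump_Cc_inf) auto
 have pf: "partial i f x = (1 / \<epsilon>) * partial i bump ((1 / \<epsilon>) *\<^sub>R x + (- (1 / \<epsilon>)) *\<^sub>R y)" for i x
  unfolding f_def by (rule partial_affine(1)) (rule smooth_differentiable[OF smooth_bump])
 have "partial i (mollify \<epsilon> (\<lambda>x. \<rho> x * u x $ i)) y = - (1 / \<epsilon> ^ 3) * (LBINT x. \<rho> x * u x $ i * partial i f x)" for i
 proof -
  have "partial i (mollify \<epsilon> (\<lambda>x. \<rho> x * u x $ i)) y = - (1 / \<epsilon>) * (LBINT z. partial i bump z *\<^sub>R (\<rho> (y + \<epsilon> *\<^sub>R z) * u (y + \<epsilon> *\<^sub>R z) $ i))"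
   using mollify_Ck1(2)[OF ru e] by simp
  also have "(LBINT z. partial i bump z *\<^sub>R (\<rho> (y + \<epsilon> *\<^sub>R z) * u (y + \<epsilon> *\<^sub>R z) $ i))
    = (1 / \<epsilon> ^ 3) *\<^sub>R (LBINT x. partial i bump ((1 / \<epsilon>) *\<^sub>R x + (- (1 / \<epsilon>)) *\<^sub>R y) *\<^sub>R (\<rho> x * u x $ i))"
   by (rule kernel_subst[OF partial_bump_facts(1,2) ru e])
  also have "- (1 / \<epsilon>) * ((1 / \<epsilon> ^ 3) *\<^sub>R (LBINT x. partial i bump ((1 / \<epsilon>) *\<^sub>R x + (- (1 / \<epsilon>)) *\<^sub>R y) *\<^sub>R (\<rho> x * u x $ i)))
    = - (1 / \<epsilon> ^ 3) * ((1 / \<epsilon>) * (LBINT x. partial i bump ((1 / \<epsilon>) *\<^sub>R x + (- (1 / \<epsilon>)) *\<^sub>R y) *\<^sub>R (\<rho> x * u x $ i)))"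
   by simp
  also have "(1 / \<epsilon>) * (LBINT x. partial i bump ((1 / \<epsilon>) *\<^sub>R x + (- (1 / \<epsilon>)) *\<^sub>R y) *\<^sub>R (\<rho> x * u x $ i)) = (LBINT x. \<rho> x * u x $ i * partial i f x)"
   unfolding pf by (subst integral_mult_right_zero[symmetric]) (simp add: mult_ac)
  finally show ?thesis .
 qed
 then have "(\<Sum>i\<in>UNIV. partial i (mollify \<epsilon> (\<lambda>x. \<rho> x * u x $ i)) y) = - (1 / \<epsilon> ^ 3) * (\<Sum>i\<in>UNIV. LBINT x. \<rho> x * u x $ i * partial i f x)"
  by (simp add: sum_distrib_left)
 also have "(\<Sum>i\<in>UNIV. LBINT x. \<rho> x * u x $ i * partial i f x) = (LBINT x. (\<Sum>i\<in>UNIV. \<rho> x * u x $ i * partial i f x))"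
 proof (rule Bochner_Integration.integral_sum[symmetric])
  fix i :: 3
  obtain R' where R': "\<And>x. x \<notin> cball 0 R' \<Longrightarrow> partial i f x = 0" using Cc_inf_bounded_support[OF Cc_inf_partial[OF f, of i]] by metis
  have "continuous_on UNIV (partial i f)" using f by (auto simp: Cc_inf_iff intro: smooth_continuous smooth_partial)
  then have "integrable lborel (\<lambda>x. partial i f x *\<^sub>R (\<rho> x * u x $ i))"
   by (rule integrable_Cc_mult[OF _ R' ru])
  then show "integrable lborel (\<lambda>x. \<rho> x * u x $ i * partial i f x)" by (simp add: mult.commute)
 qed
 also have "(LBINT x. (\<Sum>i\<in>UNIV. \<rho> x * u x $ i * partial i f x)) = (LBINT x. \<rho> x * (u x \<bullet> grad f x))"
  by (simp add: inner_vec_def sum_distrib_left mult.assoc)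
 also have "\<dots> = 0" by (rule cont[OF f])
 finally show ?thesis by simp
qed

text \<open>The mollified density \<open>r m\<close> is smooth, so b(\<open>r m\<close>) may be
  integrated by parts against \<open>u\<close>. The chain rule leaves u \<bullet> grad
  \<open>r m\<close> with the weight \<open>q m\<close>, and because the mollified momentum is
  divergence free this is a sum of commutators, whose limit supplies the term b'(\<rho>) \<rho> tr
  A.\<close>

lemma renormalized_local:
 fixes \<psi> :: "nat \<Rightarrow> R3 \<Rightarrow> R3" and \<rho> :: "R3 \<Rightarrow> real" and u :: "R3 \<Rightarrow> R3" and A :: "R3 \<Rightarrow> real ^ 3 ^ 3"
 assumes rm[measurable]: "\<rho> \<in> borel_measurable borel" and rb: "\<And>x. 0 \<le> \<rho> x" "\<And>x. \<rho> x \<le> M"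
  and \<psi>: "\<And>n i. (\<lambda>x. \<psi> n x $ i) \<in> Cc_inf \<Omega>" and u: "\<And>i. loc_integrable (\<lambda>x. u x $ i)" and A: "\<And>i. loc_integrable (\<lambda>x. A x $ i)"
  and l1: "\<And>i R. (\<lambda>n. bnorm R (\<lambda>x. \<psi> n x $ i - u x $ i)) \<longlonglongrightarrow> 0"
  and l2: "\<And>i R. (\<lambda>n. bnorm R (\<lambda>x. grad (\<lambda>x. \<psi> n x $ i) x - A x $ i)) \<longlonglongrightarrow> 0"
  and cont: "\<And>f. f \<in> Cc_inf UNIV \<Longrightarrow> (LBINT x. \<rho> x * (u x \<bullet> grad f x)) = 0"
  and b: "\<And>r. (b has_real_derivative b' r) (at r)" and b': "continuous_on UNIV b'"
  and \<theta>: "\<theta> \<in> Cc_inf UNIV"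
 shows "(LBINT x. \<theta> x * ((b' (\<rho> x) * \<rho> x - b (\<rho> x)) * trace (A x))) = (LBINT x. b (\<rho> x) * (u x \<bullet> grad \<theta> x))"
proof -
 have lr: "loc_integrable \<rho>" by (rule loc_integrable_bounded[OF rm, of M]) (use rb in auto)
 have rabs: "\<bar>\<rho> x\<bar> \<le> M" for x using rb[of x] by simp
 have ru: "loc_integrable (\<lambda>x. \<rho> x * u x $ i)" for i
  using loc_integrable_bounded_mult[OF u rm rabs, of i] by simp
 have bc: "continuous_on UNIV b" using b by (meson DERIV_isCont continuous_at_imp_continuous_on)
 have [measurable]: "b \<in> borel_measurable borel" "b' \<in> borel_measurable borel"
  using bc b' by (auto intro: borel_measurable_continuous_onI)
 have ct: "continuous_on UNIV \<theta>" "continuous_on UNIV (grad \<theta>)" "\<And>i. continuous_on UNIV (partial i \<theta>)"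
  using \<theta> by (auto simp: Cc_inf_iff intro: smooth_continuous smooth_grad_continuous smooth_partial)
 have [measurable]: "\<theta> \<in> borel_measurable borel" "grad \<theta> \<in> borel_measurable borel" "\<And>i. partial i \<theta> \<in> borel_measurable borel"
  using ct by (auto intro: borel_measurable_continuous_onI)
 obtain R where R: "\<And>x. x \<notin> cball 0 R \<Longrightarrow> \<theta> x = 0" using Cc_inf_bounded_support[OF \<theta>] by metis
 have ptz: "partial i \<theta> x = 0" if "x \<notin> cball 0 R" for x i by (rule partial_zero_outside[OF _ R that]) auto
 obtain X where X: "X > 0" "\<And>x. norm (\<theta> x) \<le> X" using bounded_continuous_cball[OF ct(1) R] by metis
 have gtz: "grad \<theta> x = 0" if "x \<notin> cball 0 R" for x using ptz[OF that] by (simp add: vec_eq_iff)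
 obtain Y where Y: "Y > 0" "\<And>x. norm (grad \<theta> x) \<le> Y" using bounded_continuous_cball[OF ct(2) gtz] by metis
 have Yp: "\<bar>partial i \<theta> x\<bar> \<le> Y" for i x using order_trans[OF component_le_norm_cart[of "grad \<theta> x" i] Y(2)] by simp
 have bnd: "\<exists>G. \<forall>r\<in>{0..M}. \<bar>h r\<bar> \<le> G" if "continuous_on UNIV h" for h :: "real \<Rightarrow> real"
 proof -
  have "compact (h ` {0..M})" by (intro compact_continuous_image continuous_on_subset[OF that]) auto
  then show ?thesis using compact_imp_bounded by (fastforce simp: bounded_iff)
 qed
 obtain G0 where G0: "\<And>r. r \<in> {0..M} \<Longrightarrow> \<bar>b' r\<bar> \<le> G0" using bnd[OF b'] by blast
 obtain B0 where B0: "\<And>r. r \<in> {0..M} \<Longrightarrow> \<bar>b r\<bar> \<le> B0" using bnd[OF bc] by blast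
 have B00: "B0 \<ge> 0" using B0[of "\<rho> 0"] rb[of 0] by auto
 obtain \<epsilon> where \<epsilon>: "\<And>m::nat. 0 < \<epsilon> m" "\<And>m. \<epsilon> m \<le> 1" "\<epsilon> \<longlonglongrightarrow> 0" 
  and ae: "AE x in lborel. x \<in> cball 0 R \<longrightarrow> (\<lambda>m. mollify (\<epsilon> m) \<rho> x) \<longlonglongrightarrow> \<rho> x"
  using mollify_AE_seq[OF lr, of R] by blast
 define r where "r m = mollify (\<epsilon> m) \<rho>" for m
 have rC: "Ck 1 (r m)" for m unfolding r_def by (rule mollify_Ck1(1)[OF lr \<epsilon>(1)])
 have rd: "r m differentiable (at x)" for m x using rC by simp
 have rM: "r m x \<in> {0..M}" for m x unfolding r_def using mollify_bounds[OF rm rb \<epsilon>(1)] by simp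
 have \<rho>M: "\<rho> x \<in> {0..M}" for x using rb by simp
 have rmeas[measurable]: "r m \<in> borel_measurable borel" for m unfolding r_def by measurable
 define q where "q m x = \<theta> x * b' (r m x)" for m x
 define q' where "q' x = \<theta> x * b' (\<rho> x)" for x
 have qm[measurable]: "q m \<in> borel_measurable borel" "q' \<in> borel_measurable borel" for m
  unfolding q_def[abs_def] q'_def[abs_def] by measurable
 have qb: "\<bar>q m x\<bar> \<le> X * G0" "\<bar>q' x\<bar> \<le> X * G0" for m x
 proof -
  have "\<bar>\<theta> x\<bar> * \<bar>b' (r m x)\<bar> \<le> X * G0" "\<bar>\<theta> x\<bar> * \<bar>b' (\<rho> x)\<bar> \<le> X * G0"
   using X(1) X(2)[of x] G0[OF rM[of m x]] G0[OF \<rho>M[of x]] by (intro mult_mono; simp)+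
  then show "\<bar>q m x\<bar> \<le> X * G0" "\<bar>q' x\<bar> \<le> X * G0" by (simp_all add: q_def q'_def abs_mult)
 qed
 have qz: "q m x = 0" "q' x = 0" if "x \<notin> cball 0 R" for m x using R[OF that] by (auto simp: q_def q'_def)
 have ae2: "AE x in lborel. x \<in> cball 0 R \<longrightarrow> (\<lambda>m. h (r m x)) \<longlonglongrightarrow> h (\<rho> x)" if h: "continuous_on UNIV h" for h :: "real \<Rightarrow> real"
  using ae
 proof eventually_elim
  case (elim x)
  show ?case
  proof
   assume "x \<in> cball 0 R"
   then have "(\<lambda>m. r m x) \<longlonglongrightarrow> \<rho> x" using elim by (simp add: r_def)
   moreover have "isCont h (\<rho> x)" using h by (simp add: continuous_on_eq_continuous_at)
   ultimately show "(\<lambda>m. h (r m x)) \<longlonglongrightarrow> h (\<rho> x)" using isCont_tendsto_compose by blast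
  qed
 qed
 have aew: "AE x in lborel. (\<lambda>m. s x * h (r m x)) \<longlonglongrightarrow> s x * h (\<rho> x)" 
  if h: "continuous_on UNIV h" and s: "\<And>x. x \<notin> cball 0 R \<Longrightarrow> s x = 0" for h :: "real \<Rightarrow> real" and s :: "R3 \<Rightarrow> real"
  using ae2[OF h]
 proof eventually_elim
  case (elim x)
  show ?case
  proof (cases "x \<in> cball 0 R")
   case True
   then show ?thesis using elim by (intro tendsto_intros) auto
  qed (simp add: s)
 qed
 \<comment> \<open>The commutator between mollification and multiplication by a velocity component:
   u times the derivative of the mollified density, minus the derivative of the mollified momentum.
   The factor 1/\<epsilon> from differentiating the kernel turns the velocity increment into a
   difference quotient.\<close>
 define T where "T m i y = (LBINT z. partial i bump z * (\<rho> (y + \<epsilon> m *\<^sub>R z) * ((u (y + \<epsilon> m *\<^sub>R z) $ i - u y $ i) / \<epsilon> m)))" for m i y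
 have Teq: "T m i y = - partial i (mollify (\<epsilon> m) (\<lambda>x. \<rho> x * u x $ i)) y + u y $ i * partial i (r m) y" for m i y
 proof -
  have e: "\<epsilon> m > 0" "\<epsilon> m \<noteq> 0" using \<epsilon>(1)[of m] by auto
  have j1: "integrable lborel (\<lambda>z. partial i bump z * (\<rho> (y + \<epsilon> m *\<^sub>R z) * u (y + \<epsilon> m *\<^sub>R z) $ i))"
   using integrable_Cc_mult[OF partial_bump_facts(1)[of i] partial_bump_facts(2)[of _ i] loc_integrable_affine[OF ru[of i] e(2), of y]] by simp
  have j2: "integrable lborel (\<lambda>z. partial i bump z * \<rho> (y + \<epsilon> m *\<^sub>R z))"
   using integrable_Cc_mult[OF partial_bump_facts(1)[of i] partial_bump_facts(2)[of _ i] loc_integrable_affine[OF lr e(2), of y]] by simp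
  have "T m i y = (LBINT z. (1 / \<epsilon> m) * (partial i bump z * (\<rho> (y + \<epsilon> m *\<^sub>R z) * u (y + \<epsilon> m *\<^sub>R z) $ i)) - (u y $ i / \<epsilon> m) * (partial i bump z * \<rho> (y + \<epsilon> m *\<^sub>R z)))"
   unfolding T_def using e by (intro Bochner_Integration.integral_cong refl) (simp add: field_simps)
  also have "\<dots> = (1 / \<epsilon> m) * (LBINT z. partial i bump z * (\<rho> (y + \<epsilon> m *\<^sub>R z) * u (y + \<epsilon> m *\<^sub>R z) $ i)) - (u y $ i / \<epsilon> m) * (LBINT z. partial i bump z * \<rho> (y + \<epsilon> m *\<^sub>R z))"
   using j1 j2 by (subst Bochner_Integration.integral_diff) auto
  finally show ?thesis unfolding r_def mollify_Ck1(2)[OF lr e(1)] mollify_Ck1(2)[OF ru e(1)] by simp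
 qed
 have divfree: "(\<Sum>i\<in>UNIV. partial i (mollify (\<epsilon> m) (\<lambda>x. \<rho> x * u x $ i)) y) = 0" for m y
  by (rule mollify_divergence_free[OF ru cont \<epsilon>(1)])
 have brC: "Ck 1 (\<lambda>x. b (r m x))" and brp: "partial i (\<lambda>x. b (r m x)) x = b' (r m x) * partial i (r m) x" for m i x
 proof -
  show p: "partial i (\<lambda>x. b (r m x)) x = b' (r m x) * partial i (r m) x" for i x
   by (rule partial_chain(1)[OF rd b])
  have "continuous_on UNIV (r m)" "\<And>i. continuous_on UNIV (partial i (r m))" using rC[of m] Ck_continuous[OF rC[of m]] by simp_all
  then have "continuous_on UNIV (\<lambda>x. b' (r m x) * partial i (r m) x)" for i
   by (intro continuous_on_mult continuous_on_compose2[OF b']) auto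
  then show "Ck 1 (\<lambda>x. b (r m x))"
   using partial_chain(2)[OF rd b] by (simp add: p[abs_def])
 qed
 have ibp: "(LBINT x. (\<theta> x * partial i (\<lambda>x. b (r m x)) x) * u x $ i) + (LBINT x. (b (r m x) * \<theta> x) * A x $ i $ i) + (LBINT x. (b (r m x) * partial i \<theta> x) * u x $ i) = 0" for i m
  by (rule integration_by_parts_limit[OF \<psi> u A l1 l2 brC \<theta>])
 \<comment> \<open>Only the sum over the three directions removes the mollified momentum; a single
   term need not vanish.\<close>
 have sumT: "(\<Sum>i\<in>UNIV. LBINT x. (\<theta> x * partial i (\<lambda>x. b (r m x)) x) * u x $ i) = (\<Sum>i\<in>UNIV. LBINT x. q m x * T m i x)" for m
 proof -
  have ia: "integrable lborel (\<lambda>x. (q m x * partial i (r m) x) * u x $ i)" for i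
  proof -
   have cont: "continuous_on UNIV (\<lambda>x. q m x * partial i (r m) x)"
    unfolding q_def using rC[of m] Ck_continuous[OF rC[of m]] ct
    by (intro continuous_on_mult continuous_on_compose2[OF b']) auto
   have z: "q m x * partial i (r m) x = 0" if "x \<notin> cball 0 R" for x using qz(1)[OF that] by simp
   have "integrable lborel (\<lambda>x. (q m x * partial i (r m) x) *\<^sub>R u x $ i)"
    by (rule integrable_Cc_mult[OF cont z u])
   then show ?thesis by simp
  qed
  have ib: "integrable lborel (\<lambda>x. q m x * partial i (mollify (\<epsilon> m) (\<lambda>x. \<rho> x * u x $ i)) x)" for i
  proof (rule integrable_continuous_cball[where R = R])
   have "continuous_on UNIV (partial i (mollify (\<epsilon> m) (\<lambda>x. \<rho> x * u x $ i)))"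
    using mollify_Ck1(1)[OF ru[of i] \<epsilon>(1)[of m]] by simp
   then show "continuous_on UNIV (\<lambda>x. q m x * partial i (mollify (\<epsilon> m) (\<lambda>x. \<rho> x * u x $ i)) x)"
    unfolding q_def using Ck_continuous[OF rC[of m]] ct
    by (intro continuous_on_mult continuous_on_compose2[OF b']) auto
  qed (simp add: qz)
  have "(\<Sum>i\<in>UNIV. LBINT x. q m x * T m i x)
    = (\<Sum>i\<in>UNIV. (LBINT x. (q m x * partial i (r m) x) * u x $ i) - (LBINT x. q m x * partial i (mollify (\<epsilon> m) (\<lambda>x. \<rho> x * u x $ i)) x))"
  proof (rule sum.cong[OF refl])
   fix i :: 3
   have "(LBINT x. q m x * T m i x) = (LBINT x. (q m x * partial i (r m) x) * u x $ i - q m x * partial i (mollify (\<epsilon> m) (\<lambda>x. \<rho> x * u x $ i)) x)"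
    unfolding Teq by (intro Bochner_Integration.integral_cong refl) (simp add: algebra_simps)
   then show "(LBINT x. q m x * T m i x) = (LBINT x. (q m x * partial i (r m) x) * u x $ i) - (LBINT x. q m x * partial i (mollify (\<epsilon> m) (\<lambda>x. \<rho> x * u x $ i)) x)"
    using ia ib by simp
  qed
  also have "\<dots> = (\<Sum>i\<in>UNIV. LBINT x. (q m x * partial i (r m) x) * u x $ i) - (LBINT x. (\<Sum>i\<in>UNIV. q m x * partial i (mollify (\<epsilon> m) (\<lambda>x. \<rho> x * u x $ i)) x))"
   using ib by (simp add: sum_subtractf)
  also have "(\<lambda>x. (\<Sum>i\<in>UNIV. q m x * partial i (mollify (\<epsilon> m) (\<lambda>x. \<rho> x * u x $ i)) x)) = (\<lambda>x. 0)"
   by (rule ext) (simp only: sum_distrib_left[symmetric] divfree mult_zero_right)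
  finally show ?thesis by (simp add: brp q_def mult.assoc)
 qed
 define a where "a i = (LBINT x. (q' x * \<rho> x) * A x $ i $ i)" for i
 have limT: "(\<lambda>m. LBINT x. q m x * T m i x) \<longlonglongrightarrow> - a i" for i
 proof -
  have cl: "(\<lambda>m. LBINT x. q m x * T m i x) \<longlonglongrightarrow> (LBINT z. partial i bump z * (LBINT y. q' y * (\<rho> y * (A y $ i \<bullet> z))))"
   unfolding T_def
  proof (rule commutator_limit[OF rm rabs u A _ partial_bump_facts(1,2) qm qb qz _ \<epsilon>])
   show "\<exists>d>0. d \<le> 1 \<and> (\<forall>h. norm h < d \<longrightarrow> bnorm R (\<lambda>y. u (y + h) $ i - u y $ i - A y $ i \<bullet> h) \<le> e * norm h)" if "e > 0" for e
    by (rule difference_quotient[OF \<psi> u A l1 l2 that])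
   show "AE x in lborel. (\<lambda>m. q m x) \<longlonglongrightarrow> q' x"
    unfolding q_def q'_def by (rule aew[OF b' R])
  qed
  \<comment> \<open>The inner integral of the limit is linear in \<open>z\<close>, namely
    \<open>w \<bullet> z\<close>; \<open>integral_partial_bump_linear\<close> then gives minus the
    i-th component of \<open>w\<close>, which is \<open>- a i\<close>.\<close>
  define w where "w = (LBINT y. (q' y * \<rho> y) *\<^sub>R A y $ i)"
  have iw: "integrable lborel (\<lambda>y. (q' y * \<rho> y) *\<^sub>R A y $ i)"
  proof -
   have qr: "\<bar>q' x * \<rho> x\<bar> \<le> X * G0 * M" for x
    unfolding abs_mult using qb(2)[of x] rabs[of x] by (intro mult_mono) auto
   have "integrable lborel (\<lambda>x. indicator (cball 0 R) x *\<^sub>R ((q' x * \<rho> x) *\<^sub>R A x $ i))"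
    by (intro loc_integrable_cball loc_integrable_bounded_mult[OF A _ qr]) measurable
   moreover have "(\<lambda>x. indicator (cball 0 R) x *\<^sub>R ((q' x * \<rho> x) *\<^sub>R A x $ i)) = (\<lambda>y. (q' y * \<rho> y) *\<^sub>R A y $ i)"
   proof
    fix x show "indicator (cball 0 R) x *\<^sub>R ((q' x * \<rho> x) *\<^sub>R A x $ i) = (q' x * \<rho> x) *\<^sub>R A x $ i"
     using qz(2)[of x] by (cases "x \<in> cball 0 R") auto
   qed
   ultimately show ?thesis by simp
  qed
  have inn: "(LBINT y. q' y * (\<rho> y * (A y $ i \<bullet> z))) = w \<bullet> z" for z
   unfolding w_def using integral_inner_left[OF iw, of z] by (simp add: mult.assoc)
  have "w $ i = w \<bullet> axis i 1" by (simp add: inner_axis)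
  also have "\<dots> = a i" unfolding inn[symmetric] a_def by (simp add: inner_axis mult.assoc)
  finally show ?thesis using cl unfolding inn integral_partial_bump_linear by simp
 qed
 have limA: "(\<lambda>m. LBINT x. (b (r m x) * \<theta> x) * A x $ i $ i) \<longlonglongrightarrow> (LBINT x. (b (\<rho> x) * \<theta> x) * A x $ i $ i)"
  and limu: "(\<lambda>m. LBINT x. (b (r m x) * partial i \<theta> x) * u x $ i) \<longlonglongrightarrow> (LBINT x. (b (\<rho> x) * partial i \<theta> x) * u x $ i)" for i
 proof -
  have Aii: "loc_integrable (\<lambda>x. A x $ i $ i)" using loc_integrable_inner_const(1)[OF A[of i], of "axis i 1"] by (simp add: inner_axis)
  show "(\<lambda>m. LBINT x. (b (r m x) * \<theta> x) * A x $ i $ i) \<longlonglongrightarrow> (LBINT x. (b (\<rho> x) * \<theta> x) * A x $ i $ i)"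
  proof (rule integral_tendsto_AE_weight[OF _ _ _ _ _ Aii])
   show "\<bar>b (r m x) * \<theta> x\<bar> \<le> B0 * X" for m x unfolding abs_mult using B0[OF rM[of m x]] X(2)[of x] B00 by (intro mult_mono) auto
   show "b (r m x) * \<theta> x = 0" if "x \<notin> cball 0 R" for m x using R[OF that] by simp
   show "AE x in lborel. (\<lambda>m. b (r m x) * \<theta> x) \<longlonglongrightarrow> b (\<rho> x) * \<theta> x"
    using aew[where s = "\<theta>", OF bc R] by (simp add: mult.commute)
  qed measurable
  show "(\<lambda>m. LBINT x. (b (r m x) * partial i \<theta> x) * u x $ i) \<longlonglongrightarrow> (LBINT x. (b (\<rho> x) * partial i \<theta> x) * u x $ i)"
  proof (rule integral_tendsto_AE_weight[OF _ _ _ _ _ u])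
   show "\<bar>b (r m x) * partial i \<theta> x\<bar> \<le> B0 * Y" for m x unfolding abs_mult using B0[OF rM[of m x]] Yp[of i x] B00 by (intro mult_mono) auto
   show "b (r m x) * partial i \<theta> x = 0" if "x \<notin> cball 0 R" for m x using ptz[OF that] by simp
   show "AE x in lborel. (\<lambda>m. b (r m x) * partial i \<theta> x) \<longlonglongrightarrow> b (\<rho> x) * partial i \<theta> x"
    using aew[where s = "partial i \<theta>", OF bc ptz] by (simp add: mult.commute)
  qed measurable
 qed
 have "(\<lambda>m. (\<Sum>i\<in>UNIV. LBINT x. q m x * T m i x) + (\<Sum>i\<in>UNIV. LBINT x. (b (r m x) * \<theta> x) * A x $ i $ i) + (\<Sum>i\<in>UNIV. LBINT x. (b (r m x) * partial i \<theta> x) * u x $ i))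
  \<longlonglongrightarrow> (\<Sum>i\<in>UNIV. - a i) + (\<Sum>i\<in>UNIV. LBINT x. (b (\<rho> x) * \<theta> x) * A x $ i $ i) + (\<Sum>i\<in>UNIV. LBINT x. (b (\<rho> x) * partial i \<theta> x) * u x $ i)"
  by (intro tendsto_add tendsto_sum limT limA limu)
 moreover have "(\<Sum>i\<in>UNIV. LBINT x. q m x * T m i x) + (\<Sum>i\<in>UNIV. LBINT x. (b (r m x) * \<theta> x) * A x $ i $ i) + (\<Sum>i\<in>UNIV. LBINT x. (b (r m x) * partial i \<theta> x) * u x $ i) = 0" for m
  unfolding sumT[symmetric] sum.distrib[symmetric] by (intro sum.neutral ballI ibp)
 ultimately have key: "(\<Sum>i\<in>UNIV. - a i) + (\<Sum>i\<in>UNIV. LBINT x. (b (\<rho> x) * \<theta> x) * A x $ i $ i) + (\<Sum>i\<in>UNIV. LBINT x. (b (\<rho> x) * partial i \<theta> x) * u x $ i) = 0"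
  by (simp only: LIMSEQ_const_iff)
 have Aii: "loc_integrable (\<lambda>x. A x $ i $ i)" for i using loc_integrable_inner_const(1)[OF A[of i], of "axis i 1"] by (simp add: inner_axis)
 have ia: "integrable lborel (\<lambda>x. (q' x * \<rho> x) * A x $ i $ i)" for i
 proof (rule integrable_bounded_cball_mult[OF _ _ _ Aii])
  show "\<bar>q' x * \<rho> x\<bar> \<le> X * G0 * M" for x
   unfolding abs_mult using qb(2)[of x] rabs[of x] by (intro mult_mono) auto
  show "q' x * \<rho> x = 0" if "x \<notin> cball 0 R" for x using qz(2)[OF that] by simp
 qed measurable
 have ib: "integrable lborel (\<lambda>x. (b (\<rho> x) * \<theta> x) * A x $ i $ i)" for i
 proof (rule integrable_bounded_cball_mult[OF _ _ _ Aii])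
  show "\<bar>b (\<rho> x) * \<theta> x\<bar> \<le> B0 * X" for x unfolding abs_mult using B0[OF \<rho>M[of x]] X(2)[of x] B00 by (intro mult_mono) auto
  show "b (\<rho> x) * \<theta> x = 0" if "x \<notin> cball 0 R" for x using R[OF that] by simp
 qed measurable
 have ic: "integrable lborel (\<lambda>x. (b (\<rho> x) * partial i \<theta> x) * u x $ i)" for i
 proof (rule integrable_bounded_cball_mult[OF _ _ _ u])
  show "\<bar>b (\<rho> x) * partial i \<theta> x\<bar> \<le> B0 * Y" for x unfolding abs_mult using B0[OF \<rho>M[of x]] Yp[of i x] B00 by (intro mult_mono) auto
  show "b (\<rho> x) * partial i \<theta> x = 0" if "x \<notin> cball 0 R" for x using ptz[OF that] by simp
 qed measurable
 have "(LBINT x. \<theta> x * ((b' (\<rho> x) * \<rho> x - b (\<rho> x)) * trace (A x))) = (LBINT x. (\<Sum>i\<in>UNIV. (q' x * \<rho> x) * A x $ i $ i) - (\<Sum>i\<in>UNIV. (b (\<rho> x) * \<theta> x) * A x $ i $ i))"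
  by (intro Bochner_Integration.integral_cong refl)
   (simp add: q'_def trace_def sum_distrib_left[symmetric] algebra_simps)
 also have "\<dots> = (\<Sum>i\<in>UNIV. a i) - (\<Sum>i\<in>UNIV. LBINT x. (b (\<rho> x) * \<theta> x) * A x $ i $ i)"
  unfolding a_def using ia ib by simp
 also have "\<dots> = (\<Sum>i\<in>UNIV. LBINT x. (b (\<rho> x) * partial i \<theta> x) * u x $ i)"
  using key by (simp add: sum_negf)
 also have "\<dots> = (LBINT x. (\<Sum>i\<in>UNIV. (b (\<rho> x) * partial i \<theta> x) * u x $ i))"
  using ic by simp
 also have "\<dots> = (LBINT x. b (\<rho> x) * (u x \<bullet> grad \<theta> x))"
  by (simp add: inner_vec_def sum_distrib_left mult_ac)
 finally show ?thesis .
qed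

text \<open>The dilated kernels \<theta> n tend pointwise to the positive number
  \<open>bump 0\<close>, with gradients of size at most \<open>L\<close> times 1/(n+1).
  Integrability of b(\<rho>) |u| makes the flux term of \<open>renormalized_local\<close> vanish,
  and \<open>bump 0\<close> is divided out.\<close>

lemma renormalized_global:
 fixes \<psi> :: "nat \<Rightarrow> R3 \<Rightarrow> R3" and \<rho> :: "R3 \<Rightarrow> real" and u :: "R3 \<Rightarrow> R3" and A :: "R3 \<Rightarrow> real ^ 3 ^ 3"
 assumes rm[measurable]: "\<rho> \<in> borel_measurable borel" and rb: "\<And>x. 0 \<le> \<rho> x" "\<And>x. \<rho> x \<le> M"
  and \<psi>: "\<And>n i. (\<lambda>x. \<psi> n x $ i) \<in> Cc_inf \<Omega>" and u: "\<And>i. loc_integrable (\<lambda>x. u x $ i)" and A: "\<And>i. loc_integrable (\<lambda>x. A x $ i)"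
  and l1: "\<And>i R. (\<lambda>n. bnorm R (\<lambda>x. \<psi> n x $ i - u x $ i)) \<longlonglongrightarrow> 0"
  and l2: "\<And>i R. (\<lambda>n. bnorm R (\<lambda>x. grad (\<lambda>x. \<psi> n x $ i) x - A x $ i)) \<longlonglongrightarrow> 0"
  and cont: "\<And>f. f \<in> Cc_inf UNIV \<Longrightarrow> (LBINT x. \<rho> x * (u x \<bullet> grad f x)) = 0"
  and b: "\<And>r. (b has_real_derivative b' r) (at r)" and b': "continuous_on UNIV b'"
  and um[measurable]: "u \<in> borel_measurable borel"
  and i1: "integrable lborel (\<lambda>x. (b' (\<rho> x) * \<rho> x - b (\<rho> x)) * trace (A x))"
  and i2: "integrable lborel (\<lambda>x. b (\<rho> x) * norm (u x))"
 shows "(LBINT x. (b' (\<rho> x) * \<rho> x - b (\<rho> x)) * trace (A x)) = 0"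
proof -
 let ?F = "\<lambda>x. (b' (\<rho> x) * \<rho> x - b (\<rho> x)) * trace (A x)" and ?t = "\<lambda>n. inverse (real (Suc n))"
 define \<theta> where "\<theta> n x = bump (?t n *\<^sub>R x + 0)" for n x
 have bc: "continuous_on UNIV b" using b by (meson DERIV_isCont continuous_at_imp_continuous_on)
 have [measurable]: "b \<in> borel_measurable borel" using bc by (rule borel_measurable_continuous_onI)
 have \<theta>: "\<theta> n \<in> Cc_inf UNIV" for n unfolding \<theta>_def[abs_def] by (intro Cc_inf_reflected bump_Cc_inf) simp
 have pt: "partial i (\<theta> n) x = ?t n * partial i bump (?t n *\<^sub>R x + 0)" for i n x
  unfolding \<theta>_def[abs_def] by (rule partial_affine(1)) (rule smooth_differentiable[OF smooth_bump])
 have gt: "grad (\<theta> n) x = ?t n *\<^sub>R grad bump (?t n *\<^sub>R x + 0)" for n x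
  by (simp add: vec_eq_iff pt)
 have cb: "continuous_on UNIV bump" "continuous_on UNIV (grad bump)"
  by (intro smooth_continuous smooth_bump, intro smooth_grad_continuous smooth_bump)
 have gz: "grad bump x = 0" if "x \<notin> cball 0 1" for x by (rule grad_zero_outside[of "cball 0 1"]) (use that in \<open>auto simp: bump_zero\<close>)
 obtain X where X: "\<And>x. norm (bump x) \<le> X" using bounded_continuous_cball[OF cb(1) bump_zero] by metis
 obtain L where L: "L > 0" "\<And>x. norm (grad bump x) \<le> L" using bounded_continuous_cball[OF cb(2) gz] by metis
 have \<theta>m[measurable]: "\<theta> n \<in> borel_measurable borel" "grad (\<theta> n) \<in> borel_measurable borel" for n
  using Cc_inf_integrable_sq[OF \<theta>] by auto
 have Fm[measurable]: "?F \<in> borel_measurable borel" using i1 by auto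
 have "(\<lambda>n. LBINT x. \<theta> n x * ?F x) \<longlonglongrightarrow> (LBINT x. bump 0 * ?F x)"
 proof (rule integral_dominated_convergence)
  show "integrable lborel (\<lambda>x. X * norm (?F x))" using i1 by (intro integrable_mult_right integrable_norm)
  show "AE x in lborel. (\<lambda>n. \<theta> n x * ?F x) \<longlonglongrightarrow> bump 0 * ?F x"
  proof (rule AE_I2)
   fix x :: R3
   have "(\<lambda>n. ?t n *\<^sub>R x + 0) \<longlonglongrightarrow> 0 *\<^sub>R x + 0" by (intro tendsto_intros LIMSEQ_inverse_real_of_nat)
   then have "(\<lambda>n. bump (?t n *\<^sub>R x + 0)) \<longlonglongrightarrow> bump (0 *\<^sub>R x + 0)"
    using cb(1) by (intro isCont_tendsto_compose[of _ bump]) (auto simp: continuous_on_eq_continuous_at)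
   then have "(\<lambda>n. \<theta> n x) \<longlonglongrightarrow> bump 0" by (simp add: \<theta>_def)
   then show "(\<lambda>n. \<theta> n x * ?F x) \<longlonglongrightarrow> bump 0 * ?F x" by (rule tendsto_mult[OF _ tendsto_const])
  qed
  show "AE x in lborel. norm (\<theta> n x * ?F x) \<le> X * norm (?F x)" for n
  proof (rule AE_I2)
   fix x
   have "norm (\<theta> n x * ?F x) = norm (\<theta> n x) * norm (?F x)" by (rule norm_mult)
   also have "\<dots> \<le> X * norm (?F x)" unfolding \<theta>_def by (intro mult_right_mono X) simp
   finally show "norm (\<theta> n x * ?F x) \<le> X * norm (?F x)" .
  qed
 qed measurable
 moreover have "(\<lambda>n. LBINT x. \<theta> n x * ?F x) \<longlonglongrightarrow> 0"
 proof (rule Lim_null_comparison)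
  have i2': "integrable lborel (\<lambda>x. \<bar>b (\<rho> x)\<bar> * norm (u x))" using integrable_norm[OF i2] by (simp add: abs_mult)
  show "(\<lambda>n. ?t n * (L * (LBINT x. \<bar>b (\<rho> x)\<bar> * norm (u x)))) \<longlonglongrightarrow> 0"
   using tendsto_mult[OF LIMSEQ_inverse_real_of_nat tendsto_const] by simp
  show "\<forall>\<^sub>F n in sequentially. norm (LBINT x. \<theta> n x * ?F x) \<le> ?t n * (L * (LBINT x. \<bar>b (\<rho> x)\<bar> * norm (u x)))"
  proof (rule always_eventually, rule allI)
   fix n
   have le: "norm (b (\<rho> x) * (u x \<bullet> grad (\<theta> n) x)) \<le> ?t n * (L * (\<bar>b (\<rho> x)\<bar> * norm (u x)))" for x
   proof -
    have "\<bar>u x \<bullet> grad (\<theta> n) x\<bar> \<le> norm (u x) * norm (grad (\<theta> n) x)" by (rule Cauchy_Schwarz_ineq2)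
    also have "\<dots> \<le> norm (u x) * (?t n * L)" unfolding gt using L(2) by (intro mult_left_mono) (auto intro!: mult_left_mono)
    finally have "\<bar>b (\<rho> x)\<bar> * \<bar>u x \<bullet> grad (\<theta> n) x\<bar> \<le> \<bar>b (\<rho> x)\<bar> * (norm (u x) * (?t n * L))" by (rule mult_left_mono) simp
    then show ?thesis by (simp only: real_norm_def abs_mult mult_ac)
   qed
   have i3: "integrable lborel (\<lambda>x. ?t n * (L * (\<bar>b (\<rho> x)\<bar> * norm (u x))))" using i2' by (intro integrable_mult_right)
   have i4: "integrable lborel (\<lambda>x. b (\<rho> x) * (u x \<bullet> grad (\<theta> n) x))"
    by (rule Bochner_Integration.integrable_bound[OF i3]) (use le in \<open>auto intro!: AE_I2 order_trans[OF _ abs_ge_self]\<close>)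
   have "norm (LBINT x. \<theta> n x * ?F x) = norm (LBINT x. b (\<rho> x) * (u x \<bullet> grad (\<theta> n) x))"
    by (simp only: renormalized_local[OF rm rb \<psi> u A l1 l2 cont b b' \<theta>])
   also have "\<dots> \<le> (LBINT x. norm (b (\<rho> x) * (u x \<bullet> grad (\<theta> n) x)))" by (rule integral_norm_bound)
   also have "\<dots> \<le> (LBINT x. ?t n * (L * (\<bar>b (\<rho> x)\<bar> * norm (u x))))"
    by (rule integral_mono[OF integrable_norm[OF i4] i3 le])
   finally show "norm (LBINT x. \<theta> n x * ?F x) \<le> ?t n * (L * (LBINT x. \<bar>b (\<rho> x)\<bar> * norm (u x)))" by simp
  qed
 qed
 ultimately have "(LBINT x. bump 0 * ?F x) = 0" by (rule LIMSEQ_unique)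
 then show ?thesis using bump_0_pos by simp
qed

section \<open>The energy argument\<close>

lemma Young_bound:
 fixes a b d p q :: real
 assumes pq: "p > 1" "q > 1" "1 / p + 1 / q = 1" and ab: "a \<ge> 0" "b \<ge> 0" and d: "d > 0"
 shows "a * b \<le> d powr p * a powr p + (1 / d) powr q * b powr q"
proof -
 have "a * b = (d * a) * (b / d)" using d by simp
 also have "\<dots> \<le> (d * a) powr p / p + (b / d) powr q / q"
  using d ab by (intro Youngs_inequality pq) auto
 also have "\<dots> \<le> (d * a) powr p + (b / d) powr q"
 proof -
  have dv: "y / s \<le> y" if "y \<ge> 0" "s > 1" for y s :: real
   using that mult_left_mono[of 1 s y] by (simp add: pos_divide_le_eq)
  show ?thesis by (intro add_mono dv pq) auto
 qed
 also have "\<dots> = d powr p * a powr p + (1 / d) powr q * b powr q"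
  using d ab by (simp add: powr_mult powr_divide)
 finally show ?thesis .
qed

text \<open>An additive form of Hoelder's inequality: the weight \<open>d\<close> replaces the
  optimization that produces the product of the norms. It suffices for integrability and for
  limits.\<close>

lemma Holder_integrable:
 fixes f :: "'a \<Rightarrow> 'b::{banach, second_countable_topology}" and g :: "'a \<Rightarrow> 'c::{banach, second_countable_topology}"
 assumes pq: "p > 1" "q > 1" "1 / p + 1 / q = 1"
  and [measurable]: "f \<in> borel_measurable M" "g \<in> borel_measurable M"
  and f: "integrable M (\<lambda>x. norm (f x) powr p)" and g: "integrable M (\<lambda>x. norm (g x) powr q)"
 shows "integrable M (\<lambda>x. norm (f x) * norm (g x))"
  and "d > 0 \<Longrightarrow> (\<integral>x. norm (f x) * norm (g x) \<partial>M) \<le> d powr p * (\<integral>x. norm (f x) powr p \<partial>M) + (1 / d) powr q * (\<integral>x. norm (g x) powr q \<partial>M)"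
proof -
 have i: "integrable M (\<lambda>x. d powr p * norm (f x) powr p + (1 / d) powr q * norm (g x) powr q)" for d
  using f g by auto
 show ii: "integrable M (\<lambda>x. norm (f x) * norm (g x))"
  by (rule Bochner_Integration.integrable_bound[OF i[of 1]])
   (use Young_bound[OF pq, of _ _ 1] in \<open>auto intro!: AE_I2 order_trans[OF _ abs_ge_self]\<close>)
 assume "d > 0"
 then have "(\<integral>x. norm (f x) * norm (g x) \<partial>M) \<le> (\<integral>x. d powr p * norm (f x) powr p + (1 / d) powr q * norm (g x) powr q \<partial>M)"
  by (intro integral_mono ii i Young_bound pq) auto
 then show "(\<integral>x. norm (f x) * norm (g x) \<partial>M) \<le> d powr p * (\<integral>x. norm (f x) powr p \<partial>M) + (1 / d) powr q * (\<integral>x. norm (g x) powr q \<partial>M)"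
  using f g by simp
qed

lemma Holder_tendsto:
 fixes f :: "'a \<Rightarrow> 'b::{banach, second_countable_topology}" and g :: "nat \<Rightarrow> 'a \<Rightarrow> 'c::{banach, second_countable_topology}"
 assumes pq: "p > 1" "q > 1" "1 / p + 1 / q = 1"
  and m: "f \<in> borel_measurable M" "\<And>n. g n \<in> borel_measurable M"
  and f: "integrable M (\<lambda>x. norm (f x) powr p)" and g: "\<And>n. integrable M (\<lambda>x. norm (g n x) powr q)"
  and lim: "(\<lambda>n. \<integral>x. norm (g n x) powr q \<partial>M) \<longlonglongrightarrow> 0"
 shows "(\<lambda>n. \<integral>x. norm (f x) * norm (g n x) \<partial>M) \<longlonglongrightarrow> 0"
proof (rule LIMSEQ_I)
 fix r :: real assume r: "r > 0"
 \<comment> \<open>The summand 1 keeps \<open>a\<close> positive; \<open>d\<close> is chosen so that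
   the part containing the fixed function \<open>f\<close> is at most r/2.\<close>
 define a where "a = (\<integral>x. norm (f x) powr p \<partial>M) + 1"
 have a: "a > 0" "(\<integral>x. norm (f x) powr p \<partial>M) \<le> a" by (auto simp: a_def intro!: add_nonneg_pos Bochner_Integration.integral_nonneg)
 define d where "d = (r / (2 * a)) powr (1 / p)"
 have d: "d > 0" using r a by (simp add: d_def)
 have dp: "d powr p = r / (2 * a)" using r a pq by (simp add: d_def powr_powr)
 have "(\<lambda>n. (1 / d) powr q * (\<integral>x. norm (g n x) powr q \<partial>M)) \<longlonglongrightarrow> (1 / d) powr q * 0" by (intro tendsto_intros lim)
 then obtain N where N: "\<And>n. n \<ge> N \<Longrightarrow> \<bar>(1 / d) powr q * (\<integral>x. norm (g n x) powr q \<partial>M)\<bar> < r / 2"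
  using LIMSEQ_D[of "\<lambda>n. (1 / d) powr q * (\<integral>x. norm (g n x) powr q \<partial>M)" 0 "r / 2"] r by auto
 have "norm ((\<integral>x. norm (f x) * norm (g n x) \<partial>M) - 0) < r" if "n \<ge> N" for n
 proof -
  have "(\<integral>x. norm (f x) * norm (g n x) \<partial>M) \<le> d powr p * (\<integral>x. norm (f x) powr p \<partial>M) + (1 / d) powr q * (\<integral>x. norm (g n x) powr q \<partial>M)"
   by (rule Holder_integrable(2)[OF pq m(1) m(2) f g d])
  also have "d powr p * (\<integral>x. norm (f x) powr p \<partial>M) \<le> r / (2 * a) * a"
   unfolding dp using a r by (intro mult_left_mono) auto
  also have "r / (2 * a) * a = r / 2" using a by simp
  finally have "(\<integral>x. norm (f x) * norm (g n x) \<partial>M) < r" using N[OF that] by linarith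
  moreover have "(\<integral>x. norm (f x) * norm (g n x) \<partial>M) \<ge> 0" by (intro Bochner_Integration.integral_nonneg) auto
  ultimately show ?thesis by simp
 qed
 then show "\<exists>no. \<forall>n\<ge>no. norm ((\<integral>x. norm (f x) * norm (g n x) \<partial>M) - 0) < r" by blast
qed

lemma integral_tendsto_dominated_diff:
 fixes F :: "nat \<Rightarrow> 'a \<Rightarrow> real"
 assumes F: "\<And>n. F n \<in> borel_measurable M" and F': "integrable M F'" and H: "\<And>n. integrable M (H n)"
  and le: "\<And>n x. \<bar>F n x - F' x\<bar> \<le> H n x" and lim: "(\<lambda>n. \<integral>x. H n x \<partial>M) \<longlonglongrightarrow> 0"
 shows "(\<lambda>n. \<integral>x. F n x \<partial>M) \<longlonglongrightarrow> (\<integral>x. F' x \<partial>M)" and "integrable M (F n)"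
proof -
 have d: "integrable M (\<lambda>x. F n x - F' x)" for n
  by (rule Bochner_Integration.integrable_bound[OF H]) (use le F F' in \<open>auto intro!: AE_I2 order_trans[OF _ abs_ge_self]\<close>)
 have i: "integrable M (F n)" for n using Bochner_Integration.integrable_add[OF d[of n] F'] by simp
 show "integrable M (F n)" by (rule i)
 have "(\<lambda>n. (\<integral>x. F n x \<partial>M) - (\<integral>x. F' x \<partial>M)) \<longlonglongrightarrow> 0"
 proof (rule Lim_null_comparison[OF _ lim], rule always_eventually, rule allI)
  fix n
  have "norm ((\<integral>x. F n x \<partial>M) - (\<integral>x. F' x \<partial>M)) = norm (\<integral>x. F n x - F' x \<partial>M)" using i F' by simp
  also have "\<dots> \<le> (\<integral>x. norm (F n x - F' x) \<partial>M)" by (rule integral_norm_bound)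
  also have "\<dots> \<le> (\<integral>x. H n x \<partial>M)" by (rule integral_mono[OF integrable_norm[OF d] H]) (use le in simp)
  finally show "norm ((\<integral>x. F n x \<partial>M) - (\<integral>x. F' x \<partial>M)) \<le> (\<integral>x. H n x \<partial>M)" .
 qed
 then show "(\<lambda>n. \<integral>x. F n x \<partial>M) \<longlonglongrightarrow> (\<integral>x. F' x \<partial>M)" by (rule LIM_zero_cancel)
qed

text \<open>\<open>difference_quotient\<close> applied to the constant sequence \<open>f\<close>
  gives convergence in L^1 on the ball that carries \<open>w\<close>. The step \<open>t n\<close>
  may have either sign.\<close>

lemma difference_quotient_weak:
 assumes f: "f \<in> Cc_inf \<Omega>" and w: "continuous_on UNIV w" "\<And>x. x \<notin> cball 0 R \<Longrightarrow> w x = (0::real)"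
  and t: "t \<longlonglongrightarrow> 0" "\<And>n. t n \<noteq> 0"
 shows "(\<lambda>n. LBINT x. w x * ((f (x + t n *\<^sub>R axis i 1) - f x) / t n)) \<longlonglongrightarrow> (LBINT x. w x * partial i f x)"
proof -
 obtain C where C: "\<And>x. norm (w x) \<le> C" using bounded_continuous_cball[OF w] by metis
 note lf = Cc_inf_loc_integrable[OF f]
 have z1: "(\<lambda>n. bnorm R (\<lambda>x. f x - f x)) \<longlonglongrightarrow> 0" and z2: "(\<lambda>n. bnorm R (\<lambda>x. grad f x - grad f x)) \<longlonglongrightarrow> 0" for R
  by (simp_all add: bnorm_def)
 have pl: "loc_integrable (\<lambda>x. partial i f x)" using loc_integrable_inner_const(1)[OF lf(2), of "axis i 1"] by (simp add: inner_axis)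
 have dl: "loc_integrable (\<lambda>x. (f (x + t n *\<^sub>R axis i 1) - f x) / t n)" for n
 proof -
  have "loc_integrable (\<lambda>x. (1 / t n) *\<^sub>R (f (x + t n *\<^sub>R axis i 1) - f x))"
   by (rule loc_integrable_bounded_mult[where B = "\<bar>1 / t n\<bar>"]) (auto intro!: loc_integrable_diff loc_integrable_translate lf)
  then show ?thesis by simp
 qed
 have lim: "(\<lambda>n. bnorm R (\<lambda>x. (f (x + t n *\<^sub>R axis i 1) - f x) / t n - partial i f x)) \<longlonglongrightarrow> 0"
 proof (rule LIMSEQ_I)
  fix r :: real assume r: "r > 0"
  obtain d where d: "d > 0" "\<And>h. norm h < d \<Longrightarrow> bnorm R (\<lambda>y. f (y + h) - f y - grad f y \<bullet> h) \<le> r / 2 * norm h"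
   using difference_quotient[OF f lf z1 z2, of "r / 2" R] r by auto
  obtain N where N: "\<And>n. n \<ge> N \<Longrightarrow> norm (t n - 0) < d" using LIMSEQ_D[OF t(1) d(1)] by blast
  have "norm (bnorm R (\<lambda>x. (f (x + t n *\<^sub>R axis i 1) - f x) / t n - partial i f x) - 0) < r" if "n \<ge> N" for n
  proof -
   have "(\<lambda>x. (f (x + t n *\<^sub>R axis i 1) - f x) / t n - partial i f x) = (\<lambda>x. (1 / t n) *\<^sub>R (f (x + t n *\<^sub>R axis i 1) - f x - grad f x \<bullet> (t n *\<^sub>R axis i 1)))"
    using t(2)[of n] by (auto simp: inner_axis field_simps)
   then have "bnorm R (\<lambda>x. (f (x + t n *\<^sub>R axis i 1) - f x) / t n - partial i f x) = \<bar>1 / t n\<bar> * bnorm R (\<lambda>x. f (x + t n *\<^sub>R axis i 1) - f x - grad f x \<bullet> (t n *\<^sub>R axis i 1))"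
    by (simp only: bnorm_const_mult)
   also have "\<dots> \<le> \<bar>1 / t n\<bar> * (r / 2 * norm (t n *\<^sub>R (axis i 1 :: R3)))"
    using N[OF that] by (intro mult_left_mono d) auto
   also have "\<dots> = r / 2" using t(2)[of n] by simp
   finally show ?thesis using r bnorm_nonneg[of R "\<lambda>x. (f (x + t n *\<^sub>R axis i 1) - f x) / t n - partial i f x"] by simp
  qed
  then show "\<exists>no. \<forall>n\<ge>no. norm (bnorm R (\<lambda>x. (f (x + t n *\<^sub>R axis i 1) - f x) / t n - partial i f x) - 0) < r" by blast
 qed
 show ?thesis
  by (rule integral_tendsto_bnorm(1)[OF _ _ w(2) dl pl lim, of _ C]) (use C w(1) in \<open>auto intro: borel_measurable_continuous_onI\<close>)
qed

text \<open>Moving both derivatives across via difference quotients avoids the symmetry of second derivatives.\<close>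

lemma integral_partial_swap:
 assumes f: "f \<in> Cc_inf \<Omega>" and g: "g \<in> Cc_inf \<Omega>"
 shows "(LBINT x. partial j f x * partial i g x) = (LBINT x. partial i f x * partial j g x)"
proof -
 let ?t = "\<lambda>n. inverse (real (Suc n))" and ?e = "axis i 1 :: R3"
 have fU: "f \<in> Cc_inf UNIV" and gU: "g \<in> Cc_inf UNIV" using f g Cc_inf_mono by blast+
 obtain Rf where Rf: "\<And>x. x \<notin> cball 0 Rf \<Longrightarrow> f x = 0" using Cc_inf_bounded_support[OF f] by metis
 obtain Rg where Rg: "\<And>x. x \<notin> cball 0 Rg \<Longrightarrow> g x = 0" using Cc_inf_bounded_support[OF g] by metis
 have sm: "smooth f" "smooth g" using f g by (auto simp: Cc_inf_iff)
 have c: "continuous_on UNIV f" "continuous_on UNIV (partial j f)" "continuous_on UNIV (partial j g)"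
  by (intro smooth_continuous smooth_partial sm)+
 have zf: "partial j f x = 0" if "x \<notin> cball 0 Rf" for x by (rule partial_zero_outside[OF _ Rf that]) auto
 have zg: "partial j g x = 0" if "x \<notin> cball 0 Rg" for x by (rule partial_zero_outside[OF _ Rg that]) auto
 have t: "?t \<longlonglongrightarrow> 0" "\<And>n. ?t n \<noteq> 0" "(\<lambda>n. - ?t n) \<longlonglongrightarrow> 0" "\<And>n. - ?t n \<noteq> 0"
  using LIMSEQ_inverse_real_of_nat tendsto_minus[OF LIMSEQ_inverse_real_of_nat] by auto
 have A: "(\<lambda>n. LBINT x. partial j f x * ((g (x + ?t n *\<^sub>R ?e) - g x) / ?t n)) \<longlonglongrightarrow> (LBINT x. partial j f x * partial i g x)"
  by (rule difference_quotient_weak[OF g c(2) zf t(1,2)])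
 have B: "(\<lambda>n. LBINT x. partial j g x * ((f (x + (- ?t n) *\<^sub>R ?e) - f x) / (- ?t n))) \<longlonglongrightarrow> (LBINT x. partial j g x * partial i f x)"
  by (rule difference_quotient_weak[OF f c(3) zg t(3,4)])
 \<comment> \<open>An exact identity for each step \<open>s\<close>: integrate by parts in direction
   j, translate by \<open>s\<close>, and the quotient in direction i has moved to the other factor
   with step \<open>- s\<close>.\<close>
 have eq: "(LBINT x. partial j f x * ((g (x + s *\<^sub>R ?e) - g x) / s)) = (LBINT x. partial j g x * ((f (x + (- s) *\<^sub>R ?e) - f x) / (- s)))" if s: "s \<noteq> 0" for s
 proof -
  have gs: "(\<lambda>x. g (x + s *\<^sub>R ?e)) \<in> Cc_inf UNIV" using Cc_inf_reflected[OF gU, of 1 "s *\<^sub>R ?e"] by simp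
  have ps: "partial j (\<lambda>x. g (x + s *\<^sub>R ?e)) x = partial j g (x + s *\<^sub>R ?e)" for x
   using partial_affine(1)[of g 1 x "s *\<^sub>R ?e" j] smooth_differentiable[OF sm(2)] by simp
  have ic: "integrable lborel (\<lambda>x. w x * v x)" if "continuous_on UNIV w" "continuous_on UNIV v" "\<And>x. x \<notin> cball 0 R \<Longrightarrow> w x = 0" for w v :: "R3 \<Rightarrow> real" and R
   by (rule integrable_continuous_cball[where R = R]) (use that in \<open>auto intro!: continuous_intros\<close>)
  have ibp: "(LBINT x. partial j f x * k x) = - (LBINT x. f x * partial j k x)" if k: "k \<in> Cc_inf UNIV" for k
  proof -
   have sk: "smooth k" using k by (simp add: Cc_inf_iff)
   have "0 = (LBINT x. partial j (\<lambda>x. f x * k x) x)"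
    using f k by (intro integral_partial_eq_0[symmetric, where R = Rf] Ck_mult) (auto simp: Rf intro: Cc_inf_Ck simp del: Ck.simps One_nat_def)
   also have "\<dots> = (LBINT x. f x * partial j k x + partial j f x * k x)"
    by (simp add: partial_mult smooth_differentiable sm sk)
   also have "\<dots> = (LBINT x. f x * partial j k x) + (LBINT x. partial j f x * k x)"
    by (intro Bochner_Integration.integral_add ic[OF _ _ Rf] ic[OF _ _ zf] c smooth_continuous smooth_partial sk)
   finally show ?thesis by simp
  qed
  have cs: "continuous_on UNIV (\<lambda>x. g (x + s *\<^sub>R ?e))" "continuous_on UNIV (\<lambda>x. partial j g (x + s *\<^sub>R ?e))" "continuous_on UNIV (\<lambda>x. f (x + (- s) *\<^sub>R ?e))"
   by (rule continuous_on_compose2[OF smooth_continuous[OF sm(2)]], auto intro!: continuous_intros)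
    (rule continuous_on_compose2[OF c(3)], auto intro!: continuous_intros,
     rule continuous_on_compose2[OF c(1)], auto intro!: continuous_intros)
  have i1: "integrable lborel (\<lambda>x. partial j f x * g (x + s *\<^sub>R ?e))" "integrable lborel (\<lambda>x. partial j f x * g x)"
   by (rule ic[OF c(2) cs(1) zf], assumption) (rule ic[OF c(2) smooth_continuous[OF sm(2)] zf])
  have i2: "integrable lborel (\<lambda>x. partial j g x * f (x + (- s) *\<^sub>R ?e))" "integrable lborel (\<lambda>x. partial j g x * f x)"
   by (rule ic[OF c(3) cs(3) zg], assumption) (rule ic[OF c(3) c(1) zg])
  have "(LBINT x. f x * partial j g (x + s *\<^sub>R ?e)) = (LBINT x. f (x + s *\<^sub>R ?e + (- s) *\<^sub>R ?e) * partial j g (x + s *\<^sub>R ?e))"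
   by simp
  also have "\<dots> = (LBINT x. f (x + (- s) *\<^sub>R ?e) * partial j g x)"
   by (rule integral_translate(1)[of "\<lambda>x. f (x + (- s) *\<^sub>R ?e) * partial j g x"])
    (intro borel_measurable_continuous_onI continuous_on_mult cs c)
  finally have tr: "(LBINT x. f x * partial j g (x + s *\<^sub>R ?e)) = (LBINT x. partial j g x * f (x + (- s) *\<^sub>R ?e))"
   by (simp add: mult.commute)
  have "(LBINT x. partial j f x * ((g (x + s *\<^sub>R ?e) - g x) / s)) = (LBINT x. (partial j f x * g (x + s *\<^sub>R ?e) - partial j f x * g x) / s)"
   by (simp add: right_diff_distrib)
  also have "\<dots> = ((LBINT x. partial j f x * g (x + s *\<^sub>R ?e)) - (LBINT x. partial j f x * g x)) / s"
   using i1 by simp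
  also have "\<dots> = ((LBINT x. partial j g x * f x) - (LBINT x. partial j g x * f (x + (- s) *\<^sub>R ?e))) / s"
   unfolding ibp[OF gs] ibp[OF gU] ps tr by (simp add: mult.commute)
  also have "\<dots> = (LBINT x. (partial j g x * f x - partial j g x * f (x + (- s) *\<^sub>R ?e)) / s)"
   using i2 by simp
  also have "\<dots> = (LBINT x. partial j g x * ((f (x + (- s) *\<^sub>R ?e) - f x) / (- s)))"
   by (intro Bochner_Integration.integral_cong refl) (use s in \<open>simp add: field_simps\<close>)
  finally show ?thesis .
 qed
 have "(LBINT x. partial j f x * partial i g x) = (LBINT x. partial j g x * partial i f x)"
  by (rule LIMSEQ_unique[OF A B[unfolded eq[OF t(2), symmetric]]])
 then show ?thesis by (simp add: mult.commute)
qed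

section \<open>Matrix identities for the stress and the convective term\<close>

lemma norm_outer: "norm (outer a b) = norm a * norm b"
proof -
 have "(norm (outer a b))\<^sup>2 = (\<Sum>i\<in>UNIV. \<Sum>j\<in>UNIV. (a $ i * b $ j) * (a $ i * b $ j))"
  by (simp add: power2_norm_eq_inner inner_vec_def outer_def)
 also have "\<dots> = (\<Sum>i\<in>UNIV. a $ i * a $ i) * (\<Sum>j\<in>UNIV. b $ j * b $ j)"
  by (simp add: sum_product mult_ac)
 also have "\<dots> = (norm a * norm b)\<^sup>2"
  by (simp add: power2_norm_eq_inner inner_vec_def power_mult_distrib)
 finally show ?thesis by (simp add: power2_eq_iff_nonneg)
qed

lemma abs_trace_le: "\<bar>trace (B :: real ^ 3 ^ 3)\<bar> \<le> 3 * norm B"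
proof -
 have c: "\<bar>B $ i $ i\<bar> \<le> norm B" for i
  using order_trans[OF component_le_norm_cart[of "B $ i" i]] by (simp add: Finite_Cartesian_Product.norm_nth_le)
 have "trace B = B $ 1 $ 1 + B $ 2 $ 2 + B $ 3 $ 3" by (simp add: trace_def sum_3)
 then show ?thesis using c[of 1] c[of 2] c[of 3] by linarith
qed

lemma stress_bounded_linear: "bounded_linear (stress \<mu> \<eta>)"
proof -
 have "linear (stress \<mu> \<eta>)"
  by (rule linearI)
   (auto simp: stress_def vec_eq_iff transpose_def trace_def sum.distrib sum_distrib_left[symmetric] mat_def algebra_simps)
 then show ?thesis by (simp add: linear_conv_bounded_linear)
qed

text \<open>Pointwise neither the transposed term nor the coefficient of the squared trace has a
  sign. Integrated over a test function, the transposed term becomes the squared trace, and the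
  total coefficient \<eta> + \<mu>/3 is nonnegative.\<close>

lemma stress_inner_self:
 "stress \<mu> \<eta> F \<bullet> F = \<mu> * (norm F)\<^sup>2 + \<mu> * (transpose F \<bullet> F) + (\<eta> - 2 / 3 * \<mu>) * (trace F)\<^sup>2"
proof -
 have m: "mat 1 \<bullet> F = trace F"
  by (simp add: inner_vec_def mat_def trace_def if_distrib[of "\<lambda>x. x * _"] sum.delta cong: if_cong)
 have n: "(norm F)\<^sup>2 = F \<bullet> F" by (simp only: power2_norm_eq_inner)
 show ?thesis
  unfolding stress_def n
  by (simp add: inner_add_left inner_diff_left m power2_eq_square algebra_simps)
qed


lemma power_powr_nonneg: "(y::real) \<ge> 0 \<Longrightarrow> (y ^ 2) powr (3 / 2) = y ^ 3" "y \<ge> 0 \<Longrightarrow> (y ^ 2) powr 3 = y ^ 6"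
proof -
 assume y: "y \<ge> 0"
 have "(y ^ 2) powr (3 / 2) = (y powr 2) powr (3 / 2)" using y by simp
 also have "\<dots> = y powr 3" by (simp only: powr_powr) simp
 finally show "(y ^ 2) powr (3 / 2) = y ^ 3" using y by simp
 show "(y ^ 2) powr 3 = y ^ 6" by simp
qed

lemma outer_inner: "outer a b \<bullet> J = (\<Sum>i\<in>UNIV. a $ i * (b \<bullet> J $ i))"
 by (simp add: inner_vec_def outer_def sum_distrib_left mult.assoc)

lemma borel_measurable_outer [measurable]:
 assumes [measurable]: "a \<in> borel_measurable M" "b \<in> borel_measurable M"
 shows "(\<lambda>x. outer (a x) (b x)) \<in> borel_measurable M"
proof -
 have "continuous_on UNIV (\<lambda>p. outer (fst p) (snd p))"
  unfolding outer_def by (intro continuous_on_vec_lambda continuous_intros)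
 then have o: "(\<lambda>p. outer (fst p) (snd p)) \<in> borel_measurable borel" by (rule borel_measurable_continuous_onI)
 have "(\<lambda>x. (a x, b x)) \<in> borel_measurable M" by (intro borel_measurable_Pair assms)
 from measurable_compose[OF this o] show ?thesis by simp
qed

text \<open>The last item is the identity behind Korn's inequality for zero boundary values: summing
  \<open>integral_partial_swap\<close> over all pairs of indices turns the product of the Jacobian
  with its transpose into the squared divergence.\<close>

lemma jacobian_facts:
 assumes \<phi>: "\<And>i. (\<lambda>x. \<phi> x $ i) \<in> Cc_inf \<Omega>"
 shows "\<phi> \<in> borel_measurable borel" "jacobian_mat \<phi> \<in> borel_measurable borel"
  and "(norm (jacobian_mat \<phi> x))\<^sup>2 = (\<Sum>i\<in>UNIV. (norm (grad (\<lambda>x. \<phi> x $ i) x))\<^sup>2)"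
  and "integrable lborel (\<lambda>x. (norm (jacobian_mat \<phi> x))\<^sup>2)"
  and "integrable lborel (\<lambda>x. (trace (jacobian_mat \<phi> x))\<^sup>2)" "integrable lborel (\<lambda>x. transpose (jacobian_mat \<phi> x) \<bullet> jacobian_mat \<phi> x)"
  and "(LBINT x. transpose (jacobian_mat \<phi> x) \<bullet> jacobian_mat \<phi> x) = (LBINT x. (trace (jacobian_mat \<phi> x))\<^sup>2)"
proof -
 have sm: "smooth (\<lambda>x. \<phi> x $ i)" for i using \<phi>[of i] by (simp add: Cc_inf_iff)
 have "continuous_on UNIV (\<lambda>x. \<chi> i. \<phi> x $ i)" by (intro continuous_on_vec_lambda smooth_continuous sm)
 then show "\<phi> \<in> borel_measurable borel" by (intro borel_measurable_continuous_onI) simp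
 have "continuous_on UNIV (jacobian_mat \<phi>)"
  unfolding jacobian_mat_def by (intro continuous_on_vec_lambda smooth_grad_continuous sm)
 then show "jacobian_mat \<phi> \<in> borel_measurable borel" by (rule borel_measurable_continuous_onI)
 show n: "(norm (jacobian_mat \<phi> x))\<^sup>2 = (\<Sum>i\<in>UNIV. (norm (grad (\<lambda>x. \<phi> x $ i) x))\<^sup>2)" for x
  by (simp add: power2_norm_eq_inner inner_vec_def[of "jacobian_mat \<phi> x"]) (simp add: jacobian_mat_def)
 show "integrable lborel (\<lambda>x. (norm (jacobian_mat \<phi> x))\<^sup>2)"
  unfolding n by (intro Bochner_Integration.integrable_sum Cc_inf_integrable_sq[OF \<phi>])
 have J: "jacobian_mat \<phi> x $ i $ j = partial j (\<lambda>x. \<phi> x $ i) x" for x i j by (simp add: jacobian_mat_def)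
 have i2: "integrable lborel (\<lambda>x. partial a (\<lambda>x. \<phi> x $ i) x * partial b (\<lambda>x. \<phi> x $ j) x)" for a b i j
 proof -
  have "(\<lambda>x. partial b (\<lambda>x. \<phi> x $ j) x * partial a (\<lambda>x. \<phi> x $ i) x) \<in> Cc_inf \<Omega>"
   by (intro Cc_inf_mult Cc_inf_partial \<phi> smooth_partial sm)
  from Cc_inf_bounded_support[OF this] obtain R where R: "\<And>x. x \<notin> cball 0 R \<Longrightarrow> partial b (\<lambda>x. \<phi> x $ j) x * partial a (\<lambda>x. \<phi> x $ i) x = 0"
   by metis
  show ?thesis
  proof (rule integrable_continuous_cball[where R = R])
   show "continuous_on UNIV (\<lambda>x. partial a (\<lambda>x. \<phi> x $ i) x * partial b (\<lambda>x. \<phi> x $ j) x)"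
    by (intro smooth_continuous smooth_mult smooth_partial sm)
  qed (use R in \<open>simp add: mult.commute\<close>)
 qed
 have t2: "(trace (jacobian_mat \<phi> x))\<^sup>2 = (\<Sum>i\<in>UNIV. \<Sum>j\<in>UNIV. partial j (\<lambda>x. \<phi> x $ j) x * partial i (\<lambda>x. \<phi> x $ i) x)" for x
  by (simp add: trace_def J power2_eq_square sum_product mult.commute)
 have tr: "transpose (jacobian_mat \<phi> x) \<bullet> jacobian_mat \<phi> x = (\<Sum>i\<in>UNIV. \<Sum>j\<in>UNIV. partial i (\<lambda>x. \<phi> x $ j) x * partial j (\<lambda>x. \<phi> x $ i) x)" for x
  by (simp add: inner_vec_def transpose_def J)
 show "integrable lborel (\<lambda>x. (trace (jacobian_mat \<phi> x))\<^sup>2)"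
  unfolding t2 by (intro Bochner_Integration.integrable_sum i2)
 show "integrable lborel (\<lambda>x. transpose (jacobian_mat \<phi> x) \<bullet> jacobian_mat \<phi> x)"
  unfolding tr by (intro Bochner_Integration.integrable_sum i2)
 show "(LBINT x. transpose (jacobian_mat \<phi> x) \<bullet> jacobian_mat \<phi> x) = (LBINT x. (trace (jacobian_mat \<phi> x))\<^sup>2)"
  unfolding tr t2 using i2 integral_partial_swap[OF \<phi> \<phi>] by simp
qed

lemma six_power_triangle: "norm (x :: 'a::real_normed_vector) ^ 6 \<le> 64 * norm (y - x) ^ 6 + 64 * norm y ^ 6"
proof -
 define m where "m = max (norm (y - x)) (norm y)"
 have "norm x \<le> 2 * m" using norm_triangle_ineq4[of y "y - x"] by (simp add: m_def)
 then have "norm x ^ 6 \<le> (2 * m) ^ 6" by (intro power_mono) auto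
 also have "\<dots> = 64 * m ^ 6" by (simp add: power_mult_distrib)
 also have "m ^ 6 \<le> norm (y - x) ^ 6 + norm y ^ 6" by (auto simp: m_def max_def)
 finally show ?thesis by simp
qed

text \<open>The limit of the momentum equation tested with \<open>\<phi> n\<close> shows that the
  integral of \<open>stress \<mu> \<eta> (A x) \<bullet> J n x\<close> tends to 0. Replacing
  \<open>A\<close> by \<open>J n\<close> inside the stress costs a null sequence, and for
  \<open>J n\<close> the dissipation is exactly coercive. Hence \<open>J n\<close> tends to 0 in
  L^2, \<open>\<phi> n\<close> tends to 0 in L^6 by Sobolev's inequality, and its limit
  \<open>u\<close> is zero.\<close>

lemma velocity_vanishes:
 fixes \<phi> :: "nat \<Rightarrow> R3 \<Rightarrow> R3" and \<rho> \<pi> :: "R3 \<Rightarrow> real" and u W :: "R3 \<Rightarrow> R3" and A :: "R3 \<Rightarrow> real ^ 3 ^ 3"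
 assumes \<phi>: "\<And>n i. (\<lambda>x. \<phi> n x $ i) \<in> Cc_inf \<Omega>"
  and rm[measurable]: "\<rho> \<in> borel_measurable borel" and rb: "\<And>x. 0 \<le> \<rho> x" "\<And>x. \<rho> x \<le> M"
  and um[measurable]: "u \<in> borel_measurable borel" and Am[measurable]: "A \<in> borel_measurable borel"
  and Wm[measurable]: "W \<in> borel_measurable borel" and \<pi>m[measurable]: "\<pi> \<in> borel_measurable borel"
  and u6: "integrable lborel (\<lambda>x. norm (u x) ^ 6)" and ru2: "integrable lborel (\<lambda>x. \<rho> x * (norm (u x))\<^sup>2)"
  and A2: "integrable lborel (\<lambda>x. (norm (A x))\<^sup>2)"
  and d6: "\<And>n. integrable lborel (\<lambda>x. norm (\<phi> n x - u x) ^ 6)" "(\<lambda>n. LBINT x. norm (\<phi> n x - u x) ^ 6) \<longlonglongrightarrow> 0"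
  and JA: "(\<lambda>n. LBINT x. (norm (jacobian_mat (\<phi> n) x - A x))\<^sup>2) \<longlonglongrightarrow> 0"
  and cont: "\<And>f. f \<in> Cc_inf UNIV \<Longrightarrow> (LBINT x. \<rho> x * (u x \<bullet> grad f x)) = 0"
  and \<pi>: "integrable lborel \<pi>" "\<And>x. 0 \<le> \<pi> x" "\<And>x. \<pi> x \<le> Q" and \<pi>A: "(LBINT x. \<pi> x * trace (A x)) = 0"
  and W: "integrable lborel (\<lambda>x. norm (\<rho> x *\<^sub>R W x) powr (6 / 5))" and W0: "(LBINT x. (\<rho> x *\<^sub>R W x) \<bullet> u x) = 0"
  and mom: "\<And>n. (LBINT x. (\<rho> x *\<^sub>R outer (u x) (u x)) \<bullet> jacobian_mat (\<phi> n) x + \<pi> x * trace (jacobian_mat (\<phi> n) x))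
    = (LBINT x. stress \<mu> \<eta> (A x) \<bullet> jacobian_mat (\<phi> n) x) - (LBINT x. (\<rho> x *\<^sub>R W x) \<bullet> \<phi> n x)"
  and \<mu>: "\<mu> > 0" "\<eta> \<ge> 0"
 shows "AE x in lborel. u x = 0"
proof -
 define J where "J n = jacobian_mat (\<phi> n)" for n
 have [measurable]: "\<phi> n \<in> borel_measurable borel" "J n \<in> borel_measurable borel" for n
  unfolding J_def by (rule jacobian_facts(1,2)[OF \<phi>])+
 have J2: "integrable lborel (\<lambda>x. (norm (J n x))\<^sup>2)" for n unfolding J_def by (rule jacobian_facts(4)[OF \<phi>])
 have B2: "integrable lborel (\<lambda>x. (norm (J n x - A x))\<^sup>2)" for n by (rule integrable_norm_diff_sq(1)[OF _ _ J2 A2]) simp_all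
 have B0: "(\<lambda>n. LBINT x. (norm (J n x - A x))\<^sup>2) \<longlonglongrightarrow> 0" using JA by (simp add: J_def)
 have h22: "(2::real) > 1" "(2::real) > 1" "1 / 2 + 1 / 2 = (1::real)" by auto
 have h65: "(6 / 5::real) > 1" "(6::real) > 1" "1 / (6 / 5) + 1 / 6 = (1::real)" by auto
 have h33: "(3 / 2::real) > 1" "(3::real) > 1" "1 / (3 / 2) + 1 / 3 = (1::real)" by auto
 have M0: "M \<ge> 0" using rb[of 0] by linarith
 have AB: "(\<lambda>n. LBINT x. norm (A x) * norm (J n x - A x)) \<longlonglongrightarrow> 0"
  by (rule Holder_tendsto[OF h22]) (use A2 B2 B0 in simp_all)
 have iAB: "integrable lborel (\<lambda>x. norm (A x) * norm (J n x - A x))" for n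
  by (rule Holder_integrable(1)[OF h22]) (use A2 B2 in simp_all)

 \<comment> \<open>Interpolation between the kinetic energy (power 2) and L^6, using that \<rho> is
   bounded. It puts the square of \<rho> |u| into L^(3/2), dual to the L^3 of the squared
   error.\<close>
 have ru3: "integrable lborel (\<lambda>x. (\<rho> x * norm (u x)) ^ 3)"
 proof (rule Bochner_Integration.integrable_bound)
  show "integrable lborel (\<lambda>x. M\<^sup>2 * (\<rho> x * (norm (u x))\<^sup>2) + M ^ 3 * norm (u x) ^ 6)" using ru2 u6 by auto
  show "AE x in lborel. norm ((\<rho> x * norm (u x)) ^ 3) \<le> norm (M\<^sup>2 * (\<rho> x * (norm (u x))\<^sup>2) + M ^ 3 * norm (u x) ^ 6)"
  proof (rule AE_I2)
   fix x
   define t where "t = norm (u x)"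
   have t: "t \<ge> 0" by (simp add: t_def)
   have t3: "t ^ 3 \<le> t\<^sup>2 + t ^ 6"
   proof (cases "t \<le> 1")
    case True
    then have "t ^ 3 \<le> t\<^sup>2" using t by (intro power_decreasing) auto
    then show ?thesis using t by (simp add: add_increasing2)
   next
    case False
    then have "t ^ 3 \<le> t ^ 6" by (intro power_increasing) auto
    then show ?thesis by (simp add: add_increasing)
   qed
   have r3: "\<rho> x ^ 3 \<le> M\<^sup>2 * \<rho> x" "\<rho> x ^ 3 \<le> M ^ 3"
   proof -
    have "\<rho> x ^ 2 \<le> M\<^sup>2" using rb[of x] by (intro power_mono) auto
    then show "\<rho> x ^ 3 \<le> M\<^sup>2 * \<rho> x" using rb(1)[of x] by (simp add: power3_eq_cube power2_eq_square mult_right_mono)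
    show "\<rho> x ^ 3 \<le> M ^ 3" using rb[of x] by (intro power_mono) auto
   qed
   have "\<rho> x ^ 3 * t ^ 3 \<le> \<rho> x ^ 3 * (t\<^sup>2 + t ^ 6)" using t3 rb(1)[of x] by (intro mult_left_mono) auto
   also have "\<dots> = \<rho> x ^ 3 * t\<^sup>2 + \<rho> x ^ 3 * t ^ 6" by (simp add: distrib_left)
   also have "\<dots> \<le> M\<^sup>2 * \<rho> x * t\<^sup>2 + M ^ 3 * t ^ 6" using r3 t by (intro add_mono mult_right_mono) auto
   finally show "norm ((\<rho> x * norm (u x)) ^ 3) \<le> norm (M\<^sup>2 * (\<rho> x * (norm (u x))\<^sup>2) + M ^ 3 * norm (u x) ^ 6)"
    using rb(1)[of x] t M0 by (simp add: power_mult_distrib t_def abs_mult power_abs mult.assoc)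
  qed
 qed measurable
 define h where "h n x = \<rho> x * norm (u x) * norm (u x - \<phi> n x)" for n x
 have [measurable]: "h n \<in> borel_measurable borel" for n unfolding h_def[abs_def] by measurable
 have hnn: "h n x \<ge> 0" for n x using rb(1) by (simp add: h_def)
 have du: "norm (u x - \<phi> n x) = norm (\<phi> n x - u x)" for n x by (rule norm_minus_commute)
 have h2eq: "(h n x)\<^sup>2 = norm ((\<rho> x * norm (u x))\<^sup>2) * norm ((norm (\<phi> n x - u x))\<^sup>2)" for n x
  by (simp add: h_def power_mult_distrib du)
 have e1: "norm ((\<rho> x * norm (u x))\<^sup>2) powr (3 / 2) = (\<rho> x * norm (u x)) ^ 3" for x
  using power_powr_nonneg(1)[of "\<rho> x * norm (u x)"] rb(1)[of x] by simp
 have e2: "norm ((norm (\<phi> n x - u x))\<^sup>2) powr 3 = norm (\<phi> n x - u x) ^ 6" for n x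
  using power_powr_nonneg(2)[of "norm (\<phi> n x - u x)"] by simp
 have h2: "integrable lborel (\<lambda>x. (h n x)\<^sup>2)" for n
  unfolding h2eq by (rule Holder_integrable(1)[OF h33]) (use ru3 d6 in \<open>simp_all only: e1 e2, measurable\<close>)
 have h0: "(\<lambda>n. LBINT x. (h n x)\<^sup>2) \<longlonglongrightarrow> 0"
  unfolding h2eq by (rule Holder_tendsto[OF h33]) (use ru3 d6 in \<open>simp_all only: e1 e2, measurable\<close>)
 have hA: "(\<lambda>n. LBINT x. norm (A x) * norm (h n x)) \<longlonglongrightarrow> 0"
  by (rule Holder_tendsto[OF h22]) (use A2 h2 h0 in simp_all)
 have ihA: "integrable lborel (\<lambda>x. norm (A x) * norm (h n x))" for n
  by (rule Holder_integrable(1)[OF h22]) (use A2 h2 in simp_all)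
 \<comment> \<open>\<open>E n\<close> is the convective term. It differs from \<open>F n\<close> by
   half of \<rho> u \<bullet> grad |\<open>\<phi> n\<close>|^2, which integrates to zero by the
   continuity equation; \<open>F n\<close> contains the factor \<open>u x - \<phi> n x\<close> and
   tends to zero.\<close>
 define F where "F n x = (\<rho> x *\<^sub>R outer (u x - \<phi> n x) (u x)) \<bullet> J n x" for n x
 define E where "E n x = (\<rho> x *\<^sub>R outer (u x) (u x)) \<bullet> J n x" for n x
 have Fle: "\<bar>F n x - 0\<bar> \<le> norm (A x) * norm (h n x) + (h n x)\<^sup>2 + (norm (J n x - A x))\<^sup>2" for n x
 proof -
  have "\<bar>F n x\<bar> \<le> norm (\<rho> x *\<^sub>R outer (u x - \<phi> n x) (u x)) * norm (J n x)" unfolding F_def by (rule Cauchy_Schwarz_ineq2)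
  also have "norm (\<rho> x *\<^sub>R outer (u x - \<phi> n x) (u x)) = h n x" using rb(1)[of x] by (simp add: norm_outer h_def)
  also have "h n x * norm (J n x) \<le> h n x * (norm (A x) + norm (J n x - A x))"
   using hnn norm_triangle_ineq[of "A x" "J n x - A x"] by (intro mult_left_mono) auto
  also have "\<dots> = norm (A x) * norm (h n x) + h n x * norm (J n x - A x)" using hnn[of n x] by (simp add: algebra_simps)
  also have "h n x * norm (J n x - A x) \<le> (h n x)\<^sup>2 + (norm (J n x - A x))\<^sup>2"
  proof -
   have "0 \<le> (h n x - norm (J n x - A x))\<^sup>2" by simp
   then have "2 * (h n x * norm (J n x - A x)) \<le> (h n x)\<^sup>2 + (norm (J n x - A x))\<^sup>2" by (simp add: power2_diff)
   moreover have "0 \<le> h n x * norm (J n x - A x)" using hnn by simp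
   ultimately show ?thesis by linarith
  qed
  finally show ?thesis by simp
 qed
 have iH: "integrable lborel (\<lambda>x. norm (A x) * norm (h n x) + (h n x)\<^sup>2 + (norm (J n x - A x))\<^sup>2)" for n
  using ihA h2 B2 by (intro Bochner_Integration.integrable_add)
 have lH: "(\<lambda>n. LBINT x. norm (A x) * norm (h n x) + (h n x)\<^sup>2 + (norm (J n x - A x))\<^sup>2) \<longlonglongrightarrow> 0"
 proof -
  have "(LBINT x. norm (A x) * norm (h n x) + (h n x)\<^sup>2 + (norm (J n x - A x))\<^sup>2)
   = (LBINT x. norm (A x) * norm (h n x)) + (LBINT x. (h n x)\<^sup>2) + (LBINT x. (norm (J n x - A x))\<^sup>2)" for n
   by (simp only: Bochner_Integration.integral_add[OF Bochner_Integration.integrable_add[OF ihA[of n] h2[of n]] B2[of n]] Bochner_Integration.integral_add[OF ihA[of n] h2[of n]])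
  then show ?thesis using tendsto_add[OF tendsto_add[OF hA h0] B0] by simp
 qed
 have Fm: "F n \<in> borel_measurable lborel" for n unfolding F_def[abs_def] by measurable
 have iz: "integrable lborel (\<lambda>x::R3. 0::real)" by simp
 have F0: "(\<lambda>n. LBINT x. F n x) \<longlonglongrightarrow> 0" and iF: "integrable lborel (F n)" for n
  using integral_tendsto_dominated_diff[of F lborel "\<lambda>x. 0", OF Fm iz iH Fle lH] by simp_all
 \<comment> \<open>The momentum flux is square integrable, again by interpolation, so
   \<open>E n\<close> is integrable and may be separated from the pressure term.\<close>
 have ru4: "integrable lborel (\<lambda>x. (\<rho> x * (norm (u x))\<^sup>2)\<^sup>2)"
 proof (rule Bochner_Integration.integrable_bound)
  show "integrable lborel (\<lambda>x. M * (\<rho> x * (norm (u x))\<^sup>2) + M\<^sup>2 * norm (u x) ^ 6)" using ru2 u6 by auto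
  show "AE x in lborel. norm ((\<rho> x * (norm (u x))\<^sup>2)\<^sup>2) \<le> norm (M * (\<rho> x * (norm (u x))\<^sup>2) + M\<^sup>2 * norm (u x) ^ 6)"
  proof (rule AE_I2)
   fix x
   define t where "t = norm (u x)"
   have t: "t \<ge> 0" by (simp add: t_def)
   have t4: "t ^ 4 \<le> t\<^sup>2 + t ^ 6"
   proof (cases "t \<le> 1")
    case True
    then have "t ^ 4 \<le> t\<^sup>2" using t by (intro power_decreasing) auto
    then show ?thesis using t by (simp add: add_increasing2)
   next
    case False
    then have "t ^ 4 \<le> t ^ 6" by (intro power_increasing) auto
    then show ?thesis by (simp add: add_increasing)
   qed
   have r2: "\<rho> x ^ 2 \<le> M * \<rho> x" "\<rho> x ^ 2 \<le> M\<^sup>2"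
    using rb[of x] by (auto simp: power2_eq_square intro!: mult_mono)
   have "\<rho> x ^ 2 * t ^ 4 \<le> \<rho> x ^ 2 * (t\<^sup>2 + t ^ 6)" using t4 by (intro mult_left_mono) auto
   also have "\<dots> = \<rho> x ^ 2 * t\<^sup>2 + \<rho> x ^ 2 * t ^ 6" by (simp add: distrib_left)
   also have "\<dots> \<le> M * \<rho> x * t\<^sup>2 + M\<^sup>2 * t ^ 6" using r2 t by (intro add_mono mult_right_mono) auto
   finally have le: "\<rho> x ^ 2 * t ^ 4 \<le> M * (\<rho> x * t\<^sup>2) + M\<^sup>2 * t ^ 6" by (simp add: mult.assoc)
   have "norm ((\<rho> x * (norm (u x))\<^sup>2)\<^sup>2) = \<rho> x ^ 2 * t ^ 4"
    by (simp add: t_def power_mult_distrib flip: power_mult)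
   then show "norm ((\<rho> x * (norm (u x))\<^sup>2)\<^sup>2) \<le> norm (M * (\<rho> x * (norm (u x))\<^sup>2) + M\<^sup>2 * norm (u x) ^ 6)"
    using le unfolding t_def real_norm_def by linarith
  qed
 qed measurable
 have iE: "integrable lborel (E n)" for n
 proof (rule Bochner_Integration.integrable_bound)
  show "integrable lborel (\<lambda>x. norm (\<rho> x * (norm (u x))\<^sup>2) * norm (J n x))"
   by (rule Holder_integrable(1)[OF h22]) (use ru4 J2 in simp_all)
  show "E n \<in> borel_measurable lborel" unfolding E_def[abs_def] by measurable
  show "AE x in lborel. norm (E n x) \<le> norm (norm (\<rho> x * (norm (u x))\<^sup>2) * norm (J n x))"
  proof (rule AE_I2)
   fix x
   have "\<bar>E n x\<bar> \<le> norm (\<rho> x *\<^sub>R outer (u x) (u x)) * norm (J n x)" unfolding E_def by (rule Cauchy_Schwarz_ineq2)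
   then show "norm (E n x) \<le> norm (norm (\<rho> x * (norm (u x))\<^sup>2) * norm (J n x))"
    by (simp add: norm_outer power2_eq_square abs_mult mult.assoc)
  qed
 qed
 have EF: "(LBINT x. E n x) = (LBINT x. F n x)" for n
 proof -
  \<comment> \<open>The squared length of \<open>\<phi> n\<close>, an admissible test function for
    the continuity equation because \<open>\<phi> n\<close> is smooth with compact support.\<close>
  define f where "f x = (\<Sum>i\<in>UNIV. \<phi> n x $ i * \<phi> n x $ i)" for x
  have sm: "smooth (\<lambda>x. \<phi> n x $ i)" for i using \<phi>[of n i] by (simp add: Cc_inf_iff)
  have "f \<in> Cc_inf \<Omega>" unfolding f_def[abs_def] by (intro Cc_inf_sum Cc_inf_mult \<phi> sm) auto
  then have f: "f \<in> Cc_inf UNIV" by (rule Cc_inf_mono) simp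
  have pd: "(\<lambda>x. \<phi> n x $ i * \<phi> n x $ i) differentiable (at x)" and pp: "partial j (\<lambda>x. \<phi> n x $ i * \<phi> n x $ i) x = 2 * (\<phi> n x $ i * partial j (\<lambda>x. \<phi> n x $ i) x)" for i j x
   by (intro smooth_differentiable smooth_mult sm) (simp add: partial_mult smooth_differentiable sm)
  have gf: "grad f x = 2 *\<^sub>R (\<Sum>i\<in>UNIV. \<phi> n x $ i *\<^sub>R J n x $ i)" for x
  proof -
   have "partial j f x = (\<Sum>i\<in>UNIV. 2 * (\<phi> n x $ i * partial j (\<lambda>x. \<phi> n x $ i) x))" for j
    unfolding f_def[abs_def] by (simp add: sum_3 partial_add pd differentiable_add pp)
   then show ?thesis by (simp add: vec_eq_iff J_def jacobian_mat_def sum_distrib_left)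
  qed
  have "\<rho> x * (u x \<bullet> grad f x) = 2 * (E n x - F n x)" for x
  proof -
   have "u x \<bullet> grad f x = 2 * (outer (\<phi> n x) (u x) \<bullet> J n x)"
    by (simp add: gf inner_sum_right outer_inner)
   moreover have "E n x - F n x = \<rho> x * (outer (\<phi> n x) (u x) \<bullet> J n x)"
    by (simp add: E_def F_def outer_inner algebra_simps sum_subtractf sum_distrib_left)
   ultimately show ?thesis by simp
  qed
  then have "(LBINT x. 2 * (E n x - F n x)) = 0" using cont[OF f] by simp
  then show ?thesis using iE[of n] iF[of n] by simp
 qed
 have E0: "(\<lambda>n. LBINT x. E n x) \<longlonglongrightarrow> 0" using F0 by (simp add: EF)

 have \<pi>2: "integrable lborel (\<lambda>x. (\<pi> x)\<^sup>2)"
 proof (rule Bochner_Integration.integrable_bound)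
  show "integrable lborel (\<lambda>x. Q * \<pi> x)" using \<pi>(1) by simp
  show "AE x in lborel. norm ((\<pi> x)\<^sup>2) \<le> norm (Q * \<pi> x)"
  proof (rule AE_I2)
   fix x
   have "\<pi> x * \<pi> x \<le> Q * \<pi> x" using \<pi>(2,3)[of x] by (intro mult_right_mono) auto
   then show "norm ((\<pi> x)\<^sup>2) \<le> norm (Q * \<pi> x)" by (simp add: power2_eq_square)
  qed
 qed measurable
 have trm[measurable]: "(\<lambda>x. trace (V x)) \<in> borel_measurable borel" if [measurable]: "V \<in> borel_measurable borel" for V :: "R3 \<Rightarrow> real ^ 3 ^ 3"
 proof -
  have "continuous_on UNIV (\<lambda>B :: real ^ 3 ^ 3. trace B)" unfolding trace_def by (intro continuous_intros)
  then have "(\<lambda>B :: real ^ 3 ^ 3. trace B) \<in> borel_measurable borel" by (rule borel_measurable_continuous_onI)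
  then show ?thesis using that by (rule measurable_compose[rotated])
 qed
 have i\<pi>A: "integrable lborel (\<lambda>x. \<pi> x * trace (A x))"
 proof (rule Bochner_Integration.integrable_bound)
  show "integrable lborel (\<lambda>x. 3 * (norm (\<pi> x) * norm (A x)))"
   by (intro integrable_mult_right Holder_integrable(1)[OF h22]) (use \<pi>2 A2 in simp_all)
  show "AE x in lborel. norm (\<pi> x * trace (A x)) \<le> norm (3 * (norm (\<pi> x) * norm (A x)))"
  proof (rule AE_I2)
   fix x
   have "\<bar>\<pi> x\<bar> * \<bar>trace (A x)\<bar> \<le> \<bar>\<pi> x\<bar> * (3 * norm (A x))" by (intro mult_left_mono abs_trace_le) simp
   then show "norm (\<pi> x * trace (A x)) \<le> norm (3 * (norm (\<pi> x) * norm (A x)))" by (simp add: abs_mult)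
  qed
 qed measurable
 have \<pi>lim: "(\<lambda>n. LBINT x. \<pi> x * trace (J n x)) \<longlonglongrightarrow> (LBINT x. \<pi> x * trace (A x))" and i\<pi>J: "integrable lborel (\<lambda>x. \<pi> x * trace (J n x))" for n
 proof -
  have m: "(\<lambda>x. \<pi> x * trace (J n x)) \<in> borel_measurable lborel" for n by measurable
  have iH: "integrable lborel (\<lambda>x. 3 * (norm (\<pi> x) * norm (J n x - A x)))" for n
   by (intro integrable_mult_right Holder_integrable(1)[OF h22]) (use \<pi>2 B2 in simp_all)
  have le: "\<bar>\<pi> x * trace (J n x) - \<pi> x * trace (A x)\<bar> \<le> 3 * (norm (\<pi> x) * norm (J n x - A x))" for n x
  proof -
   have "trace (J n x) - trace (A x) = trace (J n x - A x)" by (simp add: trace_def sum_subtractf)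
   then have "\<bar>\<pi> x * trace (J n x) - \<pi> x * trace (A x)\<bar> = \<bar>\<pi> x\<bar> * \<bar>trace (J n x - A x)\<bar>"
    by (simp flip: right_diff_distrib abs_mult)
   also have "\<dots> \<le> \<bar>\<pi> x\<bar> * (3 * norm (J n x - A x))" by (intro mult_left_mono abs_trace_le) simp
   finally show ?thesis by simp
  qed
  have "(\<lambda>n. LBINT x. norm (\<pi> x) * norm (J n x - A x)) \<longlonglongrightarrow> 0"
   by (rule Holder_tendsto[OF h22]) (use \<pi>2 B2 B0 in simp_all)
  from tendsto_mult[OF tendsto_const[of 3] this]
  have lH: "(\<lambda>n. LBINT x. 3 * (norm (\<pi> x) * norm (J n x - A x))) \<longlonglongrightarrow> 0" by simp
  show "(\<lambda>n. LBINT x. \<pi> x * trace (J n x)) \<longlonglongrightarrow> (LBINT x. \<pi> x * trace (A x))" "integrable lborel (\<lambda>x. \<pi> x * trace (J n x))"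
   using integral_tendsto_dominated_diff[OF m i\<pi>A iH le lH] by simp_all
 qed

 have iWu: "integrable lborel (\<lambda>x. (\<rho> x *\<^sub>R W x) \<bullet> u x)"
 proof (rule Bochner_Integration.integrable_bound)
  show "integrable lborel (\<lambda>x. norm (\<rho> x *\<^sub>R W x) * norm (u x))"
   by (rule Holder_integrable(1)[OF h65]) (use W u6 in simp_all)
  show "AE x in lborel. norm ((\<rho> x *\<^sub>R W x) \<bullet> u x) \<le> norm (norm (\<rho> x *\<^sub>R W x) * norm (u x))"
   using Cauchy_Schwarz_ineq2[of "\<rho> x *\<^sub>R W x" "u x" for x] by (intro AE_I2) simp
 qed measurable
 have Wlim: "(\<lambda>n. LBINT x. (\<rho> x *\<^sub>R W x) \<bullet> \<phi> n x) \<longlonglongrightarrow> (LBINT x. (\<rho> x *\<^sub>R W x) \<bullet> u x)"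
 proof (rule integral_tendsto_dominated_diff(1)[OF _ iWu])
  show "integrable lborel (\<lambda>x. norm (\<rho> x *\<^sub>R W x) * norm (\<phi> n x - u x))" for n
   by (rule Holder_integrable(1)[OF h65]) (use W d6 in simp_all)
  show "(\<lambda>n. LBINT x. norm (\<rho> x *\<^sub>R W x) * norm (\<phi> n x - u x)) \<longlonglongrightarrow> 0"
   by (rule Holder_tendsto[OF h65]) (use W d6 in simp_all)
  show "\<bar>(\<rho> x *\<^sub>R W x) \<bullet> \<phi> n x - (\<rho> x *\<^sub>R W x) \<bullet> u x\<bar> \<le> norm (\<rho> x *\<^sub>R W x) * norm (\<phi> n x - u x)" for n x
   unfolding inner_diff_right[symmetric] by (rule Cauchy_Schwarz_ineq2)
 qed measurable

 have "(\<lambda>n. (LBINT x. E n x) + (LBINT x. \<pi> x * trace (J n x)) + (LBINT x. (\<rho> x *\<^sub>R W x) \<bullet> \<phi> n x)) \<longlonglongrightarrow> 0 + 0 + 0"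
  using tendsto_add[OF tendsto_add[OF E0 \<pi>lim] Wlim] by (simp only: \<pi>A W0)
 moreover have "(LBINT x. E n x) + (LBINT x. \<pi> x * trace (J n x)) + (LBINT x. (\<rho> x *\<^sub>R W x) \<bullet> \<phi> n x) = (LBINT x. stress \<mu> \<eta> (A x) \<bullet> J n x)" for n
  using mom[of n] iE[of n] i\<pi>J[of n] by (simp add: E_def[abs_def] J_def)
 ultimately have SA0: "(\<lambda>n. LBINT x. stress \<mu> \<eta> (A x) \<bullet> J n x) \<longlonglongrightarrow> 0" by simp

 obtain K where K: "K > 0" "\<And>B. norm (stress \<mu> \<eta> B) \<le> norm B * K"
  using bounded_linear.pos_bounded[OF stress_bounded_linear] by blast
 have sm[measurable]: "stress \<mu> \<eta> \<in> borel_measurable borel"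
  by (intro borel_measurable_continuous_onI linear_continuous_on stress_bounded_linear)
 have iSA: "integrable lborel (\<lambda>x. stress \<mu> \<eta> (A x) \<bullet> J n x)" for n
 proof (rule Bochner_Integration.integrable_bound)
  show "integrable lborel (\<lambda>x. K * (norm (A x) * norm (J n x)))"
   by (intro integrable_mult_right Holder_integrable(1)[OF h22]) (use A2 J2 in simp_all)
  show "AE x in lborel. norm (stress \<mu> \<eta> (A x) \<bullet> J n x) \<le> norm (K * (norm (A x) * norm (J n x)))"
  proof (rule AE_I2)
   fix x
   have "norm (stress \<mu> \<eta> (A x) \<bullet> J n x) \<le> norm (stress \<mu> \<eta> (A x)) * norm (J n x)" by (simp add: Cauchy_Schwarz_ineq2)
   also have "\<dots> \<le> (norm (A x) * K) * norm (J n x)" by (intro mult_right_mono K) simp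
   finally show "norm (stress \<mu> \<eta> (A x) \<bullet> J n x) \<le> norm (K * (norm (A x) * norm (J n x)))" using K(1) by (simp add: mult_ac)
  qed
 qed measurable
 have SB0: "(\<lambda>n. LBINT x. stress \<mu> \<eta> (J n x - A x) \<bullet> J n x) \<longlonglongrightarrow> (\<integral>x. 0 \<partial>(lborel :: R3 measure))"
  and iSB: "integrable lborel (\<lambda>x. stress \<mu> \<eta> (J n x - A x) \<bullet> J n x)" for n
 proof -
  have m: "(\<lambda>x. stress \<mu> \<eta> (J n x - A x) \<bullet> J n x) \<in> borel_measurable lborel" for n by measurable
  have iH: "integrable lborel (\<lambda>x. K * (norm (A x) * norm (J n x - A x)) + K * (norm (J n x - A x))\<^sup>2)" for n
   using iAB[of n] B2[of n] by auto
  have lH: "(\<lambda>n. LBINT x. K * (norm (A x) * norm (J n x - A x)) + K * (norm (J n x - A x))\<^sup>2) \<longlonglongrightarrow> 0"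
  proof -
   have "(LBINT x. K * (norm (A x) * norm (J n x - A x)) + K * (norm (J n x - A x))\<^sup>2) = K * (LBINT x. norm (A x) * norm (J n x - A x)) + K * (LBINT x. (norm (J n x - A x))\<^sup>2)" for n
    using iAB[of n] B2[of n] by simp
   moreover have "(\<lambda>n. K * (LBINT x. norm (A x) * norm (J n x - A x)) + K * (LBINT x. (norm (J n x - A x))\<^sup>2)) \<longlonglongrightarrow> K * 0 + K * 0"
    by (intro tendsto_intros AB B0)
   ultimately show ?thesis by simp
  qed
  have le: "\<bar>stress \<mu> \<eta> (J n x - A x) \<bullet> J n x - 0\<bar> \<le> K * (norm (A x) * norm (J n x - A x)) + K * (norm (J n x - A x))\<^sup>2" for n x
  proof -
   have "\<bar>stress \<mu> \<eta> (J n x - A x) \<bullet> J n x\<bar> \<le> norm (stress \<mu> \<eta> (J n x - A x)) * norm (J n x)" by (rule Cauchy_Schwarz_ineq2)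
   also have "\<dots> \<le> (norm (J n x - A x) * K) * (norm (A x) + norm (J n x - A x))"
    using K norm_triangle_ineq[of "A x" "J n x - A x"] by (intro mult_mono K(2)) auto
   finally show ?thesis by (simp add: power2_eq_square algebra_simps)
  qed
  show "(\<lambda>n. LBINT x. stress \<mu> \<eta> (J n x - A x) \<bullet> J n x) \<longlonglongrightarrow> (\<integral>x. 0 \<partial>(lborel :: R3 measure))" "integrable lborel (\<lambda>x. stress \<mu> \<eta> (J n x - A x) \<bullet> J n x)"
   using integral_tendsto_dominated_diff[OF m iz iH le lH] by simp_all
 qed
 \<comment> \<open>By linearity the two integrals add up to the dissipation of \<open>J n\<close>.
   The transposed term contributes \<mu> and the trace term \<eta> - 2\<mu>/3, in total \<eta> +
   \<mu>/3 times the squared divergence, which may be dropped.\<close>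
 have SJ: "(LBINT x. stress \<mu> \<eta> (A x) \<bullet> J n x) + (LBINT x. stress \<mu> \<eta> (J n x - A x) \<bullet> J n x) \<ge> \<mu> * (LBINT x. (norm (J n x))\<^sup>2)" for n
 proof -
  interpret S: bounded_linear "stress \<mu> \<eta>" by (rule stress_bounded_linear)
  have t: "integrable lborel (\<lambda>x. (trace (J n x))\<^sup>2)" "integrable lborel (\<lambda>x. transpose (J n x) \<bullet> J n x)"
   "(LBINT x. transpose (J n x) \<bullet> J n x) = (LBINT x. (trace (J n x))\<^sup>2)"
   unfolding J_def by (rule jacobian_facts(5,6,7)[OF \<phi>])+
  have "(LBINT x. stress \<mu> \<eta> (A x) \<bullet> J n x) + (LBINT x. stress \<mu> \<eta> (J n x - A x) \<bullet> J n x)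
    = (LBINT x. stress \<mu> \<eta> (A x) \<bullet> J n x + stress \<mu> \<eta> (J n x - A x) \<bullet> J n x)"
   using iSA[of n] iSB[of n] by simp
  also have "\<dots> = (LBINT x. stress \<mu> \<eta> (J n x) \<bullet> J n x)"
   by (intro Bochner_Integration.integral_cong refl) (simp add: S.diff inner_diff_left)
  also have "\<dots> = \<mu> * (LBINT x. (norm (J n x))\<^sup>2) + \<mu> * (LBINT x. transpose (J n x) \<bullet> J n x) + (\<eta> - 2 / 3 * \<mu>) * (LBINT x. (trace (J n x))\<^sup>2)"
   unfolding stress_inner_self using J2[of n] t(1,2) by simp
  also have "\<dots> = \<mu> * (LBINT x. (norm (J n x))\<^sup>2) + (\<eta> + \<mu> / 3) * (LBINT x. (trace (J n x))\<^sup>2)"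
   unfolding t(3) by (simp add: algebra_simps)
  also have "\<dots> \<ge> \<mu> * (LBINT x. (norm (J n x))\<^sup>2)" using \<mu> by simp
  finally show ?thesis .
 qed
 have J0: "(\<lambda>n. LBINT x. (norm (J n x))\<^sup>2) \<longlonglongrightarrow> 0"
 proof (rule tendsto_sandwich[OF _ _ tendsto_const])
  let ?u = "\<lambda>n. (1 / \<mu>) * ((LBINT x. stress \<mu> \<eta> (A x) \<bullet> J n x) + (LBINT x. stress \<mu> \<eta> (J n x - A x) \<bullet> J n x))"
  have "?u \<longlonglongrightarrow> (1 / \<mu>) * (0 + (\<integral>x. 0 \<partial>(lborel :: R3 measure)))" by (intro tendsto_intros SA0 SB0)
  then show "?u \<longlonglongrightarrow> 0" by simp
  show "\<forall>\<^sub>F n in sequentially. (LBINT x. (norm (J n x))\<^sup>2) \<le> ?u n"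
   using SJ \<mu>(1) by (intro always_eventually) (simp add: pos_le_divide_eq mult.commute)
 qed simp

 have i6: "integrable lborel (\<lambda>x. (\<phi> n x $ i) ^ 6)" and s6: "(LBINT x. (\<phi> n x $ i) ^ 6) \<le> 4096 * (LBINT x. (norm (J n x))\<^sup>2) ^ 3" for n i
 proof -
  obtain R where R: "\<And>x. x \<notin> cball 0 R \<Longrightarrow> \<phi> n x $ i = 0" using Cc_inf_bounded_support[OF \<phi>] by metis
  have c: "continuous_on UNIV (\<lambda>x. \<phi> n x $ i)" using \<phi>[of n i] by (auto simp: Cc_inf_iff intro: smooth_continuous)
  show "integrable lborel (\<lambda>x. (\<phi> n x $ i) ^ 6)"
   by (rule integrable_continuous_cball[where R = R]) (auto intro!: continuous_on_power c simp: R)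
  have "(LBINT x. (\<phi> n x $ i) ^ 6) \<le> 4096 * (LBINT x. (norm (grad (\<lambda>x. \<phi> n x $ i) x))\<^sup>2) ^ 3"
   by (rule Sobolev_inequality[OF Cc_inf_Ck[OF \<phi>] R])
  also have "(LBINT x. (norm (grad (\<lambda>x. \<phi> n x $ i) x))\<^sup>2) ^ 3 \<le> (LBINT x. (norm (J n x))\<^sup>2) ^ 3"
  proof (rule power_mono, rule integral_mono[OF Cc_inf_integrable_sq(1)[OF \<phi>] J2])
   show "(norm (grad (\<lambda>x. \<phi> n x $ i) x))\<^sup>2 \<le> (norm (J n x))\<^sup>2" for x
    unfolding J_def jacobian_facts(3)[OF \<phi>] by (rule member_le_sum) auto
  qed simp
  finally show "(LBINT x. (\<phi> n x $ i) ^ 6) \<le> 4096 * (LBINT x. (norm (J n x))\<^sup>2) ^ 3" by simp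
 qed
 have "AE x in lborel. u x $ i = 0" for i
 proof -
  have ui: "integrable lborel (\<lambda>x. (u x $ i) ^ 6)"
  proof (rule Bochner_Integration.integrable_bound[OF u6])
   have "(\<lambda>x. u x \<bullet> axis i 1) \<in> borel_measurable borel" by measurable
   then show "(\<lambda>x. (u x $ i) ^ 6) \<in> borel_measurable lborel" by (simp add: inner_axis)
   have "\<bar>u x $ i\<bar> ^ 6 \<le> norm (u x) ^ 6" for x by (intro power_mono component_le_norm_cart) simp
   then show "AE x in lborel. norm ((u x $ i) ^ 6) \<le> norm (norm (u x) ^ 6)" by (intro AE_I2) (simp add: power_abs)
  qed
  \<comment> \<open>The distance of \<open>u\<close> to \<open>\<phi> n\<close> plus the size of
    \<open>\<phi> n\<close>, both null sequences. The constant 64 is the sixth power of 2 in the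
    triangle inequality.\<close>
  have le: "(LBINT x. (u x $ i) ^ 6) \<le> 64 * (LBINT x. norm (\<phi> n x - u x) ^ 6) + 64 * (4096 * (LBINT x. (norm (J n x))\<^sup>2) ^ 3)" for n
  proof -
   have "(LBINT x. (u x $ i) ^ 6) \<le> (LBINT x. 64 * norm (\<phi> n x - u x) ^ 6 + 64 * (\<phi> n x $ i) ^ 6)"
   proof (rule integral_mono[OF ui])
    show "integrable lborel (\<lambda>x. 64 * norm (\<phi> n x - u x) ^ 6 + 64 * (\<phi> n x $ i) ^ 6)" using d6(1) i6 by auto
    fix x
    have "\<bar>u x $ i\<bar> ^ 6 \<le> 64 * \<bar>\<phi> n x $ i - u x $ i\<bar> ^ 6 + 64 * \<bar>\<phi> n x $ i\<bar> ^ 6"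
     using six_power_triangle[of "u x $ i" "\<phi> n x $ i"] by simp
    also have "\<bar>\<phi> n x $ i - u x $ i\<bar> ^ 6 \<le> norm (\<phi> n x - u x) ^ 6"
     using component_le_norm_cart[of "\<phi> n x - u x" i] by (intro power_mono) auto
    finally show "(u x $ i) ^ 6 \<le> 64 * norm (\<phi> n x - u x) ^ 6 + 64 * (\<phi> n x $ i) ^ 6" by simp
   qed
   also have "\<dots> = 64 * (LBINT x. norm (\<phi> n x - u x) ^ 6) + 64 * (LBINT x. (\<phi> n x $ i) ^ 6)"
    using d6(1)[of n] i6[of n i] by simp
   finally show ?thesis using s6[of n i] by linarith
  qed
  have "(\<lambda>n. 64 * (LBINT x. norm (\<phi> n x - u x) ^ 6) + 64 * (4096 * (LBINT x. (norm (J n x))\<^sup>2) ^ 3)) \<longlonglongrightarrow> 64 * 0 + 64 * (4096 * 0 ^ 3)"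
   by (intro tendsto_intros d6(2) J0)
  then have "(LBINT x. (u x $ i) ^ 6) \<le> 64 * 0 + 64 * (4096 * 0 ^ 3)"
   by (rule LIMSEQ_le_const) (use le in blast)
  moreover have "(LBINT x. (u x $ i) ^ 6) \<ge> 0"
   by (intro Bochner_Integration.integral_nonneg) (simp add: zero_le_even_power)
  ultimately have "(LBINT x. (u x $ i) ^ 6) = 0" by simp
  then have "AE x in lborel. (u x $ i) ^ 6 = 0"
   by (subst (asm) integral_nonneg_eq_0_iff_AE[OF ui]) (auto simp: zero_le_even_power)
  then show ?thesis by simp
 qed
 then have "AE x in lborel. \<forall>i\<in>UNIV. u x $ i = 0" by (intro AE_finite_allI) auto
 then show ?thesis by eventually_elim (simp add: vec_eq_iff)
qed

section \<open>The pressure potential and the force\<close>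

lemma Liminf_pos_eventually:
 assumes "Liminf F (\<lambda>r. ereal (f r)) > 0"
 obtains \<alpha> where "\<alpha> > 0" "eventually (\<lambda>r. f r > \<alpha>) F"
proof -
 obtain \<alpha> where "0 < ereal \<alpha>" "ereal \<alpha> < Liminf F (\<lambda>r. ereal (f r))"
  using ereal_dense2[OF assms] by blast
 then have "\<alpha> > 0" "eventually (\<lambda>r. ereal (f r) > ereal \<alpha>) F" by (auto dest: less_LiminfD)
 then show ?thesis using that by simp
qed

text \<open>The bound P > \<alpha> p near zero does three things: it makes P positive, so that the
  alternative P'(0) = -infinity is impossible; it makes P' = (p + P)/r continuous at zero; and it
  dominates p, hence r^\<gamma>, by P. Away from zero P is bounded below, because P/r is
  nondecreasing, and compactness of [0, M] supplies the constants.\<close>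

lemma pressure_potential_properties:
 assumes p_cont: "continuous_on {0..} p" and p0: "p 0 = 0" and p_nonneg: "\<And>r. r \<ge> 0 \<Longrightarrow> p r \<ge> 0"
  and pot: "pressure_potential p P"
  and liminf_P: "Liminf (at_right 0) (\<lambda>r. ereal (P r / p r)) > 0"
  and liminf_p: "Liminf (at_right 0) (\<lambda>r. ereal (p r / r powr \<gamma>)) > 0"
  and \<gamma>: "\<gamma> > 1" and M: "M \<ge> 0"
 obtains b b' c where "\<And>r. (b has_real_derivative b' r) (at r)" "continuous_on UNIV b'"
  "\<And>r. r \<ge> 0 \<Longrightarrow> b r = P r" "\<And>r. r \<ge> 0 \<Longrightarrow> b' r * r - b r = p r" "c \<ge> 0"
  "\<And>r. 0 \<le> r \<Longrightarrow> r \<le> M \<Longrightarrow> 0 \<le> P r \<and> p r \<le> c * P r \<and> r powr \<gamma> \<le> c * P r"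
proof -
 have P0: "P 0 = 0" and Pd: "\<And>r. r > 0 \<Longrightarrow> P differentiable (at r) \<and> deriv P r * r - P r = p r"
  and alt: "(P has_real_derivative 0) (at 0 within {0..}) \<or> filterlim (\<lambda>r. P r / r) at_bot (at_right 0)"
  using pot by (auto simp: pressure_potential_def)
 have PD: "(P has_real_derivative ((p r + P r) / r)) (at r)" if "r > 0" for r
 proof -
  have "(P has_real_derivative deriv P r) (at r)"
   using Pd[OF that] by (simp add: DERIV_deriv_iff_real_differentiable)
  moreover have "deriv P r = (p r + P r) / r" using Pd[OF that] that by (simp add: field_simps)
  ultimately show ?thesis by simp
 qed
 obtain \<alpha> where \<alpha>: "\<alpha> > 0" "eventually (\<lambda>r. P r / p r > \<alpha>) (at_right 0)"
  using Liminf_pos_eventually[OF liminf_P] by blast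
 obtain \<beta> where \<beta>: "\<beta> > 0" "eventually (\<lambda>r. p r / r powr \<gamma> > \<beta>) (at_right 0)"
  using Liminf_pos_eventually[OF liminf_p] by blast
 have "eventually (\<lambda>r. P r / p r > \<alpha> \<and> p r / r powr \<gamma> > \<beta>) (at_right 0)" using \<alpha>(2) \<beta>(2) by (rule eventually_conj)
 then obtain d where d: "d > 0" "\<And>r. 0 < r \<Longrightarrow> r < d \<Longrightarrow> P r / p r > \<alpha> \<and> p r / r powr \<gamma> > \<beta>"
  by (auto simp: eventually_at_right_field)
 have near: "p r > 0" "P r > \<alpha> * p r" "p r > \<beta> * r powr \<gamma>" if "0 < r" "r < d" for r
 proof -
  have *: "P r / p r > \<alpha>" "p r / r powr \<gamma> > \<beta>" using d(2)[OF that] by auto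
  then have "p r \<noteq> 0" using \<alpha>(1) by auto
  then show pp: "p r > 0" using p_nonneg[of r] that by simp
  then show "P r > \<alpha> * p r" using *(1) by (simp add: field_simps)
  show "p r > \<beta> * r powr \<gamma>" using *(2) that by (simp add: field_simps)
 qed
 have Ppos: "P r > 0" if "0 < r" "r < d" for r
  using near(1,2)[OF that] mult_pos_pos[OF \<alpha>(1) near(1)[OF that]] by linarith
 have "\<not> filterlim (\<lambda>r. P r / r) at_bot (at_right 0)"
 proof
  assume "filterlim (\<lambda>r. P r / r) at_bot (at_right 0)"
  then have "eventually (\<lambda>r. P r / r < 0) (at_right 0)" by (simp add: filterlim_at_bot_dense)
  then obtain e where e: "e > 0" "\<And>r. 0 < r \<Longrightarrow> r < e \<Longrightarrow> P r / r < 0" by (auto simp: eventually_at_right_field)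
  define r where "r = min d e / 2"
  have "0 < r" "r < d" "r < e" using d(1) e(1) by (auto simp: r_def)
  then show False using e(2)[of r] Ppos[of r] by (simp add: divide_less_0_iff)
 qed
 then have D0: "(P has_real_derivative 0) (at 0 within {0..})" using alt by blast
 have "((\<lambda>r. (P r - P 0) / (r - 0)) \<longlongrightarrow> 0) (at 0 within {0..})"
  using D0 by (simp add: has_field_derivative_iff)
 then have "((\<lambda>r. P r / r) \<longlongrightarrow> 0) (at 0 within {0..})" using P0 by simp
 then have Q0: "((\<lambda>r. P r / r) \<longlongrightarrow> 0) (at_right 0)"
  by (rule tendsto_within_subset) auto
 \<comment> \<open>Extension by zero to the negative axis: the renormalization takes a C^1 function
   on the whole line, whereas P is meaningful only for nonnegative arguments.\<close>
 define b where "b r = (if r \<le> 0 then 0 else P r)" for r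
 define b' where "b' r = (if r \<le> 0 then 0 else (p r + P r) / r)" for r
 have ev_neg: "eventually (\<lambda>s. s < 0) (nhds r)" if "r < 0" for r :: real
  using eventually_nhds_in_open[of "{..<0}" r] that by (auto elim: eventually_mono)
 have ev_pos: "eventually (\<lambda>s. s > 0) (nhds r)" if "r > 0" for r :: real
  using eventually_nhds_in_open[of "{0<..}" r] that by (auto elim: eventually_mono)
 have left0: "eventually (\<lambda>h. h < (0::real)) (at_left 0)" and right0: "eventually (\<lambda>h. h > (0::real)) (at_right 0)"
  by (auto simp: eventually_at_filter)
 have bD: "(b has_real_derivative b' r) (at r)" for r
 proof -
  consider "r < 0" | "r > 0" | "r = 0" by linarith
  then show ?thesis
  proof cases
   case 1
   have "eventually (\<lambda>s. b s = 0) (nhds r)" using ev_neg[OF 1] by eventually_elim (simp add: b_def)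
   then show ?thesis using 1 by (subst DERIV_cong_ev[OF refl _ refl]) (auto simp: b'_def)
  next
   case 2
   have "eventually (\<lambda>s. b s = P s) (nhds r)" using ev_pos[OF 2] by eventually_elim (simp add: b_def)
   then show ?thesis using 2 PD[OF 2] by (subst DERIV_cong_ev[OF refl _ refl]) (auto simp: b'_def)
  next
   case 3
   have "((\<lambda>h. b h / h) \<longlongrightarrow> 0) (at_left 0)"
    using left0 by (intro tendsto_eventually) (auto elim!: eventually_mono simp: b_def)
   moreover have "((\<lambda>h. b h / h) \<longlongrightarrow> 0) (at_right 0)"
   proof (rule Lim_transform_eventually[OF Q0])
    show "\<forall>\<^sub>F r in at_right 0. P r / r = b r / r" using right0 by eventually_elim (simp add: b_def)
   qed
   ultimately have "((\<lambda>h. b h / h) \<longlongrightarrow> 0) (at 0)" by (rule filterlim_split_at)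
   then show ?thesis using 3 by (simp add: DERIV_def b_def b'_def)
  qed
 qed
 have b'c: "continuous_on UNIV b'"
 proof (rule continuous_at_imp_continuous_on, rule ballI)
  fix r :: real
  consider "r < 0" | "r > 0" | "r = 0" by linarith
  then show "isCont b' r"
  proof cases
   case 1
   have "eventually (\<lambda>s. b' s = 0) (nhds r)" using ev_neg[OF 1] by eventually_elim (simp add: b'_def)
   then have "isCont b' r \<longleftrightarrow> isCont (\<lambda>s. 0::real) r" by (intro isCont_cong)
   then show ?thesis by simp
  next
   case 2
   have "isCont p r"
    using continuous_on_interior[OF p_cont] 2 by (simp add: interior_real_atLeast)
   moreover have "isCont P r" using PD[OF 2] by (rule DERIV_isCont)
   ultimately have c: "isCont (\<lambda>r. (p r + P r) / r) r" using 2 by (intro continuous_intros) auto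
   have "eventually (\<lambda>s. b' s = (p s + P s) / s) (nhds r)" using ev_pos[OF 2] by eventually_elim (simp add: b'_def)
   then show ?thesis using c isCont_cong[of b' "\<lambda>s. (p s + P s) / s" r] by simp
  next
   case 3
   have "(b' \<longlongrightarrow> 0) (at_left 0)"
    using left0 by (intro tendsto_eventually) (auto elim!: eventually_mono simp: b'_def)
   moreover have "(b' \<longlongrightarrow> 0) (at_right 0)"
   proof (rule tendsto_sandwich[OF _ _ tendsto_const])
    \<comment> \<open>Near zero p \<le> P/\<alpha>, so P' is at most a multiple of P/r, which tends
      to P'(0) = 0.\<close>
    show "((\<lambda>r. (1 / \<alpha> + 1) * (P r / r)) \<longlongrightarrow> 0) (at_right 0)"
     using tendsto_mult[OF tendsto_const Q0, of "1 / \<alpha> + 1"] by simp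
    have ev: "eventually (\<lambda>r. 0 < r \<and> r < d) (at_right 0)"
     using d(1) by (auto simp: eventually_at_right_field)
    then show "\<forall>\<^sub>F r in at_right 0. b' r \<le> (1 / \<alpha> + 1) * (P r / r)"
    proof eventually_elim
     case (elim r)
     then have r: "0 < r" "r < d" by auto
     have "p r \<le> (1 / \<alpha>) * P r" using near(2)[OF r] \<alpha>(1) by (simp add: field_simps)
     then have "(p r + P r) / r \<le> ((1 / \<alpha>) * P r + P r) / r" using r by (intro divide_right_mono) auto
     also have "\<dots> = (1 / \<alpha> + 1) * (P r / r)" by (simp add: field_simps)
     finally show ?case using r by (simp add: b'_def)
    qed
    show "\<forall>\<^sub>F r in at_right 0. 0 \<le> b' r"
     using ev
    proof eventually_elim
     case (elim r)
     then have r: "0 < r" "r < d" by auto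
     then show ?case using near(1)[OF r] Ppos[OF r] by (simp add: b'_def)
    qed
   qed
   ultimately have "(b' \<longlongrightarrow> 0) (at 0)" by (rule filterlim_split_at)
   then show ?thesis using 3 by (simp add: isCont_def b'_def)
  qed
 qed
 \<comment> \<open>The derivative of P/r is p/r^2, nonnegative by the equation for the
   potential.\<close>
 have Qmono: "P x / x \<le> P y / y" if "0 < x" "x \<le> y" for x y
 proof (rule DERIV_nonneg_imp_nondecreasing[OF that(2)])
  fix r assume r: "x \<le> r" "r \<le> y"
  then have r0: "r > 0" using that by simp
  have "((\<lambda>r. P r / r) has_real_derivative ((p r + P r) / r * r - P r * 1) / (r * r)) (at r)"
   by (rule DERIV_divide[OF PD[OF r0] DERIV_ident]) (use r0 in simp)
  moreover have "((p r + P r) / r * r - P r * 1) / (r * r) = p r / (r * r)" using r0 by (simp add: field_simps)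
  moreover have "p r / (r * r) \<ge> 0" using p_nonneg[of r] r0 by simp
  ultimately show "\<exists>z. ((\<lambda>r. P r / r) has_real_derivative z) (at r) \<and> 0 \<le> z" by auto
 qed
 define r0 where "r0 = d / 2"
 have r0: "0 < r0" "r0 < d" using d(1) by (auto simp: r0_def)
 have Pr0: "P r0 > 0" by (rule Ppos[OF r0])
 have "compact (p ` {0..M})" by (intro compact_continuous_image continuous_on_subset[OF p_cont]) auto
 then have "bounded (p ` {0..M})" by (rule compact_imp_bounded)
 then obtain pm where "\<forall>y\<in>p ` {0..M}. norm y \<le> pm" by (auto simp: bounded_iff)
 then have pm: "\<And>r. 0 \<le> r \<Longrightarrow> r \<le> M \<Longrightarrow> p r \<le> pm" by force
 have pm0: "pm \<ge> 0" using pm[of 0] p0 M by simp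
 \<comment> \<open>The first two summands serve densities below \<open>r0\<close>, where the liminf
   bounds hold; the last two serve [r0, M], where the pressure and the power are bounded and P is at
   least \<open>P r0\<close>. Adding them avoids a maximum.\<close>
 define c where "c = 1 / \<alpha> + 1 / (\<alpha> * \<beta>) + pm / P r0 + M powr \<gamma> / P r0"
 have cs: "1 / \<alpha> \<le> c" "1 / (\<alpha> * \<beta>) \<le> c" "pm / P r0 \<le> c" "M powr \<gamma> / P r0 \<le> c" "c \<ge> 0"
  using \<alpha>(1) \<beta>(1) pm0 Pr0 by (auto simp: c_def add_increasing add_increasing2)
 have main: "0 \<le> P r \<and> p r \<le> c * P r \<and> r powr \<gamma> \<le> c * P r" if r: "0 \<le> r" "r \<le> M" for r
 proof -
  consider "r = 0" | "0 < r" "r < r0" | "r0 \<le> r" using r by linarith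
  then show ?thesis
  proof cases
   case 1
   then show ?thesis using P0 p0 by simp
  next
   case 2
   then have rd: "0 < r" "r < d" using r0 by auto
   note n = near[OF rd] Ppos[OF rd]
   have "p r \<le> (1 / \<alpha>) * P r" using n(2) \<alpha>(1) by (simp add: field_simps)
   also have "\<dots> \<le> c * P r" using cs(1) n(4) by (intro mult_right_mono) auto
   finally have a: "p r \<le> c * P r" .
   have "r powr \<gamma> \<le> (1 / \<beta>) * p r" using n(3) \<beta>(1) by (simp add: field_simps)
   also have "\<dots> \<le> (1 / \<beta>) * ((1 / \<alpha>) * P r)" using n(2) \<alpha>(1) \<beta>(1) by (intro mult_left_mono) (auto simp: field_simps)
   also have "\<dots> = (1 / (\<alpha> * \<beta>)) * P r" by simp
   also have "\<dots> \<le> c * P r" using cs(2) n(4) by (intro mult_right_mono) auto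
   finally show ?thesis using a n(4) by simp
  next
   case 3
   have rp: "r > 0" using 3 r0 by simp
   have "P r0 = r0 * (P r0 / r0)" using r0 by simp
   also have "\<dots> \<le> r * (P r / r)"
    using Qmono[OF r0(1) 3] 3 r0 Pr0 by (intro mult_mono) auto
   also have "\<dots> = P r" using rp by simp
   finally have ge: "P r0 \<le> P r" .
   have k: "x \<le> c * P r" if "x / P r0 \<le> c" "0 \<le> x" for x
   proof -
    have "x = (x / P r0) * P r0" using Pr0 by simp
    also have "\<dots> \<le> c * P r" using that ge Pr0 cs(5) by (intro mult_mono) auto
    finally show ?thesis .
   qed
   have "p r \<le> c * P r" using pm[OF r] k[OF cs(3) pm0] by linarith
   moreover have "r powr \<gamma> \<le> M powr \<gamma>" using r \<gamma> by (intro powr_mono2) auto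
   then have "r powr \<gamma> \<le> c * P r" using k[OF cs(4)] by simp
   ultimately show ?thesis using ge Pr0 by simp
  qed
 qed
 show ?thesis
 proof (rule that[OF bD b'c _ _ cs(5) main])
  show "b r = P r" if "r \<ge> 0" for r using that P0 by (auto simp: b_def)
  show "b' r * r - b r = p r" if "r \<ge> 0" for r
   using that P0 p0 by (cases "r = 0") (auto simp: b_def b'_def)
 qed
qed

section \<open>Forces whose gradient is a limit of gradients of test functions\<close>

lemma integrable_powr_larger:
 fixes \<rho> :: "R3 \<Rightarrow> real"
 assumes [measurable]: "\<rho> \<in> borel_measurable borel" and rb: "\<And>x. 0 \<le> \<rho> x" "\<And>x. \<rho> x \<le> M" and i: "integrable lborel (\<lambda>x. \<rho> x powr \<gamma>)" and s: "s \<ge> \<gamma>"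
 shows "integrable lborel (\<lambda>x. \<rho> x powr s)"
proof (rule Bochner_Integration.integrable_bound)
 show "integrable lborel (\<lambda>x. M powr (s - \<gamma>) * \<rho> x powr \<gamma>)" using i by simp
 show "AE x in lborel. norm (\<rho> x powr s) \<le> norm (M powr (s - \<gamma>) * \<rho> x powr \<gamma>)"
 proof (rule AE_I2)
  fix x
  have "\<rho> x powr s = \<rho> x powr (s - \<gamma>) * \<rho> x powr \<gamma>" by (simp flip: powr_add)
  also have "\<dots> \<le> M powr (s - \<gamma>) * \<rho> x powr \<gamma>" using rb s by (intro mult_right_mono powr_mono2) auto
  finally show "norm (\<rho> x powr s) \<le> norm (M powr (s - \<gamma>) * \<rho> x powr \<gamma>)" by simp
 qed
qed measurable

lemma integrable_weighted_powr:
 fixes \<rho> :: "R3 \<Rightarrow> real" and V :: "R3 \<Rightarrow> R3"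
 assumes rm[measurable]: "\<rho> \<in> borel_measurable borel" and rb: "\<And>x. 0 \<le> \<rho> x" and [measurable]: "V \<in> borel_measurable borel"
  and \<rho>: "integrable lborel (\<lambda>x. \<rho> x powr s)" and V: "integrable lborel (\<lambda>x. norm (V x) powr t)"
  and r: "r > 0" "s > r" "t > r" "1 / r = 1 / s + 1 / t"
 shows "integrable lborel (\<lambda>x. norm (\<rho> x *\<^sub>R V x) powr r)"
proof -
 have pq: "s / r > 1" "t / r > 1" "1 / (s / r) + 1 / (t / r) = 1"
 proof -
  show "s / r > 1" "t / r > 1" using r by simp_all
  have "1 / (s / r) + 1 / (t / r) = r * (1 / s + 1 / t)" by (simp add: distrib_left)
  also have "\<dots> = 1" unfolding r(4)[symmetric] using r(1) by simp
  finally show "1 / (s / r) + 1 / (t / r) = 1" .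
 qed
 have "integrable lborel (\<lambda>x. norm (\<rho> x powr r) * norm (norm (V x) powr r))"
  by (rule Holder_integrable(1)[OF pq]) (use \<rho> V r in \<open>simp_all add: powr_powr\<close>)
 then show ?thesis using rb by (simp add: powr_mult)
qed

lemma norm_diff_powr_le:
 assumes "q > 0" shows "norm (x - y :: 'a::real_normed_vector) powr q \<le> 2 powr q * norm x powr q + 2 powr q * norm y powr q"
proof -
 have "norm (x - y) \<le> 2 * max (norm x) (norm y)" using norm_triangle_ineq4[of x y] by (auto simp: max_def)
 then have "norm (x - y) powr q \<le> (2 * max (norm x) (norm y)) powr q" using assms by (intro powr_mono2) auto
 also have "\<dots> = 2 powr q * max (norm x) (norm y) powr q" by (simp add: powr_mult)
 also have "max (norm x) (norm y) powr q \<le> norm x powr q + norm y powr q" by (auto simp: max_def)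
 finally show ?thesis by (simp add: distrib_left)
qed

text \<open>The work of \<open>grad (\<psi> n)\<close> against the momentum is zero by the
  continuity equation. It passes to the limit because \<rho> u lies in the dual of L^q, where q is
  the exponent in which the gradients converge.\<close>

lemma force_D0:
 fixes \<rho> :: "R3 \<Rightarrow> real" and u :: "R3 \<Rightarrow> R3"
 assumes \<Omega>: "open \<Omega>" and G: "G \<in> D0 q \<Omega>" and q: "q \<ge> 6 / 5" "q > 6 / 5 \<Longrightarrow> \<gamma> \<le> 6 * q / (5 * q - 6)"
  and rm[measurable]: "\<rho> \<in> borel_measurable borel" and rb: "\<And>x. 0 \<le> \<rho> x" "\<And>x. \<rho> x \<le> M"
  and rg: "integrable lborel (\<lambda>x. \<rho> x powr \<gamma>)"
  and um[measurable]: "u \<in> borel_measurable borel" and u6: "integrable lborel (\<lambda>x. norm (u x) ^ 6)"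
  and cont: "\<And>f. f \<in> Cc_inf UNIV \<Longrightarrow> (LBINT x. \<rho> x * (u x \<bullet> grad f x)) = 0"
 shows "\<exists>W. W \<in> borel_measurable borel \<and> (\<forall>x. x \<notin> \<Omega> \<longrightarrow> W x = 0) \<and> (AE x in lborel. x \<in> \<Omega> \<longrightarrow> weak_grad \<Omega> G x = W x) \<and>
  integrable lborel (\<lambda>x. norm (\<rho> x *\<^sub>R W x) powr (6 / 5)) \<and> (LBINT x. (\<rho> x *\<^sub>R W x) \<bullet> u x) = 0"
proof -
 obtain \<psi> g where \<psi>: "\<And>n. \<psi> n \<in> Cc_inf \<Omega>" and g: "has_weak_gradient \<Omega> G g" "g \<in> Lq q \<Omega>"
  and lim: "(\<lambda>n. LINT x:\<Omega>|lebesgue. norm (grad (\<psi> n) x - g x) powr q) \<longlonglongrightarrow> 0"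
  using G unfolding D0_def D0_approx_def by blast
 have gm: "g \<in> borel_measurable (lebesgue_on \<Omega>)" and gi: "set_integrable lebesgue \<Omega> (\<lambda>x. norm (g x) powr q)"
  using g(2) by (auto simp: Lq_def)
 obtain W where Wm[measurable]: "W \<in> borel_measurable borel" and Wz: "\<And>x. x \<notin> \<Omega> \<Longrightarrow> W x = 0"
  and We: "AE x in lborel. x \<in> \<Omega> \<longrightarrow> g x = W x"
  using borel_rep_on[OF \<Omega> gm] by blast
 have wg: "AE x in lborel. x \<in> \<Omega> \<longrightarrow> weak_grad \<Omega> G x = W x"
  using weak_grad_eq_AE[OF \<Omega> g(1)] We by eventually_elim auto
 have q1: "q > 1" "q > 0" using q(1) by auto
 have Wi: "integrable lborel (\<lambda>x. norm (W x) powr q)"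
 proof (rule lebesgue_integral_borel_rep(2)[THEN iffD1, OF _ _ _ gi])
  show "AE x in lborel. x \<in> \<Omega> \<longrightarrow> norm (g x) powr q = norm (W x) powr q" using We by eventually_elim auto
 qed (auto simp: Wz)
 have gmeas[measurable]: "grad (\<psi> n) \<in> borel_measurable borel" for n by (rule Cc_inf_integrable_sq(2)[OF \<psi>])
 have d0: "(\<lambda>n. LBINT x. norm (grad (\<psi> n) x - W x) powr q) \<longlonglongrightarrow> 0"
 proof -
  have "(LINT x:\<Omega>|lebesgue. norm (grad (\<psi> n) x - g x) powr q) = (LBINT x. norm (grad (\<psi> n) x - W x) powr q)" for n
  proof (rule lebesgue_integral_borel_rep(1))
   show "AE x in lborel. x \<in> \<Omega> \<longrightarrow> norm (grad (\<psi> n) x - g x) powr q = norm (grad (\<psi> n) x - W x) powr q"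
    using We by eventually_elim auto
  qed (auto simp: Wz Cc_inf_zero_outside[OF \<psi>])
  then show ?thesis using lim by simp
 qed
 have di: "integrable lborel (\<lambda>x. norm (grad (\<psi> n) x - W x) powr q)" for n
 proof (rule Bochner_Integration.integrable_bound)
  obtain R where R: "\<And>x. x \<notin> cball 0 R \<Longrightarrow> \<psi> n x = 0" using Cc_inf_bounded_support[OF \<psi>] by metis
  have gz: "grad (\<psi> n) x = 0" if "x \<notin> cball 0 R" for x by (rule grad_zero_outside[OF _ R that]) auto
  have cg: "continuous_on UNIV (grad (\<psi> n))" using \<psi>[of n] by (auto simp: Cc_inf_iff intro: smooth_grad_continuous)
  obtain L where L: "L > 0" "\<And>x. norm (grad (\<psi> n) x) \<le> L" using bounded_continuous_cball[OF cg gz] by metis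
  have "integrable lborel (\<lambda>x. norm (grad (\<psi> n) x) powr q)"
  proof (rule Bochner_Integration.integrable_bound)
   show "integrable lborel (\<lambda>x::R3. L powr q * indicator (cball 0 R) x :: real)"
    by (intro integrable_mult_right integrable_real_indicator) (auto simp: emeasure_cball_less_top)
   show "AE x in lborel. norm (norm (grad (\<psi> n) x) powr q) \<le> norm (L powr q * indicator (cball 0 R) x :: real)"
   proof (rule AE_I2)
    fix x show "norm (norm (grad (\<psi> n) x) powr q) \<le> norm (L powr q * indicator (cball 0 R) x :: real)"
     using q1 L powr_mono2[of q "norm (grad (\<psi> n) x)" L] by (cases "x \<in> cball 0 R") (auto simp: gz)
   qed
  qed measurable
  then show "integrable lborel (\<lambda>x. 2 powr q * norm (grad (\<psi> n) x) powr q + 2 powr q * norm (W x) powr q)" using Wi by auto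
  show "AE x in lborel. norm (norm (grad (\<psi> n) x - W x) powr q) \<le> norm (2 powr q * norm (grad (\<psi> n) x) powr q + 2 powr q * norm (W x) powr q)"
   using norm_diff_powr_le[OF q1(2)] by (intro AE_I2) auto
 qed measurable
 define q' where "q' = q / (q - 1)"
 have q': "q' > 1" "1 / q' + 1 / q = 1" using q1 by (auto simp: q'_def field_simps)
 have u6': "integrable lborel (\<lambda>x. norm (u x) powr 6)" using u6 by simp
 have M0: "M \<ge> 0" using order_trans[OF rb] .
 have rW: "integrable lborel (\<lambda>x. norm (\<rho> x *\<^sub>R W x) powr (6 / 5))" and ru: "integrable lborel (\<lambda>x. norm (\<rho> x *\<^sub>R u x) powr q')"
 proof -
  have bd: "integrable lborel (\<lambda>x. norm (\<rho> x *\<^sub>R V x) powr t)" if "integrable lborel (\<lambda>x. norm (V x) powr t)" "t > 0" "V \<in> borel_measurable borel" for V :: "R3 \<Rightarrow> R3" and t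
  proof (rule Bochner_Integration.integrable_bound)
   show "integrable lborel (\<lambda>x. M powr t * norm (V x) powr t)" using that by simp
   show "(\<lambda>x. norm (\<rho> x *\<^sub>R V x) powr t) \<in> borel_measurable lborel" using that(3) by measurable
   show "AE x in lborel. norm (norm (\<rho> x *\<^sub>R V x) powr t) \<le> norm (M powr t * norm (V x) powr t)"
    using rb that(2) by (intro AE_I2) (auto simp: powr_mult intro!: mult_right_mono powr_mono2)
  qed
  have "integrable lborel (\<lambda>x. norm (\<rho> x *\<^sub>R W x) powr (6 / 5)) \<and> integrable lborel (\<lambda>x. norm (\<rho> x *\<^sub>R u x) powr q')"
  \<comment> \<open>At q = 6/5 the exponent s becomes infinite and the bound \<rho> \<le> M takes
    its place; the dual exponent of q is then 6, that of \<open>u\<close> itself.\<close>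
  proof (cases "q = 6 / 5")
   case True
   have "q' = (6 / 5) / (6 / 5 - 1)" by (simp only: q'_def True)
   then have "q' = 6" by simp
   then show ?thesis using bd[of W "6 / 5"] bd[of u 6] Wi u6' True by simp
  next
   case False
   then have q65: "q > 6 / 5" using q(1) by simp
   \<comment> \<open>The exponent with 1/s = 5/6 - 1/q. It equally satisfies 1/s = 1/q' - 1/6, so
     one integrability property of \<rho> handles both \<rho> grad G in L^(6/5) and \<rho> u in
     L^q'.\<close>
   define s where "s = 6 * q / (5 * q - 6)"
   have D: "5 * q - 6 > 0" "q - 1 > 0" using q65 by auto
   have s: "s > 6 / 5" "1 / (6 / 5) = 1 / s + 1 / q" using D q1 by (auto simp: s_def field_simps)
   have sq: "s > q'" "1 / q' = 1 / s + 1 / 6" "q' < 6"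
    using D q1 by (auto simp: s_def q'_def field_simps)
   have rs: "integrable lborel (\<lambda>x. \<rho> x powr s)"
    by (rule integrable_powr_larger[OF rm rb rg]) (use q(2)[OF q65] in \<open>simp add: s_def\<close>)
   have "integrable lborel (\<lambda>x. norm (\<rho> x *\<^sub>R W x) powr (6 / 5))"
    by (rule integrable_weighted_powr[OF rm rb(1) Wm rs Wi]) (use s q65 in auto)
   moreover have "integrable lborel (\<lambda>x. norm (\<rho> x *\<^sub>R u x) powr q')"
    by (rule integrable_weighted_powr[OF rm rb(1) um rs u6']) (use sq q' in auto)
   ultimately show ?thesis by simp
  qed
  then show "integrable lborel (\<lambda>x. norm (\<rho> x *\<^sub>R W x) powr (6 / 5))" "integrable lborel (\<lambda>x. norm (\<rho> x *\<^sub>R u x) powr q')" by auto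
 qed
 have h65: "(6 / 5::real) > 1" "(6::real) > 1" "1 / (6 / 5) + 1 / 6 = (1::real)" by auto
 have iWu: "integrable lborel (\<lambda>x. (\<rho> x *\<^sub>R W x) \<bullet> u x)"
 proof (rule Bochner_Integration.integrable_bound)
  show "integrable lborel (\<lambda>x. norm (\<rho> x *\<^sub>R W x) * norm (u x))"
   by (rule Holder_integrable(1)[OF h65]) (use rW u6 in simp_all)
  show "AE x in lborel. norm ((\<rho> x *\<^sub>R W x) \<bullet> u x) \<le> norm (norm (\<rho> x *\<^sub>R W x) * norm (u x))"
   using Cauchy_Schwarz_ineq2[of "\<rho> x *\<^sub>R W x" "u x" for x] by (intro AE_I2) simp
 qed measurable
 have "(\<lambda>n. LBINT x. \<rho> x * (u x \<bullet> grad (\<psi> n) x)) \<longlonglongrightarrow> (LBINT x. (\<rho> x *\<^sub>R W x) \<bullet> u x)"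
 proof (rule integral_tendsto_dominated_diff(1)[OF _ iWu])
  show "integrable lborel (\<lambda>x. norm (\<rho> x *\<^sub>R u x) * norm (grad (\<psi> n) x - W x))" for n
   by (rule Holder_integrable(1)[OF q'(1) q1(1) q'(2)]) (use ru di in simp_all)
  show "(\<lambda>n. LBINT x. norm (\<rho> x *\<^sub>R u x) * norm (grad (\<psi> n) x - W x)) \<longlonglongrightarrow> 0"
   by (rule Holder_tendsto[OF q'(1) q1(1) q'(2)]) (use ru di d0 in simp_all)
  show "\<bar>\<rho> x * (u x \<bullet> grad (\<psi> n) x) - (\<rho> x *\<^sub>R W x) \<bullet> u x\<bar> \<le> norm (\<rho> x *\<^sub>R u x) * norm (grad (\<psi> n) x - W x)" for n x
  proof -
   have "\<rho> x * (u x \<bullet> grad (\<psi> n) x) - (\<rho> x *\<^sub>R W x) \<bullet> u x = (\<rho> x *\<^sub>R u x) \<bullet> (grad (\<psi> n) x - W x)"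
    by (simp add: inner_diff_right inner_commute right_diff_distrib)
   then show ?thesis using Cauchy_Schwarz_ineq2 by metis
  qed
 qed measurable
 moreover have "(LBINT x. \<rho> x * (u x \<bullet> grad (\<psi> n) x)) = 0" for n
  by (rule cont) (rule Cc_inf_mono[OF \<psi>], simp)
 ultimately have "(LBINT x. (\<rho> x *\<^sub>R W x) \<bullet> u x) = 0" by (simp add: LIMSEQ_const_iff)
 then show ?thesis using Wm Wz wg rW by blast
qed

section \<open>Bounded potentials with bounded gradient\<close>

lemma convolution_Ck:
 fixes f :: "R3 \<Rightarrow> real"
 assumes f: "loc_integrable f"
 shows "k \<in> Cc_inf UNIV \<Longrightarrow> Ck m (\<lambda>y. LBINT x. k (x - y) * f x)"
proof (induction m arbitrary: k)
 case 0
 show ?case by (rule Ck_SucD) (use convolution_Ck1(1)[OF 0 f] in simp)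
next
 case (Suc m)
 have "Ck m (\<lambda>y. (-1) * (LBINT x. partial i k (x - y) * f x))" for i
  by (intro Ck_mult Ck_const Suc.IH Cc_inf_partial Suc.prems)
 moreover have "partial i (\<lambda>y. LBINT x. k (x - y) * f x) = (\<lambda>y. (-1) * (LBINT x. partial i k (x - y) * f x))" for i
  by (rule ext) (simp add: convolution_Ck1(2)[OF Suc.prems f])
 moreover have "(\<lambda>y. LBINT x. k (x - y) * f x) differentiable (at y)" for y
  using convolution_Ck1(1)[OF Suc.prems f] by simp
 ultimately show ?case by simp
qed

lemma smooth_mollify:
 fixes f :: "R3 \<Rightarrow> real"
 assumes f: "loc_integrable f" and e: "\<epsilon> > 0"
 shows "smooth (mollify \<epsilon> f)"
proof -
 define k where "k = (\<lambda>w. bump ((1 / \<epsilon>) *\<^sub>R w + 0))"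
 have k: "k \<in> Cc_inf UNIV" unfolding k_def using e by (intro Cc_inf_reflected bump_Cc_inf) auto
 have kd: "k (x - y) = bump ((1 / \<epsilon>) *\<^sub>R x + (- (1 / \<epsilon>)) *\<^sub>R y)" for x y
  by (simp add: k_def scaleR_diff_right)
 have m: "mollify \<epsilon> f = (\<lambda>y. (1 / \<epsilon> ^ 3) * (LBINT x. k (x - y) * f x))"
  using kernel_subst[OF smooth_continuous[OF smooth_bump] bump_zero f e]
  unfolding mollify_def[abs_def] kd by simp
 show ?thesis unfolding m smooth_def by (intro allI Ck_mult Ck_const convolution_Ck[OF f k])
qed

lemma continuous_loc_integrable:
 fixes f :: "R3 \<Rightarrow> real"
 assumes "continuous_on UNIV f" shows "loc_integrable f"
 unfolding loc_integrable_def
proof (intro conjI allI)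
 show "f \<in> borel_measurable borel" using assms by (rule borel_measurable_continuous_onI)
 show "integrable lborel (\<lambda>x. indicator (cball 0 R) x *\<^sub>R f x)" for R
  by (rule borel_integrable_compact) (auto intro: continuous_on_subset[OF assms])
qed

text \<open>Testing the weak gradient of \<open>G\<close> with \<open>\<theta>\<close> times the mollified, hence smooth and divergence free, momentum.\<close>

lemma localized_force:
 fixes \<rho> G0 :: "R3 \<Rightarrow> real" and u W :: "R3 \<Rightarrow> R3"
 assumes \<Omega>: "open \<Omega>" and ru: "\<And>i. loc_integrable (\<lambda>x. \<rho> x * u x $ i)"
  and cont: "\<And>f. f \<in> Cc_inf UNIV \<Longrightarrow> (LBINT x. \<rho> x * (u x \<bullet> grad f x)) = 0"
  and Gm[measurable]: "G0 \<in> borel_measurable borel" and Gb: "\<And>x. \<bar>G0 x\<bar> \<le> C"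
  and Wm[measurable]: "W \<in> borel_measurable borel" and Wb: "\<And>x. norm (W x) \<le> C"
  and wk: "\<And>\<theta> i. \<theta> \<in> Cc_inf \<Omega> \<Longrightarrow> (LBINT x. G0 x * partial i \<theta> x) = - (LBINT x. \<theta> x * W x $ i)"
  and \<theta>: "\<theta> \<in> Cc_inf \<Omega>"
 shows "(LBINT x. \<theta> x * (\<rho> x * (u x \<bullet> W x))) = - (LBINT x. G0 x * (\<rho> x * (u x \<bullet> grad \<theta> x)))"
proof -
 obtain R where R: "\<And>x. x \<notin> cball 0 R \<Longrightarrow> \<theta> x = 0" using Cc_inf_bounded_support[OF \<theta>] by metis
 have c\<theta>: "continuous_on UNIV \<theta>" "continuous_on UNIV (grad \<theta>)" using \<theta> by (auto simp: Cc_inf_iff intro: smooth_continuous smooth_grad_continuous)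
 have s\<theta>: "smooth \<theta>" using \<theta> by (simp add: Cc_inf_iff)
 have pz: "partial i \<theta> x = 0" if "x \<notin> cball 0 R" for x i by (rule partial_zero_outside[OF _ R that]) auto
 have gz: "grad \<theta> x = 0" if "x \<notin> cball 0 R" for x using pz[OF that] by (simp add: vec_eq_iff)
 obtain X where X: "\<And>x. norm (\<theta> x) \<le> X" using bounded_continuous_cball[OF c\<theta>(1) R] by metis
 obtain Y where Y: "\<And>x. norm (grad \<theta> x) \<le> Y" using bounded_continuous_cball[OF c\<theta>(2) gz] by metis
 have Yp: "\<bar>partial i \<theta> x\<bar> \<le> Y" for i x using order_trans[OF component_le_norm_cart[of "grad \<theta> x" i] Y] by simp
 have [measurable]: "\<theta> \<in> borel_measurable borel" using c\<theta>(1) by (rule borel_measurable_continuous_onI)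
 have [measurable]: "partial i \<theta> \<in> borel_measurable borel" for i by (intro borel_measurable_continuous_onI smooth_continuous smooth_partial s\<theta>)
 have Wi[measurable]: "(\<lambda>x. W x $ i) \<in> borel_measurable borel" for i
 proof -
  have "(\<lambda>x. W x \<bullet> axis i 1) \<in> borel_measurable borel" by measurable
  then show ?thesis by (simp add: inner_axis)
 qed
 have C0: "C \<ge> 0" using order_trans[OF norm_ge_zero Wb] .
 \<comment> \<open>One scale must serve all three components, since the divergence of the mollified
   momentum vanishes only when they are mollified alike; hence the minimum of the three
   thresholds.\<close>
 obtain \<epsilon> :: "nat \<Rightarrow> real" where \<epsilon>: "\<And>m. \<epsilon> m > 0" and blim: "\<And>i. (\<lambda>m. bnorm R (\<lambda>x. mollify (\<epsilon> m) (\<lambda>x. \<rho> x * u x $ i) x - \<rho> x * u x $ i)) \<longlonglongrightarrow> 0"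
 proof -
  have "\<exists>e>0. \<forall>i. bnorm R (\<lambda>x. mollify e (\<lambda>x. \<rho> x * u x $ i) x - \<rho> x * u x $ i) \<le> inverse (real (Suc m))" for m
  proof -
   have p: "inverse (real (Suc m)) > 0" by simp
   have "\<forall>i. \<exists>d>0. \<forall>e. 0 < e \<longrightarrow> e < d \<longrightarrow> bnorm R (\<lambda>x. mollify e (\<lambda>x. \<rho> x * u x $ i) x - \<rho> x * u x $ i) \<le> inverse (real (Suc m))"
   proof
    fix i show "\<exists>d>0. \<forall>e. 0 < e \<longrightarrow> e < d \<longrightarrow> bnorm R (\<lambda>x. mollify e (\<lambda>x. \<rho> x * u x $ i) x - \<rho> x * u x $ i) \<le> inverse (real (Suc m))"
     using bnorm_mollify[OF ru[of i] p, of R] by blast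
   qed
   from choice[OF this] obtain d where d: "\<forall>i. d i > 0 \<and> (\<forall>e. 0 < e \<longrightarrow> e < d i \<longrightarrow> bnorm R (\<lambda>x. mollify e (\<lambda>x. \<rho> x * u x $ i) x - \<rho> x * u x $ i) \<le> inverse (real (Suc m)))" by (rule exE)
   define e where "e = Min (range d) / 2"
   have mp: "Min (range d) > 0" using d by (subst Min_gr_iff) auto
   have "0 < e" using mp by (simp add: e_def)
   moreover have "e < d i" for i
   proof -
    have "Min (range d) \<le> d i" by (rule Min_le) auto
    then show ?thesis using mp unfolding e_def by linarith
   qed
   ultimately show ?thesis using d by blast
  qed
  then have "\<forall>m. \<exists>e>0. \<forall>i. bnorm R (\<lambda>x. mollify e (\<lambda>x. \<rho> x * u x $ i) x - \<rho> x * u x $ i) \<le> inverse (real (Suc m))" by blast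
  from choice[OF this] obtain e where e: "\<forall>m. e m > 0 \<and> (\<forall>i. bnorm R (\<lambda>x. mollify (e m) (\<lambda>x. \<rho> x * u x $ i) x - \<rho> x * u x $ i) \<le> inverse (real (Suc m)))" by (rule exE)
  have "(\<lambda>m. bnorm R (\<lambda>x. mollify (e m) (\<lambda>x. \<rho> x * u x $ i) x - \<rho> x * u x $ i)) \<longlonglongrightarrow> 0" for i
  proof (rule tendsto_sandwich[OF _ _ tendsto_const LIMSEQ_inverse_real_of_nat])
   show "\<forall>\<^sub>F m in sequentially. bnorm R (\<lambda>x. mollify (e m) (\<lambda>x. \<rho> x * u x $ i) x - \<rho> x * u x $ i) \<le> inverse (real (Suc m))"
    by (rule always_eventually, rule allI) (use e in blast)
  qed (simp add: bnorm_nonneg)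
  with that e show thesis by blast
 qed
 define v where "v m i = mollify (\<epsilon> m) (\<lambda>x. \<rho> x * u x $ i)" for m i
 have vb: "(\<lambda>m. bnorm R (\<lambda>x. v m i x - \<rho> x * u x $ i)) \<longlonglongrightarrow> 0" for i unfolding v_def by (rule blim)
 have vs: "smooth (v m i)" for m i unfolding v_def by (rule smooth_mollify[OF ru \<epsilon>])
 have vl: "loc_integrable (v m i)" for m i by (intro continuous_loc_integrable smooth_continuous vs)
 have w1: "(\<lambda>x. \<theta> x * W x $ i) \<in> borel_measurable borel" "\<And>x. \<bar>\<theta> x * W x $ i\<bar> \<le> X * C" "\<And>x. x \<notin> cball 0 R \<Longrightarrow> \<theta> x * W x $ i = 0" for i
 proof -
  show "\<bar>\<theta> x * W x $ i\<bar> \<le> X * C" for x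
   using X[of x] order_trans[OF component_le_norm_cart Wb, of x i] order_trans[OF abs_ge_zero X[of x, unfolded real_norm_def]]
   unfolding abs_mult by (intro mult_mono) auto
 qed (use R in \<open>measurable, simp\<close>)
 have w2: "(\<lambda>x. G0 x * partial i \<theta> x) \<in> borel_measurable borel" "\<And>x. \<bar>G0 x * partial i \<theta> x\<bar> \<le> C * Y" "\<And>x. x \<notin> cball 0 R \<Longrightarrow> G0 x * partial i \<theta> x = 0" for i
 proof -
  show "\<bar>G0 x * partial i \<theta> x\<bar> \<le> C * Y" for x
   using Gb[of x] Yp[of i x] C0 unfolding abs_mult by (intro mult_mono) auto
 qed (use pz in \<open>measurable, simp\<close>)
 have id: "(\<Sum>i\<in>UNIV. LBINT x. (G0 x * partial i \<theta> x) * v m i x) = - (\<Sum>i\<in>UNIV. LBINT x. (\<theta> x * W x $ i) * v m i x)" for m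
 proof -
  \<comment> \<open>The test function is \<theta> times a component of the mollified momentum. By
    the product rule, the part in which the derivative falls on the momentum sums to the divergence
    and drops out.\<close>
  have wk': "(LBINT x. G0 x * partial i (\<lambda>x. v m i x * \<theta> x) x) = - (LBINT x. (\<theta> x * W x $ i) * v m i x)" for i
   using wk[OF Cc_inf_mult[OF \<theta> vs], of i m i] by (simp add: mult_ac)
  have pv: "partial i (\<lambda>x. v m i x * \<theta> x) x = v m i x * partial i \<theta> x + partial i (v m i) x * \<theta> x" for i x
   by (intro partial_mult smooth_differentiable vs s\<theta>)
  have i1: "integrable lborel (\<lambda>x. (G0 x * partial i \<theta> x) * v m i x)" for i
   by (rule integrable_bounded_cball_mult[OF w2 vl])
  have i2: "integrable lborel (\<lambda>x. (G0 x * \<theta> x) * partial i (v m i) x)" for i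
  proof (rule integrable_bounded_cball_mult)
   show "\<bar>G0 x * \<theta> x\<bar> \<le> C * X" for x using Gb[of x] X[of x] C0 unfolding abs_mult by (intro mult_mono) auto
   show "G0 x * \<theta> x = 0" if "x \<notin> cball 0 R" for x using R[OF that] by simp
   show "loc_integrable (partial i (v m i))" by (intro continuous_loc_integrable smooth_continuous smooth_partial vs)
  qed measurable
  have "(LBINT x. G0 x * partial i (\<lambda>x. v m i x * \<theta> x) x) = (LBINT x. (G0 x * partial i \<theta> x) * v m i x) + (LBINT x. (G0 x * \<theta> x) * partial i (v m i) x)" for i
  proof -
   have "(LBINT x. G0 x * partial i (\<lambda>x. v m i x * \<theta> x) x) = (LBINT x. (G0 x * partial i \<theta> x) * v m i x + (G0 x * \<theta> x) * partial i (v m i) x)"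
    unfolding pv by (simp add: algebra_simps)
   then show ?thesis using i1[of i] i2[of i] by simp
  qed
  then have "(\<Sum>i\<in>UNIV. LBINT x. G0 x * partial i (\<lambda>x. v m i x * \<theta> x) x)
    = (\<Sum>i\<in>UNIV. LBINT x. (G0 x * partial i \<theta> x) * v m i x) + (\<Sum>i\<in>UNIV. LBINT x. (G0 x * \<theta> x) * partial i (v m i) x)"
   by (simp add: sum.distrib)
  also have "(\<Sum>i\<in>UNIV. LBINT x. (G0 x * \<theta> x) * partial i (v m i) x) = (LBINT x. (\<Sum>i\<in>UNIV. (G0 x * \<theta> x) * partial i (v m i) x))"
   by (rule Bochner_Integration.integral_sum[symmetric]) (rule i2)
  also have "(\<lambda>x. (\<Sum>i\<in>UNIV. (G0 x * \<theta> x) * partial i (v m i) x)) = (\<lambda>x. 0)"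
   unfolding v_def by (rule ext) (simp only: sum_distrib_left[symmetric] mollify_divergence_free[OF ru cont \<epsilon>] mult_zero_right)
  finally have "(\<Sum>i\<in>UNIV. LBINT x. G0 x * partial i (\<lambda>x. v m i x * \<theta> x) x) = (\<Sum>i\<in>UNIV. LBINT x. (G0 x * partial i \<theta> x) * v m i x)"
   by simp
  then show ?thesis unfolding wk' by (simp add: sum_negf)
 qed
 have l1: "(\<lambda>m. \<Sum>i\<in>UNIV. LBINT x. (G0 x * partial i \<theta> x) * v m i x) \<longlonglongrightarrow> (\<Sum>i\<in>UNIV. LBINT x. (G0 x * partial i \<theta> x) * (\<rho> x * u x $ i))"
  by (rule tendsto_sum, rule integral_tendsto_bnorm(1)[OF w2 vl ru vb])
 have l2: "(\<lambda>m. - (\<Sum>i\<in>UNIV. LBINT x. (\<theta> x * W x $ i) * v m i x)) \<longlonglongrightarrow> - (\<Sum>i\<in>UNIV. LBINT x. (\<theta> x * W x $ i) * (\<rho> x * u x $ i))"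
  by (rule tendsto_minus, rule tendsto_sum, rule integral_tendsto_bnorm(1)[OF w1 vl ru vb])
 have eq: "(\<Sum>i\<in>UNIV. LBINT x. (G0 x * partial i \<theta> x) * (\<rho> x * u x $ i)) = - (\<Sum>i\<in>UNIV. LBINT x. (\<theta> x * W x $ i) * (\<rho> x * u x $ i))"
  by (rule LIMSEQ_unique[OF l1 l2[folded id]])
 have "(\<Sum>i\<in>UNIV. LBINT x. (G0 x * partial i \<theta> x) * (\<rho> x * u x $ i)) = (LBINT x. (\<Sum>i\<in>UNIV. (G0 x * partial i \<theta> x) * (\<rho> x * u x $ i)))"
  by (rule Bochner_Integration.integral_sum[symmetric]) (rule integrable_bounded_cball_mult[OF w2 ru])
 also have "\<dots> = (LBINT x. G0 x * (\<rho> x * (u x \<bullet> grad \<theta> x)))"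
  by (simp add: inner_vec_def sum_distrib_left mult_ac)
 finally have e1: "(\<Sum>i\<in>UNIV. LBINT x. (G0 x * partial i \<theta> x) * (\<rho> x * u x $ i)) = (LBINT x. G0 x * (\<rho> x * (u x \<bullet> grad \<theta> x)))" .
 have "(\<Sum>i\<in>UNIV. LBINT x. (\<theta> x * W x $ i) * (\<rho> x * u x $ i)) = (LBINT x. (\<Sum>i\<in>UNIV. (\<theta> x * W x $ i) * (\<rho> x * u x $ i)))"
  by (rule Bochner_Integration.integral_sum[symmetric]) (rule integrable_bounded_cball_mult[OF w1 ru])
 also have "\<dots> = (LBINT x. \<theta> x * (\<rho> x * (u x \<bullet> W x)))"
  by (simp add: inner_vec_def sum_distrib_left mult_ac)
 finally show ?thesis using eq e1 by simp
qed

text \<open>Truncating the representatives at \<open>C\<close> turns bounds almost everywhere into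
  bounds everywhere and changes the functions inside \<Omega> only on a null set, so the weak
  gradient identity survives.\<close>

lemma W1_inf_weak_gradient:
 assumes \<Omega>: "open \<Omega>" and G: "G \<in> W1_inf \<Omega>"
 obtains G0 C W where "G0 \<in> borel_measurable borel" "\<And>x. \<bar>G0 x\<bar> \<le> C"
  "W \<in> borel_measurable borel" "\<And>x. norm (W x) \<le> C" "\<And>x. x \<notin> \<Omega> \<Longrightarrow> W x = 0"
  "AE x in lborel. x \<in> \<Omega> \<longrightarrow> weak_grad \<Omega> G x = W x"
  "\<And>\<theta> i. \<theta> \<in> Cc_inf \<Omega> \<Longrightarrow> (LBINT x. G0 x * partial i \<theta> x) = - (LBINT x. \<theta> x * W x $ i)"
proof -
 obtain g where g: "has_weak_gradient \<Omega> G g" and gL: "g \<in> Linf \<Omega>" and GL: "G \<in> Linf \<Omega>" using G by (auto simp: W1_inf_def)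
 obtain C1 C2 where C1: "AE x in lborel. x \<in> \<Omega> \<longrightarrow> norm (G x) \<le> C1" and C2: "AE x in lborel. x \<in> \<Omega> \<longrightarrow> norm (g x) \<le> C2"
  using gL GL by (auto simp: Linf_def AE_completion_iff)
 define C where "C = max 0 (max C1 C2)"
 obtain G1 where G1[measurable]: "G1 \<in> borel_measurable borel" and G1z: "\<And>x. x \<notin> \<Omega> \<Longrightarrow> G1 x = 0" and G1e: "AE x in lborel. x \<in> \<Omega> \<longrightarrow> G x = G1 x"
  using borel_rep_on[OF \<Omega>, of G] GL unfolding Linf_def by blast
 obtain W1 where W1[measurable]: "W1 \<in> borel_measurable borel" and W1z: "\<And>x. x \<notin> \<Omega> \<Longrightarrow> W1 x = 0" and W1e: "AE x in lborel. x \<in> \<Omega> \<longrightarrow> g x = W1 x"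
  using borel_rep_on[OF \<Omega>, of g] gL unfolding Linf_def by blast
 define G0 where "G0 x = (if norm (G1 x) \<le> C then G1 x else 0)" for x
 define W where "W x = (if norm (W1 x) \<le> C then W1 x else 0)" for x
 have [measurable]: "G0 \<in> borel_measurable borel" "W \<in> borel_measurable borel" unfolding G0_def[abs_def] W_def[abs_def] by measurable
 have b: "\<bar>G0 x\<bar> \<le> C" "norm (W x) \<le> C" for x by (auto simp: G0_def W_def C_def)
 have z: "G0 x = 0" "W x = 0" if "x \<notin> \<Omega>" for x using G1z[OF that] W1z[OF that] by (auto simp: G0_def W_def)
 have Ge: "AE x in lborel. x \<in> \<Omega> \<longrightarrow> G x = G0 x" using C1 G1e by eventually_elim (auto simp: G0_def C_def)
 have We: "AE x in lborel. x \<in> \<Omega> \<longrightarrow> g x = W x" using C2 W1e by eventually_elim (auto simp: W_def C_def)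
 have wg: "AE x in lborel. x \<in> \<Omega> \<longrightarrow> weak_grad \<Omega> G x = W x"
  using weak_grad_eq_AE[OF \<Omega> g] We by eventually_elim auto
 have wk: "(LBINT x. G0 x * partial i \<theta> x) = - (LBINT x. \<theta> x * W x $ i)" if \<theta>: "\<theta> \<in> Cc_inf \<Omega>" for \<theta> i
 proof -
  obtain R where R: "\<And>x. x \<notin> cball 0 R \<Longrightarrow> \<theta> x = 0" using Cc_inf_bounded_support[OF \<theta>] by metis
  have c: "continuous_on UNIV \<theta>" "continuous_on UNIV (grad \<theta>)" using \<theta> by (auto simp: Cc_inf_iff intro: smooth_continuous smooth_grad_continuous)
  have gz: "grad \<theta> x = 0" if "x \<notin> cball 0 R" for x by (rule grad_zero_outside[OF _ R that]) auto
  have [measurable]: "\<theta> \<in> borel_measurable borel" "grad \<theta> \<in> borel_measurable borel" using c by (auto intro: borel_measurable_continuous_onI)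
  have i1: "integrable lborel (\<lambda>x. G0 x *\<^sub>R grad \<theta> x)"
  proof (rule Bochner_Integration.integrable_bound)
   show "integrable lborel (\<lambda>x. C *\<^sub>R grad \<theta> x)" by (intro integrable_scaleR_right integrable_continuous_cball[OF c(2) gz])
   show "AE x in lborel. norm (G0 x *\<^sub>R grad \<theta> x) \<le> norm (C *\<^sub>R grad \<theta> x)"
    using order_trans[OF b(1) abs_ge_self] by (auto intro!: mult_right_mono)
  qed measurable
  have i2: "integrable lborel (\<lambda>x. \<theta> x *\<^sub>R W x)"
  proof (rule Bochner_Integration.integrable_bound)
   show "integrable lborel (\<lambda>x. C *\<^sub>R \<theta> x)" by (intro integrable_scaleR_right integrable_continuous_cball[OF c(1) R])
   have "\<bar>\<theta> x\<bar> * norm (W x) \<le> \<bar>\<theta> x\<bar> * \<bar>C\<bar>" for x using order_trans[OF b(2) abs_ge_self] by (intro mult_left_mono) auto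
   then show "AE x in lborel. norm (\<theta> x *\<^sub>R W x) \<le> norm (C *\<^sub>R \<theta> x)" by (simp add: abs_mult mult.commute)
  qed measurable
  have Ge': "AE x in lborel. x \<in> \<Omega> \<longrightarrow> G x *\<^sub>R grad \<theta> x = G0 x *\<^sub>R grad \<theta> x" using Ge by eventually_elim auto
  have We': "AE x in lborel. x \<in> \<Omega> \<longrightarrow> \<theta> x *\<^sub>R g x = \<theta> x *\<^sub>R W x" using We by eventually_elim auto
  have "(LINT x:\<Omega>|lebesgue. G x *\<^sub>R grad \<theta> x) = - (LINT x:\<Omega>|lebesgue. \<theta> x *\<^sub>R g x)" using g \<theta> by (auto simp: has_weak_gradient_def)
  also have "(LINT x:\<Omega>|lebesgue. G x *\<^sub>R grad \<theta> x) = (LBINT x. G0 x *\<^sub>R grad \<theta> x)"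
   by (rule lebesgue_integral_borel_rep(1)[OF _ _ Ge']) (measurable, simp add: z)
  also have "(LINT x:\<Omega>|lebesgue. \<theta> x *\<^sub>R g x) = (LBINT x. \<theta> x *\<^sub>R W x)"
   by (rule lebesgue_integral_borel_rep(1)[OF _ _ We']) (measurable, simp add: z)
  finally have "(LBINT x. G0 x *\<^sub>R grad \<theta> x) \<bullet> axis i 1 = (- (LBINT x. \<theta> x *\<^sub>R W x)) \<bullet> axis i 1" by simp
  then have "(LBINT x. (G0 x *\<^sub>R grad \<theta> x) \<bullet> axis i 1) = - (LBINT x. (\<theta> x *\<^sub>R W x) \<bullet> axis i 1)"
   unfolding inner_minus_left using integral_inner_left[OF i1] integral_inner_left[OF i2] by simp
  then show ?thesis by (simp add: inner_axis)
 qed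
 show thesis using that[of G0 C W] b z wg wk by simp
qed

lemma product_dominates_squares: "(a::real) * b \<le> a\<^sup>2 + b\<^sup>2"
proof -
 have "2 * (a * b) \<le> a\<^sup>2 + b\<^sup>2" using sum_squares_bound[of a b] by (simp add: mult.assoc)
 moreover have "0 \<le> a\<^sup>2 + b\<^sup>2" by simp
 ultimately show ?thesis by linarith
qed

text \<open>The coefficient is that of the gradient of |v|^2/(|v|^2 + \<delta>). The first bound
  depends on \<delta> and serves the approximation of \<open>u\<close> at fixed \<delta>; the second
  is uniform and serves the limit in which \<delta> tends to 0.\<close>

lemma cutoff_coefficient_bounds:
 fixes v :: R3
 assumes d: "\<delta> > 0"
 shows "2 * \<delta> / ((norm v)\<^sup>2 + \<delta>)\<^sup>2 * norm v \<le> 2 * (1 + 1 / \<delta>)" and "2 * \<delta> / ((norm v)\<^sup>2 + \<delta>)\<^sup>2 * (norm v)\<^sup>2 \<le> 2"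
proof -
 define t where "t = (norm v)\<^sup>2"
 have t: "t \<ge> 0" "t + \<delta> > 0" using d by (auto simp: t_def add_nonneg_pos)
 have "norm v \<le> 1 + t" using product_dominates_squares[of 1 "norm v"] by (simp add: t_def)
 also have "\<dots> \<le> (1 + 1 / \<delta>) * (t + \<delta>)" using t d by (simp add: field_simps add_increasing)
 finally have n: "norm v \<le> (1 + 1 / \<delta>) * (t + \<delta>)" .
 have "2 * \<delta> / (t + \<delta>)\<^sup>2 * norm v \<le> 2 * \<delta> / (t + \<delta>)\<^sup>2 * ((1 + 1 / \<delta>) * (t + \<delta>))"
  using d by (intro mult_left_mono n) auto
 also have "\<dots> = 2 * (1 + 1 / \<delta>) * (\<delta> / (t + \<delta>))" using t by (simp add: power2_eq_square)
 also have "\<dots> \<le> 2 * (1 + 1 / \<delta>) * 1" using t d by (intro mult_left_mono) auto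
 finally show "2 * \<delta> / ((norm v)\<^sup>2 + \<delta>)\<^sup>2 * norm v \<le> 2 * (1 + 1 / \<delta>)" by (simp add: t_def)
 have "\<delta> * t \<le> (t + \<delta>)\<^sup>2" using t d by (simp add: power2_sum)
 then have "\<delta> * t / (t + \<delta>)\<^sup>2 \<le> 1" using t by (intro divide_le_eq_1_pos[THEN iffD2]) auto
 then have "2 * (\<delta> * t / (t + \<delta>)\<^sup>2) \<le> 2" by linarith
 then show "2 * \<delta> / ((norm v)\<^sup>2 + \<delta>)\<^sup>2 * (norm v)\<^sup>2 \<le> 2" by (simp add: t_def mult.assoc)
qed

lemma abs_outer_inner_le: "\<bar>outer a b \<bullet> J\<bar> \<le> norm a * norm b * norm J"
 using Cauchy_Schwarz_ineq2[of "outer a b" J] by (simp add: norm_outer)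

text \<open>The chain rule for t/(t + \<delta>), with derivative \<delta>/(t + \<delta>)^2, at t =
  |\<phi>|^2. The positive denominator keeps the quotient smooth, and the numerator gives it the
  support of \<phi>.\<close>

lemma cutoff_grad:
 fixes \<phi> :: "R3 \<Rightarrow> R3"
 assumes \<phi>: "\<And>i. (\<lambda>x. \<phi> x $ i) \<in> Cc_inf \<Omega>" and d: "\<delta> > 0"
 defines "\<theta> \<equiv> \<lambda>x. (norm (\<phi> x))\<^sup>2 / ((norm (\<phi> x))\<^sup>2 + \<delta>)"
 shows "\<theta> \<in> Cc_inf \<Omega>" and "v \<bullet> grad \<theta> x = 2 * \<delta> / ((norm (\<phi> x))\<^sup>2 + \<delta>)\<^sup>2 * (outer (\<phi> x) v \<bullet> jacobian_mat \<phi> x)"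
proof -
 define F where "F x = (\<Sum>i\<in>UNIV. \<phi> x $ i * \<phi> x $ i)" for x
 have Fn: "(norm (\<phi> x))\<^sup>2 = F x" for x unfolding F_def power2_norm_eq_inner inner_vec_def by simp
 have s: "smooth (\<lambda>x. \<phi> x $ i)" for i using \<phi> by (simp add: Cc_inf_iff)
 have FC: "F \<in> Cc_inf \<Omega>" unfolding F_def[abs_def] by (intro Cc_inf_sum Cc_inf_mult \<phi> s) auto
 have F0: "F x \<ge> 0" "F x + \<delta> > 0" for x using d unfolding Fn[symmetric] by (auto simp: add_nonneg_pos)
 have \<theta>: "\<theta> = (\<lambda>x. inverse (F x + \<delta>) * F x)" unfolding \<theta>_def Fn by (simp add: divide_inverse mult.commute)
 show "\<theta> \<in> Cc_inf \<Omega>" unfolding \<theta>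
  by (intro Cc_inf_mult[OF FC] smooth_inverse F0 smooth_add smooth_const) (use FC in \<open>simp add: Cc_inf_iff\<close>)
 have D: "((\<lambda>x. \<phi> x $ i) has_derivative (\<lambda>h. grad (\<lambda>x. \<phi> x $ i) x \<bullet> h)) (at x)" for i
  by (rule has_derivative_grad[OF smooth_differentiable[OF s]])
 have "(F has_derivative (\<lambda>h. \<Sum>i\<in>UNIV. \<phi> x $ i * (grad (\<lambda>x. \<phi> x $ i) x \<bullet> h) + (grad (\<lambda>x. \<phi> x $ i) x \<bullet> h) * \<phi> x $ i)) (at x)"
  unfolding F_def[abs_def] by (intro has_derivative_sum has_derivative_mult D)
 moreover have "((\<lambda>t. inverse (t + \<delta>) * t) has_real_derivative \<delta> / (F x + \<delta>)\<^sup>2) (at (F x))"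
  using F0(2)[of x] by (auto intro!: derivative_eq_intros simp: power2_eq_square field_simps)
 ultimately have D': "(\<theta> has_derivative (\<lambda>h. (\<Sum>i\<in>UNIV. \<phi> x $ i * (grad (\<lambda>x. \<phi> x $ i) x \<bullet> h) + (grad (\<lambda>x. \<phi> x $ i) x \<bullet> h) * \<phi> x $ i) * (\<delta> / (F x + \<delta>)\<^sup>2))) (at x)"
  unfolding \<theta> by (rule DERIV_compose_FDERIV[rotated])
 have E: "(\<Sum>i\<in>UNIV. \<phi> x $ i * (grad (\<lambda>x. \<phi> x $ i) x \<bullet> h) + (grad (\<lambda>x. \<phi> x $ i) x \<bullet> h) * \<phi> x $ i) * (\<delta> / (F x + \<delta>)\<^sup>2)
   = ((2 * \<delta> / (F x + \<delta>)\<^sup>2) *\<^sub>R (\<Sum>i\<in>UNIV. \<phi> x $ i *\<^sub>R grad (\<lambda>x. \<phi> x $ i) x)) \<bullet> h" for h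
  by (simp add: inner_sum_left sum_distrib_left sum_distrib_right mult_ac)
 have "grad \<theta> x = (2 * \<delta> / (F x + \<delta>)\<^sup>2) *\<^sub>R (\<Sum>i\<in>UNIV. \<phi> x $ i *\<^sub>R grad (\<lambda>x. \<phi> x $ i) x)"
  by (rule grad_eqI[OF D'[unfolded E]])
 then show "v \<bullet> grad \<theta> x = 2 * \<delta> / ((norm (\<phi> x))\<^sup>2 + \<delta>)\<^sup>2 * (outer (\<phi> x) v \<bullet> jacobian_mat \<phi> x)"
  unfolding Fn by (simp add: outer_inner inner_sum_right jacobian_mat_def)
qed

text \<open>\<open>G\<close> need not vanish on the boundary; the test function \<open>\<bar>u\<bar>\<^sup>2 / (\<bar>u\<bar>\<^sup>2 + \<delta>)\<close> supplies the cutoff.\<close>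

lemma force_W1_inf:
 fixes \<rho> :: "R3 \<Rightarrow> real" and u :: "R3 \<Rightarrow> R3" and A :: "R3 \<Rightarrow> real ^ 3 ^ 3" and \<phi> :: "nat \<Rightarrow> R3 \<Rightarrow> R3"
 assumes \<Omega>: "open \<Omega>" and G: "G \<in> W1_inf \<Omega>" and \<gamma>: "\<gamma> \<le> 6 / 5"
  and rm[measurable]: "\<rho> \<in> borel_measurable borel" and rb: "\<And>x. 0 \<le> \<rho> x" "\<And>x. \<rho> x \<le> M"
  and rg: "integrable lborel (\<lambda>x. \<rho> x powr \<gamma>)"
  and um[measurable]: "u \<in> borel_measurable borel" and Am[measurable]: "A \<in> borel_measurable borel"
  and u6: "integrable lborel (\<lambda>x. norm (u x) ^ 6)" and ru2: "integrable lborel (\<lambda>x. \<rho> x * (norm (u x))\<^sup>2)"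
  and A2: "integrable lborel (\<lambda>x. (norm (A x))\<^sup>2)"
  and \<phi>: "\<And>n i. (\<lambda>x. \<phi> n x $ i) \<in> Cc_inf \<Omega>"
  and d6: "\<And>n. integrable lborel (\<lambda>x. norm (\<phi> n x - u x) ^ 6)" "(\<lambda>n. LBINT x. norm (\<phi> n x - u x) ^ 6) \<longlonglongrightarrow> 0"
  and JA: "(\<lambda>n. LBINT x. (norm (jacobian_mat (\<phi> n) x - A x))\<^sup>2) \<longlonglongrightarrow> 0"
  and cont: "\<And>f. f \<in> Cc_inf UNIV \<Longrightarrow> (LBINT x. \<rho> x * (u x \<bullet> grad f x)) = 0"
 shows "\<exists>W. W \<in> borel_measurable borel \<and> (\<forall>x. x \<notin> \<Omega> \<longrightarrow> W x = 0) \<and> (AE x in lborel. x \<in> \<Omega> \<longrightarrow> weak_grad \<Omega> G x = W x) \<and>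
  integrable lborel (\<lambda>x. norm (\<rho> x *\<^sub>R W x) powr (6 / 5)) \<and> (LBINT x. (\<rho> x *\<^sub>R W x) \<bullet> u x) = 0"
proof (rule W1_inf_weak_gradient[OF \<Omega> G])
 fix G0 :: "R3 \<Rightarrow> real" and C and W :: "R3 \<Rightarrow> R3"
 assume Gm[measurable]: "G0 \<in> borel_measurable borel" and Gb: "\<And>x. \<bar>G0 x\<bar> \<le> C"
  and Wm[measurable]: "W \<in> borel_measurable borel" and Wb: "\<And>x. norm (W x) \<le> C" and Wz: "\<And>x. x \<notin> \<Omega> \<Longrightarrow> W x = 0"
  and wg: "AE x in lborel. x \<in> \<Omega> \<longrightarrow> weak_grad \<Omega> G x = W x"
  and wk: "\<And>\<theta> i. \<theta> \<in> Cc_inf \<Omega> \<Longrightarrow> (LBINT x. G0 x * partial i \<theta> x) = - (LBINT x. \<theta> x * W x $ i)"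
 have C0: "C \<ge> 0" using order_trans[OF norm_ge_zero Wb] .
 note [measurable] = jacobian_facts(1,2)[OF \<phi>]
 have JmA: "integrable lborel (\<lambda>x. (norm (jacobian_mat (\<phi> n) x - A x))\<^sup>2)" for n
  by (rule integrable_norm_diff_sq[OF _ _ jacobian_facts(4)[OF \<phi>] A2]) measurable
 \<comment> \<open>The assumption \<gamma> \<le> 6/5 puts \<rho> into L^(6/5), and the gradient of
   the potential is bounded.\<close>
 have W65: "integrable lborel (\<lambda>x. norm (\<rho> x *\<^sub>R W x) powr (6 / 5))"
 proof (rule Bochner_Integration.integrable_bound)
  show "integrable lborel (\<lambda>x. C powr (6 / 5) * \<rho> x powr (6 / 5))"
   using integrable_powr_larger[OF rm rb rg \<gamma>] by simp
  show "AE x in lborel. norm (norm (\<rho> x *\<^sub>R W x) powr (6 / 5)) \<le> norm (C powr (6 / 5) * \<rho> x powr (6 / 5))"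
  proof (rule AE_I2)
   fix x
   have "\<rho> x powr (6 / 5) * norm (W x) powr (6 / 5) \<le> \<rho> x powr (6 / 5) * C powr (6 / 5)" using Wb by (intro mult_left_mono powr_mono2) auto
   then show "norm (norm (\<rho> x *\<^sub>R W x) powr (6 / 5)) \<le> norm (C powr (6 / 5) * \<rho> x powr (6 / 5))"
    using rb(1) by (simp add: powr_mult mult.commute)
  qed
 qed measurable
 have f1: "integrable lborel (\<lambda>x. norm (\<rho> x *\<^sub>R W x) * norm (u x))"
  by (rule Holder_integrable(1)[OF _ _ _ _ _ W65, of 6]) (use u6 in \<open>simp_all add: powr_numeral\<close>)
 have ru: "loc_integrable (\<lambda>x. \<rho> x * u x $ i)" for i
 proof (rule integrable_power_loc_integrable(1)[where k = 5])
  have [measurable]: "(\<lambda>x. u x $ i) \<in> borel_measurable borel"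
  proof -
   have "(\<lambda>x. u x \<bullet> axis i 1) \<in> borel_measurable borel" by measurable
   then show ?thesis by (simp add: inner_axis)
  qed
  show m: "(\<lambda>x. \<rho> x * u x $ i) \<in> borel_measurable borel" by measurable
  show "integrable lborel (\<lambda>x. norm (\<rho> x * u x $ i) ^ Suc 5)"
  proof (rule Bochner_Integration.integrable_bound)
   show "integrable lborel (\<lambda>x. M ^ 6 * norm (u x) ^ 6)" using u6 by simp
   have "norm (\<rho> x * u x $ i) ^ 6 \<le> (M * norm (u x)) ^ 6" for x
    using rb[of x] component_le_norm_cart[of "u x" i] by (intro power_mono) (auto simp: abs_mult intro!: mult_mono)
   then show "AE x in lborel. norm (norm (\<rho> x * u x $ i) ^ Suc 5) \<le> norm (M ^ 6 * norm (u x) ^ 6)"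
    by (simp add: power_mult_distrib abs_mult)
  qed (use m in measurable)
 qed
 have "integrable lborel (\<lambda>x. norm ((\<phi> n x - u x)) ^ 6)" "(\<lambda>n. LBINT x. norm (norm (\<phi> n x - u x) ^ 6)) \<longlonglongrightarrow> 0" for n
  using d6 by simp_all
 \<comment> \<open>The cutoff depends nonlinearly on the velocity, so pointwise convergence along a
   subsequence is needed in addition to L^6 convergence.\<close>
 from tendsto_L1_AE_subseq[OF this] obtain r where r: "strict_mono r" and r6: "AE x in lborel. (\<lambda>n. norm (\<phi> (r n) x - u x) ^ 6) \<longlonglongrightarrow> 0"
  by blast
 have ae: "AE x in lborel. (\<lambda>n. \<phi> (r n) x) \<longlonglongrightarrow> u x"
  using r6
 proof eventually_elim
  case (elim x)
  have "(\<lambda>n. root 6 (norm (\<phi> (r n) x - u x) ^ 6)) \<longlonglongrightarrow> root 6 0" by (intro tendsto_real_root elim)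
  then have "(\<lambda>n. norm (\<phi> (r n) x - u x)) \<longlonglongrightarrow> 0" by (simp add: real_root_power_cancel)
  then show ?case by (simp add: tendsto_norm_zero_iff LIM_zero_iff)
 qed
 have ru2': "integrable lborel (\<lambda>x. (\<rho> x * norm (u x))\<^sup>2)"
 proof (rule Bochner_Integration.integrable_bound)
  show "integrable lborel (\<lambda>x. M * (\<rho> x * (norm (u x))\<^sup>2))" using ru2 by simp
  have "(\<rho> x * norm (u x))\<^sup>2 \<le> M * (\<rho> x * (norm (u x))\<^sup>2)" for x
  proof -
   have "(\<rho> x * norm (u x))\<^sup>2 = \<rho> x * (\<rho> x * (norm (u x))\<^sup>2)" by (simp add: power2_eq_square)
   also have "\<dots> \<le> M * (\<rho> x * (norm (u x))\<^sup>2)" using rb by (intro mult_right_mono) auto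
   finally show ?thesis .
  qed
  then show "AE x in lborel. norm ((\<rho> x * norm (u x))\<^sup>2) \<le> norm (M * (\<rho> x * (norm (u x))\<^sup>2))"
   by (intro AE_I2) (simp add: order_trans[OF _ abs_ge_self])
 qed measurable
 have ruA: "integrable lborel (\<lambda>x. \<rho> x * norm (u x) * norm (A x))"
 proof (rule Bochner_Integration.integrable_bound)
  show "integrable lborel (\<lambda>x. (\<rho> x * norm (u x))\<^sup>2 + (norm (A x))\<^sup>2)" using ru2' A2 by simp
  show "AE x in lborel. norm (\<rho> x * norm (u x) * norm (A x)) \<le> norm ((\<rho> x * norm (u x))\<^sup>2 + (norm (A x))\<^sup>2)"
   using rb(1) product_dominates_squares by (intro AE_I2) (simp add: abs_mult)
 qed measurable
 \<comment> \<open>Here \<rho> is square integrable because \<gamma> \<le> 2. This product dominates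
   the boundary error uniformly in \<delta>.\<close>
 have rA: "integrable lborel (\<lambda>x. \<rho> x * norm (A x))"
 proof (rule Bochner_Integration.integrable_bound)
  have "integrable lborel (\<lambda>x. \<rho> x powr 2)" by (rule integrable_powr_larger[OF rm rb rg]) (use \<gamma> in simp)
  then show "integrable lborel (\<lambda>x. (\<rho> x)\<^sup>2 + (norm (A x))\<^sup>2)" using A2 rb(1) by (simp add: powr_numeral)
  show "AE x in lborel. norm (\<rho> x * norm (A x)) \<le> norm ((\<rho> x)\<^sup>2 + (norm (A x))\<^sup>2)"
   using rb(1) product_dominates_squares by (intro AE_I2) (simp add: abs_mult)
 qed measurable
 define K where "K \<delta> v = 2 * \<delta> / ((norm v)\<^sup>2 + \<delta>)\<^sup>2" for \<delta> :: real and v :: R3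
 define T where "T \<delta> v = (norm v)\<^sup>2 / ((norm v)\<^sup>2 + \<delta>)" for \<delta> :: real and v :: R3
 have [measurable]: "K \<delta> \<in> borel_measurable borel" "T \<delta> \<in> borel_measurable borel" for \<delta>
  unfolding K_def[abs_def] T_def[abs_def] by measurable
 have K0: "K \<delta> v \<ge> 0" if "\<delta> > 0" for \<delta> v using that by (simp add: K_def)
 have T1: "\<bar>T \<delta> v\<bar> \<le> 1" if "\<delta> > 0" for \<delta> v using that by (simp add: T_def divide_le_eq add_nonneg_pos)
 have nz: "(norm v)\<^sup>2 + \<delta> \<noteq> 0" if "\<delta> > 0" for \<delta> and v :: R3 using add_nonneg_pos[OF zero_le_power2[of "norm v"] that] by linarith
 \<comment> \<open>The limit in n at fixed \<delta>. The Jacobian is split into \<open>A\<close> and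
   the error \<open>jacobian_mat (\<phi> n) x - A x\<close>: dominated convergence treats the first
   part, and the L^2 convergence of the Jacobians the second.\<close>
 have limit1: "(LBINT x. T \<delta> (u x) * (\<rho> x * (u x \<bullet> W x))) = - (LBINT x. G0 x * (\<rho> x * (K \<delta> (u x) * (outer (u x) (u x) \<bullet> A x))))"
  if d: "\<delta> > 0" for \<delta>
 proof -
  define B where "B = 2 * (1 + 1 / \<delta>)"
  have KB: "K \<delta> v * norm v \<le> B" for v using cutoff_coefficient_bounds(1)[OF d, of v] by (simp add: K_def B_def)
  have B0: "B \<ge> 0" using d by (simp add: B_def)
  have eq: "(LBINT x. T \<delta> (\<phi> n x) * (\<rho> x * (u x \<bullet> W x))) = - (LBINT x. G0 x * (\<rho> x * (K \<delta> (\<phi> n x) * (outer (\<phi> n x) (u x) \<bullet> jacobian_mat (\<phi> n) x))))" for n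
   using localized_force[OF \<Omega> ru cont Gm Gb Wm Wb wk cutoff_grad(1)[OF \<phi> d], of n]
   unfolding cutoff_grad(2)[OF \<phi> d] T_def K_def by simp
  have le: "\<bar>G0 x * (\<rho> x * (K \<delta> v * (outer v (u x) \<bullet> J)))\<bar> \<le> C * B * (\<rho> x * norm (u x) * norm J)" for x v J
  proof -
   have "\<bar>G0 x * (\<rho> x * (K \<delta> v * (outer v (u x) \<bullet> J)))\<bar> = \<bar>G0 x\<bar> * (\<rho> x * (K \<delta> v * \<bar>outer v (u x) \<bullet> J\<bar>))"
    using rb(1) K0[OF d] by (simp add: abs_mult)
   also have "\<dots> \<le> C * (\<rho> x * (K \<delta> v * (norm v * norm (u x) * norm J)))"
    using rb(1) K0[OF d] C0 by (intro mult_mono Gb abs_outer_inner_le mult_nonneg_nonneg order_refl) auto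
   also have "\<dots> = (C * (\<rho> x * norm (u x) * norm J)) * (K \<delta> v * norm v)" by (simp add: mult_ac)
   also have "\<dots> \<le> (C * (\<rho> x * norm (u x) * norm J)) * B" using rb(1) C0 by (intro mult_left_mono KB mult_nonneg_nonneg) auto
   finally show ?thesis by (simp add: mult_ac)
  qed
  have iJ: "integrable lborel (\<lambda>x. \<rho> x * norm (u x) * norm (jacobian_mat (\<phi> n) x - A x))"
   "(\<lambda>n. LBINT x. \<rho> x * norm (u x) * norm (jacobian_mat (\<phi> n) x - A x)) \<longlonglongrightarrow> 0" for n
  proof -
   have p: "integrable lborel (\<lambda>x. norm (\<rho> x * norm (u x)) powr 2)" using ru2' rb(1) by (simp add: powr_numeral abs_mult power_mult_distrib)
   have q: "integrable lborel (\<lambda>x. norm (jacobian_mat (\<phi> n) x - A x) powr 2)" for n using JmA by (simp add: powr_numeral)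
   have l: "(\<lambda>n. LBINT x. norm (jacobian_mat (\<phi> n) x - A x) powr 2) \<longlonglongrightarrow> 0" using JA by (simp add: powr_numeral)
   have a: "norm (\<rho> x * norm (u x)) = \<rho> x * norm (u x)" for x using rb(1) by (simp add: abs_mult)
   show "integrable lborel (\<lambda>x. \<rho> x * norm (u x) * norm (jacobian_mat (\<phi> n) x - A x))"
    using Holder_integrable(1)[OF _ _ _ _ _ p q] unfolding a by simp
   show "(\<lambda>n. LBINT x. \<rho> x * norm (u x) * norm (jacobian_mat (\<phi> n) x - A x)) \<longlonglongrightarrow> 0"
    using Holder_tendsto[OF _ _ _ _ _ p q l] unfolding a by simp
  qed
  let ?R = "\<lambda>v J x. G0 x * (\<rho> x * (K \<delta> v * (outer v (u x) \<bullet> J)))"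
  have cK: "(\<lambda>n. K \<delta> (f n)) \<longlonglongrightarrow> K \<delta> v" "(\<lambda>n. T \<delta> (f n)) \<longlonglongrightarrow> T \<delta> v" if "f \<longlonglongrightarrow> v" for f v
   unfolding K_def T_def using that nz[OF d] by (auto intro!: tendsto_intros)
  have la: "(\<lambda>n. LBINT x. ?R (\<phi> (r n) x) (A x) x) \<longlonglongrightarrow> (LBINT x. ?R (u x) (A x) x)"
   and ia: "integrable lborel (\<lambda>x. ?R (\<phi> n x) (A x) x)" for n
  proof -
   show "(\<lambda>n. LBINT x. ?R (\<phi> (r n) x) (A x) x) \<longlonglongrightarrow> (LBINT x. ?R (u x) (A x) x)"
   proof (rule integral_dominated_convergence)
    show "integrable lborel (\<lambda>x. C * B * (\<rho> x * norm (u x) * norm (A x)))" using ruA by simp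
    show "AE x in lborel. (\<lambda>n. ?R (\<phi> (r n) x) (A x) x) \<longlonglongrightarrow> ?R (u x) (A x) x"
     using ae
    proof eventually_elim
     case (elim x)
     then show ?case unfolding outer_inner by (intro tendsto_intros cK)
    qed
    show "AE x in lborel. norm (?R (\<phi> (r n) x) (A x) x) \<le> C * B * (\<rho> x * norm (u x) * norm (A x))" for n
     using le by (intro AE_I2) simp
   qed measurable
   show "integrable lborel (\<lambda>x. ?R (\<phi> n x) (A x) x)"
   proof (rule Bochner_Integration.integrable_bound)
    show "integrable lborel (\<lambda>x. C * B * (\<rho> x * norm (u x) * norm (A x)))" using ruA by simp
    show "AE x in lborel. norm (?R (\<phi> n x) (A x) x) \<le> norm (C * B * (\<rho> x * norm (u x) * norm (A x)))"
     unfolding real_norm_def by (intro AE_I2 order_trans[OF le abs_ge_self])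
   qed measurable
  qed
  have ib: "integrable lborel (\<lambda>x. ?R (\<phi> n x) (jacobian_mat (\<phi> n) x - A x) x)" for n
  proof (rule Bochner_Integration.integrable_bound)
   show "integrable lborel (\<lambda>x. C * B * (\<rho> x * norm (u x) * norm (jacobian_mat (\<phi> n) x - A x)))" using iJ(1) by simp
   show "AE x in lborel. norm (?R (\<phi> n x) (jacobian_mat (\<phi> n) x - A x) x) \<le> norm (C * B * (\<rho> x * norm (u x) * norm (jacobian_mat (\<phi> n) x - A x)))"
    unfolding real_norm_def by (intro AE_I2 order_trans[OF le abs_ge_self])
  qed measurable
  have lb: "(\<lambda>n. LBINT x. ?R (\<phi> (r n) x) (jacobian_mat (\<phi> (r n)) x - A x) x) \<longlonglongrightarrow> 0"
  proof (rule Lim_null_comparison)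
   show "\<forall>\<^sub>F n in sequentially. norm (LBINT x. ?R (\<phi> (r n) x) (jacobian_mat (\<phi> (r n)) x - A x) x) \<le> C * B * (LBINT x. \<rho> x * norm (u x) * norm (jacobian_mat (\<phi> (r n)) x - A x))"
   proof (rule always_eventually, rule allI)
    fix n
    have "norm (LBINT x. ?R (\<phi> (r n) x) (jacobian_mat (\<phi> (r n)) x - A x) x) \<le> (LBINT x. C * B * (\<rho> x * norm (u x) * norm (jacobian_mat (\<phi> (r n)) x - A x)))"
     by (rule order_trans[OF integral_norm_bound], rule integral_mono) (use ib[of "r n"] iJ(1)[of "r n"] le in simp_all)
    then show "norm (LBINT x. ?R (\<phi> (r n) x) (jacobian_mat (\<phi> (r n)) x - A x) x) \<le> C * B * (LBINT x. \<rho> x * norm (u x) * norm (jacobian_mat (\<phi> (r n)) x - A x))"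
     by simp
   qed
   show "(\<lambda>n. C * B * (LBINT x. \<rho> x * norm (u x) * norm (jacobian_mat (\<phi> (r n)) x - A x))) \<longlonglongrightarrow> 0"
    by (intro tendsto_mult_right_zero LIMSEQ_subseq_LIMSEQ[OF iJ(2) r, unfolded comp_def])
  qed
  have "?R v J x = ?R v B x + ?R v (J - B) x" for v J B x by (simp add: inner_diff_right algebra_simps)
  then have "(LBINT x. ?R (\<phi> n x) (jacobian_mat (\<phi> n) x) x)
    = (LBINT x. ?R (\<phi> n x) (A x) x + ?R (\<phi> n x) (jacobian_mat (\<phi> n) x - A x) x)" for n by (intro Bochner_Integration.integral_cong) auto
  then have "(LBINT x. ?R (\<phi> n x) (jacobian_mat (\<phi> n) x) x)
    = (LBINT x. ?R (\<phi> n x) (A x) x) + (LBINT x. ?R (\<phi> n x) (jacobian_mat (\<phi> n) x - A x) x)" for n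
   using Bochner_Integration.integral_add[OF ia[of n] ib[of n]] by simp
  then have lr: "(\<lambda>n. LBINT x. ?R (\<phi> (r n) x) (jacobian_mat (\<phi> (r n)) x) x) \<longlonglongrightarrow> (LBINT x. ?R (u x) (A x) x)"
   using tendsto_add[OF la lb] by simp
  have ll: "(\<lambda>n. LBINT x. T \<delta> (\<phi> (r n) x) * (\<rho> x * (u x \<bullet> W x))) \<longlonglongrightarrow> (LBINT x. T \<delta> (u x) * (\<rho> x * (u x \<bullet> W x)))"
  proof (rule integral_dominated_convergence[OF _ _ f1])
   show "AE x in lborel. (\<lambda>n. T \<delta> (\<phi> (r n) x) * (\<rho> x * (u x \<bullet> W x))) \<longlonglongrightarrow> T \<delta> (u x) * (\<rho> x * (u x \<bullet> W x))"
    using ae by eventually_elim (intro tendsto_intros cK)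
   show "AE x in lborel. norm (T \<delta> (\<phi> (r n) x) * (\<rho> x * (u x \<bullet> W x))) \<le> norm (\<rho> x *\<^sub>R W x) * norm (u x)" for n
   proof (rule AE_I2)
    fix x
    have "\<bar>T \<delta> (\<phi> (r n) x)\<bar> * (\<bar>\<rho> x\<bar> * \<bar>u x \<bullet> W x\<bar>) \<le> 1 * (\<bar>\<rho> x\<bar> * (norm (u x) * norm (W x)))"
     by (intro mult_mono T1[OF d] Cauchy_Schwarz_ineq2 order_refl mult_nonneg_nonneg) auto
    then show "norm (T \<delta> (\<phi> (r n) x) * (\<rho> x * (u x \<bullet> W x))) \<le> norm (\<rho> x *\<^sub>R W x) * norm (u x)" by (simp add: abs_mult mult_ac)
   qed
  qed measurable
  show ?thesis by (rule LIMSEQ_unique[OF ll]) (use tendsto_minus[OF lr] in \<open>simp add: eq\<close>)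
 qed
 define D where "D m = inverse (real (Suc m))" for m
 have D: "D m > 0" for m by (simp add: D_def)
 have Dl: "D \<longlonglongrightarrow> 0" unfolding D_def[abs_def] by (rule LIMSEQ_inverse_real_of_nat)
 \<comment> \<open>As \<delta> tends to 0 the cutoff tends to 1 where \<open>u\<close> is nonzero;
   elsewhere the integrand is zero anyway.\<close>
 have l: "(\<lambda>m. LBINT x. T (D m) (u x) * (\<rho> x * (u x \<bullet> W x))) \<longlonglongrightarrow> (LBINT x. \<rho> x * (u x \<bullet> W x))"
 proof (rule integral_dominated_convergence[OF _ _ f1])
  show "AE x in lborel. (\<lambda>m. T (D m) (u x) * (\<rho> x * (u x \<bullet> W x))) \<longlonglongrightarrow> \<rho> x * (u x \<bullet> W x)"
  proof (rule AE_I2)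
   fix x show "(\<lambda>m. T (D m) (u x) * (\<rho> x * (u x \<bullet> W x))) \<longlonglongrightarrow> \<rho> x * (u x \<bullet> W x)"
   proof (cases "u x = 0")
    case False
    then have "(\<lambda>m. T (D m) (u x) * (\<rho> x * (u x \<bullet> W x))) \<longlonglongrightarrow> (norm (u x))\<^sup>2 / ((norm (u x))\<^sup>2 + 0) * (\<rho> x * (u x \<bullet> W x))"
     unfolding T_def by (intro tendsto_intros Dl) auto
    then show ?thesis using False by simp
   qed simp
  qed
  show "AE x in lborel. norm (T (D m) (u x) * (\<rho> x * (u x \<bullet> W x))) \<le> norm (\<rho> x *\<^sub>R W x) * norm (u x)" for m
  proof (rule AE_I2)
   fix x
   have "\<bar>T (D m) (u x)\<bar> * (\<bar>\<rho> x\<bar> * \<bar>u x \<bullet> W x\<bar>) \<le> 1 * (\<bar>\<rho> x\<bar> * (norm (u x) * norm (W x)))"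
    by (intro mult_mono T1[OF D] Cauchy_Schwarz_ineq2 order_refl mult_nonneg_nonneg) auto
   then show "norm (T (D m) (u x) * (\<rho> x * (u x \<bullet> W x))) \<le> norm (\<rho> x *\<^sub>R W x) * norm (u x)" by (simp add: abs_mult mult_ac)
  qed
 qed measurable
 \<comment> \<open>The integrand tends to 0 pointwise: where \<open>u\<close> is nonzero because of
   the factor \<delta> in the coefficient, elsewhere because the outer product vanishes. The uniform
   bound 2 for the coefficient times |u|^2 gives the dominating function.\<close>
 have r0: "(\<lambda>m. LBINT x. G0 x * (\<rho> x * (K (D m) (u x) * (outer (u x) (u x) \<bullet> A x)))) \<longlonglongrightarrow> (\<integral>x. (0::real) \<partial>(lborel :: R3 measure))"
 proof (rule integral_dominated_convergence)
  show "integrable lborel (\<lambda>x. 2 * C * (\<rho> x * norm (A x)))" using rA by simp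
  show "AE x in lborel. (\<lambda>m. G0 x * (\<rho> x * (K (D m) (u x) * (outer (u x) (u x) \<bullet> A x)))) \<longlonglongrightarrow> 0"
  proof (rule AE_I2)
   fix x show "(\<lambda>m. G0 x * (\<rho> x * (K (D m) (u x) * (outer (u x) (u x) \<bullet> A x)))) \<longlonglongrightarrow> 0"
   proof (cases "u x = 0")
    case False
    then have "(\<lambda>m. K (D m) (u x)) \<longlonglongrightarrow> 2 * 0 / ((norm (u x))\<^sup>2 + 0)\<^sup>2"
     unfolding K_def by (intro tendsto_intros Dl) auto
    then show ?thesis by (intro tendsto_mult_right_zero tendsto_mult_left_zero) simp
   qed (simp add: outer_inner)
  qed
  show "AE x in lborel. norm (G0 x * (\<rho> x * (K (D m) (u x) * (outer (u x) (u x) \<bullet> A x)))) \<le> 2 * C * (\<rho> x * norm (A x))" for m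
  proof (rule AE_I2)
   fix x
   have "norm (G0 x * (\<rho> x * (K (D m) (u x) * (outer (u x) (u x) \<bullet> A x)))) = \<bar>G0 x\<bar> * (\<rho> x * (K (D m) (u x) * \<bar>outer (u x) (u x) \<bullet> A x\<bar>))"
    using rb(1) K0[OF D] by (simp add: abs_mult)
   also have "\<dots> \<le> C * (\<rho> x * (K (D m) (u x) * (norm (u x) * norm (u x) * norm (A x))))"
    using rb(1) K0[OF D] C0 by (intro mult_mono Gb abs_outer_inner_le mult_nonneg_nonneg order_refl) auto
   also have "\<dots> = (C * (\<rho> x * norm (A x))) * (K (D m) (u x) * (norm (u x))\<^sup>2)" by (simp add: mult_ac power2_eq_square)
   also have "\<dots> \<le> (C * (\<rho> x * norm (A x))) * 2"
    using rb(1) C0 cutoff_coefficient_bounds(2)[OF D[of m], of "u x"] unfolding K_def by (intro mult_left_mono mult_nonneg_nonneg) auto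
   finally show "norm (G0 x * (\<rho> x * (K (D m) (u x) * (outer (u x) (u x) \<bullet> A x)))) \<le> 2 * C * (\<rho> x * norm (A x))" by (simp add: mult_ac)
  qed
 qed measurable
 have "(LBINT x. \<rho> x * (u x \<bullet> W x)) = 0"
  by (rule LIMSEQ_unique[OF l]) (use tendsto_minus[OF r0] in \<open>simp add: limit1[OF D]\<close>)
 then have "(LBINT x. (\<rho> x *\<^sub>R W x) \<bullet> u x) = 0" by (simp add: inner_commute)
 with Wm Wz wg W65 show ?thesis by blast
qed

section \<open>Vector fields assembled from their components\<close>

lemma borel_measurable_vec_lambda3:
 fixes f :: "3 \<Rightarrow> R3 \<Rightarrow> 'b::euclidean_space"
 assumes [measurable]: "\<And>i. f i \<in> borel_measurable borel"
 shows "(\<lambda>x. \<chi> i. f i x) \<in> borel_measurable borel"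
proof -
 have m: "(\<lambda>x. axis i (f i x)) \<in> borel_measurable borel" for i
 proof -
  have "continuous_on UNIV (\<lambda>y :: 'b. if j = i then y else 0)" for j by (cases "j = i") auto
  then have "continuous_on UNIV (\<lambda>y :: 'b. axis i y :: 'b ^ 3)" unfolding axis_def by (intro continuous_on_vec_lambda)
  then have "(\<lambda>y :: 'b. axis i y :: 'b ^ 3) \<in> borel_measurable borel" by (rule borel_measurable_continuous_onI)
  from measurable_compose[OF assms this] show ?thesis .
 qed
 have "(\<lambda>x. \<chi> i. f i x) = (\<lambda>x. \<Sum>i\<in>UNIV. axis i (f i x))"
  by (rule ext) (simp add: vec_eq_iff axis_def if_distrib[of "\<lambda>z. z $ _"] cong: if_cong)
 then show ?thesis using m by (simp add: borel_measurable_sum)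
qed

text \<open>Each squared component is at most the cube root of the sum of sixth powers, so |v|^2 is
  at most three times that root; cubing gives 27.\<close>

lemma norm_vec3_power6: "norm (v :: R3) ^ 6 \<le> 27 * (\<Sum>i\<in>UNIV. (v $ i) ^ 6)"
proof -
 let ?S = "\<Sum>i\<in>UNIV. (v $ i) ^ 6"
 have S0: "?S \<ge> 0" by (intro sum_nonneg) (simp add: zero_le_even_power)
 have "(norm v)\<^sup>2 \<le> 3 * root 3 ?S"
 proof -
  have "(v $ i)\<^sup>2 \<le> root 3 ?S" for i
  proof -
   have "((v $ i)\<^sup>2) ^ 3 \<le> ?S"
    using member_le_sum[of i UNIV "\<lambda>i. (v $ i) ^ 6"] by (simp add: zero_le_even_power flip: power_mult)
   then have le: "root 3 (((v $ i)\<^sup>2) ^ 3) \<le> root 3 ?S" by (rule real_root_le_mono[rotated]) simp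
   have "(v $ i)\<^sup>2 = root 3 (((v $ i)\<^sup>2) ^ 3)" by (rule real_root_power_cancel[symmetric]) auto
   also note le
   finally show ?thesis .
  qed
  then have "(\<Sum>i\<in>UNIV. (v $ i)\<^sup>2) \<le> (\<Sum>i\<in>(UNIV :: 3 set). root 3 ?S)" by (intro sum_mono) simp
  then show ?thesis by (simp add: norm_vec_def L2_set_def sum_nonneg)
 qed
 then have "((norm v)\<^sup>2) ^ 3 \<le> (3 * root 3 ?S) ^ 3" by (intro power_mono) auto
 also have "\<dots> = 27 * ?S" using S0 by (simp add: power_mult_distrib)
 finally show ?thesis by (simp flip: power_mult)
qed

text \<open>The three scalar approximations share the index n and hence form one sequence of vector
  test functions. The limits in L^2 and L^6 are recorded together with their consequences in L^1 on
  balls, because the energy argument uses the former and the renormalization the latter.\<close>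

lemma D0_fun_vec_Sobolev_limit:
 fixes u :: "R3 \<Rightarrow> R3"
 assumes \<Omega>: "open \<Omega>" and u: "u \<in> D0_fun_vec 2 \<Omega>"
 obtains \<phi> u0 A where "\<And>n i. (\<lambda>x. \<phi> n x $ i) \<in> Cc_inf \<Omega>"
  "u0 \<in> borel_measurable borel" "\<And>x. x \<notin> \<Omega> \<Longrightarrow> u0 x = 0" "AE x in lborel. x \<in> \<Omega> \<longrightarrow> u x = u0 x"
  "A \<in> borel_measurable borel" "\<And>x. x \<notin> \<Omega> \<Longrightarrow> A x = 0" "AE x in lborel. x \<in> \<Omega> \<longrightarrow> weak_jacobian \<Omega> u x = A x"
  "integrable lborel (\<lambda>x. (norm (A x))\<^sup>2)" "(\<lambda>n. LBINT x. (norm (jacobian_mat (\<phi> n) x - A x))\<^sup>2) \<longlonglongrightarrow> 0"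
  "\<And>n. integrable lborel (\<lambda>x. norm (\<phi> n x - u0 x) ^ 6)" "(\<lambda>n. LBINT x. norm (\<phi> n x - u0 x) ^ 6) \<longlonglongrightarrow> 0"
  "integrable lborel (\<lambda>x. norm (u0 x) ^ 6)" "\<And>i. loc_integrable (\<lambda>x. u0 x $ i)" "\<And>i. loc_integrable (\<lambda>x. A x $ i)"
  "\<And>i R. (\<lambda>n. bnorm R (\<lambda>x. \<phi> n x $ i - u0 x $ i)) \<longlonglongrightarrow> 0"
  "\<And>i R. (\<lambda>n. bnorm R (\<lambda>x. grad (\<lambda>x. \<phi> n x $ i) x - A x $ i)) \<longlonglongrightarrow> 0"
proof -
 let ?P = "\<lambda>i \<psi> v0 g0. (\<forall>n. \<psi> n \<in> Cc_inf \<Omega>) \<and>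
  v0 \<in> borel_measurable borel \<and> (\<forall>x. x \<notin> \<Omega> \<longrightarrow> v0 x = 0) \<and> (AE x in lborel. x \<in> \<Omega> \<longrightarrow> u x $ i = v0 x) \<and>
  g0 \<in> borel_measurable borel \<and> (\<forall>x. x \<notin> \<Omega> \<longrightarrow> g0 x = 0) \<and> (AE x in lborel. x \<in> \<Omega> \<longrightarrow> weak_grad \<Omega> (\<lambda>x. u x $ i) x = g0 x) \<and>
  integrable lborel (\<lambda>x. (norm (g0 x))\<^sup>2) \<and> (\<lambda>n. LBINT x. (norm (grad (\<psi> n) x - g0 x))\<^sup>2) \<longlonglongrightarrow> 0 \<and>
  (\<forall>n. integrable lborel (\<lambda>x. (\<psi> n x - v0 x)^6)) \<and> (\<lambda>n. LBINT x. (\<psi> n x - v0 x)^6) \<longlonglongrightarrow> 0"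
 have "\<forall>i. \<exists>\<psi> v0 g0. ?P i \<psi> v0 g0"
  by (rule allI, rule D0_fun_Sobolev_limit[OF \<Omega>]) (use u in \<open>simp add: D0_fun_vec_def\<close>)
 from choice[OF this] obtain \<psi> where "\<forall>i. \<exists>v0 g0. ?P i (\<psi> i) v0 g0" by (rule exE)
 from choice[OF this] obtain v where "\<forall>i. \<exists>g0. ?P i (\<psi> i) (v i) g0" by (rule exE)
 from choice[OF this] obtain g where all: "\<forall>i. ?P i (\<psi> i) (v i) (g i)" by (rule exE)
 note P = all[rule_format]
 have \<psi>: "\<psi> i n \<in> Cc_inf \<Omega>" for i n using P[of i] by simp
 have vm[measurable]: "v i \<in> borel_measurable borel" for i using P[of i] by simp
 have gm[measurable]: "g i \<in> borel_measurable borel" for i using P[of i] by simp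
 have z: "v i x = 0" "g i x = 0" if "x \<notin> \<Omega>" for i x using P[of i] that by simp_all
 have ve: "AE x in lborel. x \<in> \<Omega> \<longrightarrow> u x $ i = v i x" for i using P[of i] by simp
 have ge: "AE x in lborel. x \<in> \<Omega> \<longrightarrow> weak_grad \<Omega> (\<lambda>x. u x $ i) x = g i x" for i using P[of i] by simp
 have g2: "integrable lborel (\<lambda>x. (norm (g i x))\<^sup>2)" for i using P[of i] by simp
 have gl: "(\<lambda>n. LBINT x. (norm (grad (\<psi> i n) x - g i x))\<^sup>2) \<longlonglongrightarrow> 0" for i using P[of i] by simp
 have v6: "integrable lborel (\<lambda>x. (\<psi> i n x - v i x)^6)" for i n using P[of i] by simp
 have vl: "(\<lambda>n. LBINT x. (\<psi> i n x - v i x)^6) \<longlonglongrightarrow> 0" for i using P[of i] by simp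
 define \<phi> where "\<phi> n x = (\<chi> i. \<psi> i n x)" for n x
 define u0 where "u0 x = (\<chi> i. v i x)" for x
 define A where "A x = (\<chi> i. g i x)" for x
 have c: "(\<lambda>x. \<phi> n x $ i) = \<psi> i n" "u0 x $ i = v i x" "A x $ i = g i x" for n i x by (simp_all add: \<phi>_def u0_def A_def)
 have \<phi>: "(\<lambda>x. \<phi> n x $ i) \<in> Cc_inf \<Omega>" for n i unfolding c by (rule \<psi>)
 have um[measurable]: "u0 \<in> borel_measurable borel" unfolding u0_def[abs_def]
  by (rule borel_measurable_vec_lambda3) measurable
 have Am[measurable]: "A \<in> borel_measurable borel" unfolding A_def[abs_def]
  by (rule borel_measurable_vec_lambda3) measurable
 note [measurable] = jacobian_facts(1,2)[OF \<phi>] Cc_inf_integrable_sq(2,3)[OF \<psi>]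
 have nA: "(norm (B :: real ^ 3 ^ 3))\<^sup>2 = (\<Sum>i\<in>UNIV. (norm (B $ i))\<^sup>2)" for B
  by (simp add: norm_vec_def[of B] L2_set_def sum_nonneg)
 have gd: "integrable lborel (\<lambda>x. (norm (grad (\<psi> i n) x - g i x))\<^sup>2)" for i n
  by (rule integrable_norm_diff_sq[OF _ _ Cc_inf_integrable_sq(1)[OF \<psi>] g2]) measurable
 have JA: "(norm (jacobian_mat (\<phi> n) x - A x))\<^sup>2 = (\<Sum>i\<in>UNIV. (norm (grad (\<psi> i n) x - g i x))\<^sup>2)" for n x
  unfolding nA by (simp add: jacobian_mat_def c)
 have JAl: "(\<lambda>n. LBINT x. (norm (jacobian_mat (\<phi> n) x - A x))\<^sup>2) \<longlonglongrightarrow> 0"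
 proof -
  have "(\<lambda>n. \<Sum>i\<in>UNIV. LBINT x. (norm (grad (\<psi> i n) x - g i x))\<^sup>2) \<longlonglongrightarrow> (\<Sum>i\<in>(UNIV :: 3 set). 0)"
   by (intro tendsto_sum gl)
  then show ?thesis unfolding JA by (simp add: Bochner_Integration.integral_sum gd)
 qed
 have le: "norm (\<phi> n x - u0 x) ^ 6 \<le> 27 * (\<Sum>i\<in>UNIV. (\<psi> i n x - v i x) ^ 6)" for n x
  using norm_vec3_power6[of "\<phi> n x - u0 x"] by (simp add: \<phi>_def u0_def)
 have i6: "integrable lborel (\<lambda>x. 27 * (\<Sum>i\<in>UNIV. (\<psi> i n x - v i x) ^ 6))" for n
  by (intro integrable_mult_right Bochner_Integration.integrable_sum v6)
 have d6: "integrable lborel (\<lambda>x. norm (\<phi> n x - u0 x) ^ 6)" for n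
 proof (rule Bochner_Integration.integrable_bound[OF i6[of n]])
  show "AE x in lborel. norm (norm (\<phi> n x - u0 x) ^ 6) \<le> norm (27 * (\<Sum>i\<in>UNIV. (\<psi> i n x - v i x) ^ 6))"
   using order_trans[OF le abs_ge_self] by (intro AE_I2) simp
 qed measurable
 have d6l: "(\<lambda>n. LBINT x. norm (\<phi> n x - u0 x) ^ 6) \<longlonglongrightarrow> 0"
 proof (rule tendsto_sandwich[OF _ _ tendsto_const])
  have "(\<lambda>n. 27 * (\<Sum>i\<in>UNIV. LBINT x. (\<psi> i n x - v i x) ^ 6)) \<longlonglongrightarrow> 27 * (\<Sum>i\<in>(UNIV :: 3 set). 0)"
   by (intro tendsto_intros vl)
  then show "(\<lambda>n. 27 * (\<Sum>i\<in>UNIV. LBINT x. (\<psi> i n x - v i x) ^ 6)) \<longlonglongrightarrow> 0" by simp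
  have "(LBINT x. norm (\<phi> n x - u0 x) ^ 6) \<le> (LBINT x. 27 * (\<Sum>i\<in>UNIV. (\<psi> i n x - v i x) ^ 6))" for n
   by (rule integral_mono[OF d6 i6 le])
  also have "(LBINT x. 27 * (\<Sum>i\<in>UNIV. (\<psi> i n x - v i x) ^ 6)) = 27 * (\<Sum>i\<in>UNIV. LBINT x. (\<psi> i n x - v i x) ^ 6)" for n
   by (simp add: Bochner_Integration.integral_sum v6)
  finally show "\<forall>\<^sub>F n in sequentially. (LBINT x. norm (\<phi> n x - u0 x) ^ 6) \<le> 27 * (\<Sum>i\<in>UNIV. LBINT x. (\<psi> i n x - v i x) ^ 6)"
   by (intro always_eventually allI)
 qed (simp add: always_eventually)
 have A2: "integrable lborel (\<lambda>x. (norm (A x))\<^sup>2)" unfolding nA c by (intro Bochner_Integration.integrable_sum g2)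
 have zz: "u0 x = 0" "A x = 0" if "x \<notin> \<Omega>" for x using z[OF that] by (simp_all add: u0_def A_def vec_eq_iff)
 have ue: "AE x in lborel. x \<in> \<Omega> \<longrightarrow> u x = u0 x"
 proof -
  have "AE x in lborel. \<forall>i\<in>UNIV. x \<in> \<Omega> \<longrightarrow> u x $ i = v i x" by (rule AE_finite_allI[OF finite ve])
  then show ?thesis by eventually_elim (auto simp: vec_eq_iff c)
 qed
 have Ae: "AE x in lborel. x \<in> \<Omega> \<longrightarrow> weak_jacobian \<Omega> u x = A x"
 proof -
  have "AE x in lborel. \<forall>i\<in>UNIV. x \<in> \<Omega> \<longrightarrow> weak_grad \<Omega> (\<lambda>x. u x $ i) x = g i x" by (rule AE_finite_allI[OF finite ge])
  then show ?thesis by eventually_elim (auto simp: vec_eq_iff c weak_jacobian_def)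
 qed
 have \<psi>6: "integrable lborel (\<lambda>x. \<psi> i n x ^ 6)" for i n
 proof -
  obtain R where R: "\<And>x. x \<notin> cball 0 R \<Longrightarrow> \<psi> i n x = 0" using Cc_inf_bounded_support[OF \<psi>[of i n]] by metis
  have "continuous_on UNIV (\<psi> i n)" using \<psi>[of i n] by (simp add: Cc_inf_iff smooth_continuous)
  then show ?thesis by (intro integrable_continuous_cball[of _ R] continuous_intros) (simp_all add: R)
 qed
 have u6: "integrable lborel (\<lambda>x. norm (u0 x) ^ 6)"
 proof (rule Bochner_Integration.integrable_bound)
  show "integrable lborel (\<lambda>x. 64 * norm (\<phi> 0 x - u0 x) ^ 6 + 64 * (27 * (\<Sum>i\<in>UNIV. \<psi> i 0 x ^ 6)))"
   by (intro Bochner_Integration.integrable_add integrable_mult_right Bochner_Integration.integrable_sum \<psi>6 d6)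
  have B: "norm (u0 x) ^ 6 \<le> 64 * norm (\<phi> 0 x - u0 x) ^ 6 + 64 * (27 * (\<Sum>i\<in>UNIV. \<psi> i 0 x ^ 6))" for x
  proof -
   have "norm (\<phi> 0 x) ^ 6 \<le> 27 * (\<Sum>i\<in>UNIV. \<psi> i 0 x ^ 6)" using norm_vec3_power6[of "\<phi> 0 x"] by (simp add: \<phi>_def)
   then show ?thesis using six_power_triangle[of "u0 x" "\<phi> 0 x"] by linarith
  qed
  show "AE x in lborel. norm (norm (u0 x) ^ 6) \<le> norm (64 * norm (\<phi> 0 x - u0 x) ^ 6 + 64 * (27 * (\<Sum>i\<in>UNIV. \<psi> i 0 x ^ 6)))"
   using order_trans[OF B abs_ge_self] by (intro AE_I2) simp
 qed measurable
 have vi: "integrable lborel (\<lambda>x. norm (v i x) ^ Suc 5)" for i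
 proof (rule Bochner_Integration.integrable_bound[OF u6])
  have "\<bar>v i x\<bar> ^ 6 \<le> norm (u0 x) ^ 6" for x using component_le_norm_cart[of "u0 x" i] by (intro power_mono) (simp_all add: c)
  then show "AE x in lborel. norm (norm (v i x) ^ Suc 5) \<le> norm (norm (u0 x) ^ 6)" by (intro AE_I2) simp
 qed measurable
 have lu: "loc_integrable (\<lambda>x. u0 x $ i)" for i unfolding c by (rule integrable_power_loc_integrable(1)[OF vm vi])
 have lA: "loc_integrable (\<lambda>x. A x $ i)" for i unfolding c
  by (rule integrable_power_loc_integrable(1)[OF gm, where k = 1]) (use g2 in \<open>simp add: numeral_2_eq_2\<close>)
 have l1: "(\<lambda>n. bnorm R (\<lambda>x. \<phi> n x $ i - u0 x $ i)) \<longlonglongrightarrow> 0" for i R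
 proof -
  have e: "norm (\<psi> i n x - v i x) ^ Suc 5 = (\<psi> i n x - v i x) ^ 6" for n x by (simp add: power_even_abs)
  have "(\<lambda>n. bnorm R (\<lambda>x. \<psi> i n x - v i x)) \<longlonglongrightarrow> 0"
   by (rule bnorm_tendsto_power[where k = 5]; (unfold e)?) (measurable, use v6 vl in simp_all)
  then show ?thesis by (simp add: \<phi>_def u0_def)
 qed
 have l2: "(\<lambda>n. bnorm R (\<lambda>x. grad (\<lambda>x. \<phi> n x $ i) x - A x $ i)) \<longlonglongrightarrow> 0" for i R
 proof -
  have e: "norm (grad (\<psi> i n) x - g i x) ^ Suc 1 = (norm (grad (\<psi> i n) x - g i x))\<^sup>2" for n x by (simp add: numeral_2_eq_2)
  have "(\<lambda>n. bnorm R (\<lambda>x. grad (\<psi> i n) x - g i x)) \<longlonglongrightarrow> 0"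
   by (rule bnorm_tendsto_power[where k = 1]; (unfold e)?) (measurable, use gd gl in simp_all)
  then show ?thesis unfolding c .
 qed
 show thesis by (rule that[OF \<phi> um zz(1) ue Am zz(2) Ae A2 JAl d6 d6l u6 lu lA l1 l2])
qed

theorem theorem2:
  fixes \<Omega> :: "(real ^ 3) set"
    and p P :: "real \<Rightarrow> real"
    and \<gamma> \<mu> \<eta> :: real
    and G \<rho> :: "real ^ 3 \<Rightarrow> real"
    and u :: "real ^ 3 \<Rightarrow> real ^ 3"
  assumes domain: "open \<Omega>" "connected \<Omega>" "\<Omega> \<noteq> {}"
    and viscosity: "\<mu> > 0" "\<eta> \<ge> 0"
    and p_cont: "continuous_on {0..} p"
    and p_C1: "p C1_differentiable_on {0<..}"
    and p_zero: "p 0 = 0"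
    and p_nonneg: "\<And>r. r \<ge> 0 \<Longrightarrow> p r \<ge> 0"
    and p_mono: "\<And>r. r > 0 \<Longrightarrow> deriv p r \<ge> 0"
    and potential: "pressure_potential p P"
    and gamma: "\<gamma> > 1"
    and liminf_P: "Liminf (at_right 0) (\<lambda>r. ereal (P r / p r)) > 0"
    and liminf_p: "Liminf (at_right 0) (\<lambda>r. ereal (p r / r powr \<gamma>)) > 0"
    and G_large: "\<gamma> > 6 / 5 \<Longrightarrow>
      \<exists>q. 6 / 5 \<le> q \<and> q \<le> 6 * \<gamma> / (5 * \<gamma> - 6) \<and> G \<in> D0 q \<Omega>"
    and G_small: "\<gamma> \<le> 6 / 5 \<Longrightarrow>
      (\<exists>q\<ge>6 / 5. G \<in> D0 q \<Omega>) \<or> G \<in> W1_inf \<Omega>"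
    and solution: "weak_solution \<mu> \<eta> p G \<Omega> \<rho> u"
    and rho_bounded: "\<rho> \<in> Linf \<Omega>"
    and energy: "set_integrable lebesgue \<Omega> (\<lambda>x. 1 / 2 * \<rho> x * (norm (u x))\<^sup>2 + P (\<rho> x))"
  shows "AE x in lebesgue. x \<in> \<Omega> \<longrightarrow> u x = 0"
proof -
 note S = solution[unfolded weak_solution_def]
 have \<rho>m: "\<rho> \<in> borel_measurable (lebesgue_on \<Omega>)" using S by (elim conjE)
 have r0: "AE x in lebesgue. x \<in> \<Omega> \<longrightarrow> \<rho> x \<ge> 0" using S by (elim conjE)
 have cont: "\<forall>f\<in>Cc_inf UNIV. (LINT x:\<Omega>|lebesgue. (\<rho> x *\<^sub>R u x) \<bullet> grad f x) = 0" using S by (elim conjE)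
 have uD: "u \<in> D0_fun_vec 2 \<Omega>" using S by (elim conjE)
 have mom: "\<forall>\<phi>\<in>Cc1_vec \<Omega>.
   (LINT x:\<Omega>|lebesgue. (\<rho> x *\<^sub>R outer (u x) (u x)) \<bullet> jacobian_mat \<phi> x + p (\<rho> x) * trace (jacobian_mat \<phi> x))
   = (LINT x:\<Omega>|lebesgue. stress \<mu> \<eta> (weak_jacobian \<Omega> u x) \<bullet> jacobian_mat \<phi> x)
    - (LINT x:\<Omega>|lebesgue. (\<rho> x *\<^sub>R weak_grad \<Omega> G x) \<bullet> \<phi> x)"
  using S by (elim conjE)
 obtain M1 where M1: "AE x in lborel. x \<in> \<Omega> \<longrightarrow> \<bar>\<rho> x\<bar> \<le> M1" using rho_bounded by (auto simp: Linf_def AE_completion_iff)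
 define M where "M = max 0 M1"
 have M0: "M \<ge> 0" by (simp add: M_def)
 obtain \<rho>1 where \<rho>1m[measurable]: "\<rho>1 \<in> borel_measurable borel" and \<rho>1z: "\<And>x. x \<notin> \<Omega> \<Longrightarrow> \<rho>1 x = 0"
  and \<rho>1e: "AE x in lborel. x \<in> \<Omega> \<longrightarrow> \<rho> x = \<rho>1 x"
  using borel_rep_on[OF domain(1) \<rho>m] by blast
 \<comment> \<open>A truncation that changes the density inside \<Omega> only on a null set and
   makes both bounds hold at every point.\<close>
 define \<rho>0 where "\<rho>0 x = (if 0 \<le> \<rho>1 x \<and> \<rho>1 x \<le> M then \<rho>1 x else 0)" for x
 have rm[measurable]: "\<rho>0 \<in> borel_measurable borel" unfolding \<rho>0_def[abs_def] by measurable
 have rb: "0 \<le> \<rho>0 x" "\<rho>0 x \<le> M" for x using M0 by (auto simp: \<rho>0_def)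
 have rz: "\<rho>0 x = 0" if "x \<notin> \<Omega>" for x using \<rho>1z[OF that] by (simp add: \<rho>0_def)
 have re: "AE x in lborel. x \<in> \<Omega> \<longrightarrow> \<rho> x = \<rho>0 x"
  using \<rho>1e M1 r0[unfolded AE_completion_iff] by eventually_elim (auto simp: \<rho>0_def M_def)
 show ?thesis
 proof (rule D0_fun_vec_Sobolev_limit[OF domain(1) uD])
  fix \<phi> :: "nat \<Rightarrow> R3 \<Rightarrow> R3" and u0 :: "R3 \<Rightarrow> R3" and A :: "R3 \<Rightarrow> real ^ 3 ^ 3"
  assume \<phi>: "\<And>n i. (\<lambda>x. \<phi> n x $ i) \<in> Cc_inf \<Omega>"
   and um[measurable]: "u0 \<in> borel_measurable borel" and uz: "\<And>x. x \<notin> \<Omega> \<Longrightarrow> u0 x = 0" and ue: "AE x in lborel. x \<in> \<Omega> \<longrightarrow> u x = u0 x"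
   and Am[measurable]: "A \<in> borel_measurable borel" and Az: "\<And>x. x \<notin> \<Omega> \<Longrightarrow> A x = 0" and Ae: "AE x in lborel. x \<in> \<Omega> \<longrightarrow> weak_jacobian \<Omega> u x = A x"
   and A2: "integrable lborel (\<lambda>x. (norm (A x))\<^sup>2)" and JA: "(\<lambda>n. LBINT x. (norm (jacobian_mat (\<phi> n) x - A x))\<^sup>2) \<longlonglongrightarrow> 0"
   and d6: "\<And>n. integrable lborel (\<lambda>x. norm (\<phi> n x - u0 x) ^ 6)" and d6l: "(\<lambda>n. LBINT x. norm (\<phi> n x - u0 x) ^ 6) \<longlonglongrightarrow> 0"
   and u6: "integrable lborel (\<lambda>x. norm (u0 x) ^ 6)" and lu: "\<And>i. loc_integrable (\<lambda>x. u0 x $ i)" and lA: "\<And>i. loc_integrable (\<lambda>x. A x $ i)"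
   and l1: "\<And>i R. (\<lambda>n. bnorm R (\<lambda>x. \<phi> n x $ i - u0 x $ i)) \<longlonglongrightarrow> 0"
   and l2: "\<And>i R. (\<lambda>n. bnorm R (\<lambda>x. grad (\<lambda>x. \<phi> n x $ i) x - A x $ i)) \<longlonglongrightarrow> 0"
  note [measurable] = jacobian_facts(1,2)[OF \<phi>]
  have trm[measurable]: "(\<lambda>x. trace (V x)) \<in> borel_measurable borel" if [measurable]: "V \<in> borel_measurable borel" for V :: "R3 \<Rightarrow> real ^ 3 ^ 3"
  proof -
   have "continuous_on UNIV (\<lambda>B :: real ^ 3 ^ 3. trace B)" unfolding trace_def by (intro continuous_intros)
   then have "(\<lambda>B :: real ^ 3 ^ 3. trace B) \<in> borel_measurable borel" by (rule borel_measurable_continuous_onI)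
   from measurable_compose[OF that this] show ?thesis .
  qed
  have [measurable]: "stress \<mu> \<eta> \<in> borel_measurable borel"
   by (intro borel_measurable_continuous_onI linear_continuous_on stress_bounded_linear)
  \<comment> \<open>The continuity equation for the extensions by zero, with test functions that
    need not vanish on the boundary of \<Omega>.\<close>
  have cont0: "(LBINT x. \<rho>0 x * (u0 x \<bullet> grad f x)) = 0" if f: "f \<in> Cc_inf UNIV" for f
  proof -
   note [measurable] = Cc_inf_integrable_sq(2)[OF f]
   have e: "AE x in lborel. x \<in> \<Omega> \<longrightarrow> (\<rho> x *\<^sub>R u x) \<bullet> grad f x = \<rho>0 x * (u0 x \<bullet> grad f x)" using re ue by eventually_elim auto
   have "(LINT x:\<Omega>|lebesgue. (\<rho> x *\<^sub>R u x) \<bullet> grad f x) = (LBINT x. \<rho>0 x * (u0 x \<bullet> grad f x))"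
    by (rule lebesgue_integral_borel_rep(1)[OF _ _ e]) (measurable, simp add: rz)
   then show ?thesis using cont f by simp
  qed
  show ?thesis
  proof (rule pressure_potential_properties[OF p_cont p_zero p_nonneg potential liminf_P liminf_p gamma M0])
   fix b b' c assume b: "\<And>r. (b has_real_derivative b' r) (at r)" and b'c: "continuous_on UNIV b'"
    and bP: "\<And>r. r \<ge> 0 \<Longrightarrow> b r = P r" and bp: "\<And>r. r \<ge> 0 \<Longrightarrow> b' r * r - b r = p r" and c0: "c \<ge> 0"
    and c: "\<And>r. 0 \<le> r \<Longrightarrow> r \<le> M \<Longrightarrow> 0 \<le> P r \<and> p r \<le> c * P r \<and> r powr \<gamma> \<le> c * P r"
   \<comment> \<open>The pressure, written through the continuous functions \<open>b\<close> and
     \<open>b'\<close> so that it is Borel measurable; it equals p(\<rho>0) since \<rho>0 is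
     nonnegative.\<close>
   define \<pi> where "\<pi> x = b' (\<rho>0 x) * \<rho>0 x - b (\<rho>0 x)" for x
   have bcont: "continuous_on UNIV b" using b by (meson DERIV_isCont continuous_at_imp_continuous_on)
   have [measurable]: "b \<in> borel_measurable borel" "b' \<in> borel_measurable borel" using bcont b'c by (auto intro: borel_measurable_continuous_onI)
   have \<pi>m[measurable]: "\<pi> \<in> borel_measurable borel" unfolding \<pi>_def[abs_def] by measurable
   have \<pi>p: "\<pi> x = p (\<rho>0 x)" for x unfolding \<pi>_def by (rule bp[OF rb(1)])
   have b0: "b (\<rho>0 x) \<ge> 0" "\<pi> x \<le> c * b (\<rho>0 x)" "\<rho>0 x powr \<gamma> \<le> c * b (\<rho>0 x)" for x
    using c[OF rb] by (simp_all add: bP[OF rb(1)] \<pi>p)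
   have \<pi>0: "0 \<le> \<pi> x" for x unfolding \<pi>p by (rule p_nonneg[OF rb(1)])
   have bz: "b 0 = 0" using bP[of 0] potential by (simp add: pressure_potential_def)
   have "compact (b ` {0..M})" by (intro compact_continuous_image continuous_on_subset[OF bcont]) auto
   then have "bounded (b ` {0..M})" by (rule compact_imp_bounded)
   then obtain Bb where "\<forall>y\<in>b ` {0..M}. norm y \<le> Bb" by (auto simp: bounded_iff)
   then have Bb: "b (\<rho>0 x) \<le> Bb" for x using rb[of x] by force
   have \<pi>Q: "\<pi> x \<le> c * Bb" for x using b0(2) mult_left_mono[OF Bb c0] by (rule order_trans)
   have E: "integrable lborel (\<lambda>x. 1 / 2 * \<rho>0 x * (norm (u0 x))\<^sup>2 + b (\<rho>0 x))"
   proof (rule lebesgue_integral_borel_rep(2)[THEN iffD1, OF _ _ _ energy])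
    show "AE x in lborel. x \<in> \<Omega> \<longrightarrow> 1 / 2 * \<rho> x * (norm (u x))\<^sup>2 + P (\<rho> x) = 1 / 2 * \<rho>0 x * (norm (u0 x))\<^sup>2 + b (\<rho>0 x)"
     using re ue by eventually_elim (auto simp: bP[OF rb(1)])
   qed (measurable, simp add: rz bz)
   have ru2: "integrable lborel (\<lambda>x. \<rho>0 x * (norm (u0 x))\<^sup>2)"
   proof (rule Bochner_Integration.integrable_bound[OF integrable_mult_right[OF E, of 2]])
    have "\<rho>0 x * (norm (u0 x))\<^sup>2 \<le> 2 * (1 / 2 * \<rho>0 x * (norm (u0 x))\<^sup>2 + b (\<rho>0 x))" for x using b0(1)[of x] by simp
    then show "AE x in lborel. norm (\<rho>0 x * (norm (u0 x))\<^sup>2) \<le> norm (2 * (1 / 2 * \<rho>0 x * (norm (u0 x))\<^sup>2 + b (\<rho>0 x)))"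
     using rb(1) b0(1) by (intro AE_I2) simp
   qed measurable
   have bi: "integrable lborel (\<lambda>x. b (\<rho>0 x))"
   proof (rule Bochner_Integration.integrable_bound[OF E])
    show "AE x in lborel. norm (b (\<rho>0 x)) \<le> norm (1 / 2 * \<rho>0 x * (norm (u0 x))\<^sup>2 + b (\<rho>0 x))"
     using rb(1) b0(1) by (intro AE_I2) simp
   qed measurable
   have rg: "integrable lborel (\<lambda>x. \<rho>0 x powr \<gamma>)"
   proof (rule Bochner_Integration.integrable_bound[OF integrable_mult_right[OF bi, of c]])
    show "AE x in lborel. norm (\<rho>0 x powr \<gamma>) \<le> norm (c * b (\<rho>0 x))" using order_trans[OF b0(3) abs_ge_self] by (intro AE_I2) simp
   qed measurable
   have \<pi>i: "integrable lborel \<pi>"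
   proof (rule Bochner_Integration.integrable_bound[OF integrable_mult_right[OF bi, of c]])
    show "AE x in lborel. norm (\<pi> x) \<le> norm (c * b (\<rho>0 x))" using order_trans[OF b0(2) abs_ge_self] \<pi>0 by (intro AE_I2) simp
   qed measurable
   have i1: "integrable lborel (\<lambda>x. \<pi> x * trace (A x))"
   proof (rule Bochner_Integration.integrable_bound)
    show "integrable lborel (\<lambda>x. c * Bb * \<pi> x + 9 * (norm (A x))\<^sup>2)" using \<pi>i A2 by simp
    \<comment> \<open>The pressure is bounded and integrable, hence square integrable, and pairs
      with the divergence in L^2.\<close>
    have B: "\<pi> x * \<bar>trace (A x)\<bar> \<le> c * Bb * \<pi> x + 9 * (norm (A x))\<^sup>2" for x
    proof -
     have "\<pi> x * \<bar>trace (A x)\<bar> \<le> \<pi> x * (3 * norm (A x))" by (intro mult_left_mono abs_trace_le \<pi>0)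
     also have "\<dots> \<le> (\<pi> x)\<^sup>2 + (3 * norm (A x))\<^sup>2" by (rule product_dominates_squares)
     also have "(\<pi> x)\<^sup>2 \<le> c * Bb * \<pi> x" using mult_right_mono[OF \<pi>Q \<pi>0, of x x] by (simp add: power2_eq_square)
     finally show ?thesis by (simp add: power_mult_distrib)
    qed
    show "AE x in lborel. norm (\<pi> x * trace (A x)) \<le> norm (c * Bb * \<pi> x + 9 * (norm (A x))\<^sup>2)"
     using order_trans[OF B abs_ge_self] \<pi>0 by (intro AE_I2) (simp add: abs_mult)
   qed measurable
   have i2: "integrable lborel (\<lambda>x. b (\<rho>0 x) * norm (u0 x))"
   proof (rule Bochner_Integration.integrable_bound)
    show "integrable lborel (\<lambda>x. b (\<rho>0 x) + Bb * norm (u0 x) ^ 6)" using bi u6 by simp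
    \<comment> \<open>The velocity is at most 1 plus its sixth power: the first part is covered by
      the integrability of the potential, the second by its boundedness. This is the flux condition
      of \<open>renormalized_global\<close>.\<close>
    have B: "b (\<rho>0 x) * norm (u0 x) \<le> b (\<rho>0 x) + Bb * norm (u0 x) ^ 6" for x
    proof -
     have "norm (u0 x) \<le> 1 + norm (u0 x) ^ 6"
     proof (cases "norm (u0 x) \<le> 1")
      case False
      then have "norm (u0 x) ^ 1 \<le> norm (u0 x) ^ 6" by (intro power_increasing) auto
      then show ?thesis by simp
     qed (simp add: add_increasing2)
     then have "b (\<rho>0 x) * norm (u0 x) \<le> b (\<rho>0 x) * (1 + norm (u0 x) ^ 6)" by (intro mult_left_mono b0(1))
     also have "\<dots> = b (\<rho>0 x) + b (\<rho>0 x) * norm (u0 x) ^ 6" by (simp add: distrib_left)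
     also have "\<dots> \<le> b (\<rho>0 x) + Bb * norm (u0 x) ^ 6" by (intro add_left_mono mult_right_mono Bb) simp
     finally show ?thesis .
    qed
    show "AE x in lborel. norm (b (\<rho>0 x) * norm (u0 x)) \<le> norm (b (\<rho>0 x) + Bb * norm (u0 x) ^ 6)"
     using order_trans[OF B abs_ge_self] b0(1) by (intro AE_I2) (simp add: abs_mult)
   qed measurable
   have \<pi>A: "(LBINT x. \<pi> x * trace (A x)) = 0" unfolding \<pi>_def
    by (rule renormalized_global[OF rm rb \<phi> lu lA l1 l2 cont0 b b'c um i1[unfolded \<pi>_def] i2])
   have "\<exists>W. W \<in> borel_measurable borel \<and> (\<forall>x. x \<notin> \<Omega> \<longrightarrow> W x = 0) \<and> (AE x in lborel. x \<in> \<Omega> \<longrightarrow> weak_grad \<Omega> G x = W x) \<and>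
    integrable lborel (\<lambda>x. norm (\<rho>0 x *\<^sub>R W x) powr (6 / 5)) \<and> (LBINT x. (\<rho>0 x *\<^sub>R W x) \<bullet> u0 x) = 0"
   proof (cases "\<gamma> > 6 / 5")
    case True
    then obtain q where q: "6 / 5 \<le> q" "q \<le> 6 * \<gamma> / (5 * \<gamma> - 6)" "G \<in> D0 q \<Omega>" using G_large by blast
    \<comment> \<open>The relation between q and \<gamma> is symmetric: both inequalities say 5 q
      \<gamma> \<le> 6 (q + \<gamma>).\<close>
    have "\<gamma> \<le> 6 * q / (5 * q - 6)" if "q > 6 / 5"
    proof -
     have "q * (5 * \<gamma> - 6) \<le> 6 * \<gamma>" using q(2) True by (simp add: pos_le_divide_eq)
     then have "\<gamma> * (5 * q - 6) \<le> 6 * q" by (simp add: algebra_simps)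
     then show ?thesis using that by (simp add: pos_le_divide_eq)
    qed
    from force_D0[OF domain(1) q(3,1) this rm rb rg um u6 cont0] show ?thesis by blast
   next
    case False
    then have \<gamma>: "\<gamma> \<le> 6 / 5" by simp
    from G_small[OF \<gamma>] show ?thesis
    proof
     assume "\<exists>q\<ge>6 / 5. G \<in> D0 q \<Omega>"
     then obtain q where q: "6 / 5 \<le> q" "G \<in> D0 q \<Omega>" by blast
     \<comment> \<open>For small \<gamma> there is no upper restriction on q, because 6q/(5q - 6)
       exceeds 6/5 for every q > 6/5.\<close>
     have "\<gamma> \<le> 6 * q / (5 * q - 6)" if "q > 6 / 5"
     proof -
      have "6 / 5 \<le> 6 * q / (5 * q - 6)" using that by (simp add: pos_le_divide_eq)
      then show ?thesis using \<gamma> by simp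
     qed
     from force_D0[OF domain(1) q(2,1) this rm rb rg um u6 cont0] show ?thesis by blast
    next
     assume "G \<in> W1_inf \<Omega>"
     from force_W1_inf[OF domain(1) this \<gamma> rm rb rg um Am u6 ru2 A2 \<phi> d6 d6l JA cont0] show ?thesis by blast
    qed
   qed
   then obtain W where Wm[measurable]: "W \<in> borel_measurable borel" and Wz: "\<forall>x. x \<notin> \<Omega> \<longrightarrow> W x = 0"
    and We: "AE x in lborel. x \<in> \<Omega> \<longrightarrow> weak_grad \<Omega> G x = W x"
    and Wi: "integrable lborel (\<lambda>x. norm (\<rho>0 x *\<^sub>R W x) powr (6 / 5))" and W0: "(LBINT x. (\<rho>0 x *\<^sub>R W x) \<bullet> u0 x) = 0"
    by (elim exE conjE)
   have mom0: "(LBINT x. (\<rho>0 x *\<^sub>R outer (u0 x) (u0 x)) \<bullet> jacobian_mat (\<phi> n) x + \<pi> x * trace (jacobian_mat (\<phi> n) x))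
    = (LBINT x. stress \<mu> \<eta> (A x) \<bullet> jacobian_mat (\<phi> n) x) - (LBINT x. (\<rho>0 x *\<^sub>R W x) \<bullet> \<phi> n x)" for n
   proof -
    \<comment> \<open>Supports are known for each component separately; their union is a compact
      support for the vector field.\<close>
    have "\<forall>i. \<exists>K. compact K \<and> K \<subseteq> \<Omega> \<and> (\<forall>x. x \<notin> K \<longrightarrow> \<phi> n x $ i = 0)"
    proof
     fix i
     have "compact_support_in \<Omega> (\<lambda>x. \<phi> n x $ i)" using \<phi>[where n = n and i = i] by (simp add: Cc_inf_iff)
     then obtain K where "compact K" "K \<subseteq> \<Omega>" "\<And>x. x \<notin> K \<Longrightarrow> \<phi> n x $ i = 0" by (rule compact_support_inE) blast
     then show "\<exists>K. compact K \<and> K \<subseteq> \<Omega> \<and> (\<forall>x. x \<notin> K \<longrightarrow> \<phi> n x $ i = 0)" by blast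
    qed
    from choice[OF this] obtain K where K: "\<forall>i. compact (K i) \<and> K i \<subseteq> \<Omega> \<and> (\<forall>x. x \<notin> K i \<longrightarrow> \<phi> n x $ i = 0)" by (rule exE)
    have "compact_support_in \<Omega> (\<phi> n)"
    proof (rule compact_support_inI)
     show "compact (\<Union>i\<in>UNIV. K i)" using K by (intro compact_UN) auto
     show "(\<Union>i\<in>UNIV. K i) \<subseteq> \<Omega>" using K by blast
     show "\<phi> n x = 0" if "x \<notin> (\<Union>i\<in>UNIV. K i)" for x using K that by (simp add: vec_eq_iff)
    qed
    moreover have "Ck 1 (\<lambda>x. \<phi> n x $ i)" for i by (rule Cc_inf_Ck[OF \<phi>])
    ultimately have \<phi>1: "\<phi> n \<in> Cc1_vec \<Omega>" by (simp add: Cc1_vec_def)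
    have Jz: "jacobian_mat (\<phi> n) x = 0" and \<phi>z: "\<phi> n x = 0" if "x \<notin> \<Omega>" for x
     using Cc_inf_zero_outside[OF \<phi> that] by (simp_all add: jacobian_mat_def vec_eq_iff)
    have e1: "AE x in lborel. x \<in> \<Omega> \<longrightarrow> (\<rho> x *\<^sub>R outer (u x) (u x)) \<bullet> jacobian_mat (\<phi> n) x + p (\<rho> x) * trace (jacobian_mat (\<phi> n) x)
      = (\<rho>0 x *\<^sub>R outer (u0 x) (u0 x)) \<bullet> jacobian_mat (\<phi> n) x + \<pi> x * trace (jacobian_mat (\<phi> n) x)"
     using re ue by eventually_elim (auto simp: \<pi>p)
    have e2: "AE x in lborel. x \<in> \<Omega> \<longrightarrow> stress \<mu> \<eta> (weak_jacobian \<Omega> u x) \<bullet> jacobian_mat (\<phi> n) x = stress \<mu> \<eta> (A x) \<bullet> jacobian_mat (\<phi> n) x"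
     using Ae by eventually_elim auto
    have e3: "AE x in lborel. x \<in> \<Omega> \<longrightarrow> (\<rho> x *\<^sub>R weak_grad \<Omega> G x) \<bullet> \<phi> n x = (\<rho>0 x *\<^sub>R W x) \<bullet> \<phi> n x"
     using re We by eventually_elim auto
    have f1: "(LINT x:\<Omega>|lebesgue. (\<rho> x *\<^sub>R outer (u x) (u x)) \<bullet> jacobian_mat (\<phi> n) x + p (\<rho> x) * trace (jacobian_mat (\<phi> n) x))
      = (LBINT x. (\<rho>0 x *\<^sub>R outer (u0 x) (u0 x)) \<bullet> jacobian_mat (\<phi> n) x + \<pi> x * trace (jacobian_mat (\<phi> n) x))"
     by (rule lebesgue_integral_borel_rep(1)[OF _ _ e1]) (measurable, simp add: Jz rz trace_def)
    have f2: "(LINT x:\<Omega>|lebesgue. stress \<mu> \<eta> (weak_jacobian \<Omega> u x) \<bullet> jacobian_mat (\<phi> n) x) = (LBINT x. stress \<mu> \<eta> (A x) \<bullet> jacobian_mat (\<phi> n) x)"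
     by (rule lebesgue_integral_borel_rep(1)[OF _ _ e2]) (measurable, simp add: Jz)
    have f3: "(LINT x:\<Omega>|lebesgue. (\<rho> x *\<^sub>R weak_grad \<Omega> G x) \<bullet> \<phi> n x) = (LBINT x. (\<rho>0 x *\<^sub>R W x) \<bullet> \<phi> n x)"
     by (rule lebesgue_integral_borel_rep(1)[OF _ _ e3]) (measurable, simp add: rz)
    show ?thesis using mom[rule_format, OF \<phi>1] unfolding f1 f2 f3 .
   qed
   have "AE x in lborel. u0 x = 0"
    by (rule velocity_vanishes[OF \<phi> rm rb um Am Wm \<pi>m u6 ru2 A2 d6 d6l JA cont0 \<pi>i \<pi>0 \<pi>Q \<pi>A Wi W0 mom0 viscosity])
   with ue have "AE x in lborel. x \<in> \<Omega> \<longrightarrow> u x = 0" by eventually_elim auto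
   then show ?thesis by (rule AE_completion)
  qed
 qed
qed

end
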